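(* Let $H\in(1/2,1)$, $p\in(1,\infty)$ and $F\in\mathbb{D}_{1,p}\cap\mathbb{D}_{H,1,p}$. Then for $l=1,\dots,m$, $$D_s^{H,l}F=-\frac{2H\kappa_1}{\kappa_H}\,s^{\frac12-H}\frac{d}{ds}\int_s^T(u-s)^{\frac12-H}u^{H-\frac12}D_u^lF\,du$$ and $$\mathbb{D}_t^lF=c_{1,H}\int_0^Ts^{\frac12-H}|t-s|^{2H-2}\Big(\frac{d}{ds}\int_s^T(u-s)^{\frac12-H}u^{H-\frac12}D_u^lF\,du\Big)ds,$$ where $c_{1,H}=-\frac{2H^2(2H-1)\kappa_1}{\kappa_H}$.
   Context: $T\in(0,\infty)$. $W=(W_1,\dots,W_m)$ is a standard Brownian motion on $[0,T]$, and $B_j^H(t)=\int_0^tZ_H(t,s)dW_j(s)$ with $Z_H(t,s)=\kappa_H[(t/s)^{H-1/2}(t-s)^{H-1/2}-(H-\frac12)s^{1/2-H}\int_s^tu^{H-3/2}(u-s)^{H-1/2}du]$, so $B^H=(B_1^H,\dots,B_m^H)$ is a fractional Brownian motion of Hurst parameter $H$. Constants: $\kappa_H=\sqrt{\frac{2H\Gamma(\frac32-H)}{\Gamma(H+\frac12)\Gamma(2-2H)}}$ and $\kappa_1=\frac1{2H\Gamma(H+\frac12)\Gamma(\frac32-H)}$. Let $\mathbb{B}_{H,T}^*f(t)=-\frac{2H\kappa_1}{\kappa_H}t^{\frac12-H}\frac{d}{dt}\int_t^T(u-t)^{\frac12-H}u^{H-\frac12}f(u)du$; one has $\int_0^Tf\,dW_j=\int_0^T(\mathbb{B}_{H,T}^*f)\,dB_j^H$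 for nice $f$. Let $\xi_1,\xi_2,\dots$ be an orthonormal basis of $L^2([0,T])$ consisting of smooth functions, $\tilde\xi_{j,l}=\int_0^T\xi_j\,dW_l$, $\eta_j=\mathbb{B}_{H,T}^*\xi_j$, $\tilde\eta_{j,l}=\int_0^T\eta_j\,dB_l^H$. For polynomials $f,g$: - for $F=f(\tilde\xi_{j_1,l_1},\dots,\tilde\xi_{j_n,l_n})$, $D_s^lF=\sum_{i=1}^n\frac{\partial f}{\partial x_i}(\tilde\xi_{j_1,l_1},\dots,\tilde\xi_{j_n,l_n})\,\xi_{j_i}(s)I_{\{l_i=l\}}$; - for $G=g(\tilde\eta_{j_1,l_1},\dots,\tilde\eta_{j_n,l_n})$, $D_s^{H,l}G=\sum_{i=1}^n\frac{\partial g}{\partial x_i}(\tilde\eta_{j_1,l_1},\dots,\tilde\eta_{j_n,l_n})\,\eta_{j_i}(s)I_{\{l_i=l\}}$. $\mathbb{D}_{1,p}$ is the completion of such $F$ under $\|F\|_{1,p}=\|F\|_p+\sum_{l=1}^m[\mathbb{E}(\int_0^T|D_t^lF|^2dt)^{p/2}]^{1/p}$, and $\mathbb{D}_{H,1,p}$ is the completion of such $G$ under the analogous norm $\|\cdot\|_{H,1,p}$ with $D^{H,l}$ in place of $D^l$. Finally $\mathbb{D}_s^lG=\int_0^T\phi(s-r)D_r^{H,l}G\,dr$ with $\phi(s)=H(2H-1)|s|^{2H-2}$. *)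

theory Defs
  imports "HOL-Probability.Probability" "HOL-Library.Poly_Mapping"
begin

text \<open>Independence of the whole family of increments, over all components and all
  intervals of a common partition, expresses both that the components are independent of each
  other and that each of them has independent increments.\<close>

definition standard_Brownian_motion ::
    "'a measure \<Rightarrow> real \<Rightarrow> nat \<Rightarrow> (nat \<Rightarrow> real \<Rightarrow> 'a \<Rightarrow> real) \<Rightarrow> bool" where
  "standard_Brownian_motion M T m W \<longleftrightarrow>
     (\<forall>l\<in>{1..m}. \<forall>t\<in>{0..T}. W l t \<in> borel_measurable M) \<and>
     (\<forall>l\<in>{1..m}. AE \<omega> in M. W l 0 \<omega> = 0) \<and>
     (\<forall>l\<in>{1..m}. AE \<omega> in M. continuous_on {0..T} (\<lambda>t. W l t \<omega>)) \<and>
     (\<forall>l\<in>{1..m}. \<forall>s t. 0 \<le> s \<and> s < t \<and> t \<le> T \<longrightarrow>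
        distributed M lborel (\<lambda>\<omega>. W l t \<omega> - W l s \<omega>) (normal_density 0 (sqrt (t - s)))) \<and>
     (\<forall>n t. (\<forall>i\<le>n. t i \<in> {0..T}) \<and> (\<forall>i<n. t i \<le> t (Suc i)) \<longrightarrow>
        prob_space.indep_vars M (\<lambda>_. borel)
          (\<lambda>(l, i) \<omega>. W l (t (Suc i)) \<omega> - W l (t i) \<omega>) ({1..m} \<times> {..<n}))"

definition step_function :: "nat \<Rightarrow> (nat \<Rightarrow> real) \<Rightarrow> (nat \<Rightarrow> real) \<Rightarrow> real \<Rightarrow> real" where
  "step_function n t a s = (\<Sum>i<n. a i * indicator {t i<..t (Suc i)} s)"

definition step_integral ::
    "(real \<Rightarrow> 'a \<Rightarrow> real) \<Rightarrow> nat \<Rightarrow> (nat \<Rightarrow> real) \<Rightarrow> (nat \<Rightarrow> real) \<Rightarrow> 'a \<Rightarrow> real" where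
  "step_integral X n t a \<omega> = (\<Sum>i<n. a i * (X (t (Suc i)) \<omega> - X (t i) \<omega>))"

text \<open>The random variable \<open>I\<close> is a version of the integral over \<open>[0,T]\<close> of \<open>f\<close> against \<open>X\<close>,
  obtained as the mean square limit of the integrals of step functions that converge to \<open>f\<close>;
  \<open>Nsq\<close> is the square of the norm on integrands in which this convergence is meant.\<close>

definition mean_square_integral ::
    "'a measure \<Rightarrow> real \<Rightarrow> ((real \<Rightarrow> real) \<Rightarrow> real) \<Rightarrow> (real \<Rightarrow> 'a \<Rightarrow> real) \<Rightarrow>
     (real \<Rightarrow> real) \<Rightarrow> ('a \<Rightarrow> real) \<Rightarrow> bool" where
  "mean_square_integral M T Nsq X f I \<longleftrightarrow>
     I \<in> borel_measurable M \<and> integrable M (\<lambda>\<omega>. (I \<omega>)\<^sup>2) \<and>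
     (\<exists>n t a.
        (\<forall>k. \<forall>i\<le>n k. t k i \<in> {0..T}) \<and> (\<forall>k. \<forall>i<n k. t k i \<le> t k (Suc i)) \<and>
        (\<lambda>k. Nsq (\<lambda>s. step_function (n k) (t k) (a k) s - f s)) \<longlonglongrightarrow> 0 \<and>
        (\<lambda>k. \<integral>\<omega>. (step_integral X (n k) (t k) (a k) \<omega> - I \<omega>)\<^sup>2 \<partial>M) \<longlonglongrightarrow> 0)"

definition in_L2 :: "real \<Rightarrow> (real \<Rightarrow> real) \<Rightarrow> bool" where
  "in_L2 T f \<longleftrightarrow> f \<in> borel_measurable (lebesgue_on {0..T}) \<and>
     integrable (lebesgue_on {0..T}) (\<lambda>s. (f s)\<^sup>2)"

definition L2_norm_sq :: "real \<Rightarrow> (real \<Rightarrow> real) \<Rightarrow> real" where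
  "L2_norm_sq T f = (\<integral>s. (f s)\<^sup>2 \<partial>lebesgue_on {0..T})"

definition has_Wiener_integral ::
    "'a measure \<Rightarrow> real \<Rightarrow> (real \<Rightarrow> 'a \<Rightarrow> real) \<Rightarrow> (real \<Rightarrow> real) \<Rightarrow> ('a \<Rightarrow> real) \<Rightarrow> bool" where
  "has_Wiener_integral M T X f I \<longleftrightarrow>
     in_L2 T f \<and> mean_square_integral M T (L2_norm_sq T) X f I"

definition phi :: "real \<Rightarrow> real \<Rightarrow> real" where
  "phi H s = H * (2 * H - 1) * \<bar>s\<bar> powr (2 * H - 2)"

text \<open>Integrands for fractional Brownian motion with \<open>H > 1/2\<close>. The covariance of the
  increments of the process has density \<open>phi H (s - r)\<close>, so the second moment of the integral
  of a step function \<open>f\<close> is \<open>L2_phi_norm_sq H T f\<close>.\<close>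

definition in_L2_phi :: "real \<Rightarrow> real \<Rightarrow> (real \<Rightarrow> real) \<Rightarrow> bool" where
  "in_L2_phi H T f \<longleftrightarrow> f \<in> borel_measurable (lebesgue_on {0..T}) \<and>
     integrable (lebesgue_on {0..T} \<Otimes>\<^sub>M lebesgue_on {0..T})
       (\<lambda>(s, r). f s * f r * phi H (s - r))"

definition L2_phi_norm_sq :: "real \<Rightarrow> real \<Rightarrow> (real \<Rightarrow> real) \<Rightarrow> real" where
  "L2_phi_norm_sq H T f =
     (\<integral>(s, r). f s * f r * phi H (s - r) \<partial>(lebesgue_on {0..T} \<Otimes>\<^sub>M lebesgue_on {0..T}))"

definition has_fBm_integral ::
    "'a measure \<Rightarrow> real \<Rightarrow> real \<Rightarrow> (real \<Rightarrow> 'a \<Rightarrow> real) \<Rightarrow> (real \<Rightarrow> real) \<Rightarrow> ('a \<Rightarrow> real) \<Rightarrow> bool" where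
  "has_fBm_integral M H T X f I \<longleftrightarrow>
     in_L2_phi H T f \<and> mean_square_integral M T (L2_phi_norm_sq H T) X f I"

definition kappa :: "real \<Rightarrow> real" where
  "kappa H = sqrt (2 * H * Gamma (3/2 - H) / (Gamma (H + 1/2) * Gamma (2 - 2 * H)))"

definition kappa1 :: "real \<Rightarrow> real" where
  "kappa1 H = 1 / (2 * H * Gamma (H + 1/2) * Gamma (3/2 - H))"

definition c1H :: "real \<Rightarrow> real" where
  "c1H H = - (2 * H\<^sup>2 * (2 * H - 1) * kappa1 H / kappa H)"

definition Z_kernel :: "real \<Rightarrow> real \<Rightarrow> real \<Rightarrow> real" where
  "Z_kernel H t s = kappa H *
     ((t / s) powr (H - 1/2) * (t - s) powr (H - 1/2) -
      (H - 1/2) * s powr (1/2 - H) *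
        (\<integral>u. u powr (H - 3/2) * (u - s) powr (H - 1/2) \<partial>lebesgue_on {s..t}))"

definition fractional_Brownian_motion_of ::
    "'a measure \<Rightarrow> real \<Rightarrow> real \<Rightarrow> nat \<Rightarrow> (nat \<Rightarrow> real \<Rightarrow> 'a \<Rightarrow> real) \<Rightarrow>
     (nat \<Rightarrow> real \<Rightarrow> 'a \<Rightarrow> real) \<Rightarrow> bool" where
  "fractional_Brownian_motion_of M H T m W B \<longleftrightarrow>
     (\<forall>l\<in>{1..m}. \<forall>t\<in>{0..T}.
        has_Wiener_integral M T (W l) (\<lambda>s. indicator {0..t} s * Z_kernel H t s) (B l t))"

definition B_star :: "real \<Rightarrow> real \<Rightarrow> (real \<Rightarrow> real) \<Rightarrow> real \<Rightarrow> real" where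
  "B_star H T f t = - (2 * H * kappa1 H / kappa H) * t powr (1/2 - H) *
     deriv (\<lambda>t. \<integral>u. (u - t) powr (1/2 - H) * u powr (H - 1/2) * f u \<partial>lebesgue_on {t..T}) t"

text \<open>\<open>g n\<close> is the \<open>n\<close>-th derivative, one-sided at the end points.\<close>

definition smooth_on_Icc :: "real \<Rightarrow> (real \<Rightarrow> real) \<Rightarrow> bool" where
  "smooth_on_Icc T f \<longleftrightarrow>
     (\<exists>g. (\<forall>x\<in>{0..T}. g 0 x = f x) \<and>
        (\<forall>n. \<forall>x\<in>{0..T}. (g n has_real_derivative g (Suc n) x) (at x within {0..T})))"

definition L2_inner :: "real \<Rightarrow> (real \<Rightarrow> real) \<Rightarrow> (real \<Rightarrow> real) \<Rightarrow> real" where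
  "L2_inner T f g = (\<integral>s. f s * g s \<partial>lebesgue_on {0..T})"

definition orthonormal_basis_L2 :: "real \<Rightarrow> (nat \<Rightarrow> real \<Rightarrow> real) \<Rightarrow> bool" where
  "orthonormal_basis_L2 T e \<longleftrightarrow>
     (\<forall>i. in_L2 T (e i)) \<and>
     (\<forall>i j. L2_inner T (e i) (e j) = (if i = j then 1 else 0)) \<and>
     (\<forall>f. in_L2 T f \<longrightarrow>
        (\<lambda>n. L2_norm_sq T (\<lambda>s. f s - (\<Sum>i<n. L2_inner T f (e i) * e i s))) \<longlonglongrightarrow> 0)"

text \<open>A polynomial in the variables \<open>x 0, x 1, \<dots>\<close> maps each monomial, given by its
  exponents, to its coefficient.\<close>

type_synonym real_mpoly = "(nat \<Rightarrow>\<^sub>0 nat) \<Rightarrow>\<^sub>0 real"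

definition mpoly_eval :: "real_mpoly \<Rightarrow> (nat \<Rightarrow> real) \<Rightarrow> real" where
  "mpoly_eval f x =
     (\<Sum>\<mu>\<in>Poly_Mapping.keys f. Poly_Mapping.lookup f \<mu> *
        (\<Prod>i\<in>Poly_Mapping.keys \<mu>. x i ^ Poly_Mapping.lookup \<mu> i))"

definition mpoly_in_vars :: "nat \<Rightarrow> real_mpoly \<Rightarrow> bool" where
  "mpoly_in_vars n f \<longleftrightarrow> (\<forall>\<mu>\<in>Poly_Mapping.keys f. Poly_Mapping.keys \<mu> \<subseteq> {..<n})"

definition partial_deriv :: "((nat \<Rightarrow> real) \<Rightarrow> real) \<Rightarrow> nat \<Rightarrow> (nat \<Rightarrow> real) \<Rightarrow> real" where
  "partial_deriv g i x = deriv (\<lambda>y. g (x(i := y))) (x i)"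

text \<open>Pairs of a polynomial functional \<open>F\<close> of the random variables \<open>X j l\<close> and its derivative,
  whose component \<open>l\<close> at time \<open>s\<close> is \<open>DF l s\<close>. The operator \<open>D\<close> arises from \<open>e = \<xi>\<close> and
  \<open>X j l = \<integral> \<xi> j dW l\<close>, the operator \<open>D\<^sup>H\<close> from \<open>e = \<eta>\<close> and \<open>X j l = \<integral> \<eta> j dB l\<close>.\<close>

definition polynomial_functionals ::
    "nat \<Rightarrow> (nat \<Rightarrow> real \<Rightarrow> real) \<Rightarrow> (nat \<Rightarrow> nat \<Rightarrow> 'a \<Rightarrow> real) \<Rightarrow>
     (('a \<Rightarrow> real) \<times> (nat \<Rightarrow> real \<Rightarrow> 'a \<Rightarrow> real)) set" where
  "polynomial_functionals m e X =
     {(F, DF). \<exists>n f j k. mpoly_in_vars n f \<and> (\<forall>i<n. k i \<in> {1..m}) \<and>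
        F = (\<lambda>\<omega>. mpoly_eval f (\<lambda>i. X (j i) (k i) \<omega>)) \<and>
        DF = (\<lambda>l s \<omega>. \<Sum>i<n. partial_deriv (mpoly_eval f) i (\<lambda>i. X (j i) (k i) \<omega>)
                 * e (j i) s * (if k i = l then 1 else 0))}"

definition norm_1p ::
    "'a measure \<Rightarrow> real \<Rightarrow> nat \<Rightarrow> real \<Rightarrow> ('a \<Rightarrow> real) \<Rightarrow> (nat \<Rightarrow> real \<Rightarrow> 'a \<Rightarrow> real) \<Rightarrow> real" where
  "norm_1p M T m p F DF =
     (\<integral>\<omega>. \<bar>F \<omega>\<bar> powr p \<partial>M) powr (1/p) +
     (\<Sum>l=1..m. (\<integral>\<omega>. (\<integral>t. \<bar>DF l t \<omega>\<bar>\<^sup>2 \<partial>lebesgue_on {0..T}) powr (p/2) \<partial>M) powr (1/p))"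

definition in_Lp :: "'a measure \<Rightarrow> real \<Rightarrow> ('a \<Rightarrow> real) \<Rightarrow> bool" where
  "in_Lp M p F \<longleftrightarrow> F \<in> borel_measurable M \<and> integrable M (\<lambda>\<omega>. \<bar>F \<omega>\<bar> powr p)"

definition in_Lp_L2 :: "'a measure \<Rightarrow> real \<Rightarrow> real \<Rightarrow> (real \<Rightarrow> 'a \<Rightarrow> real) \<Rightarrow> bool" where
  "in_Lp_L2 M T p Z \<longleftrightarrow>
     (\<lambda>(t, \<omega>). Z t \<omega>) \<in> borel_measurable (lebesgue_on {0..T} \<Otimes>\<^sub>M M) \<and>
     (AE \<omega> in M. integrable (lebesgue_on {0..T}) (\<lambda>t. (Z t \<omega>)\<^sup>2)) \<and>
     integrable M (\<lambda>\<omega>. (\<integral>t. (Z t \<omega>)\<^sup>2 \<partial>lebesgue_on {0..T}) powr (p/2))"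

text \<open>\<open>F\<close> belongs to the completion of the polynomial functionals under \<^const>\<open>norm_1p\<close> and
  \<open>DF\<close> is a version of its derivative. The completion is realised inside \<open>L\<^sup>p(\<Omega>)\<close>, with
  derivatives in \<open>L\<^sup>p(\<Omega>; L\<^sup>2([0,T]))\<close>, so that the spaces for \<open>D\<close> and \<open>D\<^sup>H\<close> can be intersected.\<close>

definition in_D1p ::
    "'a measure \<Rightarrow> real \<Rightarrow> nat \<Rightarrow> real \<Rightarrow> (nat \<Rightarrow> real \<Rightarrow> real) \<Rightarrow> (nat \<Rightarrow> nat \<Rightarrow> 'a \<Rightarrow> real) \<Rightarrow>
     ('a \<Rightarrow> real) \<Rightarrow> (nat \<Rightarrow> real \<Rightarrow> 'a \<Rightarrow> real) \<Rightarrow> bool" where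
  "in_D1p M T m p e X F DF \<longleftrightarrow>
     in_Lp M p F \<and> (\<forall>l\<in>{1..m}. in_Lp_L2 M T p (DF l)) \<and>
     (\<exists>G DG. (\<forall>k. (G k, DG k) \<in> polynomial_functionals m e X) \<and>
        (\<lambda>k. norm_1p M T m p (\<lambda>\<omega>. G k \<omega> - F \<omega>) (\<lambda>l t \<omega>. DG k l t \<omega> - DF l t \<omega>))
          \<longlonglongrightarrow> 0)"

definition phi_derivative ::
    "real \<Rightarrow> real \<Rightarrow> (nat \<Rightarrow> real \<Rightarrow> 'a \<Rightarrow> real) \<Rightarrow> nat \<Rightarrow> real \<Rightarrow> 'a \<Rightarrow> real" where
  "phi_derivative H T DHF l s \<omega> = (\<integral>r. phi H (s - r) * DHF l r \<omega> \<partial>lebesgue_on {0..T})"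

end

theory Submission
  imports Defs
begin

text \<open>Put \<open>\<alpha> = H - 1/2\<close> and let \<open>K f (s) = s\<^sup>-\<^sup>\<alpha> \<integral> u\<^sup>\<alpha> (u - s)\<^sup>\<alpha>\<^sup>-\<^sup>1 f(u) du\<close>, integrated over \<open>[s,T]\<close>. An integration
by parts in the definition of the Volterra kernel shows that \<open>Z_kernel H t\<close> is \<open>\<kappa> K 1\<close> with the
indicator function of \<open>(0,t]\<close> and \<open>\<kappa> = kappa H \<cdot> \<alpha>\<close>. So \<open>\<kappa> K\<close> turns integrands against the fractional
Brownian motion into integrands against the Brownian motion. Everything rests on three properties
of \<open>\<kappa> K\<close>.

\<^item> It is an isometry from the \<open>\<phi>\<close>-norm to \<open>L\<^sup>2\<close> (\<open>L2_phi_norm_sq_eq\<close>), and it is bounded on \<open>L\<^sup>2\<close>. Both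
  follow from a Beta integral that expresses \<open>\<phi>\<close> through the kernel of \<open>K\<close>.
\<^item> It is inverse to \<open>B_star H T\<close> (\<open>B_star_inverse\<close>, \<open>fbm_op_inverse_AE\<close>). This is the inversion of
  Abel's integral equation: the kernels \<open>(u - s)\<^sup>a\<^sup>-\<^sup>1\<close> form a convolution semigroup in \<open>a\<close>, and the
  derivative in \<open>B_star\<close> exists almost everywhere by the Lebesgue differentiation theorem.
\<^item> Its adjoint maps bounded functions to bounded functions (\<open>fbm_adj_in_L2\<close>, \<open>fbm_op_adjoint\<close>).

By the isometry and the inversion, the integral of \<open>\<eta> j\<close> against \<open>B l\<close> equals the integral of \<open>\<xi> j\<close> against
\<open>W l\<close> almost surely (\<open>fBm_integral_eq_Wiener_integral\<close>). Hence both derivatives are defined on the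
same polynomials in independent standard Gaussian variables, and there \<open>D = \<kappa> K D\<^sup>H\<close>, because
\<open>\<xi> j = \<kappa> K (\<eta> j)\<close>.

To pass to the completions one has to face that \<open>F\<close> may be the limit of different sequences in the
two norms, so the derivative has to be recovered from \<open>F\<close> alone. This is done by integration by
parts: if \<open>b = (j, l)\<close>, if \<open>h\<close> is a dual vector that pairs to \<open>1\<close> with the \<open>j\<close>-th function and to
\<open>0\<close> with the others, and if \<open>Z\<close> is the pairing of \<open>h\<close> with the component \<open>l\<close> of the derivative of
\<open>F\<close>, then \<open>E[(Z + i \<theta>\<^sub>b F) e] = E[F X\<^sub>b e]\<close> for all \<open>e = exp(i \<Sum> \<theta>\<^sub>a X\<^sub>a)\<close>. The identity survives limits
in \<open>L\<^sup>p\<close>, since Gaussian variables have all moments, and it determines \<open>Z\<close>, since a limit of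
polynomials in \<open>X\<close> is determined by its Fourier transform (\<open>fourier_zero_imp_null\<close>). The dual vectors
are \<open>\<xi> j\<close> for \<open>D\<close> and the adjoint of \<open>\<kappa> K\<close> applied to \<open>\<xi> j\<close> for \<open>D\<^sup>H\<close>. So \<open>DF\<close> and \<open>\<kappa> K DHF\<close> have
the same coefficients with respect to the orthonormal basis \<open>\<xi>\<close> and are equal
(\<open>derivative_transfer\<close>). Inverting \<open>\<kappa> K\<close> gives the first formula of the theorem. The second one is
the first, inserted into the definition of \<open>phi_derivative\<close> (\<open>inversion_formulas\<close>).\<close>

section \<open>The Lebesgue differentiation theorem on the line\<close>

lemma real_Icc_eq_cball: "{c..d} = cball ((c+d)/2) ((d-c)/2::real)"
  by (auto simp: cball_def dist_real_def abs_if field_simps)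

text \<open>Fix \<open>e\<close> and consider the points \<open>x\<close> at which arbitrarily short intervals with end point \<open>x\<close> have a
difference quotient that differs from \<open>f x\<close> by at least \<open>e\<close>. By Vitali's theorem countably many
disjoint such intervals, as fine as a given gauge, cover almost all of these points. By Henstock's
lemma the sum of the differences \<open>\<bar>f(x) \<bar>I\<bar> - \<integral>\<^sub>I f\<bar>\<close> over finitely many of them is arbitrarily small. As
each difference is at least \<open>e \<bar>I\<bar>\<close>, the exceptional set is negligible.\<close>

theorem indefinite_integral_has_derivative_ae:
  fixes f :: "real \<Rightarrow> real"
  assumes f: "f integrable_on {a..b}"
  obtains N where "negligible N"
    "\<And>x. x \<in> {a<..<b} - N \<Longrightarrow> ((\<lambda>x. integral {a..x} f) has_real_derivative f x) (at x)"
proof -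
  define F where "F x = integral {a..x} f" for x
  define bad where "bad e x y \<longleftrightarrow> y \<in> {a<..<b} \<and> y \<noteq> x \<and> e * \<bar>y - x\<bar> \<le> \<bar>F y - F x - (y - x) * f x\<bar>" for e x y
  define S where "S e = {x \<in> {a<..<b}. \<forall>d>0. \<exists>y. \<bar>y - x\<bar> < d \<and> bad e x y}" for e
  have int: "integral {min x y..max x y} f = sgn (y - x) * (F y - F x)" if "x \<in> {a<..<b}" "y \<in> {a<..<b}" for x y
  proof -
    have *: "integral {x..y} f = F y - F x" if "x \<le> y" "x \<in> {a<..<b}" "y \<in> {a<..<b}" for x y
    proof -
      have "integral {a..x} f + integral {x..y} f = integral {a..y} f"
        by (rule Henstock_Kurzweil_Integration.integral_combine) (use that in \<open>auto intro: integrable_subinterval_real[OF f]\<close>)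
      then show ?thesis by (simp add: F_def)
    qed
    show ?thesis using *[of x y] *[of y x] that by (cases x y rule: linorder_cases) (auto simp: min_def max_def F_def)
  qed
  have neg: "negligible (S e)" if "e > 0" for e
  proof (subst negligible_outer_le, intro allI impI)
    fix \<mu> :: real assume "\<mu> > 0"
    define \<delta> where "\<delta> = e * \<mu> / 2"
    have "\<delta> > 0" using \<open>e > 0\<close> \<open>\<mu> > 0\<close> by (simp add: \<delta>_def)
    have f': "f integrable_on cbox a b" using f by simp
    obtain \<gamma> where \<gamma>: "gauge \<gamma>" and hen: "\<And>p. p tagged_partial_division_of cbox a b \<Longrightarrow> \<gamma> fine p \<Longrightarrow>
        sum (\<lambda>(x,k). norm (measure lborel k *\<^sub>R f x - integral k f)) p < \<delta>"
      using Henstock_lemma[OF f' \<open>\<delta> > 0\<close>] by blast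
    (* An interval is represented by its tag and its other end point, so both right-sided and
       left-sided difference quotients are covered. *)
    define K where "K = {(x,y). x \<in> S e \<and> bad e x y \<and> {min x y..max x y} \<subseteq> \<gamma> x}"
    define ce where "ce i = (case i of (x,y) \<Rightarrow> (x+y)/2)" for i :: "real \<times> real"
    define ra where "ra i = (case i of (x,y) \<Rightarrow> \<bar>y-x\<bar>/2)" for i :: "real \<times> real"
    have cb: "cball (ce (x,y)) (ra (x,y)) = {min x y..max x y}" for x y
      unfolding real_Icc_eq_cball ce_def ra_def by (auto simp: min_def max_def add_ac)
    have rapos: "0 < ra i" if "i \<in> K" for i using that by (auto simp: K_def ra_def bad_def split: prod.splits)
    have cov: "\<exists>i. i \<in> K \<and> x \<in> cball (ce i) (ra i) \<and> ra i < d" if x: "x \<in> S e" and d: "0 < d" for x d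
    proof -
      obtain r where r: "r > 0" "ball x r \<subseteq> \<gamma> x" using \<gamma> unfolding gauge_def
        by (meson open_contains_ball)
      have "min r d > 0" using r d by simp
      with x obtain y where y: "\<bar>y - x\<bar> < min r d" "bad e x y" unfolding S_def by blast
      have "{min x y..max x y} \<subseteq> ball x r" using y by (auto simp: dist_real_def)
      then have "(x,y) \<in> K" using r y x by (auto simp: K_def)
      moreover have "ra (x,y) < d" using y by (auto simp: ra_def)
      ultimately show ?thesis using cb[of x y] by (intro exI[of _ "(x,y)"]) auto
    qed
    obtain C where C: "countable C" "C \<subseteq> K" and pw: "pairwise (\<lambda>i j. disjnt (cball (ce i) (ra i)) (cball (ce j) (ra j))) C"
      and ng: "negligible (S e - (\<Union>i\<in>C. cball (ce i) (ra i)))"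
      using Vitali_covering_theorem_cballs[OF rapos cov] by blast
    have fin: "measure lebesgue (\<Union>i\<in>D. cball (ce i) (ra i)) \<le> \<mu>" if D: "D \<subseteq> C" "finite D" for D
    proof -
      define p where "p = (\<lambda>i. (fst i, cball (ce i) (ra i))) ` D"
      have injp: "inj_on (\<lambda>i. (fst i, cball (ce i) (ra i))) D"
      proof (rule inj_onI)
        fix i j assume ij: "i \<in> D" "j \<in> D" "(fst i, cball (ce i) (ra i)) = (fst j, cball (ce j) (ra j))"
        show "i = j"
        proof (rule ccontr)
          assume "i \<noteq> j"
          then have "disjnt (cball (ce i) (ra i)) (cball (ce j) (ra j))" using pairwiseD[OF pw, of i j] ij D by blast
          then have "cball (ce i) (ra i) = {}" using ij by (simp add: disjnt_def)
          then show False using rapos[of i] ij D C by (auto simp: cball_eq_empty)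
        qed
      qed
      have "p tagged_partial_division_of cbox a b"
        unfolding tagged_partial_division_of_def
      proof (intro conjI allI impI)
        show "finite p" using D by (simp add: p_def)
        fix x k assume "(x,k) \<in> p"
        then obtain y where xy: "(x,y) \<in> K" "k = {min x y..max x y}" using D C by (auto simp: p_def cb)
        then have "x \<in> {a<..<b}" "y \<in> {a<..<b}" by (auto simp: K_def S_def bad_def)
        then show "x \<in> k" "k \<subseteq> cbox a b" "\<exists>a b. k = cbox a b" using xy by (auto simp: min_def max_def split: if_splits)
      next
        fix x1 k1 x2 k2 assume A: "(x1,k1) \<in> p \<and> (x2,k2) \<in> p \<and> (x1,k1) \<noteq> (x2,k2)"
        then obtain i j where "i \<in> D" "j \<in> D" "i \<noteq> j" "k1 = cball (ce i) (ra i)" "k2 = cball (ce j) (ra j)"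
          unfolding p_def by auto
        then have "disjnt k1 k2" using pw D by (auto simp: pairwise_def)
        then show "interior k1 \<inter> interior k2 = {}" using interior_subset[of k1] interior_subset[of k2] by (auto simp: disjnt_def)
      qed
      moreover have "\<gamma> fine p"
        unfolding fine_def
      proof clarify
        fix x k z assume "(x,k) \<in> p" "z \<in> k"
        moreover from this obtain y where "(x,y) \<in> K" "k = {min x y..max x y}" using D C by (auto simp: p_def cb)
        ultimately show "z \<in> \<gamma> x" by (auto simp: K_def)
      qed
      ultimately have "sum (\<lambda>(x,k). norm (measure lborel k *\<^sub>R f x - integral k f)) p < \<delta>" by (rule hen)
      then have *: "(\<Sum>i\<in>D. \<bar>measure lborel (cball (ce i) (ra i)) * f (fst i) - integral (cball (ce i) (ra i)) f\<bar>) < \<delta>"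
        unfolding p_def by (subst (asm) sum.reindex[OF injp]) (simp add: o_def)
      have "e * (\<Sum>i\<in>D. measure lborel (cball (ce i) (ra i))) = (\<Sum>i\<in>D. e * measure lborel (cball (ce i) (ra i)))"
        by (simp add: sum_distrib_left)
      also have "\<dots> \<le> (\<Sum>i\<in>D. \<bar>measure lborel (cball (ce i) (ra i)) * f (fst i) - integral (cball (ce i) (ra i)) f\<bar>)"
      proof (rule sum_mono)
        fix i assume "i \<in> D"
        then have "i \<in> K" using D C by auto
        then obtain x y where i: "i = (x,y)" and K: "x \<in> S e" "bad e x y" by (auto simp: K_def)
        have xy: "x \<in> {a<..<b}" "y \<in> {a<..<b}" "y \<noteq> x" using K by (auto simp: S_def bad_def)
        have c: "measure lborel {min x y..max x y} = \<bar>y-x\<bar>" by (auto simp: min_def max_def)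
        have "\<bar>y - x\<bar> * f x - sgn (y-x) * (F y - F x) = - sgn (y - x) * (F y - F x - (y - x) * f x)"
          using xy by (cases "x < y") (auto simp: sgn_if algebra_simps)
        then have "\<bar>\<bar>y - x\<bar> * f x - sgn (y-x) * (F y - F x)\<bar> = \<bar>F y - F x - (y - x) * f x\<bar>"
          using xy by (simp add: abs_mult sgn_if)
        then show "e * measure lborel (cball (ce i) (ra i)) \<le> \<bar>measure lborel (cball (ce i) (ra i)) * f (fst i) - integral (cball (ce i) (ra i)) f\<bar>"
          using K(2) unfolding i cb fst_conv int[OF xy(1,2)] c by (simp add: bad_def)
      qed
      also have "\<dots> < \<delta>" by (rule *)
      finally have "(\<Sum>i\<in>D. measure lborel (cball (ce i) (ra i))) < \<mu> / 2" using \<open>e > 0\<close> by (simp add: \<delta>_def)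
      moreover have "measure lebesgue (\<Union>i\<in>D. cball (ce i) (ra i)) \<le> (\<Sum>i\<in>D. measure lebesgue (cball (ce i) (ra i)))"
        by (rule measure_UNION_le) (use D in auto)
      moreover have "(\<Sum>i\<in>D. measure lebesgue (cball (ce i) (ra i))) = (\<Sum>i\<in>D. measure lborel (cball (ce i) (ra i)))"
        by simp
      ultimately show ?thesis using \<open>\<mu> > 0\<close> by linarith
    qed
    have U: "(\<Union>i\<in>C. cball (ce i) (ra i)) \<in> lmeasurable" "measure lebesgue (\<Union>i\<in>C. cball (ce i) (ra i)) \<le> \<mu>"
      using fmeasurable_UN_bound[OF \<open>countable C\<close> _ fin] measure_UN_bound[OF \<open>countable C\<close> _ fin] by auto
    show "\<exists>T. S e \<subseteq> T \<and> T \<in> lmeasurable \<and> measure lebesgue T \<le> \<mu>"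
    proof (intro exI conjI)
      let ?T = "(S e - (\<Union>i\<in>C. cball (ce i) (ra i))) \<union> (\<Union>i\<in>C. cball (ce i) (ra i))"
      show "S e \<subseteq> ?T" by auto
      have n: "(S e - (\<Union>i\<in>C. cball (ce i) (ra i))) \<in> lmeasurable" using ng by (rule negligible_imp_measurable)
      show "?T \<in> lmeasurable" using U n by (intro fmeasurable.Un)
      have "measure lebesgue ?T \<le> measure lebesgue (S e - (\<Union>i\<in>C. cball (ce i) (ra i))) + measure lebesgue (\<Union>i\<in>C. cball (ce i) (ra i))"
        by (rule measure_Un_le) (use U n in auto)
      then show "measure lebesgue ?T \<le> \<mu>" using U negligible_imp_measure0[OF ng] by simp
    qed
  qed
  have "negligible (\<Union>n. S (1 / real (Suc n)))"
    by (rule negligible_countable_Union) (auto intro!: neg)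
  moreover have "(F has_real_derivative f x) (at x)" if x: "x \<in> {a<..<b} - (\<Union>n. S (1 / real (Suc n)))" for x
    unfolding has_field_derivative_iff
  proof (rule LIM_I)
    fix r :: real assume "r > 0"
    then obtain n where n: "1 / real (Suc n) < r" by (metis nat_approx_posE of_nat_Suc)
    have "x \<notin> S (1 / real (Suc n))" using x by auto
    then obtain d where d: "d > 0" "\<And>y. \<bar>y - x\<bar> < d \<Longrightarrow> \<not> bad (1 / real (Suc n)) x y" using x by (auto simp: S_def)
    obtain d' where d': "d' > 0" "ball x d' \<subseteq> {a<..<b}" using x by (metis open_contains_ball Diff_iff open_greaterThanLessThan)
    show "\<exists>s>0. \<forall>y. y \<noteq> x \<and> norm (y - x) < s \<longrightarrow> norm ((F y - F x) / (y - x) - f x) < r"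
    proof (intro exI[of _ "min d d'"] conjI allI impI)
      fix y assume y: "y \<noteq> x \<and> norm (y - x) < min d d'"
      then have "y \<in> {a<..<b}" using d'(2) by (auto simp: dist_real_def subset_eq)
      with d(2)[of y] y have "\<bar>F y - F x - (y - x) * f x\<bar> < 1 / real (Suc n) * \<bar>y - x\<bar>" by (auto simp: bad_def not_le)
      also have "\<dots> \<le> r * \<bar>y - x\<bar>" using n by (intro mult_right_mono) auto
      finally have "\<bar>F y - F x - (y - x) * f x\<bar> / \<bar>y - x\<bar> < r" using y by (simp add: field_simps)
      then show "norm ((F y - F x) / (y - x) - f x) < r" using y by (simp add: divide_simps flip: abs_divide) (simp add: field_simps)
    qed (use d d' in auto)
  qed
  ultimately show ?thesis using that unfolding F_def by blast
qed

section \<open>Riemann-Liouville kernels and Beta integrals\<close>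

text \<open>Integration against \<open>rl_kernel a s\<close> is \<open>Gamma a\<close> times the right-sided Riemann-Liouville fractional
integral of order \<open>a\<close>. The normalising factor is left out, so that Beta functions appear in the
semigroup law instead.\<close>

definition rl_kernel :: "real \<Rightarrow> real \<Rightarrow> real \<Rightarrow> real" where
  "rl_kernel a s u = (if s < u then (u - s) powr (a - 1) else 0)"

lemma rl_kernel_nonneg [simp]: "0 \<le> rl_kernel a s u"
  by (simp add: rl_kernel_def)

lemma rl_kernel_one: "rl_kernel 1 s u = (if s < u then 1 else 0)"
  by (simp add: rl_kernel_def)

lemma rl_kernel_measurable [measurable]:
  assumes "f \<in> borel_measurable M" "g \<in> borel_measurable M"
  shows "(\<lambda>x. rl_kernel a (f x) (g x)) \<in> borel_measurable M"
  unfolding rl_kernel_def using assms by measurable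

lemma borel_measurable_lebesgue_onI:
  fixes f :: "'a::euclidean_space \<Rightarrow> 'b::topological_space"
  shows "f \<in> borel_measurable borel \<Longrightarrow> f \<in> borel_measurable (lebesgue_on A)"
  by (intro measurable_restrict_space1 measurable_completion) auto

lemma lebesgue_on_to_borel:
  fixes f :: "'a \<Rightarrow> 'b::euclidean_space"
  shows "f \<in> M \<rightarrow>\<^sub>M lebesgue_on A \<Longrightarrow> f \<in> borel_measurable M"
  using measurable_compose[OF _ borel_measurable_lebesgue_onI[of "\<lambda>x. x" A]] by auto

lemma measurable_lebesgue_on_id [measurable]: "(\<lambda>x. x) \<in> borel_measurable (lebesgue_on A)"
  by (rule borel_measurable_lebesgue_onI) auto

lemma measurable_lebesgue_on_fst [measurable]:
  "fst \<in> borel_measurable (lebesgue_on A \<Otimes>\<^sub>M N)"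
  by (rule lebesgue_on_to_borel) auto

lemma measurable_lebesgue_on_snd [measurable]:
  "snd \<in> borel_measurable (N \<Otimes>\<^sub>M lebesgue_on A)"
  by (rule lebesgue_on_to_borel) auto

lemma nn_integral_lebesgue_on_borel:
  fixes f :: "real \<Rightarrow> ennreal"
  assumes [measurable]: "f \<in> borel_measurable borel" "A \<in> sets borel"
  shows "(\<integral>\<^sup>+x. f x \<partial>lebesgue_on A) = (\<integral>\<^sup>+x. f x * indicator A x \<partial>lborel)"
proof -
  have "(\<integral>\<^sup>+x. f x \<partial>lebesgue_on A) = (\<integral>\<^sup>+x. f x * indicator A x \<partial>lebesgue)"
    by (subst nn_integral_restrict_space) auto
  also have "\<dots> = (\<integral>\<^sup>+x. f x * indicator A x \<partial>lborel)"
    by (subst nn_integral_completion) auto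
  finally show ?thesis .
qed

lemma Beta_pos: "0 < a \<Longrightarrow> 0 < b \<Longrightarrow> 0 < Beta a (b::real)"
  by (simp add: Beta_def)

text \<open>The affine change of variables that maps \<open>[0,1]\<close> to \<open>[s,v]\<close> reduces the integral to Euler's Beta integral.\<close>

lemma nn_integral_rl_convolution:
  assumes "a > 0" "b > 0" "s < v"
  shows "(\<integral>\<^sup>+u. ennreal (rl_kernel a s u * rl_kernel b u v) \<partial>lborel)
    = ennreal (Beta a b * (v - s) powr (a + b - 1))"
proof -
  define c where "c = v - s"
  have c: "c > 0" using assms by (simp add: c_def)
  have "(\<integral>\<^sup>+u. ennreal (rl_kernel a s u * rl_kernel b u v) \<partial>lborel)
      = ennreal c * (\<integral>\<^sup>+x. ennreal (rl_kernel a s (s + c * x) * rl_kernel b (s + c * x) v) \<partial>lborel)"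
    using nn_integral_real_affine[of "\<lambda>u. ennreal (rl_kernel a s u * rl_kernel b u v)" c s] c
    by simp
  also have "(\<lambda>x. ennreal (rl_kernel a s (s + c * x) * rl_kernel b (s + c * x) v))
      = (\<lambda>x. ennreal (c powr (a + b - 2)) * ennreal (indicator {0<..<1} x * (x powr (a - 1) * (1 - x) powr (b - 1))))"
  proof
    fix x
    have 1: "s < s + c * x \<longleftrightarrow> 0 < x" using c by (auto simp: zero_less_mult_iff)
    have "s + c * x < v \<longleftrightarrow> c * x < c * 1" by (auto simp: c_def)
    then have 2: "s + c * x < v \<longleftrightarrow> x < 1" using c by simp
    have 3: "v - (s + c * x) = c * (1 - x)" by (simp add: c_def algebra_simps)
    show "ennreal (rl_kernel a s (s + c * x) * rl_kernel b (s + c * x) v)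
      = ennreal (c powr (a + b - 2)) * ennreal (indicator {0<..<1} x * (x powr (a - 1) * (1 - x) powr (b - 1)))"
    proof (cases "0 < x \<and> x < 1")
      case True
      have "c powr (a - 1) * c powr (b - 1) = c powr (a + b - 2)"
        by (simp add: powr_add[symmetric])
      then have "(c * x) powr (a - 1) * (c * (1 - x)) powr (b - 1) = c powr (a + b - 2) * (x powr (a - 1) * (1 - x) powr (b - 1))"
        using True c by (simp add: powr_mult mult_ac)
      then show ?thesis unfolding rl_kernel_def 1 2 3 using True by (simp add: ennreal_mult'[symmetric])
    next
      case False
      then show ?thesis using 1 2 by (auto simp: rl_kernel_def indicator_def)
    qed
  qed
  also have "(\<integral>\<^sup>+x. ennreal (c powr (a + b - 2)) * ennreal (indicator {0<..<1} x * (x powr (a - 1) * (1 - x) powr (b - 1))) \<partial>lborel)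
     = ennreal (c powr (a + b - 2)) * ennreal (Beta a b)"
  proof -
    have "((\<lambda>x. x powr (a - 1) * (1 - x) powr (b - 1)) has_integral Beta a b) {0<..<1}"
      using has_integral_Beta_real[OF assms(1,2)] by (simp add: has_integral_Icc_iff_Ioo)
    then have "((\<lambda>x. indicator {0<..<1} x * (x powr (a - 1) * (1 - x) powr (b - 1))) has_integral Beta a b) UNIV"
      by (subst (asm) has_integral_restrict_UNIV[symmetric]) (simp add: indicator_def of_bool_def if_distrib[of "\<lambda>x. x * _"] cong: if_cong)
    then have "(\<integral>\<^sup>+x. ennreal (indicator {0<..<1} x * (x powr (a - 1) * (1 - x) powr (b - 1))) \<partial>lborel) = ennreal (Beta a b)"
      by (intro nn_integral_has_integral_lborel) (auto simp: indicator_def)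
    then show ?thesis by (subst nn_integral_cmult) auto
  qed
  also have "ennreal c * (ennreal (c powr (a + b - 2)) * ennreal (Beta a b)) = ennreal (Beta a b * c powr (a + b - 1))"
  proof -
    have "c * c powr (a + b - 2) = c powr (a + b - 1)"
      using c powr_add[of c 1 "a + b - 2"] by (simp add: algebra_simps)
    then have "Beta a b * c powr (a + b - 1) = c * (c powr (a + b - 2) * Beta a b)" by simp
    then show ?thesis using c by (simp only: ennreal_mult'[OF less_imp_le, OF c] ennreal_mult'[OF powr_ge_zero])
  qed
  finally show ?thesis by (simp add: c_def)
qed

lemma nn_integral_rl_convolution_Icc:
  assumes "a > 0" "b > 0" "0 \<le> s" "s < v" "v \<le> T"
  shows "(\<integral>\<^sup>+u. ennreal (rl_kernel a s u * rl_kernel b u v) \<partial>lebesgue_on {0..T})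
    = ennreal (Beta a b * (v - s) powr (a + b - 1))"
proof -
  have "(\<integral>\<^sup>+u. ennreal (rl_kernel a s u * rl_kernel b u v) \<partial>lebesgue_on {0..T})
    = (\<integral>\<^sup>+u. ennreal (rl_kernel a s u * rl_kernel b u v) \<partial>lborel)"
    using assms by (subst nn_integral_lebesgue_on_borel) (auto intro!: nn_integral_cong simp: rl_kernel_def indicator_def)
  then show ?thesis using nn_integral_rl_convolution[OF assms(1,2,4)] by simp
qed

lemma AE_lebesgue_on_neq:
  fixes c :: "'a::euclidean_space"
  assumes "A \<in> sets lebesgue"
  shows "AE u in lebesgue_on A. u \<noteq> c"
proof -
  have "AE u in lebesgue. u \<noteq> c" by (rule AE_completion[OF AE_lborel_singleton])
  then have "AE u in lebesgue. u \<in> A \<longrightarrow> u \<noteq> c" by (rule eventually_mono) auto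
  then show ?thesis using assms by (subst AE_restrict_space_iff) auto
qed

text \<open>This is the convolution with \<open>rl_kernel 1\<close>, which is an indicator function.\<close>

lemma nn_integral_rl_kernel_Icc:
  assumes "a > 0" "0 \<le> s" "s < T"
  shows "(\<integral>\<^sup>+u. ennreal (rl_kernel a s u) \<partial>lebesgue_on {0..T}) = ennreal ((T - s) powr a / a)"
proof -
  have "(\<integral>\<^sup>+u. ennreal (rl_kernel a s u) \<partial>lebesgue_on {0..T}) = (\<integral>\<^sup>+u. ennreal (rl_kernel a s u * rl_kernel 1 u T) \<partial>lebesgue_on {0..T})"
  proof (rule nn_integral_cong_AE)
    have "AE u in lebesgue_on {0..T}. u \<noteq> T"
      by (rule AE_lebesgue_on_neq) auto
    then show "AE u in lebesgue_on {0..T}. ennreal (rl_kernel a s u) = ennreal (rl_kernel a s u * rl_kernel 1 u T)"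
      by (rule AE_mp) (auto intro!: AE_I2 simp: rl_kernel_one)
  qed
  also have "\<dots> = ennreal (Beta a 1 * (T - s) powr (a + 1 - 1))"
    by (rule nn_integral_rl_convolution_Icc) (use assms in auto)
  also have "Beta a 1 = 1 / a"
  proof -
    have "a \<notin> \<int>\<^sub>\<le>\<^sub>0" using assms nonpos_Ints_nonpos[of a] by linarith
    then have "Gamma (a + 1) = a * Gamma a" by (rule Gamma_plus1)
    moreover have "Gamma a > 0" using assms by simp
    ultimately show ?thesis by (simp add: Beta_def)
  qed
  finally show ?thesis by simp
qed

text \<open>Substitute \<open>u = r s w / (s - r + r w)\<close>, which maps \<open>[0,1]\<close> onto \<open>[0,r]\<close>. With \<open>q = s - r + r w\<close> one has
\<open>s - u = s (s - r) / q\<close> and \<open>r - u = r (s - r) (1 - w) / q\<close>, and all powers of \<open>q\<close> cancel against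
those of the Jacobian. What remains is a Beta integral in \<open>w\<close>.\<close>

lemma nn_integral_covariance_kernel_aux:
  fixes \<alpha> r s :: real
  assumes "0 < \<alpha>" "\<alpha> < 1/2" "0 < r" "r < s"
  shows "(\<integral>\<^sup>+u. ennreal (indicator {0<..<r} u * (u powr (-2*\<alpha>) * (s - u) powr (\<alpha> - 1) * (r - u) powr (\<alpha> - 1))) \<partial>lborel)
     = ennreal (Beta \<alpha> (1 - 2*\<alpha>) * (r * s) powr (-\<alpha>) * (s - r) powr (2*\<alpha> - 1))"
proof -
  (* q in the proof below is the denominator of g *)
  define g where "g w = r * s * w / (s - r + r * w)" for w
  define g' where "g' w = r * s * (s - r) / (s - r + r * w)^2" for w
  define f where "f u = u powr (-2*\<alpha>) * (s - u) powr (\<alpha> - 1) * (r - u) powr (\<alpha> - 1)" for u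
  have pos: "s - r + r * w > 0" if "w \<in> {0..1}" for w using that assms by (auto intro: add_pos_nonneg)
  have g01: "g 0 = 0" "g 1 = r" using assms by (auto simp: g_def)
  have "(\<integral>\<^sup>+u. ennreal (f u) * indicator {g 0..g 1} u \<partial>lborel) = (\<integral>\<^sup>+w. ennreal (f (g w) * g' w) * indicator {0..1} w \<partial>lborel)"
  proof -
    have "(\<integral>\<^sup>+u. ennreal (f u * indicator {g 0..g 1} u) \<partial>lborel) = (\<integral>\<^sup>+w. ennreal (f (g w) * g' w * indicator {0..1} w) \<partial>lborel)"
    proof (rule nn_integral_substitution)
      show "set_borel_measurable borel {g 0..g 1} f" unfolding set_borel_measurable_def f_def by measurable
      show "(g has_real_derivative g' x) (at x)" if "x \<in> {0..1}" for x
        unfolding g_def g'_def using pos[OF that]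
        by (auto intro!: derivative_eq_intros simp: power2_eq_square field_simps)
      show "continuous_on {0..1} g'" unfolding g'_def using pos by (auto intro!: continuous_intros) fastforce
      show "0 \<le> g' x" if "x \<in> {0..1}" for x unfolding g'_def using pos[OF that] assms by auto
    qed auto
    moreover have "(\<lambda>u. ennreal (f u) * indicator {g 0..g 1} u) = (\<lambda>u. ennreal (f u * indicator {g 0..g 1} u))"
      "(\<lambda>w. ennreal (f (g w) * g' w) * indicator {0..1} w) = (\<lambda>w. ennreal (f (g w) * g' w * indicator {0..1} w))"
      by (auto simp: indicator_def fun_eq_iff)
    ultimately show ?thesis by simp
  qed
  also have "\<dots> = (\<integral>\<^sup>+w. ennreal ((r * s) powr (-\<alpha>) * (s - r) powr (2*\<alpha> - 1)) * ennreal (rl_kernel (1-2*\<alpha>) 0 w * rl_kernel \<alpha> w 1) \<partial>lborel)"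
  proof (rule nn_integral_cong_AE)
    have "AE w in lborel. w \<noteq> 0 \<and> w \<noteq> (1::real)" using AE_lborel_singleton[of "0::real"] AE_lborel_singleton[of "1::real"] by auto
    then show "AE w in lborel. ennreal (f (g w) * g' w) * indicator {0..1} w = ennreal ((r * s) powr (-\<alpha>) * (s - r) powr (2*\<alpha> - 1)) * ennreal (rl_kernel (1-2*\<alpha>) 0 w * rl_kernel \<alpha> w 1)"
    proof (rule AE_mp, intro AE_I2 impI)
      fix w :: real assume w: "w \<noteq> 0 \<and> w \<noteq> 1"
      show "ennreal (f (g w) * g' w) * indicator {0..1} w = ennreal ((r * s) powr (-\<alpha>) * (s - r) powr (2*\<alpha> - 1)) * ennreal (rl_kernel (1-2*\<alpha>) 0 w * rl_kernel \<alpha> w 1)"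
      proof (cases "w \<in> {0..1}")
        case True
        then have w01: "0 < w" "w < 1" using w by auto
        define q where "q = s - r + r * w"
        have q: "q > 0" using pos True by (simp add: q_def)
        have e1: "g w = (r * s) * w / q" by (simp add: g_def q_def)
        have e2: "s - g w = s * (s - r) / q" using q by (simp add: g_def q_def field_simps)
        have e3: "r - g w = r * (s - r) * (1 - w) / q" using q by (simp add: g_def q_def field_simps)
        have e4: "g' w = (r * s) * (s - r) * q powr (-2)" using q
          by (simp add: g'_def q_def powr_minus divide_inverse)
        have "f (g w) * g' w = ((r * s) powr (-2*\<alpha>) * w powr (-2*\<alpha>) * q powr (2*\<alpha>)) * (s powr (\<alpha>-1) * (s-r) powr (\<alpha>-1) * q powr (1-\<alpha>))
             * (r powr (\<alpha>-1) * (s-r) powr (\<alpha>-1) * (1-w) powr (\<alpha>-1) * q powr (1-\<alpha>)) * ((r * s) powr 1 * (s - r) powr 1 * q powr (-2))"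
        proof -
          have d: "(x / q) powr a = x powr a * q powr (-a)" if "x > 0" for x a
            using that q by (simp add: powr_divide powr_minus_divide)
          have "(r * s * w / q) powr (-2*\<alpha>) = (r * s) powr (-2*\<alpha>) * w powr (-2*\<alpha>) * q powr (2*\<alpha>)"
            using assms w01 by (subst d) (simp_all add: powr_mult)
          moreover have "(s * (s - r) / q) powr (\<alpha> - 1) = s powr (\<alpha>-1) * (s-r) powr (\<alpha>-1) * q powr (1-\<alpha>)"
            using assms w01 by (subst d) (simp_all add: powr_mult)
          moreover have "(r * (s - r) * (1 - w) / q) powr (\<alpha> - 1) = r powr (\<alpha>-1) * (s-r) powr (\<alpha>-1) * (1-w) powr (\<alpha>-1) * q powr (1-\<alpha>)"
            using assms w01 by (subst d) (simp_all add: powr_mult)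
          ultimately show ?thesis unfolding f_def e2 e3 e4 unfolding e1 using assms by simp
        qed
        also have "\<dots> = ((r * s) powr (-2*\<alpha>) * (r powr (\<alpha>-1) * s powr (\<alpha>-1)) * (r * s) powr 1) * ((s-r) powr (\<alpha>-1) * (s-r) powr (\<alpha>-1) * (s-r) powr 1)
             * (q powr (2*\<alpha>) * q powr (1-\<alpha>) * q powr (1-\<alpha>) * q powr (-2)) * (w powr (-2*\<alpha>) * (1-w) powr (\<alpha>-1))"
          by (simp only: mult_ac)
        also have "(r * s) powr (-2*\<alpha>) * (r powr (\<alpha>-1) * s powr (\<alpha>-1)) * (r * s) powr 1 = (r * s) powr (-\<alpha>)"
          using assms by (simp only: powr_mult[symmetric] powr_add[symmetric]) simp
        also have "(s-r) powr (\<alpha>-1) * (s-r) powr (\<alpha>-1) * (s-r) powr 1 = (s-r) powr (2*\<alpha>-1)"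
          using assms by (simp only: powr_add[symmetric]) (simp add: algebra_simps)
        also have "q powr (2*\<alpha>) * q powr (1-\<alpha>) * q powr (1-\<alpha>) * q powr (-2) = 1"
          using q by (simp only: powr_add[symmetric]) simp
        finally have "f (g w) * g' w = (r * s) powr (-\<alpha>) * (s - r) powr (2*\<alpha> - 1) * (rl_kernel (1-2*\<alpha>) 0 w * rl_kernel \<alpha> w 1)"
          using w01 by (simp add: rl_kernel_def)
        then show ?thesis using True by (simp add: ennreal_mult'[symmetric])
      qed (auto simp: rl_kernel_def)
    qed
  qed
  also have "\<dots> = ennreal ((r * s) powr (-\<alpha>) * (s - r) powr (2*\<alpha> - 1)) * ennreal (Beta (1-2*\<alpha>) \<alpha>)"
    by (subst nn_integral_cmult) (use assms nn_integral_rl_convolution[of "1-2*\<alpha>" \<alpha> 0 1] in auto)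
  also have "\<dots> = ennreal (Beta \<alpha> (1 - 2*\<alpha>) * (r * s) powr (-\<alpha>) * (s - r) powr (2*\<alpha> - 1))"
    using assms Beta_pos[of \<alpha> "1-2*\<alpha>"] Beta_commute[of "1-2*\<alpha>" \<alpha>]
    by (subst ennreal_mult'[symmetric]) (auto simp: mult_ac)
  finally have "(\<integral>\<^sup>+u. ennreal (f u) * indicator {g 0..g 1} u \<partial>lborel) = ennreal (Beta \<alpha> (1 - 2*\<alpha>) * (r * s) powr (-\<alpha>) * (s - r) powr (2*\<alpha> - 1))" .
  moreover have "(\<integral>\<^sup>+u. ennreal (f u) * indicator {g 0..g 1} u \<partial>lborel) = (\<integral>\<^sup>+u. ennreal (indicator {0<..<r} u * f u) \<partial>lborel)"
  proof (rule nn_integral_cong_AE)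
    have "AE w in lborel. w \<noteq> 0 \<and> w \<noteq> r" using AE_lborel_singleton[of "0::real"] AE_lborel_singleton[of r] by auto
    then show "AE u in lborel. ennreal (f u) * indicator {g 0..g 1} u = ennreal (indicator {0<..<r} u * f u)"
      unfolding g01 by (rule AE_mp) (auto intro!: AE_I2 simp: indicator_def)
  qed
  ultimately show ?thesis by (simp add: f_def)
qed

text \<open>Up to the factor \<open>kappa H \<cdot> \<alpha>\<close> this is the partial derivative in \<open>u\<close> of \<open>Z_kernel H u s\<close>, where
\<open>\<alpha> = H - 1/2\<close>.\<close>

definition fbm_kernel :: "real \<Rightarrow> real \<Rightarrow> real \<Rightarrow> real" where
  "fbm_kernel \<alpha> s u = s powr (-\<alpha>) * u powr \<alpha> * rl_kernel \<alpha> s u"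

lemma fbm_kernel_nonneg [simp]: "0 \<le> fbm_kernel \<alpha> s u"
  by (simp add: fbm_kernel_def)

lemma fbm_kernel_measurable [measurable]:
  assumes "f \<in> borel_measurable M" "g \<in> borel_measurable M"
  shows "(\<lambda>x. fbm_kernel a (f x) (g x)) \<in> borel_measurable M"
  unfolding fbm_kernel_def using assms by measurable

text \<open>The inner product of two rows of the kernel is the covariance density of fractional Brownian motion,
up to a constant. All later norm identities and bounds come from this formula.\<close>

lemma nn_integral_fbm_kernel_product:
  assumes "0 < \<alpha>" "\<alpha> < 1/2" "u \<in> {0..T}" "v \<in> {0..T}" "u \<noteq> v" "u \<noteq> 0" "v \<noteq> 0"
  shows "(\<integral>\<^sup>+s. ennreal (fbm_kernel \<alpha> s u * fbm_kernel \<alpha> s v) \<partial>lebesgue_on {0..T})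
     = ennreal (Beta \<alpha> (1 - 2*\<alpha>) * \<bar>u - v\<bar> powr (2*\<alpha> - 1))"
proof -
  have *: "(\<integral>\<^sup>+s. ennreal (fbm_kernel \<alpha> s u * fbm_kernel \<alpha> s v) \<partial>lebesgue_on {0..T})
     = ennreal (Beta \<alpha> (1 - 2*\<alpha>) * (v - u) powr (2*\<alpha> - 1))" if uv: "0 < u" "u < v" "v \<le> T" for u v
  proof -
    have "(\<integral>\<^sup>+s. ennreal (fbm_kernel \<alpha> s u * fbm_kernel \<alpha> s v) \<partial>lebesgue_on {0..T})
      = (\<integral>\<^sup>+s. ennreal (fbm_kernel \<alpha> s u * fbm_kernel \<alpha> s v) * indicator {0..T} s \<partial>lborel)"
      by (rule nn_integral_lebesgue_on_borel) measurable
    also have "\<dots> = (\<integral>\<^sup>+s. ennreal ((u * v) powr \<alpha>) * ennreal (indicator {0<..<u} s * (s powr (-2*\<alpha>) * (v - s) powr (\<alpha> - 1) * (u - s) powr (\<alpha> - 1))) \<partial>lborel)"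
    proof (rule nn_integral_cong, goal_cases)
      case (1 s)
      have "s powr (-\<alpha>) * s powr (-\<alpha>) = s powr (-2*\<alpha>)" by (simp add: powr_add[symmetric])
      then have "0 < s \<Longrightarrow> s < u \<Longrightarrow> fbm_kernel \<alpha> s u * fbm_kernel \<alpha> s v = (u * v) powr \<alpha> * (s powr (-2*\<alpha>) * (v - s) powr (\<alpha> - 1) * (u - s) powr (\<alpha> - 1))"
        using uv by (simp add: fbm_kernel_def rl_kernel_def powr_mult mult_ac)
      moreover have "\<not> (0 < s \<and> s < u) \<Longrightarrow> 0 \<le> s \<Longrightarrow> fbm_kernel \<alpha> s u * fbm_kernel \<alpha> s v = 0"
        by (auto simp: fbm_kernel_def rl_kernel_def)
      ultimately show ?case using uv by (auto simp: indicator_def ennreal_mult'[symmetric])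
    qed
    also have "\<dots> = ennreal ((u * v) powr \<alpha>) * ennreal (Beta \<alpha> (1 - 2*\<alpha>) * (u * v) powr (-\<alpha>) * (v - u) powr (2*\<alpha> - 1))"
      by (subst nn_integral_cmult) (use nn_integral_covariance_kernel_aux[OF assms(1,2) uv(1,2)] in auto)
    also have "\<dots> = ennreal (Beta \<alpha> (1 - 2*\<alpha>) * (v - u) powr (2*\<alpha> - 1))"
    proof -
      have cancel: "x * (b * y * z) = b * z" if "x * y = 1" for x y b z :: real
      proof -
        have "x * (b * y * z) = (x * y) * (b * z)" by (simp only: mult_ac)
        then show ?thesis using that by simp
      qed
      have "u * v \<noteq> 0" using uv by simp
      then have "(u * v) powr \<alpha> * (u * v) powr (-\<alpha>) = 1" by (metis powr_add powr_zero_eq_one add.right_inverse)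
      then have "(u * v) powr \<alpha> * (Beta \<alpha> (1 - 2*\<alpha>) * (u * v) powr (-\<alpha>) * (v - u) powr (2*\<alpha> - 1)) = Beta \<alpha> (1 - 2*\<alpha>) * (v - u) powr (2*\<alpha> - 1)"
        by (rule cancel)
      then show ?thesis by (simp only: ennreal_mult'[OF powr_ge_zero, symmetric])
    qed
    finally show ?thesis .
  qed
  show ?thesis
  proof (cases "u < v")
    case True then show ?thesis using *[of u v] assms by (simp add: abs_minus_commute)
  next
    case False
    have "(\<integral>\<^sup>+s. ennreal (fbm_kernel \<alpha> s u * fbm_kernel \<alpha> s v) \<partial>lebesgue_on {0..T})
      = (\<integral>\<^sup>+s. ennreal (fbm_kernel \<alpha> s v * fbm_kernel \<alpha> s u) \<partial>lebesgue_on {0..T})"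
      by (simp only: mult.commute)
    also have "\<dots> = ennreal (Beta \<alpha> (1 - 2*\<alpha>) * \<bar>u - v\<bar> powr (2*\<alpha> - 1))"
      using *[of v u] assms False by simp
    finally show ?thesis .
  qed
qed

section \<open>The Volterra operator of fractional Brownian motion\<close>

lemma finite_measure_lebesgue_on_Icc: "finite_measure (lebesgue_on {a..b::real})"
  by (rule finite_measureI) (simp add: emeasure_restrict_space emeasure_lborel_Icc_eq)

lemma nn_integral_rl_kernel_left_Icc:
  assumes "b > 0" "0 < u" "u \<le> T"
  shows "(\<integral>\<^sup>+s. ennreal (rl_kernel b s u) \<partial>lebesgue_on {0..T}) = ennreal (u powr b / b)"
proof -
  have "(\<integral>\<^sup>+s. ennreal (rl_kernel b s u) \<partial>lebesgue_on {0..T}) = (\<integral>\<^sup>+s. ennreal (rl_kernel 1 0 s * rl_kernel b s u) \<partial>lebesgue_on {0..T})"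
  proof (rule nn_integral_cong_AE)
    have "AE s in lebesgue_on {0..T}. s \<noteq> 0" by (rule AE_lebesgue_on_neq) auto
    moreover have "AE s in lebesgue_on {0..T}. s \<in> {0..T}" by (rule AE_I2) simp
    ultimately show "AE s in lebesgue_on {0..T}. ennreal (rl_kernel b s u) = ennreal (rl_kernel 1 0 s * rl_kernel b s u)"
      by eventually_elim (auto simp: rl_kernel_one)
  qed
  also have "\<dots> = ennreal (Beta 1 b * (u - 0) powr (1 + b - 1))"
    by (rule nn_integral_rl_convolution_Icc) (use assms in auto)
  also have "Beta 1 b = 1 / b"
  proof -
    have "b \<notin> \<int>\<^sub>\<le>\<^sub>0" using assms nonpos_Ints_nonpos[of b] by linarith
    then have "Gamma (b + 1) = b * Gamma b" by (rule Gamma_plus1)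
    moreover have "Gamma b > 0" using assms by simp
    ultimately show ?thesis by (simp add: Beta_def add.commute)
  qed
  finally show ?thesis by simp
qed

locale frac_kernel =
  fixes T \<alpha> :: real
  assumes T_pos: "0 < T" and \<alpha>_pos: "0 < \<alpha>" and \<alpha>_less: "\<alpha> < 1/2"
begin

abbreviation L :: "real measure" where "L \<equiv> lebesgue_on {0..T}"

sublocale L: finite_measure L by (rule finite_measure_lebesgue_on_Icc)
sublocale LL: pair_sigma_finite L L ..
sublocale LLL: pair_sigma_finite L "L \<Otimes>\<^sub>M L" ..

lemma AE_L_in: "AE s in L. s \<in> {0..T}" by (rule AE_I2) simp

lemma AE_L_neq: "AE s in L. s \<noteq> c" by (rule AE_lebesgue_on_neq) auto

definition fbm_op :: "(real \<Rightarrow> real) \<Rightarrow> real \<Rightarrow> real" where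
  "fbm_op f s = (\<integral>u. fbm_kernel \<alpha> s u * f u \<partial>L)"

text \<open>A constant multiple of \<open>phi H (u - v)\<close>, see \<open>kappa_covariance\<close>.\<close>

definition cov_kernel :: "real \<Rightarrow> real \<Rightarrow> real" where
  "cov_kernel u v = Beta \<alpha> (1 - 2*\<alpha>) * \<bar>u - v\<bar> powr (2*\<alpha> - 1)"

lemma cov_kernel_nonneg [simp]: "0 \<le> cov_kernel u v"
  using \<alpha>_pos \<alpha>_less by (simp add: cov_kernel_def Beta_pos less_imp_le)

lemma cov_kernel_measurable [measurable]:
  assumes "f \<in> borel_measurable M" "g \<in> borel_measurable M"
  shows "(\<lambda>x. cov_kernel (f x) (g x)) \<in> borel_measurable M"
  unfolding cov_kernel_def using assms by measurable

definition schur_const :: real where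
  "schur_const = Beta \<alpha> (1 - 2*\<alpha>) * (T powr (2*\<alpha>) / \<alpha>)"

lemma nn_integral_cov_kernel_le:
  assumes "u \<in> {0..T}"
  shows "(\<integral>\<^sup>+v. ennreal (cov_kernel u v) \<partial>L) \<le> ennreal schur_const"
proof -
  define B where "B = Beta \<alpha> (1 - 2*\<alpha>)"
  have B: "B > 0" using \<alpha>_pos \<alpha>_less by (simp add: B_def Beta_pos)
  have "(\<integral>\<^sup>+v. ennreal (cov_kernel u v) \<partial>L) = (\<integral>\<^sup>+v. ennreal B * (ennreal (rl_kernel (2*\<alpha>) u v) + ennreal (rl_kernel (2*\<alpha>) v u)) \<partial>L)"
  proof (rule nn_integral_cong)
    fix v
    show "ennreal (cov_kernel u v) = ennreal B * (ennreal (rl_kernel (2*\<alpha>) u v) + ennreal (rl_kernel (2*\<alpha>) v u))"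
      using B by (cases u v rule: linorder_cases) (auto simp: cov_kernel_def B_def rl_kernel_def ennreal_mult')
  qed
  also have "\<dots> = ennreal B * ((\<integral>\<^sup>+v. ennreal (rl_kernel (2*\<alpha>) u v) \<partial>L) + (\<integral>\<^sup>+v. ennreal (rl_kernel (2*\<alpha>) v u) \<partial>L))"
    by (subst nn_integral_cmult) (auto simp: nn_integral_add)
  also have "\<dots> \<le> ennreal B * (ennreal (T powr (2*\<alpha>) / (2*\<alpha>)) + ennreal (T powr (2*\<alpha>) / (2*\<alpha>)))"
  proof (intro mult_left_mono add_mono)
    show "(\<integral>\<^sup>+v. ennreal (rl_kernel (2*\<alpha>) u v) \<partial>L) \<le> ennreal (T powr (2*\<alpha>) / (2*\<alpha>))"
    proof (cases "u < T")
      case True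
      have "(T - u) powr (2*\<alpha>) \<le> T powr (2*\<alpha>)" using assms \<alpha>_pos by (intro powr_mono2) auto
      then show ?thesis using assms \<alpha>_pos True
        by (subst nn_integral_rl_kernel_Icc) (auto intro!: ennreal_leI divide_right_mono)
    next
      case False
      have "(\<integral>\<^sup>+v. ennreal (rl_kernel (2*\<alpha>) u v) \<partial>L) = (\<integral>\<^sup>+v. 0 \<partial>L)"
        by (rule nn_integral_cong) (use False in \<open>auto simp: rl_kernel_def\<close>)
      then show ?thesis by simp
    qed
    show "(\<integral>\<^sup>+v. ennreal (rl_kernel (2*\<alpha>) v u) \<partial>L) \<le> ennreal (T powr (2*\<alpha>) / (2*\<alpha>))"
    proof (cases "0 < u")
      case True
      have "u powr (2*\<alpha>) \<le> T powr (2*\<alpha>)" using assms \<alpha>_pos by (intro powr_mono2) auto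
      then show ?thesis using assms \<alpha>_pos True
        by (subst nn_integral_rl_kernel_left_Icc) (auto intro!: ennreal_leI divide_right_mono)
    next
      case False
      have "(\<integral>\<^sup>+v. ennreal (rl_kernel (2*\<alpha>) v u) \<partial>L) = (\<integral>\<^sup>+v. 0 \<partial>L)"
        by (rule nn_integral_cong) (use False in \<open>auto simp: rl_kernel_def\<close>)
      then show ?thesis by simp
    qed
  qed auto
  also have "\<dots> = ennreal B * ennreal (T powr (2*\<alpha>) / \<alpha>)"
    using \<alpha>_pos by (subst ennreal_plus[symmetric]) (auto simp: field_simps)
  also have "\<dots> = ennreal schur_const" using B by (simp only: schur_const_def B_def ennreal_mult'[OF less_imp_le])
  finally show ?thesis .
qed

text \<open>Schur's test: \<open>\<bar>f(u) f(v)\<bar> \<le> f(u)\<^sup>2 + f(v)\<^sup>2\<close>, and the symmetric kernel has bounded row integrals.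
Together with the next lemma this makes \<open>fbm_op\<close> bounded on \<open>L\<^sup>2\<close>.\<close>

lemma nn_integral_cov_kernel_schur:
  assumes [measurable]: "f \<in> borel_measurable L"
  shows "(\<integral>\<^sup>+u. \<integral>\<^sup>+v. ennreal (\<bar>f u\<bar> * \<bar>f v\<bar> * cov_kernel u v) \<partial>L \<partial>L)
     \<le> ennreal (2 * schur_const) * (\<integral>\<^sup>+u. ennreal ((f u)\<^sup>2) \<partial>L)"
proof -
  have le: "ennreal (\<bar>f u\<bar> * \<bar>f v\<bar> * cov_kernel u v) \<le> ennreal ((f u)\<^sup>2) * ennreal (cov_kernel u v) + ennreal ((f v)\<^sup>2) * ennreal (cov_kernel v u)" for u v
  proof -
    have c: "cov_kernel v u = cov_kernel u v" by (simp add: cov_kernel_def abs_minus_commute)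
    have "\<bar>f u\<bar> * \<bar>f v\<bar> \<le> (f u)\<^sup>2 + (f v)\<^sup>2"
    proof -
      have "0 \<le> (\<bar>f u\<bar> - \<bar>f v\<bar>)\<^sup>2" "0 \<le> \<bar>f u\<bar> * \<bar>f v\<bar>" by simp_all
      then show ?thesis unfolding power2_diff power2_abs by linarith
    qed
    then have "\<bar>f u\<bar> * \<bar>f v\<bar> * cov_kernel u v \<le> ((f u)\<^sup>2 + (f v)\<^sup>2) * cov_kernel u v"
      by (rule mult_right_mono) simp
    then show ?thesis unfolding c by (simp add: ennreal_mult'[symmetric] ennreal_plus[symmetric] distrib_right ennreal_leI del: ennreal_plus)
  qed
  have m1: "(\<integral>\<^sup>+u. \<integral>\<^sup>+v. ennreal ((f u)\<^sup>2) * ennreal (cov_kernel u v) \<partial>L \<partial>L) \<le> ennreal schur_const * (\<integral>\<^sup>+u. ennreal ((f u)\<^sup>2) \<partial>L)"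
  proof -
    have "(\<integral>\<^sup>+u. \<integral>\<^sup>+v. ennreal ((f u)\<^sup>2) * ennreal (cov_kernel u v) \<partial>L \<partial>L) \<le> (\<integral>\<^sup>+u. ennreal ((f u)\<^sup>2) * ennreal schur_const \<partial>L)"
    proof (rule nn_integral_mono)
      fix u assume "u \<in> space L"
      then have u: "u \<in> {0..T}" by simp
      have "(\<integral>\<^sup>+v. ennreal ((f u)\<^sup>2) * ennreal (cov_kernel u v) \<partial>L) = ennreal ((f u)\<^sup>2) * (\<integral>\<^sup>+v. ennreal (cov_kernel u v) \<partial>L)"
        by (rule nn_integral_cmult) measurable
      also have "\<dots> \<le> ennreal ((f u)\<^sup>2) * ennreal schur_const"
        by (intro mult_left_mono nn_integral_cov_kernel_le u) auto
      finally show "(\<integral>\<^sup>+v. ennreal ((f u)\<^sup>2) * ennreal (cov_kernel u v) \<partial>L) \<le> ennreal ((f u)\<^sup>2) * ennreal schur_const" .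
    qed
    also have "\<dots> = ennreal schur_const * (\<integral>\<^sup>+u. ennreal ((f u)\<^sup>2) \<partial>L)"
      by (subst nn_integral_multc) (auto simp: mult.commute)
    finally show ?thesis .
  qed
  have "(\<integral>\<^sup>+u. \<integral>\<^sup>+v. ennreal (\<bar>f u\<bar> * \<bar>f v\<bar> * cov_kernel u v) \<partial>L \<partial>L)
    \<le> (\<integral>\<^sup>+u. \<integral>\<^sup>+v. ennreal ((f u)\<^sup>2) * ennreal (cov_kernel u v) + ennreal ((f v)\<^sup>2) * ennreal (cov_kernel v u) \<partial>L \<partial>L)"
    by (intro nn_integral_mono le)
  also have "\<dots> = (\<integral>\<^sup>+u. (\<integral>\<^sup>+v. ennreal ((f u)\<^sup>2) * ennreal (cov_kernel u v) \<partial>L) + (\<integral>\<^sup>+v. ennreal ((f v)\<^sup>2) * ennreal (cov_kernel v u) \<partial>L) \<partial>L)"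
    by (intro nn_integral_cong nn_integral_add) measurable
  also have "\<dots> = (\<integral>\<^sup>+u. \<integral>\<^sup>+v. ennreal ((f u)\<^sup>2) * ennreal (cov_kernel u v) \<partial>L \<partial>L) + (\<integral>\<^sup>+u. \<integral>\<^sup>+v. ennreal ((f v)\<^sup>2) * ennreal (cov_kernel v u) \<partial>L \<partial>L)"
    by (intro nn_integral_add) measurable
  also have "(\<integral>\<^sup>+u. \<integral>\<^sup>+v. ennreal ((f v)\<^sup>2) * ennreal (cov_kernel v u) \<partial>L \<partial>L) = (\<integral>\<^sup>+v. \<integral>\<^sup>+u. ennreal ((f v)\<^sup>2) * ennreal (cov_kernel v u) \<partial>L \<partial>L)"
    by (rule LL.Fubini') measurable
  also have "(\<integral>\<^sup>+u. \<integral>\<^sup>+v. ennreal ((f u)\<^sup>2) * ennreal (cov_kernel u v) \<partial>L \<partial>L) + \<dots>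
     \<le> ennreal schur_const * (\<integral>\<^sup>+u. ennreal ((f u)\<^sup>2) \<partial>L) + ennreal schur_const * (\<integral>\<^sup>+u. ennreal ((f u)\<^sup>2) \<partial>L)"
    by (intro add_mono m1)
  also have "\<dots> = ennreal (2 * schur_const) * (\<integral>\<^sup>+u. ennreal ((f u)\<^sup>2) \<partial>L)"
  proof -
    have "schur_const \<ge> 0" using \<alpha>_pos \<alpha>_less by (simp add: schur_const_def Beta_pos less_imp_le)
    then have "ennreal (2 * schur_const) = ennreal schur_const + ennreal schur_const"
      by (subst ennreal_plus[symmetric]) auto
    then show ?thesis by (simp add: distrib_right)
  qed
  finally show ?thesis .
qed

text \<open>Expand the square and integrate over \<open>s\<close> first. The diagonal has to be left out, because the inner
integral is infinite there.\<close>

lemma nn_integral_fbm_op_sq: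
  assumes [measurable]: "f \<in> borel_measurable L"
  shows "(\<integral>\<^sup>+s. (\<integral>\<^sup>+u. ennreal (fbm_kernel \<alpha> s u * \<bar>f u\<bar>) \<partial>L)\<^sup>2 \<partial>L)
     = (\<integral>\<^sup>+u. \<integral>\<^sup>+v. ennreal (\<bar>f u\<bar> * \<bar>f v\<bar> * cov_kernel u v) \<partial>L \<partial>L)"
proof -
  let ?k = "\<lambda>s u. ennreal (fbm_kernel \<alpha> s u * \<bar>f u\<bar>)"
  have "(\<integral>\<^sup>+s. (\<integral>\<^sup>+u. ?k s u \<partial>L)\<^sup>2 \<partial>L) = (\<integral>\<^sup>+s. \<integral>\<^sup>+u. \<integral>\<^sup>+v. ?k s u * ?k s v \<partial>L \<partial>L \<partial>L)"
  proof (rule nn_integral_cong)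
    fix s
    have "(\<integral>\<^sup>+u. \<integral>\<^sup>+v. ?k s u * ?k s v \<partial>L \<partial>L) = (\<integral>\<^sup>+u. ?k s u * (\<integral>\<^sup>+v. ?k s v \<partial>L) \<partial>L)"
      by (intro nn_integral_cong nn_integral_cmult) measurable
    also have "\<dots> = (\<integral>\<^sup>+u. ?k s u \<partial>L) * (\<integral>\<^sup>+v. ?k s v \<partial>L)"
      by (intro nn_integral_multc) measurable
    finally show "(\<integral>\<^sup>+u. ?k s u \<partial>L)\<^sup>2 = (\<integral>\<^sup>+u. \<integral>\<^sup>+v. ?k s u * ?k s v \<partial>L \<partial>L)"
      by (simp add: power2_eq_square)
  qed
  also have "\<dots> = (\<integral>\<^sup>+u. \<integral>\<^sup>+s. \<integral>\<^sup>+v. ?k s u * ?k s v \<partial>L \<partial>L \<partial>L)"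
    by (rule LL.Fubini') measurable
  also have "\<dots> = (\<integral>\<^sup>+u. \<integral>\<^sup>+v. \<integral>\<^sup>+s. ?k s u * ?k s v \<partial>L \<partial>L \<partial>L)"
    by (intro nn_integral_cong LL.Fubini') measurable
  also have "\<dots> = (\<integral>\<^sup>+u. \<integral>\<^sup>+v. ennreal (\<bar>f u\<bar> * \<bar>f v\<bar> * cov_kernel u v) \<partial>L \<partial>L)"
  proof (intro nn_integral_cong_AE)
    show "AE u in L. (\<integral>\<^sup>+v. \<integral>\<^sup>+s. ?k s u * ?k s v \<partial>L \<partial>L) = (\<integral>\<^sup>+v. ennreal (\<bar>f u\<bar> * \<bar>f v\<bar> * cov_kernel u v) \<partial>L)"
      using AE_L_neq[of 0] AE_L_in
    proof eventually_elim
      fix u assume u: "u \<noteq> 0" "u \<in> {0..T}"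
      show "(\<integral>\<^sup>+v. \<integral>\<^sup>+s. ?k s u * ?k s v \<partial>L \<partial>L) = (\<integral>\<^sup>+v. ennreal (\<bar>f u\<bar> * \<bar>f v\<bar> * cov_kernel u v) \<partial>L)"
      proof (intro nn_integral_cong_AE)
        show "AE v in L. (\<integral>\<^sup>+s. ?k s u * ?k s v \<partial>L) = ennreal (\<bar>f u\<bar> * \<bar>f v\<bar> * cov_kernel u v)"
          using AE_L_neq[of 0] AE_L_neq[of u] AE_L_in
        proof eventually_elim
          fix v assume v: "v \<noteq> 0" "v \<noteq> u" "v \<in> {0..T}"
          have "(\<integral>\<^sup>+s. ?k s u * ?k s v \<partial>L) = (\<integral>\<^sup>+s. ennreal (\<bar>f u\<bar> * \<bar>f v\<bar>) * ennreal (fbm_kernel \<alpha> s u * fbm_kernel \<alpha> s v) \<partial>L)"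
            by (intro nn_integral_cong) (simp add: ennreal_mult'[symmetric] mult_ac)
          also have "\<dots> = ennreal (\<bar>f u\<bar> * \<bar>f v\<bar>) * (\<integral>\<^sup>+s. ennreal (fbm_kernel \<alpha> s u * fbm_kernel \<alpha> s v) \<partial>L)"
            by (intro nn_integral_cmult) measurable
          also have "\<dots> = ennreal (\<bar>f u\<bar> * \<bar>f v\<bar> * cov_kernel u v)"
            using u v \<alpha>_pos \<alpha>_less by (subst nn_integral_fbm_kernel_product) (auto simp: cov_kernel_def ennreal_mult')
          finally show "(\<integral>\<^sup>+s. ?k s u * ?k s v \<partial>L) = ennreal (\<bar>f u\<bar> * \<bar>f v\<bar> * cov_kernel u v)" .
        qed
      qed
    qed
  qed
  finally show ?thesis .
qed

lemma in_L2_nn_integral_finite: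
  assumes "in_L2 T f"
  shows "(\<integral>\<^sup>+u. ennreal ((f u)\<^sup>2) \<partial>L) < \<infinity>"
  using assms integrableD(2)[of L "\<lambda>u. (f u)\<^sup>2"] by (simp add: in_L2_def less_top)

lemma nn_integral_fbm_op_sq_finite:
  assumes "in_L2 T f"
  shows "(\<integral>\<^sup>+s. (\<integral>\<^sup>+u. ennreal (fbm_kernel \<alpha> s u * \<bar>f u\<bar>) \<partial>L)\<^sup>2 \<partial>L) < \<infinity>"
proof -
  have [measurable]: "f \<in> borel_measurable L" using assms by (simp add: in_L2_def)
  show ?thesis
    unfolding nn_integral_fbm_op_sq[OF \<open>f \<in> borel_measurable L\<close>]
    by (rule le_less_trans[OF nn_integral_cov_kernel_schur])
       (use in_L2_nn_integral_finite[OF assms] in \<open>auto simp: ennreal_mult_less_top\<close>)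
qed

lemma fbm_kernel_integrable_AE:
  assumes "in_L2 T f"
  shows "AE s in L. integrable L (\<lambda>u. fbm_kernel \<alpha> s u * f u)"
proof -
  have [measurable]: "f \<in> borel_measurable L" using assms by (simp add: in_L2_def)
  have "AE s in L. (\<integral>\<^sup>+u. ennreal (fbm_kernel \<alpha> s u * \<bar>f u\<bar>) \<partial>L)\<^sup>2 \<noteq> \<infinity>"
    by (rule nn_integral_PInf_AE) (use nn_integral_fbm_op_sq_finite[OF assms] in auto)
  then show ?thesis
  proof eventually_elim
    fix s assume *: "(\<integral>\<^sup>+u. ennreal (fbm_kernel \<alpha> s u * \<bar>f u\<bar>) \<partial>L)\<^sup>2 \<noteq> \<infinity>"
    then have "(\<integral>\<^sup>+u. ennreal (fbm_kernel \<alpha> s u * \<bar>f u\<bar>) \<partial>L) < \<infinity>"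
      by (cases "(\<integral>\<^sup>+u. ennreal (fbm_kernel \<alpha> s u * \<bar>f u\<bar>) \<partial>L)") (auto simp: power2_eq_square ennreal_top_mult)
    then show "integrable L (\<lambda>u. fbm_kernel \<alpha> s u * f u)"
      by (intro integrableI_bounded) (auto simp: abs_mult)
  qed
qed

lemma fbm_op_measurable:
  assumes [measurable]: "f \<in> borel_measurable L"
  shows "fbm_op f \<in> borel_measurable L"
  unfolding fbm_op_def by measurable

lemma fbm_op_in_L2:
  assumes "in_L2 T f"
  shows "in_L2 T (fbm_op f)"
proof -
  have [measurable]: "f \<in> borel_measurable L" using assms by (simp add: in_L2_def)
  note fbm_op_measurable[measurable]
  have "(\<integral>\<^sup>+s. ennreal (norm ((fbm_op f s)\<^sup>2)) \<partial>L) \<le> (\<integral>\<^sup>+s. (\<integral>\<^sup>+u. ennreal (fbm_kernel \<alpha> s u * \<bar>f u\<bar>) \<partial>L)\<^sup>2 \<partial>L)"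
  proof (rule nn_integral_mono)
    fix s
    have "ennreal \<bar>fbm_op f s\<bar> \<le> (\<integral>\<^sup>+u. ennreal (norm (fbm_kernel \<alpha> s u * f u)) \<partial>L)"
      unfolding fbm_op_def using integral_norm_bound_ennreal[of L "\<lambda>u. fbm_kernel \<alpha> s u * f u"]
      by (cases "integrable L (\<lambda>u. fbm_kernel \<alpha> s u * f u)") (auto simp: not_integrable_integral_eq)
    then have "(ennreal \<bar>fbm_op f s\<bar>)\<^sup>2 \<le> (\<integral>\<^sup>+u. ennreal (norm (fbm_kernel \<alpha> s u * f u)) \<partial>L)\<^sup>2"
      by (rule power_mono) simp
    then show "ennreal (norm ((fbm_op f s)\<^sup>2)) \<le> (\<integral>\<^sup>+u. ennreal (fbm_kernel \<alpha> s u * \<bar>f u\<bar>) \<partial>L)\<^sup>2"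
      by (simp add: ennreal_power abs_mult)
  qed
  also have "\<dots> < \<infinity>" by (rule nn_integral_fbm_op_sq_finite[OF assms])
  finally have "integrable L (\<lambda>s. (fbm_op f s)\<^sup>2)" by (intro integrableI_bounded) auto
  then show ?thesis by (simp add: in_L2_def)
qed

lemma integral_product_square:
  fixes h :: "real \<Rightarrow> real"
  assumes h: "integrable L h"
  shows "(\<integral>p. h (fst p) * h (snd p) \<partial>(L \<Otimes>\<^sub>M L)) = (integral\<^sup>L L h)\<^sup>2"
proof -
  have [measurable]: "h \<in> borel_measurable L" using h by auto
  have "integrable (L \<Otimes>\<^sub>M L) (\<lambda>p. h (fst p) * h (snd p))"
    by (rule LL.Fubini_integrable) (use h in \<open>auto simp: abs_mult\<close>)
  from LL.integral_fst'[OF this] show ?thesis by (simp add: power2_eq_square)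
qed

text \<open>The same computation as for absolute values, whose finiteness now justifies Fubini's theorem for
functions with signs.\<close>

lemma fbm_op_isometry:
  assumes "in_L2 T f"
  shows "integrable (L \<Otimes>\<^sub>M L) (\<lambda>p. f (fst p) * f (snd p) * cov_kernel (fst p) (snd p))" (is ?int)
    and "(\<integral>s. (fbm_op f s)\<^sup>2 \<partial>L) = (\<integral>p. f (fst p) * f (snd p) * cov_kernel (fst p) (snd p) \<partial>(L \<Otimes>\<^sub>M L))" (is ?eq)
proof -
  have [measurable]: "f \<in> borel_measurable L" using assms by (simp add: in_L2_def)
  have fin: "(\<integral>\<^sup>+u. \<integral>\<^sup>+v. ennreal (\<bar>f u\<bar> * \<bar>f v\<bar> * cov_kernel u v) \<partial>L \<partial>L) < \<infinity>"
    using nn_integral_fbm_op_sq_finite[OF assms] nn_integral_fbm_op_sq[of f] by simp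
  have e: "(\<integral>\<^sup>+p. ennreal (\<bar>f (fst p)\<bar> * \<bar>f (snd p)\<bar> * cov_kernel (fst p) (snd p)) \<partial>(L \<Otimes>\<^sub>M L)) = (\<integral>\<^sup>+u. \<integral>\<^sup>+v. ennreal (\<bar>f u\<bar> * \<bar>f v\<bar> * cov_kernel u v) \<partial>L \<partial>L)"
    by (subst L.nn_integral_fst[symmetric]) simp_all
  show ?int
    by (rule integrableI_bounded) (use fin e in \<open>auto simp: abs_mult\<close>)
  define G where "G s p = fbm_kernel \<alpha> s (fst p) * f (fst p) * (fbm_kernel \<alpha> s (snd p) * f (snd p))" for s p
  have id3: "(\<lambda>q. fst q) \<in> borel_measurable (L \<Otimes>\<^sub>M (L \<Otimes>\<^sub>M L))" "(\<lambda>q. fst (snd q)) \<in> borel_measurable (L \<Otimes>\<^sub>M (L \<Otimes>\<^sub>M L))"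
     "(\<lambda>q. snd (snd q)) \<in> borel_measurable (L \<Otimes>\<^sub>M (L \<Otimes>\<^sub>M L))"
    by (rule lebesgue_on_to_borel; measurable)+
  have Gm [measurable]: "(\<lambda>(s,p). G s p) \<in> borel_measurable (L \<Otimes>\<^sub>M (L \<Otimes>\<^sub>M L))"
    unfolding G_def case_prod_beta
    by (intro borel_measurable_times fbm_kernel_measurable id3 measurable_compose[OF _ \<open>f \<in> borel_measurable L\<close>]) measurable
  have "(\<integral>\<^sup>+q. ennreal (norm (case q of (s,p) \<Rightarrow> G s p)) \<partial>(L \<Otimes>\<^sub>M (L \<Otimes>\<^sub>M L))) = (\<integral>\<^sup>+s. \<integral>\<^sup>+p. ennreal (norm (G s p)) \<partial>(L \<Otimes>\<^sub>M L) \<partial>L)"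
    using LL.P.nn_integral_fst[of "\<lambda>q. ennreal (norm (case q of (s,p) \<Rightarrow> G s p))" L] by simp
  also have "\<dots> = (\<integral>\<^sup>+s. (\<integral>\<^sup>+u. ennreal (fbm_kernel \<alpha> s u * \<bar>f u\<bar>) \<partial>L)\<^sup>2 \<partial>L)"
  proof (rule nn_integral_cong)
    fix s
    have "(\<integral>\<^sup>+p. ennreal (norm (G s p)) \<partial>(L \<Otimes>\<^sub>M L)) = (\<integral>\<^sup>+u. \<integral>\<^sup>+v. ennreal (norm (G s (u,v))) \<partial>L \<partial>L)"
      unfolding G_def by (subst L.nn_integral_fst[symmetric]) simp_all
    also have "\<dots> = (\<integral>\<^sup>+u. \<integral>\<^sup>+v. ennreal (fbm_kernel \<alpha> s u * \<bar>f u\<bar>) * ennreal (fbm_kernel \<alpha> s v * \<bar>f v\<bar>) \<partial>L \<partial>L)"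
      by (simp add: G_def abs_mult ennreal_mult'[symmetric])
    also have "\<dots> = (\<integral>\<^sup>+u. ennreal (fbm_kernel \<alpha> s u * \<bar>f u\<bar>) * (\<integral>\<^sup>+v. ennreal (fbm_kernel \<alpha> s v * \<bar>f v\<bar>) \<partial>L) \<partial>L)"
      by (intro nn_integral_cong nn_integral_cmult) measurable
    also have "\<dots> = (\<integral>\<^sup>+u. ennreal (fbm_kernel \<alpha> s u * \<bar>f u\<bar>) \<partial>L)\<^sup>2"
      by (subst nn_integral_multc) (auto simp: power2_eq_square)
    finally show "(\<integral>\<^sup>+p. ennreal (norm (G s p)) \<partial>(L \<Otimes>\<^sub>M L)) = (\<integral>\<^sup>+u. ennreal (fbm_kernel \<alpha> s u * \<bar>f u\<bar>) \<partial>L)\<^sup>2" .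
  qed
  also have "\<dots> < \<infinity>" by (rule nn_integral_fbm_op_sq_finite[OF assms])
  finally have Gi: "integrable (L \<Otimes>\<^sub>M (L \<Otimes>\<^sub>M L)) (\<lambda>(s,p). G s p)"
    by (intro integrableI_bounded Gm)
  have "(\<integral>s. (fbm_op f s)\<^sup>2 \<partial>L) = (\<integral>s. \<integral>p. G s p \<partial>(L \<Otimes>\<^sub>M L) \<partial>L)"
  proof (rule integral_cong_AE)
    show "AE s in L. (fbm_op f s)\<^sup>2 = (\<integral>p. G s p \<partial>(L \<Otimes>\<^sub>M L))"
      using fbm_kernel_integrable_AE[OF assms]
      by eventually_elim (simp add: G_def fbm_op_def integral_product_square[symmetric])
  qed (use fbm_op_measurable[of f] in measurable)
  also have "\<dots> = (\<integral>p. \<integral>s. G s p \<partial>L \<partial>(L \<Otimes>\<^sub>M L))"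
    by (rule LLL.Fubini_integral[symmetric]) (rule Gi)
  also have "\<dots> = (\<integral>p. f (fst p) * f (snd p) * cov_kernel (fst p) (snd p) \<partial>(L \<Otimes>\<^sub>M L))"
  proof (rule integral_cong_AE)
    have nz: "AE p in L \<Otimes>\<^sub>M L. fst p \<in> {0..T} \<and> snd p \<in> {0..T} \<and> fst p \<noteq> snd p \<and> fst p \<noteq> 0 \<and> snd p \<noteq> 0"
    proof (rule LL.AE_pair_measure)
      show "{p \<in> space (L \<Otimes>\<^sub>M L). fst p \<in> {0..T} \<and> snd p \<in> {0..T} \<and> fst p \<noteq> snd p \<and> fst p \<noteq> 0 \<and> snd p \<noteq> 0} \<in> sets (L \<Otimes>\<^sub>M L)"
        by measurable
      show "AE x in L. AE y in L. fst (x,y) \<in> {0..T} \<and> snd (x,y) \<in> {0..T} \<and> fst (x,y) \<noteq> snd (x,y) \<and> fst (x,y) \<noteq> 0 \<and> snd (x,y) \<noteq> 0"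
        using AE_L_neq[of 0] AE_L_in
      proof eventually_elim
        fix x assume x: "x \<noteq> 0" "x \<in> {0..T}"
        show "AE y in L. fst (x,y) \<in> {0..T} \<and> snd (x,y) \<in> {0..T} \<and> fst (x,y) \<noteq> snd (x,y) \<and> fst (x,y) \<noteq> 0 \<and> snd (x,y) \<noteq> 0"
          using AE_L_neq[of 0] AE_L_neq[of x] AE_L_in by eventually_elim (use x in auto)
      qed
    qed
    show "AE p in L \<Otimes>\<^sub>M L. (\<integral>s. G s p \<partial>L) = f (fst p) * f (snd p) * cov_kernel (fst p) (snd p)"
      using nz
    proof eventually_elim
      fix p assume p: "fst p \<in> {0..T} \<and> snd p \<in> {0..T} \<and> fst p \<noteq> snd p \<and> fst p \<noteq> 0 \<and> snd p \<noteq> 0"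
      have "(\<integral>s. fbm_kernel \<alpha> s (fst p) * fbm_kernel \<alpha> s (snd p) \<partial>L) = cov_kernel (fst p) (snd p)"
      proof -
        have "(\<integral>s. fbm_kernel \<alpha> s (fst p) * fbm_kernel \<alpha> s (snd p) \<partial>L) = enn2real (\<integral>\<^sup>+s. ennreal (fbm_kernel \<alpha> s (fst p) * fbm_kernel \<alpha> s (snd p)) \<partial>L)"
          by (rule integral_eq_nn_integral) auto
        also have "\<dots> = cov_kernel (fst p) (snd p)"
          using p \<alpha>_pos \<alpha>_less cov_kernel_nonneg[of "fst p" "snd p"]
          by (subst nn_integral_fbm_kernel_product) (auto simp: cov_kernel_def)
        finally show ?thesis .
      qed
      moreover have "(\<lambda>s. G s p) = (\<lambda>s. f (fst p) * f (snd p) * (fbm_kernel \<alpha> s (fst p) * fbm_kernel \<alpha> s (snd p)))"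
        by (simp add: G_def mult_ac)
      ultimately show "(\<integral>s. G s p \<partial>L) = f (fst p) * f (snd p) * cov_kernel (fst p) (snd p)" by simp
    qed
    show "(\<lambda>p. \<integral>s. G s p \<partial>L) \<in> borel_measurable (L \<Otimes>\<^sub>M L)"
      using LLL.integrable_snd[OF Gi] by (simp add: borel_measurable_integrable)
  qed measurable
  finally show ?eq .
qed

end

section \<open>Inversion and adjoint of the Volterra operator\<close>

lemma AE_lebesgue_on_iff_negligible:
  assumes "A \<in> sets lebesgue"
  shows "(AE x in lebesgue_on A. P x) \<longleftrightarrow> negligible {x \<in> A. \<not> P x}"
proof -
  have "(AE x in lebesgue_on A. P x) \<longleftrightarrow> (AE x in lebesgue. x \<in> A \<longrightarrow> P x)"
    using assms by (subst AE_restrict_space_iff) auto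
  also have "\<dots> \<longleftrightarrow> negligible {x \<in> A. \<not> P x}"
  proof
    assume "AE x in lebesgue. x \<in> A \<longrightarrow> P x"
    then obtain N where N: "{x \<in> space lebesgue. \<not> (x \<in> A \<longrightarrow> P x)} \<subseteq> N" "emeasure lebesgue N = 0" "N \<in> sets lebesgue"
      by (rule AE_E)
    then have "negligible N" by (auto simp: negligible_iff_null_sets)
    then show "negligible {x \<in> A. \<not> P x}" by (rule negligible_subset) (use N in auto)
  next
    assume "negligible {x \<in> A. \<not> P x}"
    then show "AE x in lebesgue. x \<in> A \<longrightarrow> P x"
      by (intro AE_I'[of "{x \<in> A. \<not> P x}"]) (auto simp: negligible_iff_null_sets)
  qed
  finally show ?thesis .
qed

text \<open>Completeness of Lebesgue measure gives the measurability of \<open>g\<close>. This matters for functions that are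
given by \<open>deriv\<close>.\<close>

lemma integrable_lebesgue_on_cong_AE:
  fixes f g :: "real \<Rightarrow> real"
  assumes "integrable (lebesgue_on A) f" "AE x in lebesgue_on A. g x = f x" "A \<in> sets lebesgue"
  shows "integrable (lebesgue_on A) g"
proof -
  have ng: "negligible {x \<in> A. g x \<noteq> f x}" using assms(2,3) by (simp add: AE_lebesgue_on_iff_negligible)
  have sf: "set_integrable lebesgue A f" using assms by (simp add: integrable_restrict_space set_integrable_def)
  have "set_integrable lebesgue A g"
    by (rule absolutely_integrable_spike[OF sf ng]) auto
  then show ?thesis using assms by (simp add: integrable_restrict_space set_integrable_def)
qed

lemma integrable_congI:
  "integrable M f \<Longrightarrow> (\<And>x. x \<in> space M \<Longrightarrow> g x = f x) \<Longrightarrow> integrable M g"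
  using Bochner_Integration.integrable_cong[of M M g f] by simp

context frac_kernel
begin

lemma rl_kernel_integrable: 
  assumes "a > 0" "0 \<le> s"
  shows "integrable L (\<lambda>u. rl_kernel a s u)"
proof (cases "s < T")
  case True
  show ?thesis by (rule integrableI_bounded) (use nn_integral_rl_kernel_Icc[OF assms True] in auto)
next
  case False
  have "integrable L (\<lambda>u. 0::real)" by simp
  then show ?thesis by (rule integrable_congI) (use False in \<open>auto simp: rl_kernel_def\<close>)
qed

lemma rl_kernel_convolution:
  assumes "a > 0" "b > 0" "0 \<le> s" "v \<le> T"
  shows "integrable L (\<lambda>u. rl_kernel a s u * rl_kernel b u v)" (is ?int)
    and "(\<integral>u. rl_kernel a s u * rl_kernel b u v \<partial>L) = Beta a b * rl_kernel (a + b) s v" (is ?eq)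
proof -
  have *: "(\<integral>\<^sup>+u. ennreal (rl_kernel a s u * rl_kernel b u v) \<partial>L) = ennreal (Beta a b * rl_kernel (a + b) s v)"
  proof (cases "s < v")
    case True
    then show ?thesis using nn_integral_rl_convolution_Icc[OF assms(1-3) True assms(4)] by (simp add: rl_kernel_def)
  next
    case False
    then have "(\<integral>\<^sup>+u. ennreal (rl_kernel a s u * rl_kernel b u v) \<partial>L) = (\<integral>\<^sup>+u. 0 \<partial>L)"
      by (intro nn_integral_cong) (auto simp: rl_kernel_def)
    then show ?thesis using False by (simp add: rl_kernel_def)
  qed
  show ?int by (rule integrableI_bounded) (use * in auto)
  have "(\<integral>u. rl_kernel a s u * rl_kernel b u v \<partial>L) = enn2real (\<integral>\<^sup>+u. ennreal (rl_kernel a s u * rl_kernel b u v) \<partial>L)"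
    by (rule integral_eq_nn_integral) auto
  also have "\<dots> = Beta a b * rl_kernel (a + b) s v"
    unfolding * using Beta_pos[OF assms(1,2)] by simp
  finally show ?eq .
qed

lemma rl_kernel_integral:
  assumes "a > 0" "0 \<le> s"
  shows "(\<integral>u. rl_kernel a s u \<partial>L) = Beta a 1 * rl_kernel (a + 1) s T"
proof -
  have "(\<integral>u. rl_kernel a s u \<partial>L) = (\<integral>u. rl_kernel a s u * rl_kernel 1 u T \<partial>L)"
  proof (rule integral_cong_AE)
    show "AE u in L. rl_kernel a s u = rl_kernel a s u * rl_kernel 1 u T"
      using AE_L_neq[of T] AE_L_in by eventually_elim (auto simp: rl_kernel_one)
  qed measurable
  then show ?thesis using rl_kernel_convolution(2)[of a 1 s T] assms by simp
qed

text \<open>The semigroup law of fractional integration. The condition on \<open>a + b\<close> makes the composed kernel bounded,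
so that \<open>g\<close> needs to be integrable only.\<close>

lemma rl_kernel_semigroup:
  assumes g: "integrable L g" and "a > 0" "b > 0" "a + b \<ge> 1" "0 \<le> s"
  shows "integrable L (\<lambda>u. rl_kernel a s u * (\<integral>v. rl_kernel b u v * g v \<partial>L))" (is ?int)
    and "(\<integral>u. rl_kernel a s u * (\<integral>v. rl_kernel b u v * g v \<partial>L) \<partial>L) = Beta a b * (\<integral>v. rl_kernel (a + b) s v * g v \<partial>L)" (is ?eq)
    and "integrable L (\<lambda>v. rl_kernel (a + b) s v * g v)" (is ?int2)
proof -
  have [measurable]: "g \<in> borel_measurable L" using g by auto
  have bound: "rl_kernel (a + b) s v \<le> T powr (a + b - 1)" if "v \<in> {0..T}" for v
    using that assms by (auto simp: rl_kernel_def intro!: powr_mono2)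
  show ?int2
  proof (rule Bochner_Integration.integrable_bound)
    show "integrable L (\<lambda>v. T powr (a + b - 1) * g v)" using g by simp
    show "AE v in L. norm (rl_kernel (a + b) s v * g v) \<le> norm (T powr (a + b - 1) * g v)"
      using AE_L_in by eventually_elim (auto simp: abs_mult intro!: mult_right_mono bound)
  qed measurable
  have "integrable (L \<Otimes>\<^sub>M L) (\<lambda>p. rl_kernel a s (snd p) * rl_kernel b (snd p) (fst p) * g (fst p))"
  proof (rule LL.Fubini_integrable)
    have eq: "(\<integral>u. norm (rl_kernel a s (snd (v,u)) * rl_kernel b (snd (v,u)) (fst (v,u)) * g (fst (v,u))) \<partial>L) = Beta a b * (rl_kernel (a + b) s v * \<bar>g v\<bar>)" if "v \<in> {0..T}" for v
      using rl_kernel_convolution(2)[of a b s v] assms that by (simp add: abs_mult)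
    have "integrable L (\<lambda>v. Beta a b * (rl_kernel (a + b) s v * \<bar>g v\<bar>))"
      using integrable_abs[OF \<open>?int2\<close>] by (simp add: abs_mult)
    then show "integrable L (\<lambda>v. \<integral>u. norm (rl_kernel a s (snd (v,u)) * rl_kernel b (snd (v,u)) (fst (v,u)) * g (fst (v,u))) \<partial>L)"
      by (rule integrable_congI) (use eq in auto)
    show "AE v in L. integrable L (\<lambda>u. rl_kernel a s (snd (v,u)) * rl_kernel b (snd (v,u)) (fst (v,u)) * g (fst (v,u)))"
      using AE_L_in by eventually_elim (use assms rl_kernel_convolution(1)[of a b s] in auto)
  qed measurable
  then have i: "integrable (L \<Otimes>\<^sub>M L) (\<lambda>(v,u). rl_kernel a s u * rl_kernel b u v * g v)"
    by (simp add: case_prod_beta')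
  show ?int using LL.integrable_snd[OF i] by (simp add: mult.assoc)
  have "(\<integral>u. rl_kernel a s u * (\<integral>v. rl_kernel b u v * g v \<partial>L) \<partial>L) = (\<integral>v. \<integral>u. rl_kernel a s u * rl_kernel b u v * g v \<partial>L \<partial>L)"
    using LL.Fubini_integral[OF i] by (simp add: mult.assoc)
  also have "\<dots> = (\<integral>v. Beta a b * (rl_kernel (a + b) s v * g v) \<partial>L)"
    by (rule Bochner_Integration.integral_cong) (use rl_kernel_convolution(2)[of a b s] assms in auto)
  finally show ?eq by simp
qed

lemma integral_rl_kernel_one:
  assumes "integrable L g" "s \<in> {0..T}"
  shows "(\<integral>v. rl_kernel 1 s v * g v \<partial>L) = integral {s..T} g"
proof -
  have "integrable L (\<lambda>v. rl_kernel 1 s v * g v)"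
    by (rule Bochner_Integration.integrable_bound[OF assms(1)])
       (use assms(1) in \<open>auto simp: rl_kernel_one intro!: AE_I2\<close>)
  then have "(\<integral>v. rl_kernel 1 s v * g v \<partial>L) = integral {0..T} (\<lambda>v. rl_kernel 1 s v * g v)"
    by (rule lebesgue_integral_eq_integral) auto
  also have "\<dots> = integral {0..T} (\<lambda>v. if v \<in> {s..T} then g v else 0)"
    by (rule integral_spike[of "{s}"]) (auto simp: rl_kernel_one)
  also have "\<dots> = integral {s..T} g"
    using assms(2) by (subst integral_restrict_Int) (simp add: Int_absorb2)
  finally show ?thesis .
qed

text \<open>\<open>J\<close> is prescribed on \<open>[0,T]\<close> only, which determines the derivative at interior points. It will be an
integral over \<open>lebesgue_on {s..T}\<close>, for which the formula fails at \<open>s < 0\<close>.\<close>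

lemma has_derivative_integral_tail_AE:
  assumes g: "integrable L g" and J: "\<And>s. s \<in> {0..T} \<Longrightarrow> J s = (\<integral>v. rl_kernel 1 s v * g v \<partial>L)"
  shows "AE s in L. (J has_real_derivative - g s) (at s)"
proof -
  have gi: "g integrable_on {0..T}" using g by (simp add: integrable_on_lebesgue_on)
  obtain N where N: "negligible N" "\<And>x. x \<in> {0<..<T} - N \<Longrightarrow> ((\<lambda>x. integral {0..x} g) has_real_derivative g x) (at x)"
    using indefinite_integral_has_derivative_ae[OF gi] by blast
  have d: "(J has_real_derivative - g s) (at s)" if "s \<in> {0<..<T} - N" for s
  proof -
    have "((\<lambda>x. integral {0..T} g - integral {0..x} g) has_real_derivative 0 - g s) (at s)"
      by (intro derivative_intros N that)
    then have "((\<lambda>x. integral {0..T} g - integral {0..x} g) has_real_derivative - g s) (at s)" by simp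
    moreover have "open {0<..<T}" "s \<in> {0<..<T}" using that by auto
    ultimately show ?thesis
    proof (rule has_field_derivative_transform_within_open)
      fix x assume x: "x \<in> {0<..<T}"
      have "integral {0..x} g + integral {x..T} g = integral {0..T} g"
        by (rule Henstock_Kurzweil_Integration.integral_combine) (use x gi in auto)
      then show "integral {0..T} g - integral {0..x} g = J x"
        using x J[of x] integral_rl_kernel_one[OF g, of x] by simp
    qed
  qed
  have "{s \<in> {0..T}. \<not> (J has_real_derivative - g s) (at s)} \<subseteq> N \<union> {0,T}"
  proof (intro subsetI, rule ccontr)
    fix s assume "s \<in> {s \<in> {0..T}. \<not> (J has_real_derivative - g s) (at s)}" "s \<notin> N \<union> {0,T}"
    then show False using d[of s] by simp
  qed
  moreover have "negligible (N \<union> {0,T})" using N by (intro negligible_Un) auto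
  ultimately have "negligible {s \<in> {0..T}. \<not> (J has_real_derivative - g s) (at s)}"
    using negligible_subset by blast
  then show ?thesis by (subst AE_lebesgue_on_iff_negligible) auto
qed

lemma lebesgue_on_Icc_rl_kernel:
  assumes "t \<in> {0..T}"
  shows "(\<integral>u. (u - t) powr (-\<alpha>) * u powr \<alpha> * f u \<partial>lebesgue_on {t..T}) = (\<integral>u. rl_kernel (1 - \<alpha>) t u * (u powr \<alpha> * f u) \<partial>L)"
proof -
  have "(\<integral>u. (u - t) powr (-\<alpha>) * u powr \<alpha> * f u \<partial>lebesgue_on {t..T}) = (\<integral>u. indicator {t..T} u *\<^sub>R ((u - t) powr (-\<alpha>) * u powr \<alpha> * f u) \<partial>lebesgue)"
    by (rule integral_restrict_space) auto
  also have "\<dots> = (\<integral>u. indicator {0..T} u *\<^sub>R (rl_kernel (1 - \<alpha>) t u * (u powr \<alpha> * f u)) \<partial>lebesgue)"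
    using assms by (intro Bochner_Integration.integral_cong) (auto simp: indicator_def rl_kernel_def)
  also have "\<dots> = (\<integral>u. rl_kernel (1 - \<alpha>) t u * (u powr \<alpha> * f u) \<partial>L)"
    by (rule integral_restrict_space[symmetric]) auto
  finally show ?thesis .
qed

lemma fbm_op_eq_rl: "fbm_op f s = s powr (-\<alpha>) * (\<integral>u. rl_kernel \<alpha> s u * (u powr \<alpha> * f u) \<partial>L)"
proof -
  have "fbm_op f s = (\<integral>u. s powr (-\<alpha>) * (rl_kernel \<alpha> s u * (u powr \<alpha> * f u)) \<partial>L)"
    unfolding fbm_op_def fbm_kernel_def by (simp only: mult_ac)
  then show ?thesis by simp
qed

lemma L2_integrable:
  assumes "in_L2 T f"
  shows "integrable L f"
proof -
  have [measurable]: "f \<in> borel_measurable L" and i: "integrable L (\<lambda>s. (f s)\<^sup>2)" using assms by (auto simp: in_L2_def)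
  show ?thesis
  proof (rule Bochner_Integration.integrable_bound)
    show "integrable L (\<lambda>s. 1 + (f s)\<^sup>2)" using i by simp
    have "\<bar>x\<bar> \<le> 1 + x\<^sup>2" for x :: real
    proof -
      have "0 \<le> (\<bar>x\<bar> - 1)\<^sup>2" by simp
      then have "2 * \<bar>x\<bar> \<le> 1 + x\<^sup>2" by (simp add: power2_diff)
      then show ?thesis using abs_ge_zero[of x] by linarith
    qed
    then show "AE x in L. norm (f x) \<le> norm (1 + (f x)\<^sup>2)" by (auto intro!: AE_I2)
  qed measurable
qed

lemma L2_mult_powr_integrable:
  assumes "in_L2 T g"
  shows "integrable L (\<lambda>v. v powr \<alpha> * g v)"
proof (rule Bochner_Integration.integrable_bound)
  show "integrable L (\<lambda>v. T powr \<alpha> * g v)" using L2_integrable[OF assms] by simp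
  show "AE v in L. norm (v powr \<alpha> * g v) \<le> norm (T powr \<alpha> * g v)"
    using AE_L_in by eventually_elim (use \<alpha>_pos in \<open>auto simp: abs_mult intro!: mult_right_mono powr_mono2\<close>)
qed (use assms in \<open>auto simp: in_L2_def\<close>)

text \<open>Abel inversion. Fractional integration of order \<open>1 - \<alpha>\<close> after order \<open>\<alpha>\<close> gives an integral of order
\<open>1\<close>, which is differentiated almost everywhere.\<close>

lemma fbm_op_inverse_AE:
  assumes g: "in_L2 T g" and f: "AE u in L. f u = c * fbm_op g u" and fm: "f \<in> borel_measurable L"
  shows "AE s in L. ((\<lambda>t. \<integral>u. (u - t) powr (-\<alpha>) * u powr \<alpha> * f u \<partial>lebesgue_on {t..T}) has_real_derivative - (c * Beta (1 - \<alpha>) \<alpha> * (s powr \<alpha> * g s))) (at s)"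
proof (rule has_derivative_integral_tail_AE)
  let ?g = "\<lambda>v. v powr \<alpha> * g v"
  have [measurable]: "g \<in> borel_measurable L" using g by (simp add: in_L2_def)
  note fm[measurable] fbm_op_measurable[measurable]
  note gi = L2_mult_powr_integrable[OF g]
  show "integrable L (\<lambda>s. c * Beta (1 - \<alpha>) \<alpha> * (s powr \<alpha> * g s))" using gi by simp
  fix s assume s: "s \<in> {0..T}"
  have "(\<integral>u. (u - s) powr (-\<alpha>) * u powr \<alpha> * f u \<partial>lebesgue_on {s..T}) = (\<integral>u. rl_kernel (1 - \<alpha>) s u * (u powr \<alpha> * f u) \<partial>L)"
    by (rule lebesgue_on_Icc_rl_kernel[OF s])
  also have "\<dots> = (\<integral>u. c * (rl_kernel (1 - \<alpha>) s u * (\<integral>v. rl_kernel \<alpha> u v * ?g v \<partial>L)) \<partial>L)"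
  proof (rule integral_cong_AE)
    show "AE u in L. rl_kernel (1 - \<alpha>) s u * (u powr \<alpha> * f u) = c * (rl_kernel (1 - \<alpha>) s u * (\<integral>v. rl_kernel \<alpha> u v * ?g v \<partial>L))"
      using f AE_L_neq[of 0] AE_L_in
    proof eventually_elim
      fix u assume u: "f u = c * fbm_op g u" "u \<noteq> 0" "u \<in> {0..T}"
      have "u powr \<alpha> * u powr (-\<alpha>) = 1" using u by (simp add: powr_minus)
      moreover have "u powr \<alpha> * f u = c * ((u powr \<alpha> * u powr (-\<alpha>)) * (\<integral>v. rl_kernel \<alpha> u v * ?g v \<partial>L))"
        unfolding u(1) fbm_op_eq_rl by (simp only: mult_ac)
      ultimately have "u powr \<alpha> * f u = c * (\<integral>v. rl_kernel \<alpha> u v * ?g v \<partial>L)" by simp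
      then show "rl_kernel (1 - \<alpha>) s u * (u powr \<alpha> * f u) = c * (rl_kernel (1 - \<alpha>) s u * (\<integral>v. rl_kernel \<alpha> u v * ?g v \<partial>L))"
        by simp
    qed
  qed measurable
  also have "\<dots> = c * (Beta (1 - \<alpha>) \<alpha> * (\<integral>v. rl_kernel (1 - \<alpha> + \<alpha>) s v * ?g v \<partial>L))"
    using rl_kernel_semigroup(2)[OF gi, of "1-\<alpha>" \<alpha> s] \<alpha>_pos \<alpha>_less s by simp
  also have "\<dots> = (\<integral>v. rl_kernel 1 s v * (c * Beta (1 - \<alpha>) \<alpha> * (v powr \<alpha> * g v)) \<partial>L)"
  proof -
    have "(\<lambda>v. rl_kernel 1 s v * (c * Beta (1 - \<alpha>) \<alpha> * (v powr \<alpha> * g v))) = (\<lambda>v. (c * Beta (1 - \<alpha>) \<alpha>) * (rl_kernel 1 s v * ?g v))"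
      by (rule ext) (simp only: mult_ac)
    then show ?thesis by simp
  qed
  finally show "(\<integral>u. (u - s) powr (-\<alpha>) * u powr \<alpha> * f u \<partial>lebesgue_on {s..T}) = (\<integral>v. rl_kernel 1 s v * (c * Beta (1 - \<alpha>) \<alpha> * (v powr \<alpha> * g v)) \<partial>L)" .
qed

definition fbm_adj :: "(real \<Rightarrow> real) \<Rightarrow> real \<Rightarrow> real" where
  "fbm_adj h u = (\<integral>s. fbm_kernel \<alpha> s u * h s \<partial>L)"

text \<open>For bounded \<open>h\<close> the adjoint is bounded, as \<open>\<integral> s\<^sup>-\<^sup>\<alpha> (u - s)\<^sup>\<alpha>\<^sup>-\<^sup>1 ds\<close> is a Beta function, independent
of \<open>u\<close>.\<close>

lemma fbm_adj_in_L2: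
  assumes [measurable]: "h \<in> borel_measurable L" and C: "\<And>s. s \<in> {0..T} \<Longrightarrow> \<bar>h s\<bar> \<le> C"
  shows "in_L2 T (fbm_adj h)"
proof -
  have [measurable]: "fbm_adj h \<in> borel_measurable L" unfolding fbm_adj_def by measurable
  have C0: "C \<ge> 0" using C[of 0] T_pos by auto
  define D where "D = C * (T powr \<alpha> * Beta (1 - \<alpha>) \<alpha>)"
  have bd: "\<bar>fbm_adj h u\<bar> \<le> D" if u: "u \<in> {0..T}" for u
  proof -
    have k: "fbm_kernel \<alpha> s u = u powr \<alpha> * (rl_kernel (1 - \<alpha>) 0 s * rl_kernel \<alpha> s u)" if "s \<in> {0..T}" for s
      using that by (auto simp: fbm_kernel_def rl_kernel_def)
    have i: "integrable L (\<lambda>s. u powr \<alpha> * (rl_kernel (1 - \<alpha>) 0 s * rl_kernel \<alpha> s u))"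
      using rl_kernel_convolution(1)[of "1-\<alpha>" \<alpha> 0 u] \<alpha>_pos \<alpha>_less u by simp
    have ik: "integrable L (\<lambda>s. C * fbm_kernel \<alpha> s u)"
      by (rule integrable_mult_right, rule integrable_congI[OF i]) (simp add: k)
    have "\<bar>fbm_adj h u\<bar> \<le> (\<integral>s. C * fbm_kernel \<alpha> s u \<partial>L)"
      unfolding fbm_adj_def real_norm_def[symmetric]
    proof (rule Bochner_Integration.integral_norm_bound_integral)
      show "norm (fbm_kernel \<alpha> s u * h s) \<le> C * fbm_kernel \<alpha> s u" if "s \<in> space L" for s
        using C[of s] that mult_left_mono[of "\<bar>h s\<bar>" C "fbm_kernel \<alpha> s u"] by (simp add: abs_mult mult.commute)
      show "integrable L (\<lambda>s. fbm_kernel \<alpha> s u * h s)"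
      proof (rule Bochner_Integration.integrable_bound[OF ik])
        show "AE s in L. norm (fbm_kernel \<alpha> s u * h s) \<le> norm (C * fbm_kernel \<alpha> s u)"
          using AE_L_in
        proof eventually_elim
          fix s assume "s \<in> {0..T}"
          then show "norm (fbm_kernel \<alpha> s u * h s) \<le> norm (C * fbm_kernel \<alpha> s u)"
            using C[of s] C0 mult_left_mono[of "\<bar>h s\<bar>" C "fbm_kernel \<alpha> s u"] by (simp add: abs_mult mult.commute)
        qed
      qed measurable
    qed (rule ik)
    also have "\<dots> = C * (\<integral>s. u powr \<alpha> * (rl_kernel (1 - \<alpha>) 0 s * rl_kernel \<alpha> s u) \<partial>L)"
      using Bochner_Integration.integral_cong[of L L "\<lambda>s. fbm_kernel \<alpha> s u" "\<lambda>s. u powr \<alpha> * (rl_kernel (1 - \<alpha>) 0 s * rl_kernel \<alpha> s u)"] k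
      by simp
    also have "\<dots> = C * (u powr \<alpha> * (Beta (1 - \<alpha>) \<alpha> * rl_kernel 1 0 u))"
      using rl_kernel_convolution(2)[of "1-\<alpha>" \<alpha> 0 u] \<alpha>_pos \<alpha>_less u by simp
    also have "\<dots> \<le> D" unfolding D_def
      using C0 u \<alpha>_pos \<alpha>_less Beta_pos[of "1-\<alpha>" \<alpha>] by (intro mult_left_mono mult_mono powr_mono2) (auto simp: rl_kernel_one)
    finally show ?thesis .
  qed
  have "integrable L (\<lambda>u. (fbm_adj h u)\<^sup>2)"
  proof (rule L.integrable_const_bound)
    show "AE u in L. norm ((fbm_adj h u)\<^sup>2) \<le> D\<^sup>2"
      using AE_L_in
    proof eventually_elim
      fix u assume "u \<in> {0..T}"
      then show "norm ((fbm_adj h u)\<^sup>2) \<le> D\<^sup>2" using power_mono[OF bd[of u], of 2] by simp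
    qed
  qed measurable
  then show ?thesis by (simp add: in_L2_def)
qed

text \<open>Fubini's theorem. The double integral converges absolutely since \<open>fbm_op\<close> of \<open>\<bar>f\<bar>\<close> is in \<open>L\<^sup>2\<close>, hence
in \<open>L\<^sup>1\<close>.\<close>

lemma fbm_op_adjoint:
  assumes f: "in_L2 T f" and [measurable]: "h \<in> borel_measurable L" and C: "\<And>s. s \<in> {0..T} \<Longrightarrow> \<bar>h s\<bar> \<le> C"
  shows "(\<integral>s. fbm_op f s * h s \<partial>L) = (\<integral>u. f u * fbm_adj h u \<partial>L)"
proof -
  have [measurable]: "f \<in> borel_measurable L" using f by (simp add: in_L2_def)
  have C0: "C \<ge> 0" using C[of 0] T_pos by auto
  have "integrable (L \<Otimes>\<^sub>M L) (\<lambda>p. fbm_kernel \<alpha> (fst p) (snd p) * f (snd p) * h (fst p))"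
  proof (rule integrableI_bounded)
    let ?A = "\<lambda>s. \<integral>\<^sup>+u. ennreal (fbm_kernel \<alpha> s u * \<bar>f u\<bar>) \<partial>L"
    have "(\<integral>\<^sup>+p. ennreal (norm (fbm_kernel \<alpha> (fst p) (snd p) * f (snd p) * h (fst p))) \<partial>(L \<Otimes>\<^sub>M L))
       = (\<integral>\<^sup>+s. \<integral>\<^sup>+u. ennreal (norm (fbm_kernel \<alpha> s u * f u * h s)) \<partial>L \<partial>L)"
      by (subst L.nn_integral_fst[symmetric]) simp_all
    also have "\<dots> \<le> (\<integral>\<^sup>+s. ennreal C * (1 + (?A s)\<^sup>2) \<partial>L)"
    proof (rule nn_integral_mono)
      fix s assume "s \<in> space L"
      then have s: "\<bar>h s\<bar> \<le> C" using C by simp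
      have "(\<integral>\<^sup>+u. ennreal (norm (fbm_kernel \<alpha> s u * f u * h s)) \<partial>L) = (\<integral>\<^sup>+u. ennreal \<bar>h s\<bar> * ennreal (fbm_kernel \<alpha> s u * \<bar>f u\<bar>) \<partial>L)"
        by (intro nn_integral_cong) (simp add: abs_mult ennreal_mult'[symmetric] mult_ac)
      also have "\<dots> = ennreal \<bar>h s\<bar> * ?A s" by (rule nn_integral_cmult) measurable
      also have "\<dots> \<le> ennreal C * (1 + (?A s)\<^sup>2)"
      proof (intro mult_mono ennreal_leI s)
        show "?A s \<le> 1 + (?A s)\<^sup>2"
        proof (cases "?A s \<le> 1")
          case True then show ?thesis by (rule order_trans) simp
        next
          case False
          then have "?A s * 1 \<le> ?A s * ?A s" by (intro mult_left_mono) auto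
          then show ?thesis by (simp add: power2_eq_square add_increasing)
        qed
      qed auto
      finally show "(\<integral>\<^sup>+u. ennreal (norm (fbm_kernel \<alpha> s u * f u * h s)) \<partial>L) \<le> ennreal C * (1 + (?A s)\<^sup>2)" .
    qed
    also have "\<dots> = ennreal C * (emeasure L (space L) + (\<integral>\<^sup>+s. (?A s)\<^sup>2 \<partial>L))"
      by (subst nn_integral_cmult, measurable, subst nn_integral_add) auto
    also have "\<dots> < \<infinity>"
    proof -
      have "emeasure L {0..T} < \<top>" using L.emeasure_finite[of "{0..T}"] by (simp only: less_top infinity_ennreal_def)
      then show ?thesis using nn_integral_fbm_op_sq_finite[OF f] by (simp add: ennreal_mult_less_top)
    qed
    finally show "(\<integral>\<^sup>+p. ennreal (norm (fbm_kernel \<alpha> (fst p) (snd p) * f (snd p) * h (fst p))) \<partial>(L \<Otimes>\<^sub>M L)) < \<infinity>" .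
  qed measurable
  then have i: "integrable (L \<Otimes>\<^sub>M L) (\<lambda>(s,u). fbm_kernel \<alpha> s u * f u * h s)"
    by (simp add: case_prod_beta')
  have "(\<integral>s. fbm_op f s * h s \<partial>L) = (\<integral>s. \<integral>u. fbm_kernel \<alpha> s u * f u * h s \<partial>L \<partial>L)"
    by (simp add: fbm_op_def)
  also have "\<dots> = (\<integral>u. \<integral>s. fbm_kernel \<alpha> s u * f u * h s \<partial>L \<partial>L)"
    by (rule LL.Fubini_integral[OF i, symmetric])
  also have "\<dots> = (\<integral>u. \<integral>s. f u * (fbm_kernel \<alpha> s u * h s) \<partial>L \<partial>L)"
    by (simp only: mult_ac)
  also have "\<dots> = (\<integral>u. f u * fbm_adj h u \<partial>L)"
    by (simp add: fbm_adj_def)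
  finally show ?thesis .
qed

end

section \<open>The kernel of fractional Brownian motion and the operator B-star\<close>

context frac_kernel
begin

lemma fbm_op_indicator_eq_0:
  assumes "t \<le> s"
  shows "fbm_op (indicator {0<..t}) s = 0"
proof -
  have "(\<lambda>u. fbm_kernel \<alpha> s u * indicator {0<..t} u) = (\<lambda>u. 0)"
    using assms by (auto simp: fbm_kernel_def rl_kernel_def indicator_def)
  then show ?thesis by (simp add: fbm_op_def)
qed

text \<open>The product rule for \<open>u\<^sup>\<alpha> (u - s)\<^sup>\<alpha>\<close> on \<open>[s,t]\<close> turns the integral in \<open>Z_kernel\<close> into the one in
\<open>fbm_op\<close>.\<close>

lemma Z_kernel_eq_fbm_op:
  assumes s: "0 < s" and st: "s < t" and tT: "t \<le> T"
  shows "Z_kernel (\<alpha> + 1/2) t s = kappa (\<alpha> + 1/2) * \<alpha> * fbm_op (indicator {0<..t}) s"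
proof -
  define p where "p u = u powr (\<alpha> - 1) * (u - s) powr \<alpha>" for u
  define q where "q u = u powr \<alpha> * (u - s) powr (\<alpha> - 1)" for u
  define G where "G u = u powr \<alpha> * (u - s) powr \<alpha>" for u
  have "((\<lambda>u. \<alpha> * p u + \<alpha> * q u) has_integral (G t - G s)) {s..t}"
  proof (rule fundamental_theorem_of_calculus_interior)
    show "continuous_on {s..t} G" unfolding G_def using s \<alpha>_pos by (intro continuous_on_mult continuous_on_powr' continuous_intros) auto
    show "(G has_vector_derivative \<alpha> * p u + \<alpha> * q u) (at u)" if "u \<in> {s<..<t}" for u
      unfolding G_def p_def q_def has_real_derivative_iff_has_vector_derivative[symmetric] using s that
      by (auto intro!: derivative_eq_intros simp: powr_diff field_simps)
  qed (use st in simp)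
  moreover have pc: "continuous_on {s..t} p" unfolding p_def using s \<alpha>_pos by (intro continuous_on_mult continuous_on_powr' continuous_intros) auto
  then have pI: "(p has_integral integral {s..t} p) {s..t}"
    using integrable_continuous_real by (simp add: has_integral_integrable_integral)
  ultimately have "((\<lambda>u. (\<alpha> * p u + \<alpha> * q u) - \<alpha> * p u) has_integral ((G t - G s) - \<alpha> * integral {s..t} p)) {s..t}"
    by (intro has_integral_diff has_integral_mult_right)
  then have "((\<lambda>u. (1/\<alpha>) * (\<alpha> * q u)) has_integral (1/\<alpha>) * (G t - \<alpha> * integral {s..t} p)) {s..t}"
    using \<alpha>_pos by (intro has_integral_mult_right) (simp add: G_def)
  then have qI: "(q has_integral (1/\<alpha>) * (G t - \<alpha> * integral {s..t} p)) {s..t}" using \<alpha>_pos by simp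
  have "(\<integral>\<^sup>+x. ennreal (indicator {s..t} x * q x) \<partial>lborel) = ennreal ((1/\<alpha>) * (G t - \<alpha> * integral {s..t} p))"
  proof -
    have "((\<lambda>x. indicator {s..t} x * q x) has_integral (1/\<alpha>) * (G t - \<alpha> * integral {s..t} p)) UNIV"
      using qI by (subst (asm) has_integral_restrict_UNIV[symmetric]) (simp add: indicator_def of_bool_def if_distrib[of "\<lambda>x. x * _"] cong: if_cong)
    then show ?thesis
      by (intro nn_integral_has_integral_lborel) (auto simp: indicator_def q_def)
  qed
  moreover have "(\<integral>\<^sup>+x. ennreal (rl_kernel \<alpha> s x * (x powr \<alpha> * indicator {0<..t} x)) \<partial>L) = (\<integral>\<^sup>+x. ennreal (indicator {s..t} x * q x) \<partial>lborel)"
  proof -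
    have "(\<integral>\<^sup>+x. ennreal (rl_kernel \<alpha> s x * (x powr \<alpha> * indicator {0<..t} x)) \<partial>L) = (\<integral>\<^sup>+x. ennreal (rl_kernel \<alpha> s x * (x powr \<alpha> * indicator {0<..t} x)) * indicator {0..T} x \<partial>lborel)"
      by (rule nn_integral_lebesgue_on_borel) measurable
    also have "\<dots> = (\<integral>\<^sup>+x. ennreal (indicator {s..t} x * q x) \<partial>lborel)"
      by (rule nn_integral_cong) (use s st tT in \<open>auto simp: q_def rl_kernel_def indicator_def mult.commute\<close>)
    finally show ?thesis .
  qed
  ultimately have *: "(\<integral>\<^sup>+x. ennreal (rl_kernel \<alpha> s x * (x powr \<alpha> * indicator {0<..t} x)) \<partial>L) = ennreal ((1/\<alpha>) * (G t - \<alpha> * integral {s..t} p))"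
    by simp
  have nn: "0 \<le> (1/\<alpha>) * (G t - \<alpha> * integral {s..t} p)"
    by (rule has_integral_nonneg[OF qI]) (simp add: q_def)
  have "(\<integral>x. rl_kernel \<alpha> s x * (x powr \<alpha> * indicator {0<..t} x) \<partial>L) = enn2real (\<integral>\<^sup>+x. ennreal (rl_kernel \<alpha> s x * (x powr \<alpha> * indicator {0<..t} x)) \<partial>L)"
    by (rule integral_eq_nn_integral) auto
  then have "(\<integral>x. rl_kernel \<alpha> s x * (x powr \<alpha> * indicator {0<..t} x) \<partial>L) = (1/\<alpha>) * (G t - \<alpha> * integral {s..t} p)"
    unfolding * using nn by (simp only: enn2real_ennreal)
  then have op: "\<alpha> * fbm_op (indicator {0<..t}) s = s powr (-\<alpha>) * (G t - \<alpha> * integral {s..t} p)"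
    unfolding fbm_op_eq_rl using \<alpha>_pos by simp
  have "integrable (lebesgue_on {s..t}) p" by (rule continuous_imp_integrable_real[OF pc])
  then have "(\<integral>u. p u \<partial>lebesgue_on {s..t}) = integral {s..t} p" by (rule lebesgue_integral_eq_integral) auto
  moreover have "(t / s) powr \<alpha> = s powr (-\<alpha>) * t powr \<alpha>" using s st by (simp add: powr_divide powr_minus_divide)
  ultimately have "Z_kernel (\<alpha> + 1/2) t s = kappa (\<alpha> + 1/2) * (s powr (-\<alpha>) * t powr \<alpha> * (t - s) powr \<alpha> - \<alpha> * s powr (-\<alpha>) * integral {s..t} p)"
    by (simp add: Z_kernel_def p_def[symmetric])
  also have "\<dots> = kappa (\<alpha> + 1/2) * (\<alpha> * fbm_op (indicator {0<..t}) s)"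
    unfolding op by (simp add: G_def algebra_simps)
  finally show ?thesis by simp
qed

text \<open>Let \<open>\<psi>(u) = u\<^sup>\<alpha> x0(u)\<close>. Writing \<open>\<psi>\<close> as \<open>\<psi>(T)\<close> minus the integral of its derivative \<open>g\<close> and using the
semigroup law, one sees that the integral that is differentiated in \<open>B_star\<close> has the density
\<open>N(t) = \<psi>(T) (T - t)\<^sup>-\<^sup>\<alpha> - \<integral> (v - t)\<^sup>-\<^sup>\<alpha> g(v) dv\<close>. Hence \<open>B_star\<close> is \<open>y(t) = c0 t\<^sup>-\<^sup>\<alpha> N(t)\<close> almost
everywhere, and fractional integration of \<open>N\<close> of order \<open>\<alpha>\<close> gives back \<open>\<psi>\<close>.\<close>

lemma B_star_inverse:
  assumes d: "\<And>x. x \<in> {0..T} \<Longrightarrow> (x0 has_real_derivative x1 x) (at x within {0..T})"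
    and c1: "continuous_on {0..T} x1"
    and c0: "c0 = 2 * (\<alpha> + 1/2) * kappa1 (\<alpha> + 1/2) / kappa (\<alpha> + 1/2)"
  obtains y where "AE t in L. B_star (\<alpha> + 1/2) T x0 t = y t" "in_L2 T y"
    "\<And>s. s \<in> {0<..<T} \<Longrightarrow> fbm_op y s = c0 * Beta \<alpha> (1 - \<alpha>) * x0 s"
proof -
  have cx0: "continuous_on {0..T} x0"
    using d by (meson DERIV_continuous continuous_on_eq_continuous_within)
  obtain C where C: "C > 0" "\<And>x. x \<in> {0..T} \<Longrightarrow> \<bar>x0 x\<bar> \<le> C" "\<And>x. x \<in> {0..T} \<Longrightarrow> \<bar>x1 x\<bar> \<le> C"
  proof -
    have "bounded (x0 ` {0..T})" "bounded (x1 ` {0..T})"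
      using cx0 c1 by (auto intro!: compact_imp_bounded compact_continuous_image)
    then obtain a b where "\<forall>x\<in>x0 ` {0..T}. norm x \<le> a" "\<forall>x\<in>x1 ` {0..T}. norm x \<le> b" unfolding bounded_iff by blast
    then show ?thesis by (intro that[of "max 1 (max a b)"]) (auto simp: le_max_iff_disj)
  qed
  define \<psi> where "\<psi> u = u powr \<alpha> * x0 u" for u
  define g where "g u = \<alpha> * u powr (\<alpha> - 1) * x0 u + u powr \<alpha> * x1 u" for u
  have mx [measurable]: "x0 \<in> borel_measurable L" "x1 \<in> borel_measurable L"
    using cx0 c1 by (auto intro: continuous_imp_measurable_on_sets_lebesgue)
  have gm [measurable]: "g \<in> borel_measurable L" unfolding g_def by measurable
  (* The derivative of psi has a singularity at 0, of the order of v to the power alpha - 1. *)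
  define D where "D = \<alpha> * C + C * T"
  have D: "D > 0" using C \<alpha>_pos T_pos by (simp add: D_def add_pos_pos)
  have gb: "\<bar>g v\<bar> \<le> D * v powr (\<alpha> - 1)" if v: "v \<in> {0<..T}" for v
  proof -
    have "\<bar>g v\<bar> \<le> \<alpha> * v powr (\<alpha> - 1) * \<bar>x0 v\<bar> + v powr \<alpha> * \<bar>x1 v\<bar>"
      unfolding g_def using \<alpha>_pos by (intro order_trans[OF abs_triangle_ineq]) (simp add: abs_mult)
    also have "\<dots> \<le> \<alpha> * v powr (\<alpha> - 1) * C + (v powr (\<alpha> - 1) * T) * C"
    proof (intro add_mono mult_left_mono mult_mono C)
      have "v powr \<alpha> = v powr (\<alpha> - 1) * v" using v by (simp add: powr_diff)
      then show "v powr \<alpha> \<le> v powr (\<alpha> - 1) * T" using v by (simp add: mult_left_mono)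
    qed (use v \<alpha>_pos T_pos in auto)
    finally show ?thesis by (simp add: D_def algebra_simps)
  qed
  have gi: "integrable L g"
  proof (rule Bochner_Integration.integrable_bound)
    show "integrable L (\<lambda>v. D * rl_kernel \<alpha> 0 v)" using rl_kernel_integrable[of \<alpha> 0] \<alpha>_pos by simp
    show "AE v in L. norm (g v) \<le> norm (D * rl_kernel \<alpha> 0 v)"
      using AE_L_neq[of 0] AE_L_in by eventually_elim (use gb D in \<open>auto simp: rl_kernel_def\<close>)
  qed measurable
  have psi: "\<psi> u = \<psi> T - (\<integral>v. rl_kernel 1 u v * g v \<partial>L)" if u: "u \<in> {0..T}" for u
  proof -
    have "(g has_integral (\<psi> T - \<psi> u)) {u..T}"
    proof (rule fundamental_theorem_of_calculus_interior)
      show "continuous_on {u..T} \<psi>" unfolding \<psi>_def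
        using u \<alpha>_pos by (intro continuous_on_mult continuous_on_powr' continuous_intros continuous_on_subset[OF cx0]) auto
      fix x assume x: "x \<in> {u<..<T}"
      have "(x0 has_real_derivative x1 x) (at x)"
        using d[of x] x u by (simp add: at_within_Icc_at)
      then have "(\<psi> has_real_derivative g x) (at x)" unfolding \<psi>_def g_def using x u
        by (auto intro!: derivative_eq_intros simp: powr_diff field_simps)
      then show "(\<psi> has_vector_derivative g x) (at x)"
        by (simp add: has_real_derivative_iff_has_vector_derivative)
    qed (use u in simp)
    then have "integral {u..T} g = \<psi> T - \<psi> u" by (rule integral_unique)
    then show ?thesis using integral_rl_kernel_one[OF gi u] by simp
  qed
  define N where "N t = \<psi> T * rl_kernel (1 - \<alpha>) t T - (\<integral>v. rl_kernel (1 - \<alpha>) t v * g v \<partial>L)" for t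
  have a1: "0 < 1 - \<alpha>" using \<alpha>_less by simp
  have N2m [measurable]: "(\<lambda>t. \<integral>v. rl_kernel (1 - \<alpha>) t v * g v \<partial>L) \<in> borel_measurable L" by measurable
  have Nm [measurable]: "N \<in> borel_measurable L" unfolding N_def by measurable
  have i1: "integrable L (\<lambda>u. rl_kernel a s u * rl_kernel (1 - \<alpha>) u T)" if "a > 0" "0 \<le> s" for a s
    using rl_kernel_convolution(1)[OF that(1) a1 that(2), of T] by simp
  have rlN: "rl_kernel a s u * N u = \<psi> T * (rl_kernel a s u * rl_kernel (1 - \<alpha>) u T) - rl_kernel a s u * (\<integral>v. rl_kernel (1 - \<alpha>) u v * g v \<partial>L)" for a s u
    by (simp add: N_def algebra_simps)
  have rlN_int: "integrable L (\<lambda>u. rl_kernel a s u * N u)"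
     "(\<integral>u. rl_kernel a s u * N u \<partial>L) = \<psi> T * (Beta a (1 - \<alpha>) * rl_kernel (a + (1 - \<alpha>)) s T) - Beta a (1 - \<alpha>) * (\<integral>v. rl_kernel (a + (1 - \<alpha>)) s v * g v \<partial>L)"
    if "a > 0" "0 \<le> s" "a \<ge> \<alpha>" for a s
  proof -
    have i2: "integrable L (\<lambda>u. rl_kernel a s u * (\<integral>v. rl_kernel (1 - \<alpha>) u v * g v \<partial>L))"
      by (rule rl_kernel_semigroup(1)[OF gi]) (use that a1 in auto)
    show "integrable L (\<lambda>u. rl_kernel a s u * N u)" unfolding rlN
      using i1[of a s] i2 that by (intro Bochner_Integration.integrable_diff integrable_mult_right) auto
    have "(\<integral>u. rl_kernel a s u * N u \<partial>L) = \<psi> T * (\<integral>u. rl_kernel a s u * rl_kernel (1 - \<alpha>) u T \<partial>L) - (\<integral>u. rl_kernel a s u * (\<integral>v. rl_kernel (1 - \<alpha>) u v * g v \<partial>L) \<partial>L)"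
      unfolding rlN using i1[of a s] i2 that by (subst Bochner_Integration.integral_diff) auto
    then show "(\<integral>u. rl_kernel a s u * N u \<partial>L) = \<psi> T * (Beta a (1 - \<alpha>) * rl_kernel (a + (1 - \<alpha>)) s T) - Beta a (1 - \<alpha>) * (\<integral>v. rl_kernel (a + (1 - \<alpha>)) s v * g v \<partial>L)"
      using rl_kernel_convolution(2)[of a "1-\<alpha>" s T] rl_kernel_semigroup(2)[OF gi, of a "1-\<alpha>" s] that a1 by simp
  qed
  have Ni: "integrable L N"
  proof (rule integrable_lebesgue_on_cong_AE)
    show "integrable L (\<lambda>u. rl_kernel 1 0 u * N u)" using rlN_int(1)[of 1 0] \<alpha>_less by simp
    show "AE u in L. N u = rl_kernel 1 0 u * N u"
      using AE_L_neq[of 0] AE_L_in by eventually_elim (auto simp: rl_kernel_one)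
  qed auto
  have J: "(\<integral>u. (u - t) powr (-\<alpha>) * u powr \<alpha> * x0 u \<partial>lebesgue_on {t..T}) = (\<integral>v. rl_kernel 1 t v * N v \<partial>L)" if t: "t \<in> {0..T}" for t
  proof -
    have "(\<integral>u. (u - t) powr (-\<alpha>) * u powr \<alpha> * x0 u \<partial>lebesgue_on {t..T}) = (\<integral>u. rl_kernel (1 - \<alpha>) t u * (u powr \<alpha> * x0 u) \<partial>L)"
      by (rule lebesgue_on_Icc_rl_kernel[OF t])
    also have "\<dots> = (\<integral>u. \<psi> T * rl_kernel (1 - \<alpha>) t u - rl_kernel (1 - \<alpha>) t u * (\<integral>v. rl_kernel 1 u v * g v \<partial>L) \<partial>L)"
    proof (rule Bochner_Integration.integral_cong[OF refl])
      fix u assume "u \<in> space L"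
      then have "u powr \<alpha> * x0 u = \<psi> T - (\<integral>v. rl_kernel 1 u v * g v \<partial>L)" using psi[of u] by (simp add: \<psi>_def)
      then show "rl_kernel (1 - \<alpha>) t u * (u powr \<alpha> * x0 u) = \<psi> T * rl_kernel (1 - \<alpha>) t u - rl_kernel (1 - \<alpha>) t u * (\<integral>v. rl_kernel 1 u v * g v \<partial>L)"
        by (simp only: right_diff_distrib mult.commute[of "\<psi> T"])
    qed
    also have "\<dots> = \<psi> T * (\<integral>u. rl_kernel (1 - \<alpha>) t u \<partial>L) - (\<integral>u. rl_kernel (1 - \<alpha>) t u * (\<integral>v. rl_kernel 1 u v * g v \<partial>L) \<partial>L)"
      using rl_kernel_semigroup(1)[OF gi a1 zero_less_one, of t] rl_kernel_integrable[OF a1, of t] t a1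
      by (subst Bochner_Integration.integral_diff) auto
    also have "\<dots> = \<psi> T * (Beta (1 - \<alpha>) 1 * rl_kernel (1 - \<alpha> + 1) t T) - Beta (1 - \<alpha>) 1 * (\<integral>v. rl_kernel (1 - \<alpha> + 1) t v * g v \<partial>L)"
      using rl_kernel_semigroup(2)[OF gi a1 zero_less_one, of t] rl_kernel_integral[OF a1, of t] t a1 by simp
    also have "\<dots> = (\<integral>v. rl_kernel 1 t v * N v \<partial>L)"
      using rlN_int(2)[of 1 t] t \<alpha>_less by (simp add: Beta_commute add.commute)
    finally show ?thesis .
  qed
  define y where "y t = c0 * t powr (-\<alpha>) * N t" for t
  have "AE t in L. B_star (\<alpha> + 1/2) T x0 t = y t"
    using has_derivative_integral_tail_AE[OF Ni, of "\<lambda>t. \<integral>u. (u - t) powr (-\<alpha>) * u powr \<alpha> * x0 u \<partial>lebesgue_on {t..T}", OF J, simplified]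
  proof eventually_elim
    fix t assume "((\<lambda>t. \<integral>u. (u - t) powr (-\<alpha>) * u powr \<alpha> * x0 u \<partial>lebesgue_on {t..T}) has_real_derivative - N t) (at t)"
    then have "deriv (\<lambda>t. \<integral>u. (u - t) powr (-\<alpha>) * u powr \<alpha> * x0 u \<partial>lebesgue_on {t..T}) t = - N t"
      by (rule DERIV_imp_deriv)
    then show "B_star (\<alpha> + 1/2) T x0 t = y t" by (simp add: B_star_def y_def c0)
  qed
  moreover have "in_L2 T y"
  proof -
    have ym [measurable]: "y \<in> borel_measurable L" unfolding y_def by measurable
    (* Splitting off t to the power -eps makes the singularity at v = t integrable, and
       2 (alpha + eps) < 1 keeps the result square integrable at 0. *)
    define \<epsilon> where "\<epsilon> = (1/2 - \<alpha>) / 2"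
    have eps: "\<epsilon> > 0" "1 - 2*\<alpha> - 2*\<epsilon> > 0" "\<alpha> + \<epsilon> < 1" using \<alpha>_less \<alpha>_pos by (auto simp: \<epsilon>_def field_simps)
    define E where "E = D * (T powr \<epsilon> / \<epsilon>)"
    have E: "E \<ge> 0" using D eps T_pos by (simp add: E_def)
    have Nb: "\<bar>\<integral>v. rl_kernel (1 - \<alpha>) t v * g v \<partial>L\<bar> \<le> E * t powr (-\<epsilon>)" if t: "t \<in> {0<..<T}" for t
    proof -
      have pw: "\<bar>rl_kernel (1 - \<alpha>) t v * g v\<bar> \<le> D * t powr (-\<epsilon>) * rl_kernel \<epsilon> t v" if v: "v \<in> {0..T}" for v
      proof (cases "t < v")
        case True
        then have v': "v \<in> {0<..T}" using t v by auto
        have "\<bar>rl_kernel (1 - \<alpha>) t v * g v\<bar> \<le> (v - t) powr (-\<alpha>) * (D * v powr (\<alpha> - 1))"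
          using True gb[OF v'] by (auto simp: rl_kernel_def abs_mult intro!: mult_left_mono)
        also have "v powr (\<alpha> - 1) = v powr (-\<epsilon>) * v powr (\<alpha> - 1 + \<epsilon>)" by (simp add: powr_add[symmetric])
        also have "(v - t) powr (-\<alpha>) * (D * (v powr (-\<epsilon>) * v powr (\<alpha> - 1 + \<epsilon>))) \<le> (v - t) powr (-\<alpha>) * (D * (t powr (-\<epsilon>) * (v - t) powr (\<alpha> - 1 + \<epsilon>)))"
          using True t eps D by (intro mult_left_mono mult_mono powr_mono2') auto
        also have "\<dots> = D * t powr (-\<epsilon>) * ((v - t) powr (-\<alpha>) * (v - t) powr (\<alpha> - 1 + \<epsilon>))" by (simp only: mult_ac)
        also have "(v - t) powr (-\<alpha>) * (v - t) powr (\<alpha> - 1 + \<epsilon>) = rl_kernel \<epsilon> t v"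
          using True by (simp add: rl_kernel_def powr_add[symmetric])
        finally show ?thesis .
      qed (simp add: rl_kernel_def)
      have ib: "integrable L (\<lambda>v. D * t powr (-\<epsilon>) * rl_kernel \<epsilon> t v)"
        using rl_kernel_integrable[of \<epsilon> t] eps t by simp
      have "\<bar>\<integral>v. rl_kernel (1 - \<alpha>) t v * g v \<partial>L\<bar> \<le> (\<integral>v. D * t powr (-\<epsilon>) * rl_kernel \<epsilon> t v \<partial>L)"
        unfolding real_norm_def[symmetric]
      proof (rule Bochner_Integration.integral_norm_bound_integral[OF _ ib])
        show "integrable L (\<lambda>v. rl_kernel (1 - \<alpha>) t v * g v)"
        proof (rule Bochner_Integration.integrable_bound[OF ib])
          show "AE v in L. norm (rl_kernel (1 - \<alpha>) t v * g v) \<le> norm (D * t powr (-\<epsilon>) * rl_kernel \<epsilon> t v)"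
            using AE_L_in
          proof eventually_elim
            fix v assume "v \<in> {0..T}"
            from pw[OF this] show "norm (rl_kernel (1 - \<alpha>) t v * g v) \<le> norm (D * t powr (-\<epsilon>) * rl_kernel \<epsilon> t v)"
              unfolding real_norm_def by linarith
          qed
        qed measurable
        show "norm (rl_kernel (1 - \<alpha>) t v * g v) \<le> D * t powr (-\<epsilon>) * rl_kernel \<epsilon> t v" if "v \<in> space L" for v
          using pw[of v] that by simp
      qed
      also have "\<dots> = D * t powr (-\<epsilon>) * enn2real (\<integral>\<^sup>+v. ennreal (rl_kernel \<epsilon> t v) \<partial>L)"
        by (simp add: integral_eq_nn_integral)
      also have "\<dots> = D * t powr (-\<epsilon>) * ((T - t) powr \<epsilon> / \<epsilon>)"
        using eps t by (subst nn_integral_rl_kernel_Icc) auto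
      also have "\<dots> \<le> D * t powr (-\<epsilon>) * (T powr \<epsilon> / \<epsilon>)"
        using D eps t by (intro mult_left_mono divide_right_mono powr_mono2) auto
      finally show ?thesis by (simp add: E_def mult_ac)
    qed
    define P where "P t = 2 * c0\<^sup>2 * (\<psi> T)\<^sup>2 * (rl_kernel (1 - 2*\<alpha>) 0 t * rl_kernel (1 - 2*\<alpha>) t T) + 2 * c0\<^sup>2 * E\<^sup>2 * rl_kernel (1 - 2*\<alpha> - 2*\<epsilon>) 0 t" for t
    have Pi: "integrable L P" unfolding P_def
      using rl_kernel_convolution(1)[of "1-2*\<alpha>" "1-2*\<alpha>" 0 T] rl_kernel_integrable[of "1 - 2*\<alpha> - 2*\<epsilon>" 0] eps \<alpha>_less
      by (intro Bochner_Integration.integrable_add integrable_mult_right) auto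
    have "integrable L (\<lambda>t. (y t)\<^sup>2)"
    (* The bound is the inequality (a - b)^2 <= 2 a^2 + 2 b^2, applied to the two parts of N. *)
    proof (rule Bochner_Integration.integrable_bound[OF Pi])
      show "AE t in L. norm ((y t)\<^sup>2) \<le> norm (P t)"
        using AE_L_neq[of 0] AE_L_neq[of T] AE_L_in
      proof eventually_elim
        fix t assume "t \<noteq> 0" "t \<noteq> T" "t \<in> {0..T}"
        then have t: "t \<in> {0<..<T}" by auto
        let ?I = "\<integral>v. rl_kernel (1 - \<alpha>) t v * g v \<partial>L"
        have "(N t)\<^sup>2 \<le> 2 * (\<psi> T * (T - t) powr (-\<alpha>))\<^sup>2 + 2 * (E * t powr (-\<epsilon>))\<^sup>2"
        proof -
          have "(a - b)\<^sup>2 \<le> 2 * a\<^sup>2 + 2 * e\<^sup>2" if "\<bar>b\<bar> \<le> e" for a b e :: real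
          proof -
            have "b\<^sup>2 \<le> e\<^sup>2" using that by (simp add: abs_le_square_iff[symmetric])
            moreover have "0 \<le> (a + b)\<^sup>2" by simp
            ultimately show ?thesis unfolding power2_diff power2_sum by linarith
          qed
          from this[OF Nb[OF t]] show ?thesis unfolding N_def using t by (simp add: rl_kernel_def)
        qed
        then have "(y t)\<^sup>2 \<le> (c0 * t powr (-\<alpha>))\<^sup>2 * (2 * (\<psi> T * (T - t) powr (-\<alpha>))\<^sup>2 + 2 * (E * t powr (-\<epsilon>))\<^sup>2)"
          unfolding y_def power_mult_distrib[of "c0 * t powr (-\<alpha>)"] by (rule mult_left_mono) simp
        also have "\<dots> = P t"
        proof -
          have sq: "(x powr b)\<^sup>2 = x powr (2 * b)" for x b :: real by (simp add: power2_eq_square powr_add[symmetric])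
          have "t powr (2 * - \<alpha>) * t powr (2 * - \<epsilon>) = rl_kernel (1 - 2*\<alpha> - 2*\<epsilon>) 0 t"
            using t by (simp add: rl_kernel_def powr_add[symmetric])
          moreover have "t powr (2 * - \<alpha>) * (T - t) powr (2 * - \<alpha>) = rl_kernel (1 - 2*\<alpha>) 0 t * rl_kernel (1 - 2*\<alpha>) t T"
            using t by (simp add: rl_kernel_def)
          moreover have "(c0 * t powr (-\<alpha>))\<^sup>2 * (2 * (\<psi> T * (T - t) powr (-\<alpha>))\<^sup>2 + 2 * (E * t powr (-\<epsilon>))\<^sup>2)
            = 2 * c0\<^sup>2 * (\<psi> T)\<^sup>2 * (t powr (2 * - \<alpha>) * (T - t) powr (2 * - \<alpha>)) + 2 * c0\<^sup>2 * E\<^sup>2 * (t powr (2 * - \<alpha>) * t powr (2 * - \<epsilon>))"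
            unfolding power_mult_distrib sq by (simp only: distrib_left mult_ac)
          ultimately show ?thesis by (simp only: P_def)
        qed
        finally show "norm ((y t)\<^sup>2) \<le> norm (P t)" by simp
      qed
    qed measurable
    then show ?thesis by (simp add: in_L2_def)
  qed
  moreover have "fbm_op y s = c0 * Beta \<alpha> (1 - \<alpha>) * x0 s" if s: "s \<in> {0<..<T}" for s
  proof -
    have "(\<integral>u. rl_kernel \<alpha> s u * (u powr \<alpha> * y u) \<partial>L) = (\<integral>u. c0 * (rl_kernel \<alpha> s u * N u) \<partial>L)"
    proof (rule Bochner_Integration.integral_cong[OF refl])
      fix u
      show "rl_kernel \<alpha> s u * (u powr \<alpha> * y u) = c0 * (rl_kernel \<alpha> s u * N u)"
      proof (cases "s < u")
        case True
        then have "u powr \<alpha> * u powr (-\<alpha>) = 1" using s by (simp add: powr_minus)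
        moreover have "rl_kernel \<alpha> s u * (u powr \<alpha> * y u) = (u powr \<alpha> * u powr (-\<alpha>)) * (c0 * (rl_kernel \<alpha> s u * N u))"
          unfolding y_def by (simp only: mult_ac)
        ultimately show ?thesis by simp
      qed (simp add: rl_kernel_def)
    qed
    also have "\<dots> = c0 * (\<psi> T * (Beta \<alpha> (1 - \<alpha>) * rl_kernel 1 s T) - Beta \<alpha> (1 - \<alpha>) * (\<integral>v. rl_kernel 1 s v * g v \<partial>L))"
      using rlN_int(2)[of \<alpha> s] \<alpha>_pos s by simp
    also have "\<dots> = c0 * Beta \<alpha> (1 - \<alpha>) * \<psi> s"
    proof -
      have tail: "(\<integral>v. rl_kernel 1 s v * g v \<partial>L) = \<psi> T - \<psi> s" using psi[of s] s by simp
      have "rl_kernel 1 s T = 1" using s by (simp add: rl_kernel_one)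
      then show ?thesis unfolding tail by (simp add: algebra_simps)
    qed
    finally have "fbm_op y s = s powr (-\<alpha>) * (c0 * Beta \<alpha> (1 - \<alpha>) * \<psi> s)" by (simp only: fbm_op_eq_rl)
    also have "\<dots> = (s powr (-\<alpha>) * s powr \<alpha>) * (c0 * Beta \<alpha> (1 - \<alpha>) * x0 s)"
      unfolding \<psi>_def by (simp only: mult_ac)
    also have "s powr (-\<alpha>) * s powr \<alpha> = 1" using s by (simp add: powr_minus)
    finally show ?thesis by simp
  qed
  ultimately show ?thesis using that by blast
qed

end

section \<open>Mean square convergence\<close>

definition square_integrable :: "'a measure \<Rightarrow> ('a \<Rightarrow> real) \<Rightarrow> bool" where
  "square_integrable M f \<longleftrightarrow> f \<in> borel_measurable M \<and> integrable M (\<lambda>x. (f x)\<^sup>2)"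

text \<open>The integrability of the functions is part of the notion, because the Bochner integral of a function
that is not integrable is \<open>0\<close>, so that the limit alone would not mean convergence.\<close>

definition L2_tendsto :: "'a measure \<Rightarrow> (nat \<Rightarrow> 'a \<Rightarrow> real) \<Rightarrow> ('a \<Rightarrow> real) \<Rightarrow> bool" where
  "L2_tendsto M F f \<longleftrightarrow> (\<forall>k. square_integrable M (F k)) \<and> square_integrable M f \<and>
     (\<lambda>k. \<integral>x. (F k x - f x)\<^sup>2 \<partial>M) \<longlonglongrightarrow> 0"

lemma square_integrable_measurable: "square_integrable M f \<Longrightarrow> f \<in> borel_measurable M"
  by (simp add: square_integrable_def)

lemma square_integrable_mult_integrable:
  assumes f: "square_integrable M f" and g: "square_integrable M g"
  shows "integrable M (\<lambda>x. f x * g x)"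
proof (rule Bochner_Integration.integrable_bound)
  show "integrable M (\<lambda>x. (f x)\<^sup>2 + (g x)\<^sup>2)" using f g by (simp add: square_integrable_def)
  have "\<bar>a * b\<bar> \<le> a\<^sup>2 + b\<^sup>2" for a b :: real
  proof -
    have "0 \<le> (\<bar>a\<bar> - \<bar>b\<bar>)\<^sup>2" "0 \<le> \<bar>a\<bar> * \<bar>b\<bar>" by simp_all
    then show ?thesis unfolding power2_diff power2_abs abs_mult by linarith
  qed
  then show "AE x in M. norm (f x * g x) \<le> norm ((f x)\<^sup>2 + (g x)\<^sup>2)" by (intro AE_I2) simp
qed (use f g in \<open>auto simp: square_integrable_def\<close>)

lemma square_integrable_scale: "square_integrable M f \<Longrightarrow> square_integrable M (\<lambda>x. c * f x)"
  by (auto simp: square_integrable_def power_mult_distrib)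

lemma square_integrable_add:
  assumes f: "square_integrable M f" and g: "square_integrable M g"
  shows "square_integrable M (\<lambda>x. f x + g x)"
proof -
  have "integrable M (\<lambda>x. (f x)\<^sup>2 + (g x)\<^sup>2 + 2 * (f x * g x))"
    using f g square_integrable_mult_integrable[OF f g] by (simp add: square_integrable_def)
  moreover have "(\<lambda>x. f x + g x) \<in> borel_measurable M" using f g by (auto simp: square_integrable_def)
  ultimately show ?thesis by (simp add: square_integrable_def power2_sum mult.assoc)
qed

lemma square_integrable_diff:
  "square_integrable M f \<Longrightarrow> square_integrable M g \<Longrightarrow> square_integrable M (\<lambda>x. f x - g x)"
  using square_integrable_add[of M f "\<lambda>x. -1 * g x"] square_integrable_scale[of M g "-1"] by simp

lemma square_integrable_zero: "square_integrable M (\<lambda>x. 0)"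
  by (simp add: square_integrable_def)

lemma square_integrable_sum:
  "(\<And>i. i \<in> I \<Longrightarrow> square_integrable M (f i)) \<Longrightarrow> square_integrable M (\<lambda>x. \<Sum>i\<in>I. f i x)"
  by (induction I rule: infinite_finite_induct) (auto simp: square_integrable_zero square_integrable_add)

lemma integral_Cauchy_Schwarz:
  assumes f: "square_integrable M f" and g: "square_integrable M g"
  shows "(\<integral>x. \<bar>f x * g x\<bar> \<partial>M) \<le> sqrt (\<integral>x. (f x)\<^sup>2 \<partial>M) * sqrt (\<integral>x. (g x)\<^sup>2 \<partial>M)"
proof -
  have [measurable]: "f \<in> borel_measurable M" "g \<in> borel_measurable M" using f g by (auto simp: square_integrable_def)
  have i: "integrable M (\<lambda>x. \<bar>f x * g x\<bar>)" "integrable M (\<lambda>x. (f x)\<^sup>2)" "integrable M (\<lambda>x. (g x)\<^sup>2)"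
    using f g square_integrable_mult_integrable[OF f g] by (auto simp: square_integrable_def simp del: abs_mult)
  have "ennreal ((\<integral>x. \<bar>f x * g x\<bar> \<partial>M)\<^sup>2) = (\<integral>\<^sup>+x. ennreal \<bar>f x\<bar> * ennreal \<bar>g x\<bar> \<partial>M)\<^sup>2"
    using nn_integral_eq_integral[OF i(1)] by (simp add: ennreal_power[symmetric] abs_mult ennreal_mult')
  also have "\<dots> \<le> (\<integral>\<^sup>+x. (ennreal \<bar>f x\<bar>)\<^sup>2 \<partial>M) * (\<integral>\<^sup>+x. (ennreal \<bar>g x\<bar>)\<^sup>2 \<partial>M)"
    by (rule Cauchy_Schwarz_nn_integral) measurable
  also have "\<dots> = ennreal ((\<integral>x. (f x)\<^sup>2 \<partial>M) * (\<integral>x. (g x)\<^sup>2 \<partial>M))"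
    using nn_integral_eq_integral[OF i(2)] nn_integral_eq_integral[OF i(3)]
    by (simp add: ennreal_power ennreal_mult')
  finally have "(\<integral>x. \<bar>f x * g x\<bar> \<partial>M)\<^sup>2 \<le> (\<integral>x. (f x)\<^sup>2 \<partial>M) * (\<integral>x. (g x)\<^sup>2 \<partial>M)"
    by (subst (asm) ennreal_le_iff) auto
  then have "(\<integral>x. \<bar>f x * g x\<bar> \<partial>M) \<le> sqrt ((\<integral>x. (f x)\<^sup>2 \<partial>M) * (\<integral>x. (g x)\<^sup>2 \<partial>M))"
    by (rule real_le_rsqrt)
  then show ?thesis by (simp add: real_sqrt_mult)
qed

lemma integral_Cauchy_Schwarz_abs:
  assumes f: "square_integrable M f" and g: "square_integrable M g"
  shows "\<bar>\<integral>x. f x * g x \<partial>M\<bar> \<le> sqrt (\<integral>x. (f x)\<^sup>2 \<partial>M) * sqrt (\<integral>x. (g x)\<^sup>2 \<partial>M)"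
  using integral_abs_bound[of M "\<lambda>x. f x * g x"] integral_Cauchy_Schwarz[OF f g] by linarith

lemma integral_double_sum:
  fixes h :: "'i \<Rightarrow> 'j \<Rightarrow> 'a \<Rightarrow> real"
  assumes "\<And>i j. i \<in> I \<Longrightarrow> j \<in> J \<Longrightarrow> integrable M (h i j)"
  shows "(\<integral>x. (\<Sum>i\<in>I. \<Sum>j\<in>J. h i j x) \<partial>M) = (\<Sum>i\<in>I. \<Sum>j\<in>J. \<integral>x. h i j x \<partial>M)"
  using assms by (simp add: Bochner_Integration.integral_sum Bochner_Integration.integrable_sum)

lemma L2_tendsto_const: "square_integrable M f \<Longrightarrow> L2_tendsto M (\<lambda>k. f) f"
  by (simp add: L2_tendsto_def)

lemma L2_tendsto_inner:
  assumes F: "L2_tendsto M F f" and G: "L2_tendsto M G g"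
  shows "(\<lambda>k. \<integral>x. F k x * G k x \<partial>M) \<longlonglongrightarrow> (\<integral>x. f x * g x \<partial>M)"
proof -
  have sF: "square_integrable M (F k)" and sG: "square_integrable M (G k)" and sf: "square_integrable M f" and sg: "square_integrable M g" for k
    using F G by (auto simp: L2_tendsto_def)
  note sF' = square_integrable_diff[OF sF sf] and sG' = square_integrable_diff[OF sG sg]
  let ?a = "\<lambda>k. sqrt (\<integral>x. (F k x - f x)\<^sup>2 \<partial>M)" and ?b = "\<lambda>k. sqrt (\<integral>x. (G k x - g x)\<^sup>2 \<partial>M)"
  have a: "?a \<longlonglongrightarrow> 0" and b: "?b \<longlonglongrightarrow> 0"
    using F G by (auto simp: L2_tendsto_def intro: tendsto_eq_intros)
  have "(\<lambda>k. (\<integral>x. F k x * G k x \<partial>M) - (\<integral>x. f x * g x \<partial>M)) \<longlonglongrightarrow> 0"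
  proof (rule Lim_null_comparison)
    show "(\<lambda>k. ?a k * ?b k + ?a k * sqrt (\<integral>x. (g x)\<^sup>2 \<partial>M) + sqrt (\<integral>x. (f x)\<^sup>2 \<partial>M) * ?b k) \<longlonglongrightarrow> 0"
    proof -
      have "(\<lambda>k. ?a k * ?b k + ?a k * sqrt (\<integral>x. (g x)\<^sup>2 \<partial>M) + sqrt (\<integral>x. (f x)\<^sup>2 \<partial>M) * ?b k)
        \<longlonglongrightarrow> 0 * 0 + 0 * sqrt (\<integral>x. (g x)\<^sup>2 \<partial>M) + sqrt (\<integral>x. (f x)\<^sup>2 \<partial>M) * 0"
        by (intro tendsto_add tendsto_mult a b tendsto_const)
      then show ?thesis by simp
    qed
    have "norm ((\<integral>x. F k x * G k x \<partial>M) - (\<integral>x. f x * g x \<partial>M)) \<le> ?a k * ?b k + ?a k * sqrt (\<integral>x. (g x)\<^sup>2 \<partial>M) + sqrt (\<integral>x. (f x)\<^sup>2 \<partial>M) * ?b k" for k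
    proof -
      have "(\<integral>x. F k x * G k x \<partial>M) - (\<integral>x. f x * g x \<partial>M) = (\<integral>x. F k x * G k x - f x * g x \<partial>M)"
        by (subst Bochner_Integration.integral_diff) (auto intro: square_integrable_mult_integrable sF sG sf sg)
      also have "\<dots> = (\<integral>x. (F k x - f x) * (G k x - g x) + (F k x - f x) * g x + f x * (G k x - g x) \<partial>M)"
        by (rule Bochner_Integration.integral_cong) (auto simp: algebra_simps)
      also have "\<dots> = (\<integral>x. (F k x - f x) * (G k x - g x) \<partial>M) + (\<integral>x. (F k x - f x) * g x \<partial>M) + (\<integral>x. f x * (G k x - g x) \<partial>M)"
        using square_integrable_mult_integrable[OF sF' sG'] square_integrable_mult_integrable[OF sF' sg] square_integrable_mult_integrable[OF sf sG']
        by (subst Bochner_Integration.integral_add, simp, simp)+ simp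
      finally show ?thesis
        using integral_Cauchy_Schwarz_abs[OF sF'[of k] sG'[of k]] integral_Cauchy_Schwarz_abs[OF sF'[of k] sg] integral_Cauchy_Schwarz_abs[OF sf sG'[of k]]
        unfolding real_norm_def by linarith
    qed
    then show "\<forall>\<^sub>F k in sequentially. norm ((\<integral>x. F k x * G k x \<partial>M) - (\<integral>x. f x * g x \<partial>M)) \<le> ?a k * ?b k + ?a k * sqrt (\<integral>x. (g x)\<^sup>2 \<partial>M) + sqrt (\<integral>x. (f x)\<^sup>2 \<partial>M) * ?b k"
      by simp
  qed
  then show ?thesis by (rule LIM_zero_cancel)
qed

lemma L2_tendsto_scale:
  assumes "L2_tendsto M F f"
  shows "L2_tendsto M (\<lambda>k x. c * F k x) (\<lambda>x. c * f x)"
proof -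
  have "(\<lambda>k. c\<^sup>2 * (\<integral>x. (F k x - f x)\<^sup>2 \<partial>M)) \<longlonglongrightarrow> c\<^sup>2 * 0"
    using assms by (intro tendsto_mult_left) (simp add: L2_tendsto_def)
  moreover have "(\<integral>x. (c * F k x - c * f x)\<^sup>2 \<partial>M) = c\<^sup>2 * (\<integral>x. (F k x - f x)\<^sup>2 \<partial>M)" for k
    by (simp add: right_diff_distrib[symmetric] power_mult_distrib)
  ultimately show ?thesis using assms by (simp add: L2_tendsto_def square_integrable_scale)
qed

lemma L2_tendsto_add:
  assumes F: "L2_tendsto M F f" and G: "L2_tendsto M G g"
  shows "L2_tendsto M (\<lambda>k x. F k x + G k x) (\<lambda>x. f x + g x)"
proof -
  have sF: "square_integrable M (F k)" and sG: "square_integrable M (G k)" and sf: "square_integrable M f" and sg: "square_integrable M g" for k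
    using F G by (auto simp: L2_tendsto_def)
  note sF' = square_integrable_diff[OF sF sf] and sG' = square_integrable_diff[OF sG sg]
  have "(\<lambda>k. \<integral>x. (F k x + G k x - (f x + g x))\<^sup>2 \<partial>M) \<longlonglongrightarrow> 0"
  proof (rule Lim_null_comparison)
    show "(\<lambda>k. 2 * (\<integral>x. (F k x - f x)\<^sup>2 \<partial>M) + 2 * (\<integral>x. (G k x - g x)\<^sup>2 \<partial>M)) \<longlonglongrightarrow> 0"
      using F G by (auto simp: L2_tendsto_def intro!: tendsto_eq_intros)
    have "norm (\<integral>x. (F k x + G k x - (f x + g x))\<^sup>2 \<partial>M) \<le> 2 * (\<integral>x. (F k x - f x)\<^sup>2 \<partial>M) + 2 * (\<integral>x. (G k x - g x)\<^sup>2 \<partial>M)" for k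
    proof -
      have i: "integrable M (\<lambda>x. (F k x - f x)\<^sup>2)" "integrable M (\<lambda>x. (G k x - g x)\<^sup>2)"
        using sF'[of k] sG'[of k] by (auto simp: square_integrable_def)
      have "(\<integral>x. (F k x + G k x - (f x + g x))\<^sup>2 \<partial>M) \<le> (\<integral>x. 2 * (F k x - f x)\<^sup>2 + 2 * (G k x - g x)\<^sup>2 \<partial>M)"
      proof (rule integral_mono)
        show "integrable M (\<lambda>x. (F k x + G k x - (f x + g x))\<^sup>2)"
          using square_integrable_diff[OF square_integrable_add[OF sF[of k] sG[of k]] square_integrable_add[OF sf sg]]
          by (simp add: square_integrable_def)
        show "integrable M (\<lambda>x. 2 * (F k x - f x)\<^sup>2 + 2 * (G k x - g x)\<^sup>2)" using i by simp
        have "(a + b - (c + d))\<^sup>2 \<le> 2 * (a - c)\<^sup>2 + 2 * (b - d)\<^sup>2" for a b c d :: real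
        proof -
          have "0 \<le> ((a - c) - (b - d))\<^sup>2" by simp
          moreover have "(a + b - (c + d))\<^sup>2 = ((a - c) + (b - d))\<^sup>2" by (simp add: algebra_simps)
          ultimately show ?thesis unfolding power2_sum[of "a - c"] power2_diff[of "a - c"] by linarith
        qed
        then show "(F k x + G k x - (f x + g x))\<^sup>2 \<le> 2 * (F k x - f x)\<^sup>2 + 2 * (G k x - g x)\<^sup>2" for x by blast
      qed
      then show ?thesis using i by simp
    qed
    then show "\<forall>\<^sub>F k in sequentially. norm (\<integral>x. (F k x + G k x - (f x + g x))\<^sup>2 \<partial>M) \<le> 2 * (\<integral>x. (F k x - f x)\<^sup>2 \<partial>M) + 2 * (\<integral>x. (G k x - g x)\<^sup>2 \<partial>M)" by simp
  qed
  then show ?thesis using sF sG sf sg by (simp add: L2_tendsto_def square_integrable_add)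
qed

lemma L2_tendsto_sum:
  "(\<And>i. i \<in> I \<Longrightarrow> L2_tendsto M (F i) (f i)) \<Longrightarrow> L2_tendsto M (\<lambda>k x. \<Sum>i\<in>I. F i k x) (\<lambda>x. \<Sum>i\<in>I. f i x)"
  by (induction I rule: infinite_finite_induct) (auto simp: L2_tendsto_add L2_tendsto_const square_integrable_zero)

section \<open>Centred Gaussian variables\<close>

lemma norm_iexp_diff_le: "norm (iexp a - iexp b) \<le> \<bar>a - b\<bar>"
proof -
  have "iexp a - iexp b = iexp b * (iexp (a - b) - 1)"
    by (simp add: algebra_simps exp_add[symmetric] flip: exp_diff)
  then have "norm (iexp a - iexp b) = norm (iexp (a - b) - 1)" by (simp add: norm_mult)
  also have "\<dots> \<le> \<bar>a - b\<bar>" using iexp_approx1[of "a - b" 0] by simp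
  finally show ?thesis .
qed

context prob_space
begin

lemma integrable_iexp_rv: "Y \<in> borel_measurable M \<Longrightarrow> integrable M (\<lambda>\<omega>. iexp (Y \<omega>))"
  by (rule integrable_const_bound[where B=1]) auto

text \<open>Only the characteristic function at \<open>1\<close> is recorded. It is applied to linear combinations with arbitrary
coefficients, which cover all other arguments.\<close>

definition centred_gaussian :: "('a \<Rightarrow> real) \<Rightarrow> bool" where
  "centred_gaussian Y \<longleftrightarrow> square_integrable M Y \<and>
     (\<integral>\<omega>. iexp (Y \<omega>) \<partial>M) = of_real (exp (- (\<integral>\<omega>. (Y \<omega>)\<^sup>2 \<partial>M) / 2))"

text \<open>Mean square limits preserve both sides: \<open>\<bar>exp(i x) - exp(i y)\<bar> \<le> \<bar>x - y\<bar>\<close> on the left, convergence of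
second moments on the right.\<close>

lemma centred_gaussian_limit:
  assumes Y: "L2_tendsto M F f" and g: "\<And>k. centred_gaussian (F k)"
  shows "centred_gaussian f"
proof -
  have sF: "square_integrable M (F k)" and sf: "square_integrable M f" for k
    using Y by (auto simp: L2_tendsto_def)
  have [measurable]: "F k \<in> borel_measurable M" "f \<in> borel_measurable M" for k
    using sF sf by (auto simp: square_integrable_def)
  have one: "square_integrable M (\<lambda>x. 1)" by (simp add: square_integrable_def)
  have "(\<lambda>k. (\<integral>\<omega>. iexp (F k \<omega>) \<partial>M) - (\<integral>\<omega>. iexp (f \<omega>) \<partial>M)) \<longlonglongrightarrow> 0"
  proof (rule Lim_null_comparison)
    show "(\<lambda>k. sqrt (\<integral>\<omega>. (F k \<omega> - f \<omega>)\<^sup>2 \<partial>M)) \<longlonglongrightarrow> 0"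
      using Y by (auto simp: L2_tendsto_def intro: tendsto_eq_intros)
    have "norm ((\<integral>\<omega>. iexp (F k \<omega>) \<partial>M) - (\<integral>\<omega>. iexp (f \<omega>) \<partial>M)) \<le> sqrt (\<integral>\<omega>. (F k \<omega> - f \<omega>)\<^sup>2 \<partial>M)" for k
    proof -
      note sd = square_integrable_diff[OF sF[of k] sf]
      have i: "integrable M (\<lambda>\<omega>. F k \<omega> - f \<omega>)" using square_integrable_mult_integrable[OF sd one] by simp
      have "(\<integral>\<omega>. iexp (F k \<omega>) \<partial>M) - (\<integral>\<omega>. iexp (f \<omega>) \<partial>M) = (\<integral>\<omega>. iexp (F k \<omega>) - iexp (f \<omega>) \<partial>M)"
        by (rule Bochner_Integration.integral_diff[symmetric]) (auto intro: integrable_iexp_rv)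
      also have "norm \<dots> \<le> (\<integral>\<omega>. norm (iexp (F k \<omega>) - iexp (f \<omega>)) \<partial>M)" by (rule integral_norm_bound)
      also have "\<dots> \<le> (\<integral>\<omega>. \<bar>F k \<omega> - f \<omega>\<bar> \<partial>M)"
        by (rule integral_mono) (use i in \<open>auto intro!: integrable_norm Bochner_Integration.integrable_diff integrable_iexp_rv norm_iexp_diff_le\<close>)
      also have "\<dots> \<le> sqrt (\<integral>\<omega>. (F k \<omega> - f \<omega>)\<^sup>2 \<partial>M)"
        using integral_Cauchy_Schwarz[OF sd one] by (simp add: prob_space)
      finally show ?thesis .
    qed
    then show "\<forall>\<^sub>F k in sequentially. norm ((\<integral>\<omega>. iexp (F k \<omega>) \<partial>M) - (\<integral>\<omega>. iexp (f \<omega>) \<partial>M)) \<le> sqrt (\<integral>\<omega>. (F k \<omega> - f \<omega>)\<^sup>2 \<partial>M)" by simp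
  qed
  then have l1: "(\<lambda>k. \<integral>\<omega>. iexp (F k \<omega>) \<partial>M) \<longlonglongrightarrow> (\<integral>\<omega>. iexp (f \<omega>) \<partial>M)" by (rule LIM_zero_cancel)
  have "(\<lambda>k. \<integral>\<omega>. (F k \<omega>)\<^sup>2 \<partial>M) \<longlonglongrightarrow> (\<integral>\<omega>. (f \<omega>)\<^sup>2 \<partial>M)"
    using L2_tendsto_inner[OF Y Y] by (simp add: power2_eq_square)
  then have "(\<lambda>k. complex_of_real (exp (- (\<integral>\<omega>. (F k \<omega>)\<^sup>2 \<partial>M) / 2))) \<longlonglongrightarrow> of_real (exp (- (\<integral>\<omega>. (f \<omega>)\<^sup>2 \<partial>M) / 2))"
    by (intro tendsto_intros) auto
  moreover have "(\<lambda>k. \<integral>\<omega>. iexp (F k \<omega>) \<partial>M) = (\<lambda>k. complex_of_real (exp (- (\<integral>\<omega>. (F k \<omega>)\<^sup>2 \<partial>M) / 2)))"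
    using g by (simp add: centred_gaussian_def)
  ultimately have "(\<integral>\<omega>. iexp (f \<omega>) \<partial>M) = of_real (exp (- (\<integral>\<omega>. (f \<omega>)\<^sup>2 \<partial>M) / 2))"
    using l1 LIMSEQ_unique by metis
  then show ?thesis using sf by (simp add: centred_gaussian_def)
qed

lemma normal_increment:
  assumes "0 < \<sigma>" and D: "distributed M lborel X (normal_density 0 \<sigma>)"
  shows "square_integrable M X" "expectation X = 0" "(\<integral>\<omega>. (X \<omega>)\<^sup>2 \<partial>M) = \<sigma>\<^sup>2"
    "(\<integral>\<omega>. iexp (c * X \<omega>) \<partial>M) = of_real (exp (- (c\<^sup>2 * \<sigma>\<^sup>2) / 2))"
proof -
  have [measurable]: "X \<in> borel_measurable M" using D by (simp add: distributed_def)
  have "integrable M (\<lambda>\<omega>. (X \<omega>)\<^sup>2)"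
    using distributed_integrable[OF D, of "\<lambda>x. x\<^sup>2"] integrable_normal_moment[OF assms(1), of 0 2] by simp
  then show "square_integrable M X" by (simp add: square_integrable_def)
  show e: "expectation X = 0" by (rule normal_distributed_expectation[OF assms])
  show "(\<integral>\<omega>. (X \<omega>)\<^sup>2 \<partial>M) = \<sigma>\<^sup>2" using normal_distributed_variance[OF assms] by (simp add: e)
  have "distributed M lborel (\<lambda>\<omega>. (X \<omega> - 0) / \<sigma>) std_normal_density"
    using D normal_standard_normal_convert[OF assms(1), of X 0] by simp
  then have d: "distributed M lborel (\<lambda>\<omega>. X \<omega> / \<sigma>) std_normal_density" by simp
  have "distr M lborel (\<lambda>\<omega>. X \<omega> / \<sigma>) = std_normal_distribution"
    using distributed_distr_eq_density[OF d] by simp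
  then have "char (distr M lborel (\<lambda>\<omega>. X \<omega> / \<sigma>)) (c * \<sigma>) = of_real (exp (- (c * \<sigma>)\<^sup>2 / 2))"
    by (simp add: char_std_normal_distribution)
  moreover have "char (distr M lborel (\<lambda>\<omega>. X \<omega> / \<sigma>)) (c * \<sigma>) = (\<integral>\<omega>. iexp (c * X \<omega>) \<partial>M)"
    unfolding char_def using assms(1) by (subst integral_distr) auto
  ultimately show "(\<integral>\<omega>. iexp (c * X \<omega>) \<partial>M) = of_real (exp (- (c\<^sup>2 * \<sigma>\<^sup>2) / 2))"
    by (simp add: power_mult_distrib)
qed

end

locale brownian = prob_space M for M :: "'a measure" +
  fixes T :: real and m :: nat and W :: "nat \<Rightarrow> real \<Rightarrow> 'a \<Rightarrow> real"
  assumes T_pos: "0 < T" and BM: "standard_Brownian_motion M T m W"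
begin

lemma W_measurable: "l \<in> {1..m} \<Longrightarrow> t \<in> {0..T} \<Longrightarrow> W l t \<in> borel_measurable M"
  using BM by (simp add: standard_Brownian_motion_def)

lemma W_0: "l \<in> {1..m} \<Longrightarrow> AE \<omega> in M. W l 0 \<omega> = 0"
  using BM by (simp add: standard_Brownian_motion_def)

lemma W_increment:
  assumes "l \<in> {1..m}" "0 \<le> s" "s \<le> t" "t \<le> T"
  shows "square_integrable M (\<lambda>\<omega>. W l t \<omega> - W l s \<omega>)" "expectation (\<lambda>\<omega>. W l t \<omega> - W l s \<omega>) = 0"
    "(\<integral>\<omega>. (W l t \<omega> - W l s \<omega>)\<^sup>2 \<partial>M) = t - s"
    "(\<integral>\<omega>. iexp (c * (W l t \<omega> - W l s \<omega>)) \<partial>M) = of_real (exp (- (c\<^sup>2 * (t - s)) / 2))"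
proof -
  have "square_integrable M (\<lambda>\<omega>. W l t \<omega> - W l s \<omega>) \<and> expectation (\<lambda>\<omega>. W l t \<omega> - W l s \<omega>) = 0 \<and>
    (\<integral>\<omega>. (W l t \<omega> - W l s \<omega>)\<^sup>2 \<partial>M) = t - s \<and>
    (\<integral>\<omega>. iexp (c * (W l t \<omega> - W l s \<omega>)) \<partial>M) = of_real (exp (- (c\<^sup>2 * (t - s)) / 2))"
  proof (cases "s = t")
    case True then show ?thesis by (simp add: square_integrable_zero prob_space)
  next
    case False
    then have "distributed M lborel (\<lambda>\<omega>. W l t \<omega> - W l s \<omega>) (normal_density 0 (sqrt (t - s)))"
      using BM assms unfolding standard_Brownian_motion_def by auto
    from normal_increment(1-3)[OF _ this] normal_increment(4)[OF _ this, of c] show ?thesis using False assms by simp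
  qed
  then show "square_integrable M (\<lambda>\<omega>. W l t \<omega> - W l s \<omega>)" "expectation (\<lambda>\<omega>. W l t \<omega> - W l s \<omega>) = 0"
    "(\<integral>\<omega>. (W l t \<omega> - W l s \<omega>)\<^sup>2 \<partial>M) = t - s"
    "(\<integral>\<omega>. iexp (c * (W l t \<omega> - W l s \<omega>)) \<partial>M) = of_real (exp (- (c\<^sup>2 * (t - s)) / 2))"
    by auto
qed

lemma W_square_integrable:
  assumes "l \<in> {1..m}" "t \<in> {0..T}"
  shows "square_integrable M (W l t)"
proof -
  note [measurable] = W_measurable[OF assms]
  have "AE \<omega> in M. (W l t \<omega> - W l 0 \<omega>)\<^sup>2 = (W l t \<omega>)\<^sup>2" using W_0[OF assms(1)] by eventually_elim simp
  moreover have "integrable M (\<lambda>\<omega>. (W l t \<omega> - W l 0 \<omega>)\<^sup>2)" "W l 0 \<in> borel_measurable M"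
    using W_increment(1)[of l 0 t] W_measurable[of l 0] assms by (auto simp: square_integrable_def)
  ultimately have "integrable M (\<lambda>\<omega>. (W l t \<omega>)\<^sup>2)"
    by (subst integrable_cong_AE[of _ _ "\<lambda>\<omega>. (W l t \<omega> - W l 0 \<omega>)\<^sup>2"]) (auto elim: eventually_mono)
  then show ?thesis by (simp add: square_integrable_def)
qed

text \<open>Increments are indexed by pairs of a component and an interval of the partition, as in the definition
of Brownian motion.\<close>

definition incr :: "(nat \<Rightarrow> real) \<Rightarrow> nat \<times> nat \<Rightarrow> 'a \<Rightarrow> real" where
  "incr \<tau> a \<omega> = W (fst a) (\<tau> (Suc (snd a))) \<omega> - W (fst a) (\<tau> (snd a)) \<omega>"

context
  fixes n :: nat and \<tau> :: "nat \<Rightarrow> real"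
  assumes tau: "\<And>i. i \<le> n \<Longrightarrow> \<tau> i \<in> {0..T}" and mono: "\<And>i. i < n \<Longrightarrow> \<tau> i \<le> \<tau> (Suc i)"
begin

lemma incr_indep: "indep_vars (\<lambda>_. borel) (incr \<tau>) ({1..m} \<times> {..<n})"
proof -
  have "indep_vars (\<lambda>_. borel) (\<lambda>(l, i) \<omega>. W l (\<tau> (Suc i)) \<omega> - W l (\<tau> i) \<omega>) ({1..m} \<times> {..<n})"
    using BM tau mono unfolding standard_Brownian_motion_def by blast
  moreover have "(\<lambda>(l, i) \<omega>. W l (\<tau> (Suc i)) \<omega> - W l (\<tau> i) \<omega>) = incr \<tau>"
    by (auto simp: incr_def fun_eq_iff)
  ultimately show ?thesis by simp
qed

lemma incr_props:
  assumes "a \<in> {1..m} \<times> {..<n}"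
  shows "square_integrable M (incr \<tau> a)" "expectation (incr \<tau> a) = 0" "(\<integral>\<omega>. (incr \<tau> a \<omega>)\<^sup>2 \<partial>M) = \<tau> (Suc (snd a)) - \<tau> (snd a)"
    "(\<integral>\<omega>. iexp (c * incr \<tau> a \<omega>) \<partial>M) = of_real (exp (- (c\<^sup>2 * (\<tau> (Suc (snd a)) - \<tau> (snd a))) / 2))"
proof -
  have "fst a \<in> {1..m}" "0 \<le> \<tau> (snd a)" "\<tau> (snd a) \<le> \<tau> (Suc (snd a))" "\<tau> (Suc (snd a)) \<le> T"
    using assms tau[of "snd a"] tau[of "Suc (snd a)"] mono[of "snd a"] by auto
  from W_increment(1-3)[OF this] W_increment(4)[OF this, of c] show "square_integrable M (incr \<tau> a)" "expectation (incr \<tau> a) = 0" "(\<integral>\<omega>. (incr \<tau> a \<omega>)\<^sup>2 \<partial>M) = \<tau> (Suc (snd a)) - \<tau> (snd a)"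
    "(\<integral>\<omega>. iexp (c * incr \<tau> a \<omega>) \<partial>M) = of_real (exp (- (c\<^sup>2 * (\<tau> (Suc (snd a)) - \<tau> (snd a))) / 2))"
    unfolding incr_def[abs_def] by simp_all
qed

lemma incr_uncorrelated:
  assumes a: "a \<in> {1..m} \<times> {..<n}" and b: "b \<in> {1..m} \<times> {..<n}" and ne: "a \<noteq> b"
  shows "(\<integral>\<omega>. incr \<tau> a \<omega> * incr \<tau> b \<omega> \<partial>M) = 0"
proof -
  have one: "square_integrable M (\<lambda>x. 1)" by (simp add: square_integrable_def)
  have i: "integrable M (incr \<tau> a)" "integrable M (incr \<tau> b)"
    using square_integrable_mult_integrable[OF incr_props(1)[OF a] one] square_integrable_mult_integrable[OF incr_props(1)[OF b] one] by auto
  have "(\<integral>\<omega>. (\<Prod>c\<in>{a,b}. incr \<tau> c \<omega>) \<partial>M) = (\<Prod>c\<in>{a,b}. \<integral>\<omega>. incr \<tau> c \<omega> \<partial>M)"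
    by (rule indep_vars_lebesgue_integral) (use a b i indep_vars_subset[OF incr_indep, of "{a,b}"] in auto)
  then show ?thesis using ne incr_props(2)[OF a] by simp
qed

lemma incr_combination_gaussian: "centred_gaussian (\<lambda>\<omega>. \<Sum>a\<in>{1..m} \<times> {..<n}. b a * incr \<tau> a \<omega>)"
proof -
  let ?I = "{1..m} \<times> {..<n}"
  let ?v = "\<lambda>a. \<tau> (Suc (snd a)) - \<tau> (snd a)"
  have sq: "square_integrable M (\<lambda>\<omega>. \<Sum>a\<in>?I. b a * incr \<tau> a \<omega>)"
    by (intro square_integrable_sum square_integrable_scale incr_props)
  have int: "integrable M (\<lambda>\<omega>. b a * incr \<tau> a \<omega> * (b c * incr \<tau> c \<omega>))" if "a \<in> ?I" "c \<in> ?I" for a c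
    by (intro square_integrable_mult_integrable square_integrable_scale incr_props that)
  have "(\<integral>\<omega>. (\<Sum>a\<in>?I. b a * incr \<tau> a \<omega>)\<^sup>2 \<partial>M) = (\<integral>\<omega>. (\<Sum>a\<in>?I. \<Sum>c\<in>?I. b a * incr \<tau> a \<omega> * (b c * incr \<tau> c \<omega>)) \<partial>M)"
    unfolding power2_eq_square sum_product by simp
  also have "\<dots> = (\<Sum>a\<in>?I. \<Sum>c\<in>?I. \<integral>\<omega>. b a * incr \<tau> a \<omega> * (b c * incr \<tau> c \<omega>) \<partial>M)"
    using int by (simp add: Bochner_Integration.integral_sum Bochner_Integration.integrable_sum)
  also have "\<dots> = (\<Sum>a\<in>?I. \<Sum>c\<in>?I. if c = a then (b a)\<^sup>2 * ?v a else 0)"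
  proof (intro sum.cong refl)
    fix a c assume ac: "a \<in> ?I" "c \<in> ?I"
    have "(\<integral>\<omega>. b a * incr \<tau> a \<omega> * (b c * incr \<tau> c \<omega>) \<partial>M) = b a * b c * (\<integral>\<omega>. incr \<tau> a \<omega> * incr \<tau> c \<omega> \<partial>M)"
      by (simp add: mult_ac flip: integral_mult_right_zero)
    then show "(\<integral>\<omega>. b a * incr \<tau> a \<omega> * (b c * incr \<tau> c \<omega>) \<partial>M) = (if c = a then (b a)\<^sup>2 * ?v a else 0)"
      using incr_uncorrelated[OF ac] incr_props(3)[OF ac(1)] by (auto simp: power2_eq_square)
  qed
  also have "\<dots> = (\<Sum>a\<in>?I. (b a)\<^sup>2 * ?v a)" by (intro sum.cong refl) (simp add: sum.delta)
  finally have var: "(\<integral>\<omega>. (\<Sum>a\<in>?I. b a * incr \<tau> a \<omega>)\<^sup>2 \<partial>M) = (\<Sum>a\<in>?I. (b a)\<^sup>2 * ?v a)" .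
  have "(\<integral>\<omega>. iexp (\<Sum>a\<in>?I. b a * incr \<tau> a \<omega>) \<partial>M) = (\<integral>\<omega>. (\<Prod>a\<in>?I. iexp (b a * incr \<tau> a \<omega>)) \<partial>M)"
    by (simp add: sum_distrib_left exp_sum)
  also have "\<dots> = (\<Prod>a\<in>?I. \<integral>\<omega>. iexp (b a * incr \<tau> a \<omega>) \<partial>M)"
  proof (rule indep_vars_lebesgue_integral)
    show "indep_vars (\<lambda>_. borel) (\<lambda>a \<omega>. iexp (b a * incr \<tau> a \<omega>)) ?I"
      by (rule indep_vars_compose2[OF incr_indep, of "\<lambda>a x. iexp (b a * x)" "\<lambda>_. borel"]) measurable
    show "integrable M (\<lambda>\<omega>. iexp (b a * incr \<tau> a \<omega>))" if "a \<in> ?I" for a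
      using incr_props(1)[OF that] by (intro integrable_iexp_rv borel_measurable_times) (auto simp: square_integrable_def)
  qed simp
  also have "\<dots> = (\<Prod>a\<in>?I. complex_of_real (exp (- ((b a)\<^sup>2 * ?v a) / 2)))"
    by (intro prod.cong refl incr_props)
  also have "\<dots> = of_real (exp (- (\<Sum>a\<in>?I. (b a)\<^sup>2 * ?v a) / 2))"
    by (simp add: exp_sum[symmetric] sum_negf sum_divide_distrib flip: of_real_prod)
  finally show ?thesis using sq var by (simp add: centred_gaussian_def)
qed

end

end

section \<open>Wiener integrals\<close>

lemma in_L2_iff: "in_L2 T f \<longleftrightarrow> square_integrable (lebesgue_on {0..T}) f"
  by (simp add: in_L2_def square_integrable_def)

lemma bounded_square_integrable:
  fixes f :: "real \<Rightarrow> real"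
  assumes "f \<in> borel_measurable (lebesgue_on {a..b})" "\<And>x. \<bar>f x\<bar> \<le> C"
  shows "square_integrable (lebesgue_on {a..b}) f"
proof -
  interpret L: finite_measure "lebesgue_on {a..b}" by (rule finite_measure_lebesgue_on_Icc)
  have "integrable (lebesgue_on {a..b}) (\<lambda>x. (f x)\<^sup>2)"
  proof (rule L.integrable_const_bound)
    show "AE x in lebesgue_on {a..b}. norm ((f x)\<^sup>2) \<le> C\<^sup>2"
    proof (rule AE_I2)
      fix x show "norm ((f x)\<^sup>2) \<le> C\<^sup>2" using power_mono[OF assms(2)[of x], of 2] by simp
    qed
  qed (use assms in measurable)
  then show ?thesis using assms by (simp add: square_integrable_def)
qed

lemma indicator_Ioc_square_integrable:
  fixes s t T :: real
  shows "square_integrable (lebesgue_on {0..T}) (indicator {s<..t})"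
proof (rule bounded_square_integrable)
  show "indicator {s<..t} \<in> borel_measurable (lebesgue_on {0..T})"
    by (rule borel_measurable_lebesgue_onI) simp
  show "\<bar>indicator {s<..t} x :: real\<bar> \<le> 1" for x by (simp add: indicator_def)
qed

lemma step_function_square_integrable: "square_integrable (lebesgue_on {0..T}) (step_function n t a)"
  unfolding step_function_def[abs_def]
  by (intro square_integrable_sum square_integrable_scale indicator_Ioc_square_integrable)

lemma integral_indicator_Ioc_product:
  assumes "s \<in> {0..T}" "t \<in> {0..T}"
  shows "(\<integral>x. indicator {0<..s} x * indicator {0<..t} x \<partial>lebesgue_on {0..T}) = (min s t :: real)"
proof -
  have "(\<integral>x. indicator {0<..s} x * (indicator {0<..t} x :: real) \<partial>lebesgue_on {0..T}) = (\<integral>x. indicator {0..T} x *\<^sub>R (indicator {0<..s} x * indicator {0<..t} x) \<partial>lebesgue)"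
    by (rule integral_restrict_space) auto
  also have "\<dots> = (\<integral>x. indicator {0<..min s t} x \<partial>lebesgue)"
    by (rule Bochner_Integration.integral_cong) (use assms in \<open>auto simp: indicator_def\<close>)
  also have "\<dots> = (min s t :: real)" using assms by (simp add: min_def)
  finally show ?thesis .
qed

lemma step_function_eq:
  assumes "\<And>i. i \<le> n \<Longrightarrow> 0 \<le> t i" "\<And>i. i < n \<Longrightarrow> t i \<le> t (Suc i)"
  shows "step_function n t a x = (\<Sum>i<n. a i * (indicator {0<..t (Suc i)} x - indicator {0<..t i} x))"
  unfolding step_function_def
proof (intro sum.cong refl)
  fix i assume i: "i \<in> {..<n}"
  then have "0 \<le> t i" "t i \<le> t (Suc i)" using assms(1)[of i] assms(2)[of i] by auto
  then show "a i * indicator {t i<..t (Suc i)} x = a i * (indicator {0<..t (Suc i)} x - indicator {0<..t i} x)"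
    by (auto simp: indicator_def)
qed

context brownian
begin

lemma W_telescope:
  assumes "l \<in> {1..m}" "\<tau> 0 = (0::real)"
  shows "AE \<omega> in M. W l (\<tau> k) \<omega> = (\<Sum>i<k. incr \<tau> (l, i) \<omega>)"
  using W_0[OF assms(1)]
proof eventually_elim
  fix \<omega> assume 0: "W l 0 \<omega> = 0"
  have "(\<Sum>i<k. incr \<tau> (l, i) \<omega>) = W l (\<tau> k) \<omega> - W l (\<tau> 0) \<omega>"
    by (simp add: incr_def sum_lessThan_telescope[of "\<lambda>i. W l (\<tau> i) \<omega>"])
  then show "W l (\<tau> k) \<omega> = (\<Sum>i<k. incr \<tau> (l, i) \<omega>)" using 0 assms by simp
qed

text \<open>For \<open>s \<le> t\<close> split both values into increments over \<open>[0,s]\<close> and \<open>[s,t]\<close>, which are uncorrelated.\<close>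

lemma W_covariance:
  assumes l: "l \<in> {1..m}" "l' \<in> {1..m}" and s: "s \<in> {0..T}" and t: "t \<in> {0..T}"
  shows "(\<integral>\<omega>. W l s \<omega> * W l' t \<omega> \<partial>M) = (if l = l' then min s t else 0)"
proof -
  have *: "(\<integral>\<omega>. W l s \<omega> * W l' t \<omega> \<partial>M) = (if l = l' then s else 0)"
    if l: "l \<in> {1..m}" "l' \<in> {1..m}" and s: "0 \<le> s" "s \<le> t" "t \<le> T" for l l' s t
  proof -
    define \<tau> where "\<tau> i = (if i = 0 then 0 else if i = 1 then s else t)" for i :: nat
    have tau: "\<And>i. i \<le> 2 \<Longrightarrow> \<tau> i \<in> {0..T}" and mono: "\<And>i. i < 2 \<Longrightarrow> \<tau> i \<le> \<tau> (Suc i)"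
      using s by (auto simp: \<tau>_def)
    note P = incr_props[of 2 \<tau>, OF tau mono] and U = incr_uncorrelated[of 2 \<tau>, OF tau mono]
    have mem: "(l,0) \<in> {1..m} \<times> {..<2::nat}" "(l',0) \<in> {1..m} \<times> {..<2::nat}" "(l',Suc 0) \<in> {1..m} \<times> {..<2::nat}" using l by auto
    have sq: "square_integrable M (incr \<tau> (l,0))" "square_integrable M (incr \<tau> (l',0))" "square_integrable M (incr \<tau> (l',Suc 0))"
      by (intro P mem; simp)+
    have "(\<integral>\<omega>. W l s \<omega> * W l' t \<omega> \<partial>M) = (\<integral>\<omega>. incr \<tau> (l,0) \<omega> * incr \<tau> (l',0) \<omega> + incr \<tau> (l,0) \<omega> * incr \<tau> (l',Suc 0) \<omega> \<partial>M)"
    proof (rule integral_cong_AE)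
      show "AE \<omega> in M. W l s \<omega> * W l' t \<omega> = incr \<tau> (l,0) \<omega> * incr \<tau> (l',0) \<omega> + incr \<tau> (l,0) \<omega> * incr \<tau> (l',Suc 0) \<omega>"
      proof -
        have tau_values: "\<tau> 0 = 0" "\<tau> 1 = s" "\<tau> 2 = t" by (simp_all add: \<tau>_def)
        show ?thesis
          using W_telescope[where \<tau>=\<tau> and k=1, OF l(1) tau_values(1)] W_telescope[where \<tau>=\<tau> and k=2, OF l(2) tau_values(1)]
          unfolding tau_values by eventually_elim (simp add: numeral_2_eq_2 distrib_left)
      qed
      show "(\<lambda>\<omega>. W l s \<omega> * W l' t \<omega>) \<in> borel_measurable M" using W_measurable l s by auto
    qed (use sq in \<open>auto simp: square_integrable_def\<close>)
    also have "\<dots> = (\<integral>\<omega>. incr \<tau> (l,0) \<omega> * incr \<tau> (l',0) \<omega> \<partial>M) + (\<integral>\<omega>. incr \<tau> (l,0) \<omega> * incr \<tau> (l',Suc 0) \<omega> \<partial>M)"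
      by (intro Bochner_Integration.integral_add square_integrable_mult_integrable sq)
    also have "(\<integral>\<omega>. incr \<tau> (l,0) \<omega> * incr \<tau> (l',Suc 0) \<omega> \<partial>M) = 0"
      by (rule U) (use mem in auto)
    also have "(\<integral>\<omega>. incr \<tau> (l,0) \<omega> * incr \<tau> (l',0) \<omega> \<partial>M) = (if l = l' then s else 0)"
    proof (cases "l = l'")
      case True
      then show ?thesis using P(3)[of "(l,0)"] mem by (simp add: \<tau>_def power2_eq_square)
    next
      case False
      then show ?thesis using U[of "(l,0)" "(l',0)"] mem by simp
    qed
    finally show ?thesis by simp
  qed
  show ?thesis
  proof (cases "s \<le> t")
    case True then show ?thesis using *[of l l' s t] l s t by simp
  next
    case False 
    have "(\<integral>\<omega>. W l s \<omega> * W l' t \<omega> \<partial>M) = (\<integral>\<omega>. W l' t \<omega> * W l s \<omega> \<partial>M)" by (simp only: mult.commute)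
    then show ?thesis using *[of l' l t s] l s t False by simp
  qed
qed

text \<open>On the partition formed by \<open>0\<close> and all times \<open>t q\<close>, sorted, the combination is one of independent
increments.\<close>

lemma W_combination_gaussian:
  assumes Q: "finite Q" and l: "\<And>q. q \<in> Q \<Longrightarrow> l q \<in> {1..m}" and t: "\<And>q. q \<in> Q \<Longrightarrow> t q \<in> {0..T}"
  shows "centred_gaussian (\<lambda>\<omega>. \<Sum>q\<in>Q. c q * W (l q) (t q) \<omega>)"
proof -
  define S where "S = insert 0 (t ` Q)"
  define xs where "xs = sorted_list_of_set S"
  define n where "n = length xs - 1"
  define \<tau> where "\<tau> i = (if i \<le> n then xs ! i else T)" for i
  have S: "finite S" "S \<subseteq> {0..T}" using Q t T_pos by (auto simp: S_def)
  have xs: "set xs = S" by (simp only: xs_def set_sorted_list_of_set[OF S(1)])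
  have sxs: "sorted xs" by (simp only: xs_def sorted_sorted_list_of_set)
  have nxs: "xs \<noteq> []" using xs by (auto simp: S_def)
  have len: "length xs = Suc n" using nxs by (simp add: n_def)
  have tau: "\<tau> i \<in> {0..T}" if "i \<le> n" for i
  proof -
    have "xs ! i \<in> set xs" using that len by (intro nth_mem) simp
    then have "xs ! i \<in> {0..T}" using S(2) xs by blast
    then show ?thesis using that by (simp add: \<tau>_def)
  qed
  have mono: "\<tau> i \<le> \<tau> (Suc i)" if "i < n" for i
    using that sxs len by (simp add: \<tau>_def sorted_iff_nth_mono)
  have tau0: "\<tau> 0 = 0"
  proof -
    have "0 \<in> set xs" using xs by (simp add: S_def)
    then obtain i where "i < length xs" "xs ! i = 0" by (auto simp: in_set_conv_nth)
    then have "xs ! 0 \<le> 0" using sxs by (metis le0 sorted_iff_nth_mono)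
    then show ?thesis using tau[of 0] by (simp add: \<tau>_def)
  qed
  have "\<exists>k\<le>n. \<tau> k = t q" if "q \<in> Q" for q
  proof -
    have "t q \<in> set xs" using that xs by (simp add: S_def)
    then obtain i where "i < length xs" "xs ! i = t q" by (auto simp: in_set_conv_nth)
    then show ?thesis using len by (intro exI[of _ i]) (auto simp: \<tau>_def)
  qed
  then obtain k where k: "\<And>q. q \<in> Q \<Longrightarrow> k q \<le> n" "\<And>q. q \<in> Q \<Longrightarrow> \<tau> (k q) = t q" by metis
  define b where "b a = (\<Sum>q\<in>Q. if l q = fst a \<and> snd a < k q then c q else 0)" for a :: "nat \<times> nat"
  let ?I = "{1..m} \<times> {..<n}"
  have g: "centred_gaussian (\<lambda>\<omega>. \<Sum>a\<in>?I. b a * incr \<tau> a \<omega>)"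
    by (rule incr_combination_gaussian) (use tau mono in blast)+
  have "AE \<omega> in M. \<forall>q\<in>Q. W (l q) (t q) \<omega> = (\<Sum>i<k q. incr \<tau> (l q, i) \<omega>)"
  proof (subst AE_finite_all[OF Q], intro ballI)
    fix q assume q: "q \<in> Q"
    show "AE \<omega> in M. W (l q) (t q) \<omega> = (\<Sum>i<k q. incr \<tau> (l q, i) \<omega>)"
      using W_telescope[where \<tau>=\<tau> and k="k q", OF l[OF q] tau0] k(2)[OF q] by simp
  qed
  then have ae: "AE \<omega> in M. (\<Sum>q\<in>Q. c q * W (l q) (t q) \<omega>) = (\<Sum>a\<in>?I. b a * incr \<tau> a \<omega>)"
  proof eventually_elim
    fix \<omega> assume *: "\<forall>q\<in>Q. W (l q) (t q) \<omega> = (\<Sum>i<k q. incr \<tau> (l q, i) \<omega>)"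
    have "(\<Sum>a\<in>?I. b a * incr \<tau> a \<omega>) = (\<Sum>q\<in>Q. \<Sum>a\<in>?I. (if l q = fst a \<and> snd a < k q then c q else 0) * incr \<tau> a \<omega>)"
      unfolding b_def sum_distrib_right by (rule sum.swap)
    also have "\<dots> = (\<Sum>q\<in>Q. c q * W (l q) (t q) \<omega>)"
    proof (rule sum.cong[OF refl])
      fix q assume q: "q \<in> Q"
      have "(\<Sum>a\<in>?I. (if l q = fst a \<and> snd a < k q then c q else 0) * incr \<tau> a \<omega>) = (\<Sum>a\<in>{l q} \<times> {..<k q}. (if l q = fst a \<and> snd a < k q then c q else 0) * incr \<tau> a \<omega>)"
        by (rule sum.mono_neutral_right) (use l[OF q] k(1)[OF q] in auto)
      also have "\<dots> = (\<Sum>a\<in>{l q} \<times> {..<k q}. c q * incr \<tau> a \<omega>)"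
        by (rule sum.cong) auto
      also have "\<dots> = (\<Sum>x\<in>{l q}. \<Sum>y\<in>{..<k q}. c q * incr \<tau> (x, y) \<omega>)"
        by (subst sum.cartesian_product) (simp add: case_prod_beta)
      also have "\<dots> = c q * W (l q) (t q) \<omega>" using * q by (simp add: sum_distrib_left)
      finally show "(\<Sum>a\<in>?I. (if l q = fst a \<and> snd a < k q then c q else 0) * incr \<tau> a \<omega>) = c q * W (l q) (t q) \<omega>" .
    qed
    finally show "(\<Sum>q\<in>Q. c q * W (l q) (t q) \<omega>) = (\<Sum>a\<in>?I. b a * incr \<tau> a \<omega>)" by simp
  qed
  have sq: "square_integrable M (\<lambda>\<omega>. \<Sum>q\<in>Q. c q * W (l q) (t q) \<omega>)"
    by (intro square_integrable_sum square_integrable_scale W_square_integrable l t)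
  note [measurable] = square_integrable_measurable[OF sq]
  have [measurable]: "(\<lambda>\<omega>. \<Sum>a\<in>?I. b a * incr \<tau> a \<omega>) \<in> borel_measurable M"
    using g by (simp add: centred_gaussian_def square_integrable_def)
  have "(\<integral>\<omega>. (\<Sum>q\<in>Q. c q * W (l q) (t q) \<omega>)\<^sup>2 \<partial>M) = (\<integral>\<omega>. (\<Sum>a\<in>?I. b a * incr \<tau> a \<omega>)\<^sup>2 \<partial>M)"
  proof (rule integral_cong_AE)
    show "AE \<omega> in M. (\<Sum>q\<in>Q. c q * W (l q) (t q) \<omega>)\<^sup>2 = (\<Sum>a\<in>?I. b a * incr \<tau> a \<omega>)\<^sup>2"
      using ae by eventually_elim simp
  qed measurable
  moreover have "(\<integral>\<omega>. iexp (\<Sum>q\<in>Q. c q * W (l q) (t q) \<omega>) \<partial>M) = (\<integral>\<omega>. iexp (\<Sum>a\<in>?I. b a * incr \<tau> a \<omega>) \<partial>M)"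
  proof (rule integral_cong_AE)
    show "AE \<omega> in M. iexp (\<Sum>q\<in>Q. c q * W (l q) (t q) \<omega>) = iexp (\<Sum>a\<in>?I. b a * incr \<tau> a \<omega>)"
      using ae by eventually_elim simp
  qed measurable
  ultimately show ?thesis using g sq unfolding centred_gaussian_def by simp
qed

lemma step_integral_square_integrable:
  assumes "l \<in> {1..m}" "\<And>i. i \<le> n \<Longrightarrow> t i \<in> {0..T}"
  shows "square_integrable M (step_integral (W l) n t a)"
  unfolding step_integral_def[abs_def]
  by (intro square_integrable_sum square_integrable_scale square_integrable_diff W_square_integrable assms) auto

text \<open>Both sides are bilinear, so it is enough to compare \<open>E[W\<^sub>s W\<^sub>t] = min s t\<close> with the inner product of
indicator functions, without passing to a common refinement of the two partitions.\<close>

lemma step_integral_covariance: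
  assumes l: "l \<in> {1..m}" "l' \<in> {1..m}"
    and t: "\<And>i. i \<le> n \<Longrightarrow> t i \<in> {0..T}" "\<And>i. i < n \<Longrightarrow> t i \<le> t (Suc i)"
    and t': "\<And>i. i \<le> n' \<Longrightarrow> t' i \<in> {0..T}" "\<And>i. i < n' \<Longrightarrow> t' i \<le> t' (Suc i)"
  shows "(\<integral>\<omega>. step_integral (W l) n t a \<omega> * step_integral (W l') n' t' a' \<omega> \<partial>M)
     = (if l = l' then (\<integral>x. step_function n t a x * step_function n' t' a' x \<partial>lebesgue_on {0..T}) else 0)"
proof -
  let ?L = "lebesgue_on {0..T}"
  let ?e = "\<lambda>s. indicator {0<..s} :: real \<Rightarrow> real"
  have cov: "(\<integral>\<omega>. (W l u \<omega> - W l v \<omega>) * (W l' u' \<omega> - W l' v' \<omega>) \<partial>M) = (if l = l' then (\<integral>x. (?e u x - ?e v x) * (?e u' x - ?e v' x) \<partial>?L) else 0)"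
    if "u \<in> {0..T}" "v \<in> {0..T}" "u' \<in> {0..T}" "v' \<in> {0..T}" for u v u' v'
  proof -
    have i: "integrable M (\<lambda>\<omega>. W l p \<omega> * W l' q \<omega>)" if "p \<in> {0..T}" "q \<in> {0..T}" for p q
      by (intro square_integrable_mult_integrable W_square_integrable l that)
    have j: "integrable ?L (\<lambda>x. ?e p x * ?e q x)" for p q
      by (intro square_integrable_mult_integrable indicator_Ioc_square_integrable)
    have "(\<integral>\<omega>. (W l u \<omega> - W l v \<omega>) * (W l' u' \<omega> - W l' v' \<omega>) \<partial>M)
      = (\<integral>\<omega>. W l u \<omega> * W l' u' \<omega> - W l u \<omega> * W l' v' \<omega> - (W l v \<omega> * W l' u' \<omega> - W l v \<omega> * W l' v' \<omega>) \<partial>M)"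
      by (rule Bochner_Integration.integral_cong) (auto simp: algebra_simps)
    also have "\<dots> = (\<integral>\<omega>. W l u \<omega> * W l' u' \<omega> \<partial>M) - (\<integral>\<omega>. W l u \<omega> * W l' v' \<omega> \<partial>M) - ((\<integral>\<omega>. W l v \<omega> * W l' u' \<omega> \<partial>M) - (\<integral>\<omega>. W l v \<omega> * W l' v' \<omega> \<partial>M))"
      using i that by simp
    also have "\<dots> = (if l = l' then min u u' - min u v' - (min v u' - min v v') else 0)"
      using W_covariance[OF l] that by simp
    also have "min u u' - min u v' - (min v u' - min v v') = (\<integral>x. ?e u x * ?e u' x \<partial>?L) - (\<integral>x. ?e u x * ?e v' x \<partial>?L) - ((\<integral>x. ?e v x * ?e u' x \<partial>?L) - (\<integral>x. ?e v x * ?e v' x \<partial>?L))"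
      using that by (simp only: integral_indicator_Ioc_product)
    also have "\<dots> = (\<integral>x. ?e u x * ?e u' x - ?e u x * ?e v' x - (?e v x * ?e u' x - ?e v x * ?e v' x) \<partial>?L)"
      using j by simp
    also have "\<dots> = (\<integral>x. (?e u x - ?e v x) * (?e u' x - ?e v' x) \<partial>?L)"
      by (rule Bochner_Integration.integral_cong) (auto simp: algebra_simps)
    finally show ?thesis .
  qed
  have i: "integrable M (\<lambda>\<omega>. a i * (W l (t (Suc i)) \<omega> - W l (t i) \<omega>) * (a' j * (W l' (t' (Suc j)) \<omega> - W l' (t' j) \<omega>)))" if "i \<in> {..<n}" "j \<in> {..<n'}" for i j
    using that t(1)[of i] t(1)[of "Suc i"] t'(1)[of j] t'(1)[of "Suc j"]
    by (intro square_integrable_mult_integrable square_integrable_scale square_integrable_diff W_square_integrable l) auto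
  have j: "integrable ?L (\<lambda>x. a i * (?e (t (Suc i)) x - ?e (t i) x) * (a' j * (?e (t' (Suc j)) x - ?e (t' j) x)))" for i j
    by (intro square_integrable_mult_integrable square_integrable_scale square_integrable_diff indicator_Ioc_square_integrable)
  have "(\<integral>\<omega>. step_integral (W l) n t a \<omega> * step_integral (W l') n' t' a' \<omega> \<partial>M)
    = (\<Sum>i<n. \<Sum>j<n'. \<integral>\<omega>. a i * (W l (t (Suc i)) \<omega> - W l (t i) \<omega>) * (a' j * (W l' (t' (Suc j)) \<omega> - W l' (t' j) \<omega>)) \<partial>M)"
    unfolding step_integral_def sum_product by (rule integral_double_sum) (rule i)
  also have "\<dots> = (\<Sum>i<n. \<Sum>j<n'. if l = l' then (\<integral>x. a i * (?e (t (Suc i)) x - ?e (t i) x) * (a' j * (?e (t' (Suc j)) x - ?e (t' j) x)) \<partial>?L) else 0)"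
  proof (intro sum.cong refl)
    fix i j assume "i \<in> {..<n}" "j \<in> {..<n'}"
    then have ij: "t (Suc i) \<in> {0..T}" "t i \<in> {0..T}" "t' (Suc j) \<in> {0..T}" "t' j \<in> {0..T}"
      using t(1)[of i] t(1)[of "Suc i"] t'(1)[of j] t'(1)[of "Suc j"] by auto
    have f: "(a i * x * (a' j * y)) = (a i * a' j) * (x * y)" for x y by (simp only: mult_ac)
    show "(\<integral>\<omega>. a i * (W l (t (Suc i)) \<omega> - W l (t i) \<omega>) * (a' j * (W l' (t' (Suc j)) \<omega> - W l' (t' j) \<omega>)) \<partial>M) = (if l = l' then (\<integral>x. a i * (?e (t (Suc i)) x - ?e (t i) x) * (a' j * (?e (t' (Suc j)) x - ?e (t' j) x)) \<partial>?L) else 0)"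
      unfolding f integral_mult_right_zero cov[OF ij] by simp
  qed
  also have "\<dots> = (if l = l' then (\<integral>x. step_function n t a x * step_function n' t' a' x \<partial>?L) else 0)"
  proof -
    have e: "step_function n t a x = (\<Sum>i<n. a i * (?e (t (Suc i)) x - ?e (t i) x))"
      "step_function n' t' a' x = (\<Sum>i<n'. a' i * (?e (t' (Suc i)) x - ?e (t' i) x))" for x
      using t t' by (intro step_function_eq; simp)+
    show ?thesis
      unfolding e sum_product using j
      by (simp add: Bochner_Integration.integral_sum Bochner_Integration.integrable_sum)
  qed
  finally show ?thesis .
qed

lemma has_Wiener_integral_approx:
  assumes l: "l \<in> {1..m}" and I: "has_Wiener_integral M T (W l) f I"
  obtains n t a where
    "\<And>k i. i \<le> n k \<Longrightarrow> t k i \<in> {0..T}" "\<And>k i. i < n k \<Longrightarrow> t k i \<le> t k (Suc i)"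
    "L2_tendsto (lebesgue_on {0..T}) (\<lambda>k. step_function (n k) (t k) (a k)) f"
    "L2_tendsto M (\<lambda>k. step_integral (W l) (n k) (t k) (a k)) I"
proof -
  obtain n :: "nat \<Rightarrow> nat" and t a where *: "\<forall>k. \<forall>i\<le>n k. t k i \<in> {0..T}" "\<forall>k. \<forall>i<n k. t k i \<le> t k (Suc i)"
        "(\<lambda>k. L2_norm_sq T (\<lambda>s. step_function (n k) (t k) (a k) s - f s)) \<longlonglongrightarrow> 0"
        "(\<lambda>k. \<integral>\<omega>. (step_integral (W l) (n k) (t k) (a k) \<omega> - I \<omega>)\<^sup>2 \<partial>M) \<longlonglongrightarrow> 0"
     and I: "in_L2 T f" "square_integrable M I"
    using I unfolding has_Wiener_integral_def mean_square_integral_def square_integrable_def by blast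
  show ?thesis
  proof (rule that)
    show "L2_tendsto (lebesgue_on {0..T}) (\<lambda>k. step_function (n k) (t k) (a k)) f"
      using * I by (simp add: L2_tendsto_def in_L2_iff L2_norm_sq_def step_function_square_integrable)
    show "L2_tendsto M (\<lambda>k. step_integral (W l) (n k) (t k) (a k)) I"
      using * I l by (simp add: L2_tendsto_def step_integral_square_integrable)
  qed (use * in auto)
qed

lemma Wiener_integral_covariance:
  assumes l: "l \<in> {1..m}" "l' \<in> {1..m}"
    and I: "has_Wiener_integral M T (W l) f I" and J: "has_Wiener_integral M T (W l') g J"
  shows "(\<integral>\<omega>. I \<omega> * J \<omega> \<partial>M) = (if l = l' then L2_inner T f g else 0)"
proof -
  obtain n t a where 1: "\<And>k i. i \<le> n k \<Longrightarrow> t k i \<in> {0..T}" "\<And>k i. i < n k \<Longrightarrow> t k i \<le> t k (Suc i)"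
    "L2_tendsto (lebesgue_on {0..T}) (\<lambda>k. step_function (n k) (t k) (a k)) f"
    "L2_tendsto M (\<lambda>k. step_integral (W l) (n k) (t k) (a k)) I"
    using has_Wiener_integral_approx[OF l(1) I] by blast
  obtain n' t' a' where 2: "\<And>k i. i \<le> n' k \<Longrightarrow> t' k i \<in> {0..T}" "\<And>k i. i < n' k \<Longrightarrow> t' k i \<le> t' k (Suc i)"
    "L2_tendsto (lebesgue_on {0..T}) (\<lambda>k. step_function (n' k) (t' k) (a' k)) g"
    "L2_tendsto M (\<lambda>k. step_integral (W l') (n' k) (t' k) (a' k)) J"
    using has_Wiener_integral_approx[OF l(2) J] by blast
  have "(\<lambda>k. \<integral>\<omega>. step_integral (W l) (n k) (t k) (a k) \<omega> * step_integral (W l') (n' k) (t' k) (a' k) \<omega> \<partial>M) \<longlonglongrightarrow> (\<integral>\<omega>. I \<omega> * J \<omega> \<partial>M)"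
    by (rule L2_tendsto_inner[OF 1(4) 2(4)])
  moreover have "(\<lambda>k. if l = l' then \<integral>x. step_function (n k) (t k) (a k) x * step_function (n' k) (t' k) (a' k) x \<partial>lebesgue_on {0..T} else 0) \<longlonglongrightarrow> (if l = l' then L2_inner T f g else 0)"
    using L2_tendsto_inner[OF 1(3) 2(3)] by (simp add: L2_inner_def)
  moreover have "(\<integral>\<omega>. step_integral (W l) (n k) (t k) (a k) \<omega> * step_integral (W l') (n' k) (t' k) (a' k) \<omega> \<partial>M)
    = (if l = l' then \<integral>x. step_function (n k) (t k) (a k) x * step_function (n' k) (t' k) (a' k) x \<partial>lebesgue_on {0..T} else 0)" for k
    by (rule step_integral_covariance) (use l 1(1,2) 2(1,2) in blast)+
  ultimately show ?thesis by (simp only:) (rule LIMSEQ_unique)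
qed

lemma has_Wiener_integral_square_integrable:
  "has_Wiener_integral M T X f I \<Longrightarrow> square_integrable M I"
  by (simp add: has_Wiener_integral_def mean_square_integral_def square_integrable_def)

text \<open>A linear combination of Wiener integrals is the mean square limit of linear combinations of values of
the Brownian motion.\<close>

lemma Wiener_integrals_gaussian:
  assumes Q: "finite Q" and l: "\<And>q. q \<in> Q \<Longrightarrow> l q \<in> {1..m}"
    and I: "\<And>q. q \<in> Q \<Longrightarrow> has_Wiener_integral M T (W (l q)) (f q) (I q)"
  shows "centred_gaussian (\<lambda>\<omega>. \<Sum>q\<in>Q. c q * I q \<omega>)"
proof -
  have "\<forall>q\<in>Q. \<exists>n t a. (\<forall>k. \<forall>i\<le>n k. t k i \<in> {0..T}) \<and> L2_tendsto M (\<lambda>k. step_integral (W (l q)) (n k) (t k) (a k)) (I q)"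
  proof
    fix q assume q: "q \<in> Q"
    show "\<exists>n t a. (\<forall>k. \<forall>i\<le>n k. t k i \<in> {0..T}) \<and> L2_tendsto M (\<lambda>k. step_integral (W (l q)) (n k) (t k) (a k)) (I q)"
      by (rule has_Wiener_integral_approx[OF l[OF q] I[OF q]]) blast
  qed
  then obtain n t a where nta: "\<And>q k i. q \<in> Q \<Longrightarrow> i \<le> n q k \<Longrightarrow> t q k i \<in> {0..T}"
    "\<And>q. q \<in> Q \<Longrightarrow> L2_tendsto M (\<lambda>k. step_integral (W (l q)) (n q k) (t q k) (a q k)) (I q)"
    by metis
  have "L2_tendsto M (\<lambda>k \<omega>. \<Sum>q\<in>Q. c q * step_integral (W (l q)) (n q k) (t q k) (a q k) \<omega>) (\<lambda>\<omega>. \<Sum>q\<in>Q. c q * I q \<omega>)"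
    by (intro L2_tendsto_sum L2_tendsto_scale nta)
  then show ?thesis
  proof (rule centred_gaussian_limit)
    fix k
    (* The Boolean selects the right or the left end point of an interval of the partition. *)
    define R where "R = (SIGMA q:Q. {..<n q k} \<times> (UNIV :: bool set))"
    define cc where "cc r = (case r of (q, i, b) \<Rightarrow> c q * a q k i * (if b then 1 else -1))" for r :: "'b \<times> nat \<times> bool"
    define tt where "tt r = (case r of (q, i, b) \<Rightarrow> t q k (if b then Suc i else i))" for r :: "'b \<times> nat \<times> bool"
    have "centred_gaussian (\<lambda>\<omega>. \<Sum>r\<in>R. cc r * W (l (fst r)) (tt r) \<omega>)"
    proof (rule W_combination_gaussian)
      show "finite R" using Q by (simp add: R_def)
      show "l (fst r) \<in> {1..m}" if "r \<in> R" for r using l that by (auto simp: R_def)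
      show "tt r \<in> {0..T}" if "r \<in> R" for r using that nta(1) by (auto simp: R_def tt_def simp del: atLeastAtMost_iff split: prod.splits)
    qed
    moreover have "(\<Sum>r\<in>R. cc r * W (l (fst r)) (tt r) \<omega>) = (\<Sum>q\<in>Q. c q * step_integral (W (l q)) (n q k) (t q k) (a q k) \<omega>)" for \<omega>
    proof -
      have "(\<Sum>r\<in>R. cc r * W (l (fst r)) (tt r) \<omega>) = (\<Sum>q\<in>Q. \<Sum>ib\<in>{..<n q k} \<times> UNIV. cc (q, ib) * W (l q) (tt (q, ib)) \<omega>)"
        unfolding R_def using Q by (subst sum.Sigma) (auto simp: case_prod_beta)
      also have "\<dots> = (\<Sum>q\<in>Q. \<Sum>i<n q k. \<Sum>b\<in>UNIV. cc (q, i, b) * W (l q) (tt (q, i, b)) \<omega>)"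
        by (intro sum.cong refl) (simp add: sum.cartesian_product case_prod_beta)
      also have "\<dots> = (\<Sum>q\<in>Q. c q * step_integral (W (l q)) (n q k) (t q k) (a q k) \<omega>)"
        by (simp add: UNIV_bool cc_def tt_def step_integral_def sum_distrib_left algebra_simps)
      finally show ?thesis .
    qed
    ultimately show "centred_gaussian (\<lambda>\<omega>. \<Sum>q\<in>Q. c q * step_integral (W (l q)) (n q k) (t q k) (a q k) \<omega>)" by simp
  qed
qed

end

section \<open>Uniqueness of Fourier transforms of integrable variables\<close>

lemma iexp_eq_cis: "iexp x = cis x"
  by (simp add: cis_conv_exp)

context prob_space
begin

text \<open>The positive and the negative part of \<open>Z\<close>, taken as densities and normalised, push forward under \<open>X\<close> to
probability measures with equal characteristic functions. Levy's uniqueness theorem applies.\<close>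

lemma integral_mult_indicator_eq_0:
  assumes Z: "integrable M (Z :: 'a \<Rightarrow> real)" and [measurable]: "X \<in> borel_measurable M"
    and char0: "\<And>\<theta>. (\<integral>\<omega>. of_real (Z \<omega>) * iexp (\<theta> * X \<omega>) \<partial>M) = 0"
    and A: "A \<in> sets borel"
  shows "(\<integral>\<omega>. Z \<omega> * indicator A (X \<omega>) \<partial>M) = 0"
proof -
  have [measurable]: "Z \<in> borel_measurable M" using Z by auto
  note [measurable] = A
  define P where "P \<omega> = max 0 (Z \<omega>)" for \<omega>
  define N where "N \<omega> = max 0 (- Z \<omega>)" for \<omega>
  have PN: "Z \<omega> = P \<omega> - N \<omega>" "0 \<le> P \<omega>" "0 \<le> N \<omega>" for \<omega> by (auto simp: P_def N_def)
  have [measurable]: "P \<in> borel_measurable M" "N \<in> borel_measurable M" by (auto simp: P_def[abs_def] N_def[abs_def])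
  have iP: "integrable M P" and iN: "integrable M N"
    using Z by (auto simp: P_def[abs_def] N_def[abs_def])
  have iPe: "integrable M (\<lambda>\<omega>. of_real (P \<omega>) * iexp (\<theta> * X \<omega>))" and iNe: "integrable M (\<lambda>\<omega>. of_real (N \<omega>) * iexp (\<theta> * X \<omega>))" for \<theta>
    by (rule Bochner_Integration.integrable_bound[OF iP], auto simp: norm_mult,
        rule Bochner_Integration.integrable_bound[OF iN], auto simp: norm_mult)
  have eq: "(\<integral>\<omega>. of_real (P \<omega>) * iexp (\<theta> * X \<omega>) \<partial>M) = (\<integral>\<omega>. of_real (N \<omega>) * iexp (\<theta> * X \<omega>) \<partial>M)" for \<theta>
  proof -
    have "(\<integral>\<omega>. of_real (P \<omega>) * iexp (\<theta> * X \<omega>) \<partial>M) - (\<integral>\<omega>. of_real (N \<omega>) * iexp (\<theta> * X \<omega>) \<partial>M) = (\<integral>\<omega>. of_real (Z \<omega>) * iexp (\<theta> * X \<omega>) \<partial>M)"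
      by (subst Bochner_Integration.integral_diff[symmetric, OF iPe iNe]) (simp add: PN(1) left_diff_distrib)
    then show ?thesis using char0 by simp
  qed
  define c where "c = (\<integral>\<omega>. P \<omega> \<partial>M)"
  have cN: "c = (\<integral>\<omega>. N \<omega> \<partial>M)"
  proof -
    have "(\<integral>\<omega>. complex_of_real (P \<omega>) \<partial>M) = (\<integral>\<omega>. complex_of_real (N \<omega>) \<partial>M)" using eq[of 0] by simp
    then show ?thesis unfolding c_def integral_complex_of_real by simp
  qed
  have c0: "c \<ge> 0" unfolding c_def by (simp add: PN)
  show ?thesis
  proof (cases "c = 0")
    case True
    have "AE \<omega> in M. P \<omega> = 0"
      using True iP PN(2) unfolding c_def by (subst (asm) integral_nonneg_eq_0_iff_AE) auto
    moreover have "AE \<omega> in M. N \<omega> = 0"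
      using True iN PN(3) unfolding cN by (subst (asm) integral_nonneg_eq_0_iff_AE) auto
    ultimately have "AE \<omega> in M. Z \<omega> * indicator A (X \<omega>) = 0" by eventually_elim (simp add: PN(1))
    then show ?thesis by (rule integral_eq_zero_AE)
  next
    case False
    then have c: "c > 0" using c0 by simp
    have prob: "prob_space (density M (\<lambda>\<omega>. ennreal (Q \<omega> / c)))" if "integrable M Q" "\<And>\<omega>. 0 \<le> Q \<omega>" "(\<integral>\<omega>. Q \<omega> \<partial>M) = c" for Q
    proof
      have [measurable]: "Q \<in> borel_measurable M" using that by auto
      have "emeasure (density M (\<lambda>\<omega>. ennreal (Q \<omega> / c))) (space M) = (\<integral>\<^sup>+\<omega>. ennreal (Q \<omega> / c) \<partial>M)"
        by (subst emeasure_density) (auto intro!: nn_integral_cong)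
      also have "\<dots> = ennreal (\<integral>\<omega>. Q \<omega> / c \<partial>M)"
        by (rule nn_integral_eq_integral) (use that c in auto)
      also have "\<dots> = 1" using that c by simp
      finally show "emeasure (density M (\<lambda>\<omega>. ennreal (Q \<omega> / c))) (space (density M (\<lambda>\<omega>. ennreal (Q \<omega> / c)))) = 1" by simp
    qed
    let ?D = "\<lambda>Q. distr (density M (\<lambda>\<omega>. ennreal (Q \<omega> / c))) borel X"
    have rd: "real_distribution (?D Q)" if "integrable M Q" "\<And>\<omega>. 0 \<le> Q \<omega>" "(\<integral>\<omega>. Q \<omega> \<partial>M) = c" for Q
    proof -
      interpret Q: prob_space "density M (\<lambda>\<omega>. ennreal (Q \<omega> / c))" by (rule prob[OF that])
      show ?thesis by (rule Q.real_distribution_distr) simp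
    qed
    have ch: "char (?D Q) \<theta> = (\<integral>\<omega>. of_real (Q \<omega>) * iexp (\<theta> * X \<omega>) \<partial>M) / c" if [measurable]: "integrable M Q" and "\<And>\<omega>. 0 \<le> Q \<omega>" for Q \<theta>
    proof -
      have [measurable]: "Q \<in> borel_measurable M" using that by auto
      have "char (?D Q) \<theta> = (\<integral>\<omega>. (Q \<omega> / c) *\<^sub>R iexp (\<theta> * X \<omega>) \<partial>M)"
        unfolding char_def using that c by (subst integral_distr, simp, simp, subst integral_density) auto
      also have "\<dots> = (\<integral>\<omega>. (of_real (Q \<omega>) * iexp (\<theta> * X \<omega>)) / c \<partial>M)"
        by (simp add: scaleR_conv_of_real)
      finally show ?thesis by simp
    qed
    have "?D P = ?D N"
    proof (rule Levy_uniqueness)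
      show "real_distribution (?D P)" by (rule rd[OF iP PN(2)]) (simp add: c_def)
      show "real_distribution (?D N)" by (rule rd[OF iN PN(3)]) (simp add: cN)
      show "char (?D P) = char (?D N)" by (rule ext) (simp only: ch[OF iP PN(2)] ch[OF iN PN(3)] eq)
    qed
    then have "(\<integral>x. (indicator A x :: real) \<partial>?D P) = (\<integral>x. indicator A x \<partial>?D N)" by simp
    moreover have "(\<integral>x. (indicator A x :: real) \<partial>?D Q) = (\<integral>\<omega>. (Q \<omega> / c) * indicator A (X \<omega>) \<partial>M)" if "integrable M Q" and "\<And>\<omega>. 0 \<le> Q \<omega>" for Q
    proof -
      have [measurable]: "Q \<in> borel_measurable M" using that by auto
      show ?thesis using that c
        by (subst integral_distr, simp, simp, subst integral_real_density) auto
    qed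
    ultimately have "(\<integral>\<omega>. P \<omega> * indicator A (X \<omega>) \<partial>M) / c = (\<integral>\<omega>. N \<omega> * indicator A (X \<omega>) \<partial>M) / c"
      using iP iN PN(2,3) by simp
    then have "(\<integral>\<omega>. P \<omega> * indicator A (X \<omega>) \<partial>M) = (\<integral>\<omega>. N \<omega> * indicator A (X \<omega>) \<partial>M)" using c by simp
    moreover have "integrable M (\<lambda>\<omega>. P \<omega> * indicator A (X \<omega>))" "integrable M (\<lambda>\<omega>. N \<omega> * indicator A (X \<omega>))"
      by (rule Bochner_Integration.integrable_bound[OF iP], auto simp: indicator_def,
          rule Bochner_Integration.integrable_bound[OF iN], auto simp: indicator_def)
    ultimately show ?thesis by (simp add: PN(1) left_diff_distrib)
  qed
qed

text \<open>Induction on the number of variables: \<open>Z cos(t X\<^sub>a)\<close> and \<open>Z sin(t X\<^sub>a)\<close> have vanishing Fourier transforms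
in the remaining variables. After the induction step has inserted the other indicator functions,
the uniqueness result for one variable is applied in \<open>X\<^sub>a\<close>.\<close>

lemma integral_mult_prod_indicator_eq_0:
  assumes "finite I" "integrable M (Z :: 'a \<Rightarrow> real)" "\<And>i. i \<in> I \<Longrightarrow> X i \<in> borel_measurable M"
    and "\<And>\<theta>. (\<integral>\<omega>. of_real (Z \<omega>) * iexp (\<Sum>i\<in>I. \<theta> i * X i \<omega>) \<partial>M) = 0"
    and "\<And>i. i \<in> I \<Longrightarrow> A i \<in> sets borel"
  shows "(\<integral>\<omega>. Z \<omega> * (\<Prod>i\<in>I. indicator (A i) (X i \<omega>)) \<partial>M) = 0"
  using assms
proof (induction I arbitrary: Z rule: finite_induct)
  case empty
  then have "(\<integral>\<omega>. complex_of_real (Z \<omega>) \<partial>M) = 0" by simp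
  then show ?case by (simp add: integral_complex_of_real)
next
  case (insert a I)
  have m [measurable]: "X a \<in> borel_measurable M" "\<And>i. i \<in> I \<Longrightarrow> X i \<in> borel_measurable M" "Z \<in> borel_measurable M" using insert.prems by auto
  have [measurable]: "A a \<in> sets borel" "\<And>i. i \<in> I \<Longrightarrow> A i \<in> sets borel" using insert.prems by auto
  let ?\<Pi> = "\<lambda>\<omega>. \<Prod>i\<in>I. indicator (A i) (X i \<omega>) :: real"
  have pm [measurable]: "?\<Pi> \<in> borel_measurable M" by measurable
  have p1: "0 \<le> ?\<Pi> \<omega>" "?\<Pi> \<omega> \<le> 1" for \<omega>
    by (auto intro!: prod_nonneg prod_le_1 simp: indicator_def)
  define S where "S \<theta> \<omega> = (\<Sum>i\<in>I. \<theta> i * X i \<omega>)" for \<theta> :: "'b \<Rightarrow> real" and \<omega>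
  have Sm [measurable]: "S \<theta> \<in> borel_measurable M" for \<theta> unfolding S_def[abs_def] by measurable
  have z: "(\<integral>\<omega>. of_real (Z \<omega>) * (iexp (t * X a \<omega>) * iexp (S \<theta> \<omega>)) \<partial>M) = 0" for t \<theta>
  proof -
    have "(\<Sum>i\<in>insert a I. (\<theta>(a := t)) i * X i \<omega>) = t * X a \<omega> + S \<theta> \<omega>" for \<omega>
      unfolding S_def using insert.hyps by (simp cong: sum.cong) (auto intro!: sum.cong)
    then show ?thesis using insert.prems(3)[of "\<theta>(a := t)"] by (simp add: distrib_left exp_add)
  qed
  have zi: "integrable M (\<lambda>\<omega>. of_real (Z \<omega>) * (iexp (t * X a \<omega>) * iexp (S \<theta> \<omega>)))" for t \<theta>
    by (rule Bochner_Integration.integrable_bound[OF insert.prems(1)]) (auto simp: norm_mult)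
  have c: "(\<integral>\<omega>. (Z \<omega> * cos (t * X a \<omega>)) * ?\<Pi> \<omega> \<partial>M) = 0" for t
  proof (rule insert.IH)
    show "integrable M (\<lambda>\<omega>. Z \<omega> * cos (t * X a \<omega>))"
      by (rule Bochner_Integration.integrable_bound[OF insert.prems(1)]) (auto simp: abs_mult intro!: mult_left_le)
    fix \<theta> :: "'b \<Rightarrow> real"
    have e: "complex_of_real (cos x) = (iexp x + iexp (- x)) / 2" for x
      unfolding iexp_eq_cis by (simp add: complex_eq_iff)
    have "(\<integral>\<omega>. complex_of_real (Z \<omega> * cos (t * X a \<omega>)) * iexp (S \<theta> \<omega>) \<partial>M)
      = (\<integral>\<omega>. (of_real (Z \<omega>) * (iexp (t * X a \<omega>) * iexp (S \<theta> \<omega>)) + of_real (Z \<omega>) * (iexp ((-t) * X a \<omega>) * iexp (S \<theta> \<omega>))) / 2 \<partial>M)"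
      unfolding of_real_mult[of "Z _"] e by (intro Bochner_Integration.integral_cong refl) (simp add: algebra_simps)
    also have "\<dots> = ((\<integral>\<omega>. of_real (Z \<omega>) * (iexp (t * X a \<omega>) * iexp (S \<theta> \<omega>)) \<partial>M) + (\<integral>\<omega>. of_real (Z \<omega>) * (iexp ((-t) * X a \<omega>) * iexp (S \<theta> \<omega>)) \<partial>M)) / 2"
      by (subst integral_divide_zero, subst Bochner_Integration.integral_add[OF zi zi]) simp
    also have "\<dots> = 0" unfolding z by simp
    finally show "(\<integral>\<omega>. complex_of_real (Z \<omega> * cos (t * X a \<omega>)) * iexp (\<Sum>i\<in>I. \<theta> i * X i \<omega>) \<partial>M) = 0"
      unfolding S_def .
  qed (use insert.prems in auto)
  have s: "(\<integral>\<omega>. (Z \<omega> * sin (t * X a \<omega>)) * ?\<Pi> \<omega> \<partial>M) = 0" for t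
  proof (rule insert.IH)
    show "integrable M (\<lambda>\<omega>. Z \<omega> * sin (t * X a \<omega>))"
      by (rule Bochner_Integration.integrable_bound[OF insert.prems(1)]) (auto simp: abs_mult intro!: mult_left_le)
    fix \<theta> :: "'b \<Rightarrow> real"
    have e: "complex_of_real (sin x) = (iexp x - iexp (- x)) / (2 * \<i>)" for x
      unfolding iexp_eq_cis by (simp add: complex_eq_iff)
    have "(\<integral>\<omega>. complex_of_real (Z \<omega> * sin (t * X a \<omega>)) * iexp (S \<theta> \<omega>) \<partial>M)
      = (\<integral>\<omega>. (of_real (Z \<omega>) * (iexp (t * X a \<omega>) * iexp (S \<theta> \<omega>)) - of_real (Z \<omega>) * (iexp ((-t) * X a \<omega>) * iexp (S \<theta> \<omega>))) / (2 * \<i>) \<partial>M)"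
      unfolding of_real_mult[of "Z _"] e by (intro Bochner_Integration.integral_cong refl) (simp add: algebra_simps)
    also have "\<dots> = ((\<integral>\<omega>. of_real (Z \<omega>) * (iexp (t * X a \<omega>) * iexp (S \<theta> \<omega>)) \<partial>M) - (\<integral>\<omega>. of_real (Z \<omega>) * (iexp ((-t) * X a \<omega>) * iexp (S \<theta> \<omega>)) \<partial>M)) / (2 * \<i>)"
      by (subst integral_divide_zero, subst Bochner_Integration.integral_diff[OF zi zi]) simp
    also have "\<dots> = 0" unfolding z by simp
    finally show "(\<integral>\<omega>. complex_of_real (Z \<omega> * sin (t * X a \<omega>)) * iexp (\<Sum>i\<in>I. \<theta> i * X i \<omega>) \<partial>M) = 0"
      unfolding S_def .
  qed (use insert.prems in auto)
  have Zi: "integrable M (\<lambda>\<omega>. Z \<omega> * ?\<Pi> \<omega>)"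
    by (rule Bochner_Integration.integrable_bound[OF insert.prems(1)]) (use p1 in \<open>auto simp: abs_mult intro!: mult_left_le\<close>)
  have ci: "integrable M (\<lambda>\<omega>. Z \<omega> * ?\<Pi> \<omega> * cos (t * X a \<omega>))" "integrable M (\<lambda>\<omega>. Z \<omega> * ?\<Pi> \<omega> * sin (t * X a \<omega>))" for t
    by (rule Bochner_Integration.integrable_bound[OF Zi], auto simp: abs_mult intro!: mult_left_le,
        rule Bochner_Integration.integrable_bound[OF Zi], auto simp: abs_mult intro!: mult_left_le)
  have "(\<integral>\<omega>. (Z \<omega> * ?\<Pi> \<omega>) * indicator (A a) (X a \<omega>) \<partial>M) = 0"
  proof (rule integral_mult_indicator_eq_0[OF Zi])
    fix t
    have "(\<integral>\<omega>. complex_of_real (Z \<omega> * ?\<Pi> \<omega>) * iexp (t * X a \<omega>) \<partial>M) = (\<integral>\<omega>. complex_of_real (Z \<omega> * ?\<Pi> \<omega> * cos (t * X a \<omega>)) + \<i> * complex_of_real (Z \<omega> * ?\<Pi> \<omega> * sin (t * X a \<omega>)) \<partial>M)"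
    proof -
      have "complex_of_real z * iexp x = complex_of_real (z * cos x) + \<i> * complex_of_real (z * sin x)" for z x
        unfolding iexp_eq_cis by (simp add: complex_eq_iff)
      then show ?thesis by (simp only:)
    qed
    also have "\<dots> = of_real (\<integral>\<omega>. Z \<omega> * ?\<Pi> \<omega> * cos (t * X a \<omega>) \<partial>M) + \<i> * of_real (\<integral>\<omega>. Z \<omega> * ?\<Pi> \<omega> * sin (t * X a \<omega>) \<partial>M)"
      using ci[of t] by (subst Bochner_Integration.integral_add) (simp_all only: integrable_of_real integrable_mult_right integral_mult_right_zero integral_complex_of_real)
    also have "\<dots> = 0"
    proof -
      have "(\<integral>\<omega>. Z \<omega> * ?\<Pi> \<omega> * cos (t * X a \<omega>) \<partial>M) = 0" using c[of t] by (simp only: mult_ac)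
      moreover have "(\<integral>\<omega>. Z \<omega> * ?\<Pi> \<omega> * sin (t * X a \<omega>) \<partial>M) = 0" using s[of t] by (simp only: mult_ac)
      ultimately show ?thesis by simp
    qed
    finally show "(\<integral>\<omega>. complex_of_real (Z \<omega> * ?\<Pi> \<omega>) * iexp (t * X a \<omega>) \<partial>M) = 0" .
  qed auto
  then show ?case using insert.hyps by (simp add: mult_ac)
qed

text \<open>Boxes generate the product \<open>\<sigma>\<close>-algebra, so the two parts of \<open>Z\<close> push forward to the same measure.\<close>

lemma integral_mult_measurable_eq_0:
  fixes I :: "'i set" and Z :: "'a \<Rightarrow> real"
  assumes I: "finite I" and Z: "integrable M Z" and X: "\<And>i. i \<in> I \<Longrightarrow> X i \<in> borel_measurable M"
    and char0: "\<And>\<theta>. (\<integral>\<omega>. of_real (Z \<omega>) * iexp (\<Sum>i\<in>I. \<theta> i * X i \<omega>) \<partial>M) = 0"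
    and g: "g \<in> borel_measurable (Pi\<^sub>M I (\<lambda>_. borel :: real measure))"
    and bd: "\<And>x. \<bar>g x\<bar> \<le> (C :: real)"
  shows "(\<integral>\<omega>. Z \<omega> * g (\<lambda>i\<in>I. X i \<omega>) \<partial>M) = 0"
proof -
  have [measurable]: "Z \<in> borel_measurable M" using Z by auto
  define P where "P \<omega> = max 0 (Z \<omega>)" for \<omega>
  define N where "N \<omega> = max 0 (- Z \<omega>)" for \<omega>
  have PN: "Z \<omega> = P \<omega> - N \<omega>" "0 \<le> P \<omega>" "0 \<le> N \<omega>" for \<omega> by (auto simp: P_def N_def)
  have [measurable]: "P \<in> borel_measurable M" "N \<in> borel_measurable M" by (auto simp: P_def[abs_def] N_def[abs_def])
  have iP: "integrable M P" and iN: "integrable M N"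
    using Z by (auto simp: P_def[abs_def] N_def[abs_def])
  let ?V = "\<lambda>\<omega>. \<lambda>i\<in>I. X i \<omega>"
  let ?\<Pi> = "Pi\<^sub>M I (\<lambda>_. borel :: real measure)"
  have Vm [measurable]: "?V \<in> M \<rightarrow>\<^sub>M ?\<Pi>" by (rule measurable_restrict) (rule X)
  let ?D = "\<lambda>Q. distr (density M (\<lambda>\<omega>. ennreal (Q \<omega>))) ?\<Pi> ?V"
  have em: "emeasure (?D Q) B = ennreal (\<integral>\<omega>. Q \<omega> * indicator B (?V \<omega>) \<partial>M)" if Q: "integrable M Q" "\<And>\<omega>. 0 \<le> Q \<omega>" and B [measurable]: "B \<in> sets ?\<Pi>" for Q B
  proof -
    have [measurable]: "Q \<in> borel_measurable M" using Q by auto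
    have "emeasure (?D Q) B = (\<integral>\<^sup>+\<omega>. ennreal (Q \<omega>) * indicator (?V -` B \<inter> space M) \<omega> \<partial>M)"
      by (subst emeasure_distr, simp, simp, subst emeasure_density) auto
    also have "\<dots> = (\<integral>\<^sup>+\<omega>. ennreal (Q \<omega> * indicator B (?V \<omega>)) \<partial>M)"
      by (rule nn_integral_cong) (auto simp: indicator_def)
    also have "\<dots> = ennreal (\<integral>\<omega>. Q \<omega> * indicator B (?V \<omega>) \<partial>M)"
    proof (rule nn_integral_eq_integral)
      show "integrable M (\<lambda>\<omega>. Q \<omega> * indicator B (?V \<omega>))"
        by (rule Bochner_Integration.integrable_bound[OF Q(1)]) (auto simp: indicator_def)
    qed (use Q in auto)
    finally show ?thesis .
  qed
  have "?D P = ?D N"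
  proof (rule measure_eqI_PiM_finite[OF I])
    fix A :: "'i \<Rightarrow> real set" assume A: "\<And>i. i \<in> I \<Longrightarrow> A i \<in> sets borel"
    have B: "Pi\<^sub>E I A \<in> sets ?\<Pi>" by (rule sets_PiM_I_finite[OF I]) (rule A)
    have ind: "indicator (Pi\<^sub>E I A) (?V \<omega>) = (\<Prod>i\<in>I. indicator (A i) (X i \<omega>) :: real)" for \<omega>
    proof (cases "\<forall>i\<in>I. X i \<omega> \<in> A i")
      case True then show ?thesis by (auto simp: indicator_def PiE_def)
    next
      case False
      then obtain i where "i \<in> I" "X i \<omega> \<notin> A i" by blast
      moreover from this have "(\<Prod>i\<in>I. indicator (A i) (X i \<omega>) :: real) = 0" using I by (intro prod_zero) (auto intro!: bexI[of _ i])
      moreover from \<open>i \<in> I\<close> \<open>X i \<omega> \<notin> A i\<close> have "?V \<omega> \<notin> Pi\<^sub>E I A" using PiE_mem[of "?V \<omega>" I A i] by auto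
      ultimately show ?thesis by simp
    qed
    have "(\<integral>\<omega>. Z \<omega> * (\<Prod>i\<in>I. indicator (A i) (X i \<omega>)) \<partial>M) = 0"
      by (rule integral_mult_prod_indicator_eq_0[OF I Z X char0 A])
    then have "(\<integral>\<omega>. P \<omega> * indicator (Pi\<^sub>E I A) (?V \<omega>) - N \<omega> * indicator (Pi\<^sub>E I A) (?V \<omega>) \<partial>M) = 0"
      unfolding ind by (simp add: PN(1) left_diff_distrib)
    moreover have "integrable M (\<lambda>\<omega>. P \<omega> * indicator (Pi\<^sub>E I A) (?V \<omega>))" "integrable M (\<lambda>\<omega>. N \<omega> * indicator (Pi\<^sub>E I A) (?V \<omega>))"
    proof -
      note [measurable] = B
      have "integrable M (\<lambda>\<omega>. Q \<omega> * indicator (Pi\<^sub>E I A) (?V \<omega>))" if "integrable M Q" for Q :: "'a \<Rightarrow> real"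
      proof (rule Bochner_Integration.integrable_bound[OF that])
        have [measurable]: "Q \<in> borel_measurable M" using that by auto
        show "(\<lambda>\<omega>. Q \<omega> * indicator (Pi\<^sub>E I A) (?V \<omega>)) \<in> borel_measurable M" by measurable
        show "AE \<omega> in M. norm (Q \<omega> * indicator (Pi\<^sub>E I A) (?V \<omega>)) \<le> norm (Q \<omega>)"
          by (intro AE_I2) (simp add: indicator_def)
      qed
      then show "integrable M (\<lambda>\<omega>. P \<omega> * indicator (Pi\<^sub>E I A) (?V \<omega>))" "integrable M (\<lambda>\<omega>. N \<omega> * indicator (Pi\<^sub>E I A) (?V \<omega>))"
        using iP iN by blast+
    qed
    ultimately have "(\<integral>\<omega>. P \<omega> * indicator (Pi\<^sub>E I A) (?V \<omega>) \<partial>M) = (\<integral>\<omega>. N \<omega> * indicator (Pi\<^sub>E I A) (?V \<omega>) \<partial>M)" by simp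
    then show "emeasure (?D P) (Pi\<^sub>E I A) = emeasure (?D N) (Pi\<^sub>E I A)"
      by (simp add: em[OF iP PN(2) B] em[OF iN PN(3) B])
  next
    show "range (\<lambda>_::nat. Pi\<^sub>E I (\<lambda>_. UNIV)) \<subseteq> prod_algebra I (\<lambda>_. borel :: real measure)"
      using I by (auto intro!: prod_algebraI_finite)
    show "(\<Union>i::nat. Pi\<^sub>E I (\<lambda>_. UNIV)) = space ?\<Pi>" by (simp add: space_PiM)
    have "Pi\<^sub>E I (\<lambda>_. UNIV) \<in> sets ?\<Pi>" using I by (intro sets_PiM_I_finite) auto
    from em[OF iP PN(2) this] show "emeasure (?D P) (Pi\<^sub>E I (\<lambda>_. UNIV)) \<noteq> \<infinity>" by simp
  qed simp_all
  then have "(\<integral>x. g x \<partial>?D P) = (\<integral>x. g x \<partial>?D N)" by simp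
  moreover have "(\<integral>x. g x \<partial>?D Q) = (\<integral>\<omega>. Q \<omega> * g (?V \<omega>) \<partial>M)" if "integrable M Q" "\<And>\<omega>. 0 \<le> Q \<omega>" for Q
  proof -
    have [measurable]: "Q \<in> borel_measurable M" using that by auto
    note [measurable] = g
    show ?thesis using that
      by (subst integral_distr, simp, simp, subst integral_real_density) auto
  qed
  ultimately have "(\<integral>\<omega>. P \<omega> * g (?V \<omega>) \<partial>M) = (\<integral>\<omega>. N \<omega> * g (?V \<omega>) \<partial>M)"
    using iP iN PN by simp
  moreover have "integrable M (\<lambda>\<omega>. Q \<omega> * g (?V \<omega>))" if "integrable M Q" for Q :: "'a \<Rightarrow> real"
  proof (rule Bochner_Integration.integrable_bound)
    show "integrable M (\<lambda>\<omega>. C * Q \<omega>)" using that by simp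
    have [measurable]: "Q \<in> borel_measurable M" using that by auto
    note [measurable] = g
    show "(\<lambda>\<omega>. Q \<omega> * g (?V \<omega>)) \<in> borel_measurable M" by measurable
    have "\<bar>g x\<bar> \<le> \<bar>C\<bar>" for x using bd[of x] by linarith
    then show "AE \<omega> in M. norm (Q \<omega> * g (?V \<omega>)) \<le> norm (C * Q \<omega>)"
      by (intro AE_I2) (auto simp: abs_mult mult.commute[of "\<bar>C\<bar>"] intro!: mult_left_mono)
  qed
  ultimately show ?thesis using iP iN by (simp add: PN(1) left_diff_distrib)
qed

end

section \<open>Integration by parts for polynomials in Gaussian variables\<close>

context prob_space
begin

text \<open>This class contains the Gaussian variables, is an algebra, and lies in every \<open>L\<^sup>p\<close>.\<close>

definition all_moments :: "('a \<Rightarrow> real) \<Rightarrow> bool" where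
  "all_moments Y \<longleftrightarrow> Y \<in> borel_measurable M \<and> (\<forall>n::nat. integrable M (\<lambda>\<omega>. \<bar>Y \<omega>\<bar> ^ n))"

lemma all_moments_measurable: "all_moments Y \<Longrightarrow> Y \<in> borel_measurable M"
  by (simp add: all_moments_def)

lemma all_moments_integrable: "all_moments Y \<Longrightarrow> integrable M Y"
  unfolding all_moments_def using integrable_abs_cancel[of M Y] spec[of "\<lambda>n. integrable M (\<lambda>\<omega>. \<bar>Y \<omega>\<bar> ^ n)" 1] by simp

lemma all_moments_const: "all_moments (\<lambda>\<omega>. c)"
  by (simp add: all_moments_def)

lemma all_moments_mult:
  assumes "all_moments X" "all_moments Y"
  shows "all_moments (\<lambda>\<omega>. X \<omega> * Y \<omega>)"
  unfolding all_moments_def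
proof (intro conjI allI)
  have [measurable]: "X \<in> borel_measurable M" "Y \<in> borel_measurable M" using assms by (auto simp: all_moments_def)
  show "(\<lambda>\<omega>. X \<omega> * Y \<omega>) \<in> borel_measurable M" by measurable
  fix n :: nat
  show "integrable M (\<lambda>\<omega>. \<bar>X \<omega> * Y \<omega>\<bar> ^ n)"
  proof (rule Bochner_Integration.integrable_bound)
    show "integrable M (\<lambda>\<omega>. \<bar>X \<omega>\<bar> ^ (2 * n) + \<bar>Y \<omega>\<bar> ^ (2 * n))" using assms by (simp add: all_moments_def)
    have "\<bar>x * y\<bar> ^ n \<le> \<bar>x\<bar> ^ (2 * n) + \<bar>y\<bar> ^ (2 * n)" for x y :: real
    proof -
      have "a * b \<le> a\<^sup>2 + b\<^sup>2" if "a \<ge> 0" "b \<ge> 0" for a b :: real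
      proof -
        have "0 \<le> (a - b)\<^sup>2" "0 \<le> a * b" using that by simp_all
        then show ?thesis unfolding power2_diff by linarith
      qed
      from this[of "\<bar>x\<bar> ^ n" "\<bar>y\<bar> ^ n"] show ?thesis
        by (simp add: abs_mult power_mult_distrib power_mult[symmetric] mult.commute)
    qed
    then show "AE \<omega> in M. norm (\<bar>X \<omega> * Y \<omega>\<bar> ^ n) \<le> norm (\<bar>X \<omega>\<bar> ^ (2 * n) + \<bar>Y \<omega>\<bar> ^ (2 * n))"
      by (intro AE_I2) simp
  qed measurable
qed

lemma all_moments_add:
  assumes "all_moments X" "all_moments Y"
  shows "all_moments (\<lambda>\<omega>. X \<omega> + Y \<omega>)"
  unfolding all_moments_def
proof (intro conjI allI)
  have [measurable]: "X \<in> borel_measurable M" "Y \<in> borel_measurable M" using assms by (auto simp: all_moments_def)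
  show "(\<lambda>\<omega>. X \<omega> + Y \<omega>) \<in> borel_measurable M" by measurable
  fix n :: nat
  show "integrable M (\<lambda>\<omega>. \<bar>X \<omega> + Y \<omega>\<bar> ^ n)"
  proof (rule Bochner_Integration.integrable_bound)
    show "integrable M (\<lambda>\<omega>. 2 ^ n * (\<bar>X \<omega>\<bar> ^ n + \<bar>Y \<omega>\<bar> ^ n))" using assms by (simp add: all_moments_def)
    have "\<bar>x + y\<bar> ^ n \<le> 2 ^ n * (\<bar>x\<bar> ^ n + \<bar>y\<bar> ^ n)" for x y :: real
    proof -
      have "\<bar>x + y\<bar> ^ n \<le> (2 * max \<bar>x\<bar> \<bar>y\<bar>) ^ n" by (rule power_mono) auto
      also have "\<dots> = 2 ^ n * (max \<bar>x\<bar> \<bar>y\<bar>) ^ n" by (simp add: power_mult_distrib)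
      also have "\<dots> \<le> 2 ^ n * (\<bar>x\<bar> ^ n + \<bar>y\<bar> ^ n)" by (rule mult_left_mono) (auto simp: max_def)
      finally show ?thesis .
    qed
    then show "AE \<omega> in M. norm (\<bar>X \<omega> + Y \<omega>\<bar> ^ n) \<le> norm (2 ^ n * (\<bar>X \<omega>\<bar> ^ n + \<bar>Y \<omega>\<bar> ^ n))"
      by (intro AE_I2) simp
  qed measurable
qed

lemma all_moments_sum: "(\<And>i. i \<in> I \<Longrightarrow> all_moments (f i)) \<Longrightarrow> all_moments (\<lambda>\<omega>. \<Sum>i\<in>I. f i \<omega>)"
  by (induction I rule: infinite_finite_induct) (auto simp: all_moments_const all_moments_add)

lemma all_moments_prod: "(\<And>i. i \<in> I \<Longrightarrow> all_moments (f i)) \<Longrightarrow> all_moments (\<lambda>\<omega>. \<Prod>i\<in>I. f i \<omega>)"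
  by (induction I rule: infinite_finite_induct) (auto simp: all_moments_const all_moments_mult)

lemma all_moments_power: "all_moments Y \<Longrightarrow> all_moments (\<lambda>\<omega>. Y \<omega> ^ n)"
  by (induction n) (auto simp: all_moments_const all_moments_mult)

lemma all_moments_powr:
  assumes "all_moments Y" "0 \<le> p"
  shows "integrable M (\<lambda>\<omega>. \<bar>Y \<omega>\<bar> powr p)"
proof (rule Bochner_Integration.integrable_bound)
  let ?n = "nat \<lceil>p\<rceil> + 1"
  have [measurable]: "Y \<in> borel_measurable M" using assms by (auto simp: all_moments_def)
  show "integrable M (\<lambda>\<omega>. 1 + \<bar>Y \<omega>\<bar> ^ ?n)" using assms by (simp add: all_moments_def del: power_Suc)
  have "\<bar>y\<bar> powr p \<le> 1 + \<bar>y\<bar> ^ ?n" for y :: real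
  proof (cases "\<bar>y\<bar> \<le> 1")
    case True
    then have "\<bar>y\<bar> powr p \<le> 1 powr p" using assms by (intro powr_mono2) auto
    then have "\<bar>y\<bar> powr p \<le> 1" by simp
    moreover have "0 \<le> \<bar>y\<bar> ^ ?n" by simp
    ultimately show ?thesis by linarith
  next
    case False
    have "p \<le> real ?n" by linarith
    then have "\<bar>y\<bar> powr p \<le> \<bar>y\<bar> powr real ?n" using False by (intro powr_mono) auto
    also have "\<dots> = \<bar>y\<bar> ^ ?n" using False by (intro powr_realpow) auto
    finally show ?thesis by simp
  qed
  then show "AE \<omega> in M. norm (\<bar>Y \<omega>\<bar> powr p) \<le> norm (1 + \<bar>Y \<omega>\<bar> ^ ?n)"
    by (intro AE_I2) (simp del: power_Suc)
qed (use assms in \<open>auto simp: all_moments_def\<close>)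

end

lemma mpoly_partial_deriv:
  "partial_deriv (mpoly_eval f) i x =
     (\<Sum>\<mu>\<in>Poly_Mapping.keys f. Poly_Mapping.lookup f \<mu> *
        (if i \<in> Poly_Mapping.keys \<mu> then real (Poly_Mapping.lookup \<mu> i) * x i ^ (Poly_Mapping.lookup \<mu> i - 1)
           * (\<Prod>k\<in>Poly_Mapping.keys \<mu> - {i}. x k ^ Poly_Mapping.lookup \<mu> k) else 0))"
  unfolding partial_deriv_def
proof (rule DERIV_imp_deriv)
  have mon: "((\<lambda>y. \<Prod>k\<in>Poly_Mapping.keys \<mu>. (x(i := y)) k ^ Poly_Mapping.lookup \<mu> k) has_real_derivative
      (if i \<in> Poly_Mapping.keys \<mu> then real (Poly_Mapping.lookup \<mu> i) * x i ^ (Poly_Mapping.lookup \<mu> i - 1)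
           * (\<Prod>k\<in>Poly_Mapping.keys \<mu> - {i}. x k ^ Poly_Mapping.lookup \<mu> k) else 0)) (at (x i))" for \<mu> :: "nat \<Rightarrow>\<^sub>0 nat"
  proof (cases "i \<in> Poly_Mapping.keys \<mu>")
    case True
    have "(\<Prod>k\<in>Poly_Mapping.keys \<mu>. (x(i := y)) k ^ Poly_Mapping.lookup \<mu> k) = y ^ Poly_Mapping.lookup \<mu> i * (\<Prod>k\<in>Poly_Mapping.keys \<mu> - {i}. x k ^ Poly_Mapping.lookup \<mu> k)" for y
      using True by (subst prod.remove[of _ i]) (auto intro!: prod.cong)
    then show ?thesis using True by (auto intro!: derivative_eq_intros)
  next
    case False
    have "(\<Prod>k\<in>Poly_Mapping.keys \<mu>. (x(i := y)) k ^ Poly_Mapping.lookup \<mu> k) = (\<Prod>k\<in>Poly_Mapping.keys \<mu>. x k ^ Poly_Mapping.lookup \<mu> k)" for y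
      using False by (intro prod.cong) auto
    then show ?thesis using False by simp
  qed
  show "((\<lambda>y. mpoly_eval f (x(i := y))) has_real_derivative
     (\<Sum>\<mu>\<in>Poly_Mapping.keys f. Poly_Mapping.lookup f \<mu> *
        (if i \<in> Poly_Mapping.keys \<mu> then real (Poly_Mapping.lookup \<mu> i) * x i ^ (Poly_Mapping.lookup \<mu> i - 1)
           * (\<Prod>k\<in>Poly_Mapping.keys \<mu> - {i}. x k ^ Poly_Mapping.lookup \<mu> k) else 0))) (at (x i))"
    unfolding mpoly_eval_def by (intro DERIV_sum DERIV_cmult mon)
qed

text \<open>A family of independent standard Gaussian variables, expressed through characteristic functions. In
this form the property passes to mean square limits and is what the integration by parts formula
uses.\<close>

locale gaussian_family = prob_space M for M :: "'a measure" +
  fixes X :: "'i \<Rightarrow> 'a \<Rightarrow> real" and A :: "'i set"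
  assumes X_measurable: "a \<in> A \<Longrightarrow> X a \<in> borel_measurable M"
    and X_char: "finite F \<Longrightarrow> F \<subseteq> A \<Longrightarrow>
      (\<integral>\<omega>. iexp (\<Sum>a\<in>F. \<theta> a * X a \<omega>) \<partial>M) = of_real (exp (- (\<Sum>a\<in>F. (\<theta> a)\<^sup>2) / 2))"
begin

lemma X_all_moments:
  assumes a: "a \<in> A"
  shows "all_moments (X a)"
proof -
  note [measurable] = X_measurable[OF a]
  have "distr M borel (X a) = std_normal_distribution"
  proof (rule Levy_uniqueness)
    show "real_distribution (distr M borel (X a))" by (rule real_distribution_distr) simp
    show "real_distribution std_normal_distribution" by (rule real_dist_normal_dist)
    show "char (distr M borel (X a)) = char std_normal_distribution"
    proof
      fix t
      have "char (distr M borel (X a)) t = (\<integral>\<omega>. iexp (t * X a \<omega>) \<partial>M)"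
        unfolding char_def by (subst integral_distr) auto
      also have "\<dots> = char std_normal_distribution t"
        using X_char[of "{a}" "\<lambda>_. t"] a by (simp add: char_std_normal_distribution)
      finally show "char (distr M borel (X a)) t = char std_normal_distribution t" .
    qed
  qed
  then have d: "distributed M lborel (X a) std_normal_density"
    by (simp add: distributed_def cong: distr_cong)
  have "integrable M (\<lambda>\<omega>. \<bar>X a \<omega>\<bar> ^ n)" for n
    using distributed_integrable[OF d, of "\<lambda>x. \<bar>x\<bar> ^ n"] integrable_std_normal_moment_abs[of n] by simp
  then show ?thesis by (simp add: all_moments_def)
qed

context
  fixes F :: "'i set"
  assumes F: "finite F" "F \<subseteq> A"
begin

definition fourier :: "('a \<Rightarrow> real) \<Rightarrow> ('i \<Rightarrow> real) \<Rightarrow> complex" where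
  "fourier Y \<theta> = (\<integral>\<omega>. of_real (Y \<omega>) * iexp (\<Sum>a\<in>F. \<theta> a * X a \<omega>) \<partial>M)"

lemma phase_measurable: "(\<lambda>\<omega>. \<Sum>a\<in>F. \<theta> a * X a \<omega>) \<in> borel_measurable M"
  using F X_measurable by (intro borel_measurable_sum borel_measurable_times) auto

lemma fourier_integrable:
  assumes "integrable M Y"
  shows "integrable M (\<lambda>\<omega>. of_real (Y \<omega>) * iexp (\<Sum>a\<in>F. \<theta> a * X a \<omega>))"
proof (rule Bochner_Integration.integrable_bound[OF assms])
  note [measurable] = phase_measurable[of \<theta>]
  have [measurable]: "Y \<in> borel_measurable M" using assms by auto
  show "(\<lambda>\<omega>. of_real (Y \<omega>) * iexp (\<Sum>a\<in>F. \<theta> a * X a \<omega>)) \<in> borel_measurable M" by measurable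
  show "AE \<omega> in M. norm (of_real (Y \<omega>) * iexp (\<Sum>a\<in>F. \<theta> a * X a \<omega>)) \<le> norm (Y \<omega>)"
    by (intro AE_I2) (simp add: norm_mult del: of_real_sum)
qed

lemma fourier_add:
  assumes "integrable M Y" "integrable M Y'"
  shows "fourier (\<lambda>\<omega>. Y \<omega> + Y' \<omega>) \<theta> = fourier Y \<theta> + fourier Y' \<theta>"
  unfolding fourier_def
  by (subst Bochner_Integration.integral_add[symmetric, OF fourier_integrable fourier_integrable])
     (use assms in \<open>simp_all add: distrib_right\<close>)

lemma fourier_scale: "fourier (\<lambda>\<omega>. c * Y \<omega>) \<theta> = of_real c * fourier Y \<theta>"
  unfolding fourier_def by (simp add: mult.assoc)

lemma fourier_zero: "fourier (\<lambda>\<omega>. 0) \<theta> = 0"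
  by (simp add: fourier_def)

text \<open>Differentiation of \<open>\<theta> \<mapsto> E[Y exp(i \<Sum> \<theta>\<^sub>a X\<^sub>a)]\<close> in direction \<open>q\<close>, along the sequence \<open>1/(n+1)\<close>. This suffices,
as the limit is used only to compare derivatives of equal functions.\<close>

lemma fourier_difference_quotient:
  assumes Y: "integrable M Y" and YX: "integrable M (\<lambda>\<omega>. Y \<omega> * X q \<omega>)" and q: "q \<in> F"
  defines "t \<equiv> \<lambda>n. 1 / real (Suc n)"
  shows "(\<lambda>n. (fourier Y (\<theta>(q := \<theta> q + t n)) - fourier Y \<theta>) / of_real (t n)) \<longlonglongrightarrow> \<i> * fourier (\<lambda>\<omega>. Y \<omega> * X q \<omega>) \<theta>"
proof -
  note [measurable] = phase_measurable
  have [measurable]: "Y \<in> borel_measurable M" "X q \<in> borel_measurable M" using Y q F X_measurable by auto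
  have t: "t n > 0" for n by (simp add: t_def)
  let ?e = "\<lambda>\<omega>. iexp (\<Sum>a\<in>F. \<theta> a * X a \<omega>)"
  have shift: "iexp (\<Sum>a\<in>F. (\<theta>(q := \<theta> q + t n)) a * X a \<omega>) = ?e \<omega> * iexp (t n * X q \<omega>)" for n \<omega>
  proof -
    have "(\<Sum>a\<in>F. (\<theta>(q := \<theta> q + t n)) a * X a \<omega>) = (\<Sum>a\<in>F. \<theta> a * X a \<omega> + (if a = q then t n * X q \<omega> else 0))"
      by (rule sum.cong) (auto simp: distrib_right)
    also have "\<dots> = (\<Sum>a\<in>F. \<theta> a * X a \<omega>) + t n * X q \<omega>"
      using F q by (simp add: sum.distrib sum.delta)
    finally show ?thesis by (simp only: of_real_add distrib_left exp_add)
  qed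
  let ?s = "\<lambda>n \<omega>. of_real (Y \<omega>) * ?e \<omega> * ((iexp (t n * X q \<omega>) - 1) / of_real (t n))"
  have "(\<lambda>n. \<integral>\<omega>. ?s n \<omega> \<partial>M) \<longlonglongrightarrow> (\<integral>\<omega>. of_real (Y \<omega>) * ?e \<omega> * (\<i> * of_real (X q \<omega>)) \<partial>M)"
  proof (rule integral_dominated_convergence)
    show "integrable M (\<lambda>\<omega>. \<bar>Y \<omega> * X q \<omega>\<bar>)" using YX by (rule integrable_abs)
    show "AE \<omega> in M. (\<lambda>n. ?s n \<omega>) \<longlonglongrightarrow> of_real (Y \<omega>) * ?e \<omega> * (\<i> * of_real (X q \<omega>))"
    proof (intro AE_I2 tendsto_mult_left)
      fix \<omega>
      have "((\<lambda>z. exp (\<i> * of_real (X q \<omega>) * z)) has_field_derivative (\<i> * of_real (X q \<omega>))) (at 0)"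
        by (auto intro!: derivative_eq_intros)
      then have "((\<lambda>h. (exp (\<i> * of_real (X q \<omega>) * (0 + h)) - exp (\<i> * of_real (X q \<omega>) * 0)) / h) \<longlongrightarrow> \<i> * of_real (X q \<omega>)) (at 0)"
        by (rule DERIV_D)
      moreover have "filterlim (\<lambda>n. complex_of_real (t n)) (at 0) sequentially"
        unfolding filterlim_at
      proof
        have "t \<longlonglongrightarrow> 0" unfolding t_def using LIMSEQ_inverse_real_of_nat by (simp add: inverse_eq_divide)
        then have "(\<lambda>n. complex_of_real (t n)) \<longlonglongrightarrow> of_real 0" by (rule tendsto_of_real)
        then show "(\<lambda>n. complex_of_real (t n)) \<longlonglongrightarrow> 0" by simp
        have "t n \<noteq> 0" for n using t[of n] by simp
        then show "\<forall>\<^sub>F n in sequentially. complex_of_real (t n) \<in> UNIV \<and> complex_of_real (t n) \<noteq> 0" by simp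
      qed
      ultimately have "(\<lambda>n. (exp (\<i> * of_real (X q \<omega>) * (0 + of_real (t n))) - exp (\<i> * of_real (X q \<omega>) * 0)) / of_real (t n)) \<longlonglongrightarrow> \<i> * of_real (X q \<omega>)"
        by (rule filterlim_compose)
      then show "(\<lambda>n. (iexp (t n * X q \<omega>) - 1) / of_real (t n)) \<longlonglongrightarrow> \<i> * of_real (X q \<omega>)"
        by (simp add: mult_ac)
    qed
    show "AE \<omega> in M. norm (?s n \<omega>) \<le> \<bar>Y \<omega> * X q \<omega>\<bar>" for n
    proof (intro AE_I2)
      fix \<omega>
      have "norm (iexp (t n * X q \<omega>) - 1) \<le> t n * \<bar>X q \<omega>\<bar>"
        using norm_iexp_diff_le[of "t n * X q \<omega>" 0] t[of n] by (simp add: abs_mult)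
      then have "norm ((iexp (t n * X q \<omega>) - 1) / of_real (t n)) \<le> \<bar>X q \<omega>\<bar>"
        using t[of n] by (simp add: norm_divide divide_le_eq mult.commute)
      then have "\<bar>Y \<omega>\<bar> * norm ((iexp (t n * X q \<omega>) - 1) / of_real (t n)) \<le> \<bar>Y \<omega>\<bar> * \<bar>X q \<omega>\<bar>" by (rule mult_left_mono) simp
      then show "norm (?s n \<omega>) \<le> \<bar>Y \<omega> * X q \<omega>\<bar>" unfolding norm_mult abs_mult norm_exp_i_times norm_of_real by simp
    qed
  qed measurable
  moreover have "(\<integral>\<omega>. ?s n \<omega> \<partial>M) = (fourier Y (\<theta>(q := \<theta> q + t n)) - fourier Y \<theta>) / of_real (t n)" for n
  proof -
    have "fourier Y (\<theta>(q := \<theta> q + t n)) - fourier Y \<theta> = (\<integral>\<omega>. of_real (Y \<omega>) * iexp (\<Sum>a\<in>F. (\<theta>(q := \<theta> q + t n)) a * X a \<omega>) - of_real (Y \<omega>) * ?e \<omega> \<partial>M)"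
      unfolding fourier_def by (rule Bochner_Integration.integral_diff[symmetric, OF fourier_integrable[OF Y] fourier_integrable[OF Y]])
    also have "\<dots> = (\<integral>\<omega>. of_real (Y \<omega>) * ?e \<omega> * (iexp (t n * X q \<omega>) - 1) \<partial>M)"
      unfolding shift by (simp only: right_diff_distrib mult.assoc mult_1_right)
    finally show ?thesis by (simp only: times_divide_eq_right integral_divide_zero)
  qed
  moreover have "(\<integral>\<omega>. of_real (Y \<omega>) * ?e \<omega> * (\<i> * of_real (X q \<omega>)) \<partial>M) = \<i> * fourier (\<lambda>\<omega>. Y \<omega> * X q \<omega>) \<theta>"
  proof -
    have "(\<lambda>\<omega>. of_real (Y \<omega>) * ?e \<omega> * (\<i> * of_real (X q \<omega>))) = (\<lambda>\<omega>. \<i> * (of_real (Y \<omega> * X q \<omega>) * ?e \<omega>))"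
      by (simp only: of_real_mult mult_ac)
    then show ?thesis unfolding fourier_def by (simp only: integral_mult_right_zero)
  qed
  ultimately show ?thesis by (simp only:)
qed

text \<open>\<open>ibp b P D\<close> is the integration by parts formula \<open>E[X\<^sub>b P e] = E[D e] + E[P \<partial>\<^sub>b e]\<close> for all test
functions \<open>e = exp(i \<Sum> \<theta>\<^sub>a X\<^sub>a)\<close>, so \<open>D\<close> is the derivative of \<open>P\<close> in direction \<open>b\<close>. As exponentials are
used as test functions, multiplication of \<open>P\<close> by a variable becomes differentiation with respect
to \<open>\<theta>\<close>, and the Leibniz rule can be proved without conditioning on the other variables.\<close>

definition ibp :: "'i \<Rightarrow> ('a \<Rightarrow> real) \<Rightarrow> ('a \<Rightarrow> real) \<Rightarrow> bool" where
  "ibp b P D \<longleftrightarrow> all_moments P \<and> all_moments D \<and>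
     (\<forall>\<theta>. fourier (\<lambda>\<omega>. X b \<omega> * P \<omega>) \<theta> = fourier D \<theta> + \<i> * of_real (\<theta> b) * fourier P \<theta>)"

text \<open>Differentiate the Gaussian characteristic function in direction \<open>b\<close>.\<close>

lemma ibp_one:
  assumes b: "b \<in> F"
  shows "ibp b (\<lambda>\<omega>. 1) (\<lambda>\<omega>. 0)"
  unfolding ibp_def
proof (intro conjI allI)
  fix \<theta> :: "'i \<Rightarrow> real"
  define t where "t n = 1 / real (Suc n)" for n
  have bA: "b \<in> A" using b F by auto
  have one: "fourier (\<lambda>\<omega>. 1) \<theta> = of_real (exp (- (\<Sum>a\<in>F. (\<theta> a)\<^sup>2) / 2))" for \<theta>
    unfolding fourier_def using X_char[OF F, of \<theta>] by simp
  define c where "c = (\<Sum>a\<in>F - {b}. (\<theta> a)\<^sup>2)"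
  define f where "f u = exp (- (c + u\<^sup>2) / 2)" for u
  have sp: "(\<Sum>a\<in>F. ((\<theta>(b := u)) a)\<^sup>2) = c + u\<^sup>2" for u
    unfolding c_def using F b by (subst sum.remove[of F b]) (auto intro!: sum.cong)
  have o1: "fourier (\<lambda>\<omega>. 1) (\<theta>(b := u)) = of_real (f u)" for u by (simp only: one sp f_def)
  have o2: "fourier (\<lambda>\<omega>. 1) \<theta> = of_real (f (\<theta> b))" using o1[of "\<theta> b"] by simp
  have "(\<lambda>n. (fourier (\<lambda>\<omega>. 1) (\<theta>(b := \<theta> b + t n)) - fourier (\<lambda>\<omega>. 1) \<theta>) / of_real (t n)) \<longlonglongrightarrow> \<i> * fourier (\<lambda>\<omega>. 1 * X b \<omega>) \<theta>"
    unfolding t_def by (rule fourier_difference_quotient) (use b all_moments_integrable[OF X_all_moments[OF bA]] in auto)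
  then have l1: "(\<lambda>n. of_real ((f (\<theta> b + t n) - f (\<theta> b)) / t n)) \<longlonglongrightarrow> \<i> * fourier (X b) \<theta>"
    unfolding o1 o2 by simp
  have "(f has_real_derivative - \<theta> b * f (\<theta> b)) (at (\<theta> b))"
    unfolding f_def by (auto intro!: derivative_eq_intros)
  then have d: "((\<lambda>h. (f (\<theta> b + h) - f (\<theta> b)) / h) \<longlongrightarrow> - \<theta> b * f (\<theta> b)) (at 0)" by (rule DERIV_D)
  have "filterlim t (at 0) sequentially"
    unfolding filterlim_at
  proof
    show "t \<longlonglongrightarrow> 0" unfolding t_def using LIMSEQ_inverse_real_of_nat by (simp add: inverse_eq_divide)
    show "\<forall>\<^sub>F n in sequentially. t n \<in> UNIV \<and> t n \<noteq> 0" by (simp add: t_def)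
  qed
  from filterlim_compose[OF d this] have "(\<lambda>n. complex_of_real ((f (\<theta> b + t n) - f (\<theta> b)) / t n)) \<longlonglongrightarrow> of_real (- \<theta> b * f (\<theta> b))"
    by (rule tendsto_of_real)
  then have e: "\<i> * fourier (X b) \<theta> = of_real (- \<theta> b * f (\<theta> b))" using l1 LIMSEQ_unique by blast
  have "fourier (X b) \<theta> = - \<i> * (\<i> * fourier (X b) \<theta>)" by (simp add: mult.assoc[symmetric])
  also have "\<dots> = \<i> * of_real (\<theta> b) * of_real (f (\<theta> b))" unfolding e by simp
  finally show "fourier (\<lambda>\<omega>. X b \<omega> * 1) \<theta> = fourier (\<lambda>\<omega>. 0) \<theta> + \<i> * of_real (\<theta> b) * fourier (\<lambda>\<omega>. 1) \<theta>"
    by (simp add: o2 fourier_zero)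
qed (auto intro: all_moments_const)

lemma ibp_scale:
  assumes "ibp b P D"
  shows "ibp b (\<lambda>\<omega>. c * P \<omega>) (\<lambda>\<omega>. c * D \<omega>)"
proof -
  have "fourier (\<lambda>\<omega>. X b \<omega> * (c * P \<omega>)) \<theta> = of_real c * fourier (\<lambda>\<omega>. X b \<omega> * P \<omega>) \<theta>" for \<theta>
    unfolding fourier_scale[symmetric] by (simp only: mult.left_commute)
  then show ?thesis using assms
    by (simp add: ibp_def fourier_scale all_moments_mult all_moments_const distrib_left mult_ac)
qed

lemma ibp_add:
  assumes b: "b \<in> F" and 1: "ibp b P D" and 2: "ibp b P' D'"
  shows "ibp b (\<lambda>\<omega>. P \<omega> + P' \<omega>) (\<lambda>\<omega>. D \<omega> + D' \<omega>)"
proof -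
  have bA: "b \<in> A" using b F by auto
  have am: "all_moments P" "all_moments P'" "all_moments D" "all_moments D'" using 1 2 by (auto simp: ibp_def)
  have i: "integrable M P" "integrable M P'" "integrable M D" "integrable M D'"
    "integrable M (\<lambda>\<omega>. X b \<omega> * P \<omega>)" "integrable M (\<lambda>\<omega>. X b \<omega> * P' \<omega>)"
    using am by (auto intro!: all_moments_integrable all_moments_mult X_all_moments bA)
  have "fourier (\<lambda>\<omega>. X b \<omega> * (P \<omega> + P' \<omega>)) \<theta> = fourier (\<lambda>\<omega>. X b \<omega> * P \<omega>) \<theta> + fourier (\<lambda>\<omega>. X b \<omega> * P' \<omega>) \<theta>" for \<theta>
    unfolding distrib_left by (rule fourier_add[OF i(5,6)])
  then show ?thesis using 1 2 am by (simp add: ibp_def fourier_add i all_moments_add algebra_simps)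
qed

lemma ibp_zero: "ibp b (\<lambda>\<omega>. 0) (\<lambda>\<omega>. 0)"
  by (simp add: ibp_def all_moments_const fourier_zero)

lemma ibp_sum:
  assumes "b \<in> F" "\<And>i. i \<in> I \<Longrightarrow> ibp b (P i) (D i)"
  shows "ibp b (\<lambda>\<omega>. \<Sum>i\<in>I. P i \<omega>) (\<lambda>\<omega>. \<Sum>i\<in>I. D i \<omega>)"
  using assms by (induction I rule: infinite_finite_induct) (auto simp: ibp_zero intro!: ibp_add)

text \<open>Differentiate the identity for \<open>P\<close> with respect to \<open>\<theta>\<^sub>q\<close>. If \<open>q = b\<close>, the factor \<open>\<theta>\<^sub>b\<close> contributes the
additional term of the Leibniz rule.\<close>

lemma ibp_mult_X:
  assumes b: "b \<in> F" and q: "q \<in> F" and ibp: "ibp b P D"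
  shows "ibp b (\<lambda>\<omega>. X q \<omega> * P \<omega>) (\<lambda>\<omega>. X q \<omega> * D \<omega> + (if q = b then P \<omega> else 0))"
  unfolding ibp_def
proof (intro conjI allI)
  have bA: "b \<in> A" and qA: "q \<in> A" using b q F by auto
  have am: "all_moments P" "all_moments D" using ibp by (auto simp: ibp_def)
  note amX = X_all_moments[OF bA] X_all_moments[OF qA]
  show "all_moments (\<lambda>\<omega>. X q \<omega> * P \<omega>)" by (intro all_moments_mult am amX)
  have amd: "all_moments (\<lambda>\<omega>. if q = b then P \<omega> else 0)" using am by (cases "q = b") (auto simp: all_moments_const)
  show "all_moments (\<lambda>\<omega>. X q \<omega> * D \<omega> + (if q = b then P \<omega> else 0))" by (intro all_moments_add all_moments_mult am amX amd)
  fix \<theta> :: "'i \<Rightarrow> real"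
  define t where "t n = 1 / real (Suc n)" for n
  define th where "th n = \<theta>(q := \<theta> q + t n)" for n
  define \<delta> :: complex where "\<delta> = (if q = b then 1 else 0)"
  have t0: "t \<longlonglongrightarrow> 0" unfolding t_def using LIMSEQ_inverse_real_of_nat by (simp add: inverse_eq_divide)
  have tn: "t n \<noteq> 0" for n by (simp add: t_def)
  let ?dq = "\<lambda>Y n. (fourier Y (th n) - fourier Y \<theta>) / of_real (t n)"
  have dq: "?dq Y \<longlonglongrightarrow> \<i> * fourier (\<lambda>\<omega>. Y \<omega> * X q \<omega>) \<theta>" if "all_moments Y" for Y
    unfolding th_def t_def by (rule fourier_difference_quotient[OF _ _ q]) (auto intro!: all_moments_integrable all_moments_mult amX that)
  have cont: "(\<lambda>n. fourier P (th n)) \<longlonglongrightarrow> fourier P \<theta>"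
  proof -
    have "(\<lambda>n. of_real (t n) * ?dq P n + fourier P \<theta>) \<longlonglongrightarrow> of_real 0 * (\<i> * fourier (\<lambda>\<omega>. P \<omega> * X q \<omega>) \<theta>) + fourier P \<theta>"
      by (intro tendsto_intros t0 dq am)
    then show ?thesis using tn by simp
  qed
  have eq: "?dq (\<lambda>\<omega>. X b \<omega> * P \<omega>) n = ?dq D n + \<i> * of_real (\<theta> b) * ?dq P n + \<i> * \<delta> * fourier P (th n)" for n
  proof -
    have thb: "complex_of_real (th n b) = of_real (\<theta> b) + \<delta> * of_real (t n)" by (auto simp: th_def \<delta>_def)
    have "fourier (\<lambda>\<omega>. X b \<omega> * P \<omega>) (th n) - fourier (\<lambda>\<omega>. X b \<omega> * P \<omega>) \<theta>
      = (fourier D (th n) - fourier D \<theta>) + \<i> * of_real (\<theta> b) * (fourier P (th n) - fourier P \<theta>) + \<i> * \<delta> * fourier P (th n) * of_real (t n)"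
      using ibp unfolding ibp_def by (simp add: thb algebra_simps)
    then show ?thesis using tn[of n] by (simp add: add_divide_distrib)
  qed
  have "(\<lambda>n. ?dq D n + \<i> * of_real (\<theta> b) * ?dq P n + \<i> * \<delta> * fourier P (th n)) \<longlonglongrightarrow>
     \<i> * fourier (\<lambda>\<omega>. D \<omega> * X q \<omega>) \<theta> + \<i> * of_real (\<theta> b) * (\<i> * fourier (\<lambda>\<omega>. P \<omega> * X q \<omega>) \<theta>) + \<i> * \<delta> * fourier P \<theta>"
    by (intro tendsto_add tendsto_mult tendsto_const dq am cont)
  moreover have "?dq (\<lambda>\<omega>. X b \<omega> * P \<omega>) \<longlonglongrightarrow> \<i> * fourier (\<lambda>\<omega>. X b \<omega> * P \<omega> * X q \<omega>) \<theta>"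
    by (intro dq all_moments_mult am amX)
  ultimately have "\<i> * fourier (\<lambda>\<omega>. X b \<omega> * P \<omega> * X q \<omega>) \<theta> = \<i> * fourier (\<lambda>\<omega>. D \<omega> * X q \<omega>) \<theta> + \<i> * of_real (\<theta> b) * (\<i> * fourier (\<lambda>\<omega>. P \<omega> * X q \<omega>) \<theta>) + \<i> * \<delta> * fourier P \<theta>"
    unfolding eq using LIMSEQ_unique by blast
  then have "\<i> * fourier (\<lambda>\<omega>. X b \<omega> * P \<omega> * X q \<omega>) \<theta> = \<i> * (fourier (\<lambda>\<omega>. D \<omega> * X q \<omega>) \<theta> + of_real (\<theta> b) * (\<i> * fourier (\<lambda>\<omega>. P \<omega> * X q \<omega>) \<theta>) + \<delta> * fourier P \<theta>)"
    by (simp add: algebra_simps)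
  then have main: "fourier (\<lambda>\<omega>. X b \<omega> * P \<omega> * X q \<omega>) \<theta> = fourier (\<lambda>\<omega>. D \<omega> * X q \<omega>) \<theta> + of_real (\<theta> b) * (\<i> * fourier (\<lambda>\<omega>. P \<omega> * X q \<omega>) \<theta>) + \<delta> * fourier P \<theta>"
    by (subst (asm) mult_left_cancel) auto
  have "fourier (\<lambda>\<omega>. X q \<omega> * D \<omega> + (if q = b then P \<omega> else 0)) \<theta> = fourier (\<lambda>\<omega>. X q \<omega> * D \<omega>) \<theta> + fourier (\<lambda>\<omega>. if q = b then P \<omega> else 0) \<theta>"
    by (rule fourier_add) (intro all_moments_integrable all_moments_mult am amX amd)+
  also have "fourier (\<lambda>\<omega>. if q = b then P \<omega> else 0) \<theta> = \<delta> * fourier P \<theta>" by (simp add: \<delta>_def fourier_zero)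
  finally have D': "fourier (\<lambda>\<omega>. X q \<omega> * D \<omega> + (if q = b then P \<omega> else 0)) \<theta> = fourier (\<lambda>\<omega>. D \<omega> * X q \<omega>) \<theta> + \<delta> * fourier P \<theta>"
    by (simp only: mult.commute)
  have e1: "(\<lambda>\<omega>. X b \<omega> * (X q \<omega> * P \<omega>)) = (\<lambda>\<omega>. X b \<omega> * P \<omega> * X q \<omega>)" by (simp only: mult_ac)
  have e2: "(\<lambda>\<omega>. X q \<omega> * P \<omega>) = (\<lambda>\<omega>. P \<omega> * X q \<omega>)" by (simp only: mult_ac)
  show "fourier (\<lambda>\<omega>. X b \<omega> * (X q \<omega> * P \<omega>)) \<theta> = fourier (\<lambda>\<omega>. X q \<omega> * D \<omega> + (if q = b then P \<omega> else 0)) \<theta> + \<i> * of_real (\<theta> b) * fourier (\<lambda>\<omega>. X q \<omega> * P \<omega>) \<theta>"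
    unfolding D' e1 e2 main by (simp add: algebra_simps)
qed

lemma ibp_mult_X_power:
  assumes b: "b \<in> F" and q: "q \<in> F" and ibp: "ibp b P D"
  shows "ibp b (\<lambda>\<omega>. X q \<omega> ^ k * P \<omega>) (\<lambda>\<omega>. X q \<omega> ^ k * D \<omega> + (if q = b then real k * X q \<omega> ^ (k - 1) * P \<omega> else 0))"
proof (induction k)
  case 0 show ?case using ibp by (cases "q = b") simp_all
next
  case (Suc k)
  have e: "x ^ Suc k * d + (if q = b then real (Suc k) * x ^ (Suc k - 1) * p else 0)
     = x * (x ^ k * d + (if q = b then real k * x ^ (k - 1) * p else 0)) + (if q = b then x ^ k * p else 0)" for x d p :: real
    by (cases k) (auto simp: algebra_simps)
  show ?case unfolding e using ibp_mult_X[OF b q Suc.IH] by (simp add: mult.assoc)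
qed

lemma ibp_monomial:
  assumes b: "b \<in> F" and K: "finite K" "\<And>i. i \<in> K \<Longrightarrow> a i \<in> F"
  shows "ibp b (\<lambda>\<omega>. \<Prod>i\<in>K. X (a i) \<omega> ^ \<mu> i)
    (\<lambda>\<omega>. \<Sum>i\<in>K. real (\<mu> i) * X (a i) \<omega> ^ (\<mu> i - 1) * (\<Prod>k\<in>K - {i}. X (a k) \<omega> ^ \<mu> k) * (if a i = b then 1 else 0))"
  using K
proof (induction K rule: finite_induct)
  case empty then show ?case using ibp_one[OF b] by simp
next
  case (insert j K)
  let ?x = "\<lambda>i \<omega>. X (a i) \<omega> ^ \<mu> i"
  let ?d = "\<lambda>K i \<omega>. real (\<mu> i) * X (a i) \<omega> ^ (\<mu> i - 1) * (\<Prod>k\<in>K - {i}. ?x k \<omega>) * (if a i = b then 1 else 0)"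
  have "ibp b (\<lambda>\<omega>. ?x j \<omega> * (\<Prod>i\<in>K. ?x i \<omega>)) (\<lambda>\<omega>. ?x j \<omega> * (\<Sum>i\<in>K. ?d K i \<omega>) + (if a j = b then real (\<mu> j) * X (a j) \<omega> ^ (\<mu> j - 1) * (\<Prod>i\<in>K. ?x i \<omega>) else 0))"
    by (rule ibp_mult_X_power[OF b]) (use insert in auto)
  moreover have "?x j \<omega> * (\<Sum>i\<in>K. ?d K i \<omega>) + (if a j = b then real (\<mu> j) * X (a j) \<omega> ^ (\<mu> j - 1) * (\<Prod>i\<in>K. ?x i \<omega>) else 0)
     = (\<Sum>i\<in>insert j K. ?d (insert j K) i \<omega>)" for \<omega>
  proof -
    have "?d (insert j K) i \<omega> = ?x j \<omega> * ?d K i \<omega>" if "i \<in> K" for i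
    proof -
      have "insert j K - {i} = insert j (K - {i})" using insert.hyps that by auto
      then have "(\<Prod>k\<in>insert j K - {i}. ?x k \<omega>) = ?x j \<omega> * (\<Prod>k\<in>K - {i}. ?x k \<omega>)" using insert.hyps by simp
      then show ?thesis by (simp only: mult_ac)
    qed
    then have "(\<Sum>i\<in>K. ?d (insert j K) i \<omega>) = ?x j \<omega> * (\<Sum>i\<in>K. ?d K i \<omega>)" by (simp only: sum_distrib_left cong: sum.cong)
    moreover have "insert j K - {j} = K" using insert.hyps by auto
    ultimately show ?thesis using insert.hyps by simp
  qed
  ultimately show ?case using insert.hyps by simp
qed

text \<open>Several arguments of \<open>f\<close> may be the same variable \<open>X\<^sub>b\<close>, hence the sum over all \<open>i\<close> with \<open>a i = b\<close>.\<close>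

lemma ibp_polynomial:
  assumes b: "b \<in> F" and f: "mpoly_in_vars n f" and a: "\<And>i. i < n \<Longrightarrow> a i \<in> F"
  shows "ibp b (\<lambda>\<omega>. mpoly_eval f (\<lambda>i. X (a i) \<omega>))
    (\<lambda>\<omega>. \<Sum>i<n. partial_deriv (mpoly_eval f) i (\<lambda>i. X (a i) \<omega>) * (if a i = b then 1 else 0))"
proof -
  let ?lk = "Poly_Mapping.lookup" and ?ks = "Poly_Mapping.keys"
  let ?d = "\<lambda>\<mu> i \<omega>. real (?lk \<mu> i) * X (a i) \<omega> ^ (?lk \<mu> i - 1) * (\<Prod>k\<in>?ks \<mu> - {i}. X (a k) \<omega> ^ ?lk \<mu> k)"
  have ks: "?ks \<mu> \<subseteq> {..<n}" if "\<mu> \<in> ?ks f" for \<mu> using f that by (auto simp: mpoly_in_vars_def)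
  have "ibp b (\<lambda>\<omega>. mpoly_eval f (\<lambda>i. X (a i) \<omega>)) (\<lambda>\<omega>. \<Sum>\<mu>\<in>?ks f. ?lk f \<mu> * (\<Sum>i\<in>?ks \<mu>. ?d \<mu> i \<omega> * (if a i = b then 1 else 0)))"
    unfolding mpoly_eval_def
  proof (intro ibp_sum ibp_scale ibp_monomial b)
    fix \<mu> i assume "\<mu> \<in> ?ks f" "i \<in> ?ks \<mu>"
    then show "a i \<in> F" using ks[of \<mu>] a[of i] by auto
  qed auto
  moreover have "(\<Sum>i<n. partial_deriv (mpoly_eval f) i (\<lambda>i. X (a i) \<omega>) * (if a i = b then 1 else 0))
    = (\<Sum>\<mu>\<in>?ks f. ?lk f \<mu> * (\<Sum>i\<in>?ks \<mu>. ?d \<mu> i \<omega> * (if a i = b then 1 else 0)))" for \<omega>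
  proof -
    have "(\<Sum>i<n. partial_deriv (mpoly_eval f) i (\<lambda>i. X (a i) \<omega>) * (if a i = b then 1 else 0))
      = (\<Sum>i<n. \<Sum>\<mu>\<in>?ks f. ?lk f \<mu> * ((if i \<in> ?ks \<mu> then ?d \<mu> i \<omega> else 0) * (if a i = b then 1 else 0)))"
      unfolding mpoly_partial_deriv sum_distrib_right by (simp only: mult.assoc)
    also have "\<dots> = (\<Sum>\<mu>\<in>?ks f. \<Sum>i<n. ?lk f \<mu> * ((if i \<in> ?ks \<mu> then ?d \<mu> i \<omega> else 0) * (if a i = b then 1 else 0)))"
      by (rule sum.swap)
    also have "\<dots> = (\<Sum>\<mu>\<in>?ks f. ?lk f \<mu> * (\<Sum>i\<in>?ks \<mu>. ?d \<mu> i \<omega> * (if a i = b then 1 else 0)))"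
    proof (rule sum.cong[OF refl])
      fix \<mu> assume \<mu>: "\<mu> \<in> ?ks f"
      have "(\<Sum>i<n. ?lk f \<mu> * ((if i \<in> ?ks \<mu> then ?d \<mu> i \<omega> else 0) * (if a i = b then 1 else 0)))
         = (\<Sum>i\<in>?ks \<mu>. ?lk f \<mu> * ((if i \<in> ?ks \<mu> then ?d \<mu> i \<omega> else 0) * (if a i = b then 1 else 0)))"
        by (rule sum.mono_neutral_right) (use ks[OF \<mu>] in auto)
      also have "\<dots> = ?lk f \<mu> * (\<Sum>i\<in>?ks \<mu>. ?d \<mu> i \<omega> * (if a i = b then 1 else 0))"
        unfolding sum_distrib_left by (rule sum.cong) auto
      finally show "(\<Sum>i<n. ?lk f \<mu> * ((if i \<in> ?ks \<mu> then ?d \<mu> i \<omega> else 0) * (if a i = b then 1 else 0))) = ?lk f \<mu> * (\<Sum>i\<in>?ks \<mu>. ?d \<mu> i \<omega> * (if a i = b then 1 else 0))" .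
    qed
    finally show ?thesis .
  qed
  ultimately show ?thesis by simp
qed

end

lemma partial_deriv_all_moments:
  assumes f: "mpoly_in_vars n f" and a: "\<And>i. i < n \<Longrightarrow> a i \<in> A"
  shows "all_moments (\<lambda>\<omega>. partial_deriv (mpoly_eval f) i (\<lambda>i. X (a i) \<omega>))"
  unfolding mpoly_partial_deriv
proof (intro all_moments_sum all_moments_mult all_moments_const)
  fix \<mu> assume \<mu>: "\<mu> \<in> Poly_Mapping.keys f"
  have k: "all_moments (X (a k))" if "k \<in> Poly_Mapping.keys \<mu>" for k
    using f a \<mu> that by (intro X_all_moments) (auto simp: mpoly_in_vars_def)
  show "all_moments (\<lambda>\<omega>. if i \<in> Poly_Mapping.keys \<mu> then real (Poly_Mapping.lookup \<mu> i) * X (a i) \<omega> ^ (Poly_Mapping.lookup \<mu> i - 1)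
           * (\<Prod>k\<in>Poly_Mapping.keys \<mu> - {i}. X (a k) \<omega> ^ Poly_Mapping.lookup \<mu> k) else 0)"
    by (cases "i \<in> Poly_Mapping.keys \<mu>") (auto intro!: all_moments_mult all_moments_const all_moments_power all_moments_prod k)
qed

end

section \<open>Closability of the derivative\<close>

lemma powr_add_le:
  fixes x y q :: real
  assumes "0 \<le> x" "0 \<le> y" "0 \<le> q"
  shows "(x + y) powr q \<le> 2 powr q * (x powr q + y powr q)"
proof -
  have "(x + y) powr q \<le> (2 * max x y) powr q" using assms by (intro powr_mono2) auto
  also have "\<dots> = 2 powr q * (max x y) powr q" using assms by (simp add: powr_mult)
  also have "\<dots> \<le> 2 powr q * (x powr q + y powr q)" by (rule mult_left_mono) (auto simp: max_def)
  finally show ?thesis .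
qed

text \<open>Distinguish whether \<open>\<delta> y \<le> r\<^sup>p\<^sup>-\<^sup>1\<close>. As \<open>\<delta>\<close> tends to \<open>0\<close> the second term becomes small, which
replaces Hoelder's inequality below.\<close>

lemma weighted_Young:
  fixes r y p \<delta> :: real
  assumes "0 \<le> r" "0 \<le> y" "1 < p" "0 < \<delta>"
  shows "r * y \<le> r powr p / \<delta> + \<delta> powr (1 / (p - 1)) * y powr (p / (p - 1))"
proof (cases "r = 0 \<or> y = 0")
  case True then show ?thesis using assms by auto
next
  case False
  then have pos: "r > 0" "y > 0" using assms by auto
  show ?thesis
  proof (cases "\<delta> * y \<le> r powr (p - 1)")
    case True
    then have "y \<le> r powr (p - 1) / \<delta>" using assms by (simp add: field_simps)
    then have "r * y \<le> r * (r powr (p - 1) / \<delta>)" using pos by (intro mult_left_mono) auto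
    also have "\<dots> = r powr p / \<delta>" using pos by (simp add: powr_diff)
    also have "\<dots> \<le> r powr p / \<delta> + \<delta> powr (1 / (p - 1)) * y powr (p / (p - 1))" using assms by simp
    finally show ?thesis .
  next
    case False
    then have "(r powr (p - 1)) powr (1 / (p - 1)) \<le> (\<delta> * y) powr (1 / (p - 1))"
      using assms by (intro powr_mono2) auto
    then have "r \<le> (\<delta> * y) powr (1 / (p - 1))" using assms pos by (simp add: powr_powr)
    then have "r * y \<le> (\<delta> * y) powr (1 / (p - 1)) * y" using pos by (intro mult_right_mono) auto
    also have "\<dots> = \<delta> powr (1 / (p - 1)) * (y powr (1 / (p - 1)) * y powr 1)" using assms pos by (simp add: powr_mult)
    also have "y powr (1 / (p - 1)) * y powr 1 = y powr (p / (p - 1))"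
      using assms by (simp only: powr_add[symmetric]) (simp add: field_simps)
    also have "\<delta> powr (1 / (p - 1)) * y powr (p / (p - 1)) \<le> r powr p / \<delta> + \<delta> powr (1 / (p - 1)) * y powr (p / (p - 1))"
      using assms by simp
    finally show ?thesis .
  qed
qed

lemma tendsto_powr_inverse_0:
  fixes x :: "nat \<Rightarrow> real"
  assumes "\<And>k. 0 \<le> x k" "0 < p" "(\<lambda>k. x k powr (1 / p)) \<longlonglongrightarrow> 0"
  shows "x \<longlonglongrightarrow> 0"
proof -
  have "(\<lambda>k. (x k powr (1 / p)) powr p) \<longlonglongrightarrow> 0 powr p"
    by (rule tendsto_powr2[OF assms(3) tendsto_const]) (use assms in auto)
  then show ?thesis using assms by (simp add: powr_powr)
qed

context prob_space
begin

text \<open>Convergence in \<open>L\<^sup>p\<close> with \<open>p > 1\<close> survives multiplication by an unbounded Gaussian variable. This makes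
\<open>E[F X\<^sub>b e]\<close> continuous in \<open>F\<close>.\<close>

lemma Lp_null_mult_all_moments:
  assumes p: "1 < p" and m: "\<And>k. R k \<in> borel_measurable M"
    and i: "\<And>k. integrable M (\<lambda>\<omega>. \<bar>R k \<omega>\<bar> powr p)" and lim: "(\<lambda>k. \<integral>\<omega>. \<bar>R k \<omega>\<bar> powr p \<partial>M) \<longlonglongrightarrow> 0"
    and Y: "all_moments Y"
  shows "integrable M (\<lambda>\<omega>. R k \<omega> * Y \<omega>)" and "(\<lambda>k. \<integral>\<omega>. \<bar>R k \<omega> * Y \<omega>\<bar> \<partial>M) \<longlonglongrightarrow> 0"
proof -
  note [measurable] = m all_moments_measurable[OF Y]
  let ?q = "p / (p - 1)"
  have iY: "integrable M (\<lambda>\<omega>. \<bar>Y \<omega>\<bar> powr ?q)" using p by (intro all_moments_powr Y) auto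
  define C where "C = (\<integral>\<omega>. \<bar>Y \<omega>\<bar> powr ?q \<partial>M)"
  have pw: "\<bar>R k \<omega> * Y \<omega>\<bar> \<le> \<bar>R k \<omega>\<bar> powr p / \<delta> + \<delta> powr (1 / (p - 1)) * \<bar>Y \<omega>\<bar> powr ?q" if "\<delta> > 0" for k \<omega> \<delta>
    using weighted_Young[of "\<bar>R k \<omega>\<bar>" "\<bar>Y \<omega>\<bar>" p \<delta>] p that by (simp add: abs_mult)
  have ib: "integrable M (\<lambda>\<omega>. \<bar>R k \<omega>\<bar> powr p / \<delta> + \<delta> powr (1 / (p - 1)) * \<bar>Y \<omega>\<bar> powr ?q)" for k \<delta>
    using i iY by simp
  show int: "integrable M (\<lambda>\<omega>. R k \<omega> * Y \<omega>)" for k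
  proof (rule Bochner_Integration.integrable_bound[OF ib[of k 1]])
    show "AE \<omega> in M. norm (R k \<omega> * Y \<omega>) \<le> norm (\<bar>R k \<omega>\<bar> powr p / 1 + 1 powr (1 / (p - 1)) * \<bar>Y \<omega>\<bar> powr ?q)"
      using pw[of 1 k] by (intro AE_I2) simp
  qed measurable
  have bound: "(\<integral>\<omega>. \<bar>R k \<omega> * Y \<omega>\<bar> \<partial>M) \<le> (\<integral>\<omega>. \<bar>R k \<omega>\<bar> powr p \<partial>M) / \<delta> + \<delta> powr (1 / (p - 1)) * C" if "\<delta> > 0" for k \<delta>
  proof -
    have "(\<integral>\<omega>. \<bar>R k \<omega> * Y \<omega>\<bar> \<partial>M) \<le> (\<integral>\<omega>. \<bar>R k \<omega>\<bar> powr p / \<delta> + \<delta> powr (1 / (p - 1)) * \<bar>Y \<omega>\<bar> powr ?q \<partial>M)"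
      by (intro integral_mono integrable_abs int ib pw that)
    also have "\<dots> = (\<integral>\<omega>. \<bar>R k \<omega>\<bar> powr p \<partial>M) / \<delta> + \<delta> powr (1 / (p - 1)) * C"
      using i iY by (simp add: C_def)
    finally show ?thesis .
  qed
  show "(\<lambda>k. \<integral>\<omega>. \<bar>R k \<omega> * Y \<omega>\<bar> \<partial>M) \<longlonglongrightarrow> 0"
  proof (rule LIMSEQ_I)
    fix r :: real assume r: "r > 0"
    have C0: "C \<ge> 0" by (simp add: C_def)
    (* This makes the second term in weighted_Young at most r/2. *)
    define \<delta> where "\<delta> = (r / (2 * (C + 1))) powr (p - 1)"
    have d: "\<delta> > 0" using r C0 by (simp add: \<delta>_def)
    have dp: "\<delta> powr (1 / (p - 1)) = r / (2 * (C + 1))" using r C0 p by (simp add: \<delta>_def powr_powr)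
    have small: "\<delta> powr (1 / (p - 1)) * C \<le> r / 2" unfolding dp using r C0 by (simp add: field_simps)
    have "r * \<delta> / 2 > 0" using r d by simp
    from LIMSEQ_D[OF lim this] obtain K where K: "\<And>k. k \<ge> K \<Longrightarrow> norm ((\<integral>\<omega>. \<bar>R k \<omega>\<bar> powr p \<partial>M) - 0) < r * \<delta> / 2" by blast
    show "\<exists>K. \<forall>k\<ge>K. norm ((\<integral>\<omega>. \<bar>R k \<omega> * Y \<omega>\<bar> \<partial>M) - 0) < r"
    proof (intro exI[of _ K] allI impI)
      fix k assume "k \<ge> K"
      then have "(\<integral>\<omega>. \<bar>R k \<omega>\<bar> powr p \<partial>M) < r * \<delta> / 2" using K[of k] by simp
      then have "(\<integral>\<omega>. \<bar>R k \<omega>\<bar> powr p \<partial>M) / \<delta> < r / 2" using d by (simp add: field_simps)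
      then have "(\<integral>\<omega>. \<bar>R k \<omega> * Y \<omega>\<bar> \<partial>M) < r" using bound[OF d, of k] small by linarith
      then show "norm ((\<integral>\<omega>. \<bar>R k \<omega> * Y \<omega>\<bar> \<partial>M) - 0) < r" by simp
    qed
  qed
qed

end

locale gaussian_array = gaussian_family M X "UNIV \<times> {1..m}"
  for M :: "'a measure" and X :: "nat \<times> nat \<Rightarrow> 'a \<Rightarrow> real" and m :: nat
begin

abbreviation "A \<equiv> (UNIV :: nat set) \<times> {1..m}"

lemma fourier_diff_le:
  assumes S: "finite S" "S \<subseteq> A" and Y: "integrable M Y" "integrable M Y'"
  shows "norm (fourier S Y \<theta> - fourier S Y' \<theta>) \<le> (\<integral>\<omega>. \<bar>Y \<omega> - Y' \<omega>\<bar> \<partial>M)"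
proof -
  note i = fourier_integrable[OF S]
  have "fourier S Y \<theta> - fourier S Y' \<theta> = (\<integral>\<omega>. of_real (Y \<omega>) * iexp (\<Sum>a\<in>S. \<theta> a * X a \<omega>) - of_real (Y' \<omega>) * iexp (\<Sum>a\<in>S. \<theta> a * X a \<omega>) \<partial>M)"
    unfolding fourier_def[OF S] by (rule Bochner_Integration.integral_diff[symmetric, OF i[OF Y(1)] i[OF Y(2)]])
  also have "norm \<dots> \<le> (\<integral>\<omega>. norm (of_real (Y \<omega>) * iexp (\<Sum>a\<in>S. \<theta> a * X a \<omega>) - of_real (Y' \<omega>) * iexp (\<Sum>a\<in>S. \<theta> a * X a \<omega>)) \<partial>M)"
    by (rule integral_norm_bound)
  also have "\<dots> = (\<integral>\<omega>. \<bar>Y \<omega> - Y' \<omega>\<bar> \<partial>M)"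
  proof (rule Bochner_Integration.integral_cong[OF refl])
    fix \<omega>
    have "of_real (Y \<omega>) * iexp (\<Sum>a\<in>S. \<theta> a * X a \<omega>) - of_real (Y' \<omega>) * iexp (\<Sum>a\<in>S. \<theta> a * X a \<omega>) = of_real (Y \<omega> - Y' \<omega>) * iexp (\<Sum>a\<in>S. \<theta> a * X a \<omega>)"
      by (simp only: of_real_diff left_diff_distrib)
    then show "norm (of_real (Y \<omega>) * iexp (\<Sum>a\<in>S. \<theta> a * X a \<omega>) - of_real (Y' \<omega>) * iexp (\<Sum>a\<in>S. \<theta> a * X a \<omega>)) = \<bar>Y \<omega> - Y' \<omega>\<bar>"
      by (simp only: norm_mult norm_exp_i_times norm_of_real mult_1_right)
  qed
  finally show ?thesis .
qed

lemma fourier_tendsto: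
  assumes S: "finite S" "S \<subseteq> A" and Y: "\<And>k. integrable M (Y k)" "integrable M Y'"
    and lim: "(\<lambda>k. \<integral>\<omega>. \<bar>Y k \<omega> - Y' \<omega>\<bar> \<partial>M) \<longlonglongrightarrow> 0"
  shows "(\<lambda>k. fourier S (Y k) \<theta>) \<longlonglongrightarrow> fourier S Y' \<theta>"
  by (rule LIM_zero_cancel, rule Lim_null_comparison[OF _ lim]) (use fourier_diff_le[OF S] Y in auto)

text \<open>Test functions of finitely many variables may be regarded as functions of more variables.\<close>

lemma fourier_extend:
  assumes S: "finite S" "S \<subseteq> S'" "finite S'" "S' \<subseteq> A"
  shows "fourier S' Y (\<lambda>a. if a \<in> S then \<theta> a else 0) = fourier S Y \<theta>"
proof -
  have "S \<subseteq> A" using S by auto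
  have "(\<Sum>a\<in>S'. (if a \<in> S then \<theta> a else 0) * X a \<omega>) = (\<Sum>a\<in>S. \<theta> a * X a \<omega>)" for \<omega>
  proof -
    have "(\<Sum>a\<in>S'. (if a \<in> S then \<theta> a else 0) * X a \<omega>) = (\<Sum>a\<in>S. (if a \<in> S then \<theta> a else 0) * X a \<omega>)"
      by (rule sum.mono_neutral_right) (use S in auto)
    also have "\<dots> = (\<Sum>a\<in>S. \<theta> a * X a \<omega>)" by (rule sum.cong) auto
    finally show ?thesis .
  qed
  then show ?thesis unfolding fourier_def[OF S(3,4)] fourier_def[OF S(1) \<open>S \<subseteq> A\<close>] by (simp only:)
qed

text \<open>Pairing with \<open>h\<close> extracts from the derivative of a polynomial exactly its partial derivative in
direction \<open>b = (j0, l0)\<close>. The integration by parts formula then passes to the limit and expresses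
the Fourier transform of \<open>Z\<close> through \<open>F\<close> alone. The last statement records that \<open>Z\<close> is a limit of
functions of finitely many variables, which is needed to recover \<open>Z\<close> from its Fourier transform.\<close>

lemma D1p_functional:
  assumes p: "1 < p" and e: "\<And>j. square_integrable (lebesgue_on {0..T}) (e j)"
    and h: "square_integrable (lebesgue_on {0..T}) h"
    and dual: "\<And>j. (\<integral>t. e j t * h t \<partial>lebesgue_on {0..T}) = (if j = j0 then 1 else 0)"
    and l0: "l0 \<in> {1..m}" and D: "in_D1p M T m p e (\<lambda>j l. X (j, l)) F DF"
  defines "Z \<equiv> \<lambda>\<omega>. \<integral>t. DF l0 t \<omega> * h t \<partial>lebesgue_on {0..T}"
  shows "integrable M Z"
    and "\<And>S \<theta>. finite S \<Longrightarrow> S \<subseteq> A \<Longrightarrow> (j0, l0) \<in> S \<Longrightarrow>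
       fourier S Z \<theta> = fourier S (\<lambda>\<omega>. X (j0, l0) \<omega> * F \<omega>) \<theta> - \<i> * of_real (\<theta> (j0, l0)) * fourier S F \<theta>"
    and "\<exists>S g. (\<forall>k. finite (S k) \<and> S k \<subseteq> A \<and> g k \<in> borel_measurable (Pi\<^sub>M (S k) (\<lambda>_. borel))
           \<and> integrable M (\<lambda>\<omega>. g k (\<lambda>a\<in>S k. X a \<omega>))) \<and>
         (\<lambda>k. \<integral>\<omega>. \<bar>g k (\<lambda>a\<in>S k. X a \<omega>) - Z \<omega>\<bar> \<partial>M) \<longlonglongrightarrow> 0"
proof -
  let ?L = "lebesgue_on {0..T}"
  let ?b = "(j0, l0)"
  interpret L: finite_measure ?L by (rule finite_measure_lebesgue_on_Icc)
  interpret LM: pair_sigma_finite ?L M ..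
  have bA: "?b \<in> A" using l0 by simp
  have Fp: "F \<in> borel_measurable M" "integrable M (\<lambda>\<omega>. \<bar>F \<omega>\<bar> powr p)" using D by (auto simp: in_D1p_def in_Lp_def)
  have DFp: "(\<lambda>(t, \<omega>). DF l0 t \<omega>) \<in> borel_measurable (?L \<Otimes>\<^sub>M M)"
     "AE \<omega> in M. integrable ?L (\<lambda>t. (DF l0 t \<omega>)\<^sup>2)"
     "integrable M (\<lambda>\<omega>. (\<integral>t. (DF l0 t \<omega>)\<^sup>2 \<partial>?L) powr (p / 2))"
    using D l0 by (auto simp: in_D1p_def in_Lp_L2_def)
  note [measurable] = Fp(1) square_integrable_measurable[OF e] square_integrable_measurable[OF h]
  (* G k are the approximating polynomials; rep names the polynomial and the variables behind
     each of them, and Zk is the pairing of the derivative of G k with h. *)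
  obtain G DG where G: "\<And>k. (G k, DG k) \<in> polynomial_functionals m e (\<lambda>j l. X (j, l))"
    and lim: "(\<lambda>k. norm_1p M T m p (\<lambda>\<omega>. G k \<omega> - F \<omega>) (\<lambda>l t \<omega>. DG k l t \<omega> - DF l t \<omega>)) \<longlonglongrightarrow> 0"
    using D unfolding in_D1p_def by blast
  define rep where "rep k n f j l \<longleftrightarrow> mpoly_in_vars n f \<and> (\<forall>i<n. l i \<in> {1..m}) \<and>
        G k = (\<lambda>\<omega>. mpoly_eval f (\<lambda>i. X (j i, l i) \<omega>)) \<and>
        DG k = (\<lambda>l' s \<omega>. \<Sum>i<n. partial_deriv (mpoly_eval f) i (\<lambda>i. X (j i, l i) \<omega>) * e (j i) s * (if l i = l' then 1 else 0))"
    for k n f j l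
  have "\<forall>k. \<exists>n f j l. rep k n f j l"
  proof
    fix k show "\<exists>n f j l. rep k n f j l"
      using G[of k] by (simp only: polynomial_functionals_def mem_Collect_eq prod.case rep_def)
  qed
  then obtain n f j l where rep: "\<And>k. rep k (n k) (f k) (j k) (l k)" by metis
  have poly: "mpoly_in_vars (n k) (f k)" "i < n k \<Longrightarrow> l k i \<in> {1..m}" for k i
    using rep[of k] unfolding rep_def by blast+
  have Gk: "G k = (\<lambda>\<omega>. mpoly_eval (f k) (\<lambda>i. X (j k i, l k i) \<omega>))" for k
    using rep[of k] unfolding rep_def by (elim conjE)
  have DGk: "DG k = (\<lambda>l' s \<omega>. \<Sum>i<n k. partial_deriv (mpoly_eval (f k)) i (\<lambda>i. X (j k i, l k i) \<omega>) * e (j k i) s * (if l k i = l' then 1 else 0))" for k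
    using rep[of k] unfolding rep_def by (elim conjE)
  define pd where "pd k i \<omega> = partial_deriv (mpoly_eval (f k)) i (\<lambda>i. X (j k i, l k i) \<omega>)" for k i \<omega>
  have pdm: "all_moments (pd k i)" for k i
    unfolding pd_def[abs_def] by (rule partial_deriv_all_moments[OF poly(1)]) (use poly(2) in auto)
  note [measurable] = all_moments_measurable[OF pdm]
  have DG: "DG k l0 t \<omega> = (\<Sum>i<n k. pd k i \<omega> * (if l k i = l0 then 1 else 0) * e (j k i) t)" for k t \<omega>
    unfolding DGk pd_def by (rule sum.cong) (simp_all only: mult_ac)
  define S where "S k = insert ?b ((\<lambda>i. (j k i, l k i)) ` {..<n k})" for k
  have S: "finite (S k)" "S k \<subseteq> A" "?b \<in> S k" for k using poly(2) bA by (auto simp: S_def)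
  define Zk where "Zk k \<omega> = (\<Sum>i<n k. pd k i \<omega> * (if (j k i, l k i) = ?b then 1 else 0))" for k \<omega>
  have ibp: "ibp S' ?b (G k) (Zk k)" if "finite S'" "S' \<subseteq> A" "S k \<subseteq> S'" for k S'
    unfolding Gk Zk_def[abs_def] pd_def using that by (intro ibp_polynomial poly) (auto simp: S_def)
  have Gm: "all_moments (G k)" and Zm: "all_moments (Zk k)" for k
    using ibp[OF S(1,2) order_refl, of k] by (auto simp: ibp_def[OF S(1,2)])
  note [measurable] = all_moments_measurable[OF Gm] all_moments_measurable[OF Zm]
  have DGsq: "square_integrable ?L (\<lambda>t. DG k l0 t \<omega>)" for k \<omega>
    unfolding DG by (intro square_integrable_sum square_integrable_scale e)
  have DGh: "(\<integral>t. DG k l0 t \<omega> * h t \<partial>?L) = Zk k \<omega>" for k \<omega>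
  proof -
    have i: "integrable ?L (\<lambda>t. e (j k i) t * h t)" for i by (intro square_integrable_mult_integrable e h)
    have "(\<integral>t. DG k l0 t \<omega> * h t \<partial>?L) = (\<integral>t. (\<Sum>i<n k. pd k i \<omega> * (if l k i = l0 then 1 else 0) * (e (j k i) t * h t)) \<partial>?L)"
      unfolding DG sum_distrib_right by (simp only: mult.assoc)
    also have "\<dots> = (\<Sum>i<n k. pd k i \<omega> * (if l k i = l0 then 1 else 0) * (\<integral>t. e (j k i) t * h t \<partial>?L))"
      by (subst Bochner_Integration.integral_sum) (auto intro: i)
    also have "\<dots> = Zk k \<omega>" unfolding dual Zk_def by (rule sum.cong) auto
    finally show ?thesis .
  qed
  have DFsw [measurable]: "(\<lambda>x. DF l0 (snd x) (fst x)) \<in> borel_measurable (M \<Otimes>\<^sub>M ?L)"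
    using measurable_pair_swap[OF DFp(1)] by (simp add: case_prod_beta')
  have DGsw [measurable]: "(\<lambda>x. DG k l0 (snd x) (fst x)) \<in> borel_measurable (M \<Otimes>\<^sub>M ?L)" for k
    unfolding DG by measurable
  have DFsec [measurable]: "(\<lambda>t. DF l0 t \<omega>) \<in> borel_measurable ?L" if "\<omega> \<in> space M" for \<omega>
    using measurable_Pair2[OF DFsw, of \<omega>] that by simp
  have DFsq: "AE \<omega> in M. square_integrable ?L (\<lambda>t. DF l0 t \<omega>)"
    using DFp(2) AE_space by eventually_elim (simp add: square_integrable_def DFsec)
  (* By Cauchy-Schwarz the error of Zk is at most the norm of h times sqrt N, and sqrt N tends to 0
     in the p-th mean. *)
  define N where "N k \<omega> = (\<integral>t. (DG k l0 t \<omega> - DF l0 t \<omega>)\<^sup>2 \<partial>?L)" for k \<omega>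
  have Nm [measurable]: "N k \<in> borel_measurable M" for k
    unfolding N_def[abs_def] by (rule L.borel_measurable_lebesgue_integral) (simp add: case_prod_beta')
  have N0: "0 \<le> N k \<omega>" for k \<omega> by (simp add: N_def)
  have Zmeas [measurable]: "Z \<in> borel_measurable M"
    unfolding Z_def by (rule L.borel_measurable_lebesgue_integral) (simp add: case_prod_beta')
  have Ni: "integrable M (\<lambda>\<omega>. N k \<omega> powr (p / 2))" for k
  proof (rule Bochner_Integration.integrable_bound)
    let ?a = "\<lambda>\<omega>. \<integral>t. (DG k l0 t \<omega>)\<^sup>2 \<partial>?L" and ?c = "\<lambda>\<omega>. \<integral>t. (DF l0 t \<omega>)\<^sup>2 \<partial>?L"
    have am: "all_moments ?a"
    proof -
      define w where "w i = (if l k i = l0 then 1 else 0 :: real)" for i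
      have i: "integrable ?L (\<lambda>t. e (j k i) t * e (j k i') t)" for i i' by (intro square_integrable_mult_integrable e)
      have "?a = (\<lambda>\<omega>. \<Sum>i<n k. \<Sum>i'<n k. pd k i \<omega> * (pd k i' \<omega> * (w i * w i' * (\<integral>t. e (j k i) t * e (j k i') t \<partial>?L))))"
      proof
        fix \<omega>
        have "?a \<omega> = (\<integral>t. (\<Sum>i<n k. \<Sum>i'<n k. pd k i \<omega> * (pd k i' \<omega> * (w i * w i' * (e (j k i) t * e (j k i') t)))) \<partial>?L)"
          unfolding DG power2_eq_square sum_product w_def[symmetric] by (simp only: mult_ac)
        also have "\<dots> = (\<Sum>i<n k. \<Sum>i'<n k. \<integral>t. pd k i \<omega> * (pd k i' \<omega> * (w i * w i' * (e (j k i) t * e (j k i') t))) \<partial>?L)"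
          by (rule integral_double_sum) (intro integrable_mult_right i)
        also have "\<dots> = (\<Sum>i<n k. \<Sum>i'<n k. pd k i \<omega> * (pd k i' \<omega> * (w i * w i' * (\<integral>t. e (j k i) t * e (j k i') t \<partial>?L))))"
          by (simp only: integral_mult_right_zero)
        finally show "?a \<omega> = (\<Sum>i<n k. \<Sum>i'<n k. pd k i \<omega> * (pd k i' \<omega> * (w i * w i' * (\<integral>t. e (j k i) t * e (j k i') t \<partial>?L))))" .
      qed
      then show ?thesis by (simp only:) (intro all_moments_sum all_moments_mult all_moments_const pdm)
    qed
    have a0: "0 \<le> ?a \<omega>" "0 \<le> ?c \<omega>" for \<omega> by simp_all
    have "integrable M (\<lambda>\<omega>. \<bar>?a \<omega>\<bar> powr (p / 2))" using p by (intro all_moments_powr am) simp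
    then have "integrable M (\<lambda>\<omega>. ?a \<omega> powr (p / 2))" by simp
    then show "integrable M (\<lambda>\<omega>. 2 powr (p / 2) * (2 powr (p / 2) * (?a \<omega> powr (p / 2) + ?c \<omega> powr (p / 2))))"
      using DFp(3) by simp
    show "AE \<omega> in M. norm (N k \<omega> powr (p / 2)) \<le> norm (2 powr (p / 2) * (2 powr (p / 2) * (?a \<omega> powr (p / 2) + ?c \<omega> powr (p / 2))))"
      using DFsq
    proof eventually_elim
      fix \<omega> assume s: "square_integrable ?L (\<lambda>t. DF l0 t \<omega>)"
      have i: "integrable ?L (\<lambda>t. (DG k l0 t \<omega>)\<^sup>2)" "integrable ?L (\<lambda>t. (DF l0 t \<omega>)\<^sup>2)"
        using DGsq s by (auto simp: square_integrable_def)
      have "N k \<omega> \<le> (\<integral>t. 2 * (DG k l0 t \<omega>)\<^sup>2 + 2 * (DF l0 t \<omega>)\<^sup>2 \<partial>?L)" unfolding N_def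
      proof (rule integral_mono)
        show "integrable ?L (\<lambda>t. (DG k l0 t \<omega> - DF l0 t \<omega>)\<^sup>2)"
          using square_integrable_diff[OF DGsq s] by (simp add: square_integrable_def)
        show "integrable ?L (\<lambda>t. 2 * (DG k l0 t \<omega>)\<^sup>2 + 2 * (DF l0 t \<omega>)\<^sup>2)" using i by simp
        have "(x - y)\<^sup>2 \<le> 2 * x\<^sup>2 + 2 * y\<^sup>2" for x y :: real
        proof -
          have "0 \<le> (x + y)\<^sup>2" by simp
          then show ?thesis unfolding power2_diff power2_sum by linarith
        qed
        then show "(DG k l0 t \<omega> - DF l0 t \<omega>)\<^sup>2 \<le> 2 * (DG k l0 t \<omega>)\<^sup>2 + 2 * (DF l0 t \<omega>)\<^sup>2" for t by blast
      qed
      also have "\<dots> = 2 * (?a \<omega> + ?c \<omega>)" using i by simp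
      finally have "N k \<omega> powr (p / 2) \<le> (2 * (?a \<omega> + ?c \<omega>)) powr (p / 2)" using p N0 by (intro powr_mono2) auto
      also have "\<dots> = 2 powr (p / 2) * (?a \<omega> + ?c \<omega>) powr (p / 2)" using a0 by (subst powr_mult) (auto intro: add_nonneg_nonneg)
      also have "\<dots> \<le> 2 powr (p / 2) * (2 powr (p / 2) * (?a \<omega> powr (p / 2) + ?c \<omega> powr (p / 2)))"
        using p a0 by (intro mult_left_mono powr_add_le) auto
      finally show "norm (N k \<omega> powr (p / 2)) \<le> norm (2 powr (p / 2) * (2 powr (p / 2) * (?a \<omega> powr (p / 2) + ?c \<omega> powr (p / 2))))"
        by simp
    qed
  qed measurable
  have GFi: "integrable M (\<lambda>\<omega>. \<bar>G k \<omega> - F \<omega>\<bar> powr p)" for k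
  proof (rule Bochner_Integration.integrable_bound)
    show "integrable M (\<lambda>\<omega>. 2 powr p * (\<bar>G k \<omega>\<bar> powr p + \<bar>F \<omega>\<bar> powr p))"
      using all_moments_powr[OF Gm, of p] Fp(2) p by simp
    have "\<bar>x - y\<bar> powr p \<le> 2 powr p * (\<bar>x\<bar> powr p + \<bar>y\<bar> powr p)" for x y :: real
    proof -
      have "\<bar>x - y\<bar> powr p \<le> (\<bar>x\<bar> + \<bar>y\<bar>) powr p" using p by (intro powr_mono2) auto
      also have "\<dots> \<le> 2 powr p * (\<bar>x\<bar> powr p + \<bar>y\<bar> powr p)" using p by (intro powr_add_le) auto
      finally show ?thesis .
    qed
    then show "AE \<omega> in M. norm (\<bar>G k \<omega> - F \<omega>\<bar> powr p) \<le> norm (2 powr p * (\<bar>G k \<omega>\<bar> powr p + \<bar>F \<omega>\<bar> powr p))"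
      by (intro AE_I2) simp
  qed measurable
  have nonneg: "0 \<le> (\<integral>\<omega>. \<bar>G k \<omega> - F \<omega>\<bar> powr p \<partial>M) powr (1 / p)"
    "0 \<le> (\<integral>\<omega>. (\<integral>t. \<bar>DG k l' t \<omega> - DF l' t \<omega>\<bar>\<^sup>2 \<partial>?L) powr (p / 2) \<partial>M) powr (1 / p)" for k l' by simp_all
  have GF0: "(\<lambda>k. \<integral>\<omega>. \<bar>G k \<omega> - F \<omega>\<bar> powr p \<partial>M) \<longlonglongrightarrow> 0"
  proof (rule tendsto_powr_inverse_0)
    show "(\<lambda>k. (\<integral>\<omega>. \<bar>G k \<omega> - F \<omega>\<bar> powr p \<partial>M) powr (1 / p)) \<longlonglongrightarrow> 0"
    proof (rule Lim_null_comparison[OF _ lim], intro always_eventually allI)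
      fix k show "norm ((\<integral>\<omega>. \<bar>G k \<omega> - F \<omega>\<bar> powr p \<partial>M) powr (1 / p)) \<le> norm_1p M T m p (\<lambda>\<omega>. G k \<omega> - F \<omega>) (\<lambda>l t \<omega>. DG k l t \<omega> - DF l t \<omega>)"
        unfolding norm_1p_def by (simp add: sum_nonneg)
    qed
  qed (use p in auto)
  have N_lim: "(\<lambda>k. \<integral>\<omega>. N k \<omega> powr (p / 2) \<partial>M) \<longlonglongrightarrow> 0"
  proof (rule tendsto_powr_inverse_0)
    show "(\<lambda>k. (\<integral>\<omega>. N k \<omega> powr (p / 2) \<partial>M) powr (1 / p)) \<longlonglongrightarrow> 0"
    proof (rule Lim_null_comparison[OF _ lim], intro always_eventually allI)
      fix k
      have "(\<integral>\<omega>. N k \<omega> powr (p / 2) \<partial>M) powr (1 / p) \<le> (\<Sum>l'=1..m. (\<integral>\<omega>. (\<integral>t. \<bar>DG k l' t \<omega> - DF l' t \<omega>\<bar>\<^sup>2 \<partial>?L) powr (p / 2) \<partial>M) powr (1 / p))"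
        using member_le_sum[OF l0, of "\<lambda>l'. (\<integral>\<omega>. (\<integral>t. \<bar>DG k l' t \<omega> - DF l' t \<omega>\<bar>\<^sup>2 \<partial>?L) powr (p / 2) \<partial>M) powr (1 / p)"]
        by (simp add: N_def)
      then show "norm ((\<integral>\<omega>. N k \<omega> powr (p / 2) \<partial>M) powr (1 / p)) \<le> norm_1p M T m p (\<lambda>\<omega>. G k \<omega> - F \<omega>) (\<lambda>l t \<omega>. DG k l t \<omega> - DF l t \<omega>)"
        using nonneg(1)[of k] powr_ge_zero[of "\<integral>\<omega>. N k \<omega> powr (p / 2) \<partial>M" "1 / p"] unfolding norm_1p_def real_norm_def by linarith
    qed
  qed (use p in auto)
  have sqp: "\<bar>sqrt (N k \<omega>)\<bar> powr p = N k \<omega> powr (p / 2)" for k \<omega>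
  proof -
    have "sqrt (N k \<omega>) = N k \<omega> powr (1/2)" using N0 by (simp add: powr_half_sqrt)
    then show ?thesis using N0[of k \<omega>] by (simp add: powr_powr)
  qed
  have sm: "(\<lambda>\<omega>. sqrt (N k \<omega>)) \<in> borel_measurable M" for k by measurable
  have sN: "integrable M (\<lambda>\<omega>. sqrt (N k \<omega>))" "(\<lambda>k. \<integral>\<omega>. sqrt (N k \<omega>) \<partial>M) \<longlonglongrightarrow> 0" for k
    using Lp_null_mult_all_moments[OF p sm, unfolded sqp, OF Ni N_lim all_moments_const[of 1]] N0 by simp_all
  define H where "H = sqrt (\<integral>t. (h t)\<^sup>2 \<partial>?L)"
  have ZZ: "AE \<omega> in M. \<bar>Zk k \<omega> - Z \<omega>\<bar> \<le> sqrt (N k \<omega>) * H" for k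
    using DFsq
  proof eventually_elim
    fix \<omega> assume s: "square_integrable ?L (\<lambda>t. DF l0 t \<omega>)"
    have "Zk k \<omega> - Z \<omega> = (\<integral>t. DG k l0 t \<omega> * h t - DF l0 t \<omega> * h t \<partial>?L)"
      unfolding DGh[symmetric] Z_def by (rule Bochner_Integration.integral_diff[symmetric]; intro square_integrable_mult_integrable DGsq s h)
    also have "\<dots> = (\<integral>t. (DG k l0 t \<omega> - DF l0 t \<omega>) * h t \<partial>?L)" by (simp only: left_diff_distrib)
    finally show "\<bar>Zk k \<omega> - Z \<omega>\<bar> \<le> sqrt (N k \<omega>) * H"
      using integral_Cauchy_Schwarz_abs[OF square_integrable_diff[OF DGsq s] h, of k] by (simp add: N_def H_def)
  qed
  have Zdi: "integrable M (\<lambda>\<omega>. Zk k \<omega> - Z \<omega>)" for k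
  proof (rule Bochner_Integration.integrable_bound)
    show "integrable M (\<lambda>\<omega>. sqrt (N k \<omega>) * H)" using sN by simp
    show "AE \<omega> in M. norm (Zk k \<omega> - Z \<omega>) \<le> norm (sqrt (N k \<omega>) * H)" using ZZ[of k] by eventually_elim simp
  qed measurable
  have Zki: "integrable M (Zk k)" for k by (rule all_moments_integrable[OF Zm])
  show Zi: "integrable M Z" using Bochner_Integration.integrable_diff[OF Zki[of 0] Zdi[of 0]] by simp
  have Zlim: "(\<lambda>k. \<integral>\<omega>. \<bar>Zk k \<omega> - Z \<omega>\<bar> \<partial>M) \<longlonglongrightarrow> 0"
  proof (rule Lim_null_comparison)
    show "(\<lambda>k. (\<integral>\<omega>. sqrt (N k \<omega>) \<partial>M) * H) \<longlonglongrightarrow> 0" using tendsto_mult_right[OF sN(2), of H] by simp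
    have "(\<integral>\<omega>. \<bar>Zk k \<omega> - Z \<omega>\<bar> \<partial>M) \<le> (\<integral>\<omega>. sqrt (N k \<omega>) * H \<partial>M)" for k
      by (rule integral_mono_AE) (use Zdi sN(1) ZZ in auto)
    then show "\<forall>\<^sub>F k in sequentially. norm (\<integral>\<omega>. \<bar>Zk k \<omega> - Z \<omega>\<bar> \<partial>M) \<le> (\<integral>\<omega>. sqrt (N k \<omega>) \<partial>M) * H" by simp
  qed
  have Rm: "(\<lambda>\<omega>. G k \<omega> - F \<omega>) \<in> borel_measurable M" for k by measurable
  note Lp = Lp_null_mult_all_moments[OF p Rm GFi GF0]
  have Gi: "integrable M (G k)" "integrable M (\<lambda>\<omega>. X ?b \<omega> * G k \<omega>)" for k
    by (intro all_moments_integrable all_moments_mult Gm X_all_moments bA)+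
  have Fi: "integrable M F"
    using Bochner_Integration.integrable_diff[OF Gi(1) Lp(1)[OF all_moments_const[of 1]], of 0 0] by simp
  have XFi: "integrable M (\<lambda>\<omega>. X ?b \<omega> * F \<omega>)"
    using Bochner_Integration.integrable_diff[OF Gi(2)[of 0] Lp(1)[OF X_all_moments[OF bA], of 0]] by (simp add: algebra_simps)
  show "fourier S' Z \<theta> = fourier S' (\<lambda>\<omega>. X ?b \<omega> * F \<omega>) \<theta> - \<i> * of_real (\<theta> ?b) * fourier S' F \<theta>"
    if S': "finite S'" "S' \<subseteq> A" "?b \<in> S'" for S' \<theta>
  proof -
    have eq: "fourier S' (\<lambda>\<omega>. X ?b \<omega> * G k \<omega>) \<theta> = fourier S' (Zk k) \<theta> + \<i> * of_real (\<theta> ?b) * fourier S' (G k) \<theta>" for k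
    proof -
      (* The polynomial G k may contain variables outside S'; the test function does not see them. *)
      let ?U = "S' \<union> S k"
      have U: "finite ?U" "?U \<subseteq> A" using S' S by auto
      have "ibp ?U ?b (G k) (Zk k)" by (rule ibp[OF U]) simp
      then have "fourier ?U (\<lambda>\<omega>. X ?b \<omega> * G k \<omega>) (\<lambda>a. if a \<in> S' then \<theta> a else 0) = fourier ?U (Zk k) (\<lambda>a. if a \<in> S' then \<theta> a else 0)
        + \<i> * of_real ((\<lambda>a. if a \<in> S' then \<theta> a else 0) ?b) * fourier ?U (G k) (\<lambda>a. if a \<in> S' then \<theta> a else 0)"
        unfolding ibp_def[OF U] by blast
      then show ?thesis using S'(3) by (simp only: fourier_extend[OF S'(1) Un_upper1 U] if_True)
    qed
    have "(\<lambda>k. fourier S' (\<lambda>\<omega>. X ?b \<omega> * G k \<omega>) \<theta>) \<longlonglongrightarrow> fourier S' (\<lambda>\<omega>. X ?b \<omega> * F \<omega>) \<theta>"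
      using Lp(2)[OF X_all_moments[OF bA]] by (intro fourier_tendsto S' Gi XFi) (simp add: algebra_simps)
    moreover have "(\<lambda>k. fourier S' (Zk k) \<theta> + \<i> * of_real (\<theta> ?b) * fourier S' (G k) \<theta>) \<longlonglongrightarrow> fourier S' Z \<theta> + \<i> * of_real (\<theta> ?b) * fourier S' F \<theta>"
      using Lp(2)[OF all_moments_const[of 1]] Zlim by (intro tendsto_intros fourier_tendsto S' Gi Fi Zki Zi) simp_all
    ultimately have "fourier S' (\<lambda>\<omega>. X ?b \<omega> * F \<omega>) \<theta> = fourier S' Z \<theta> + \<i> * of_real (\<theta> ?b) * fourier S' F \<theta>"
      unfolding eq by (rule LIMSEQ_unique)
    then show ?thesis by simp
  qed
  (* The partial derivative as a function of the tuple of the variables in S k, for the last claim. *)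
  define g where "g k v = (\<Sum>i<n k. partial_deriv (mpoly_eval (f k)) i (\<lambda>i. v (j k i, l k i)) * (if (j k i, l k i) = ?b then 1 else 0))" for k and v :: "nat \<times> nat \<Rightarrow> real"
  have gX: "g k (\<lambda>a\<in>S k. X a \<omega>) = Zk k \<omega>" for k \<omega>
    unfolding g_def Zk_def pd_def
  proof (intro sum.cong refl arg_cong2[where f="(*)"])
    fix i
    show "partial_deriv (mpoly_eval (f k)) i (\<lambda>i. (\<lambda>a\<in>S k. X a \<omega>) (j k i, l k i)) = partial_deriv (mpoly_eval (f k)) i (\<lambda>i. X (j k i, l k i) \<omega>)"
    proof -
      have mem: "(j k i', l k i') \<in> S k" if "\<mu> \<in> Poly_Mapping.keys (f k)" "i' \<in> Poly_Mapping.keys \<mu>" for \<mu> i'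
        using poly(1)[of k] that by (auto simp: mpoly_in_vars_def S_def)
      then show ?thesis unfolding mpoly_partial_deriv
        by (intro sum.cong refl arg_cong2[where f="(*)"] if_cong prod.cong) auto
    qed
  qed
  have gm: "g k \<in> borel_measurable (Pi\<^sub>M (S k) (\<lambda>_. borel))" for k
    unfolding g_def[abs_def]
  proof (intro borel_measurable_sum borel_measurable_times borel_measurable_const)
    fix i
    show "(\<lambda>v. partial_deriv (mpoly_eval (f k)) i (\<lambda>i. v (j k i, l k i))) \<in> borel_measurable (Pi\<^sub>M (S k) (\<lambda>_. borel))"
      unfolding mpoly_partial_deriv
    proof (intro borel_measurable_sum borel_measurable_times borel_measurable_const)
      fix \<mu> assume \<mu>: "\<mu> \<in> Poly_Mapping.keys (f k)"
      have c: "(\<lambda>v. v (j k i', l k i')) \<in> borel_measurable (Pi\<^sub>M (S k) (\<lambda>_. borel))" if "i' \<in> Poly_Mapping.keys \<mu>" for i'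
        using poly(1)[of k] that \<mu> by (intro measurable_component_singleton) (auto simp: mpoly_in_vars_def S_def)
      show "(\<lambda>v. if i \<in> Poly_Mapping.keys \<mu> then real (Poly_Mapping.lookup \<mu> i) * v (j k i, l k i) ^ (Poly_Mapping.lookup \<mu> i - 1)
           * (\<Prod>i'\<in>Poly_Mapping.keys \<mu> - {i}. v (j k i', l k i') ^ Poly_Mapping.lookup \<mu> i') else 0) \<in> borel_measurable (Pi\<^sub>M (S k) (\<lambda>_. borel))"
        by (cases "i \<in> Poly_Mapping.keys \<mu>") (auto intro!: borel_measurable_times borel_measurable_power borel_measurable_prod c)
    qed
  qed
  have "(\<forall>k. finite (S k) \<and> S k \<subseteq> A \<and> g k \<in> borel_measurable (Pi\<^sub>M (S k) (\<lambda>_. borel))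
           \<and> integrable M (\<lambda>\<omega>. g k (\<lambda>a\<in>S k. X a \<omega>))) \<and>
         (\<lambda>k. \<integral>\<omega>. \<bar>g k (\<lambda>a\<in>S k. X a \<omega>) - Z \<omega>\<bar> \<partial>M) \<longlonglongrightarrow> 0"
    unfolding gX using S(1,2) gm Zki Zlim by blast
  then show "\<exists>S g. (\<forall>k. finite (S k) \<and> S k \<subseteq> A \<and> g k \<in> borel_measurable (Pi\<^sub>M (S k) (\<lambda>_. borel))
           \<and> integrable M (\<lambda>\<omega>. g k (\<lambda>a\<in>S k. X a \<omega>))) \<and>
         (\<lambda>k. \<integral>\<omega>. \<bar>g k (\<lambda>a\<in>S k. X a \<omega>) - Z \<omega>\<bar> \<partial>M) \<longlonglongrightarrow> 0"
    by blast
qed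

text \<open>Test with the sign of an approximation \<open>Q\<^sub>k\<close> of \<open>R\<close>, a bounded function of finitely many variables:
\<open>E[R sgn Q\<^sub>k] = 0\<close> gives \<open>E\<bar>Q\<^sub>k\<bar> \<le> E\<bar>Q\<^sub>k - R\<bar>\<close>, hence \<open>E\<bar>R\<bar> \<le> 2 E\<bar>Q\<^sub>k - R\<bar>\<close>.\<close>

lemma fourier_zero_imp_null:
  assumes R: "integrable M R" and zero: "\<And>S \<theta>. finite S \<Longrightarrow> S \<subseteq> A \<Longrightarrow> fourier S R \<theta> = 0"
    and S: "\<And>k. finite (S k)" "\<And>k. S k \<subseteq> A"
    and g: "\<And>k. g k \<in> borel_measurable (Pi\<^sub>M (S k) (\<lambda>_. borel))"
    and gi: "\<And>k. integrable M (\<lambda>\<omega>. g k (\<lambda>a\<in>S k. X a \<omega>))"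
    and lim: "(\<lambda>k. \<integral>\<omega>. \<bar>g k (\<lambda>a\<in>S k. X a \<omega>) - R \<omega>\<bar> \<partial>M) \<longlonglongrightarrow> 0"
  shows "AE \<omega> in M. R \<omega> = 0"
proof -
  let ?Q = "\<lambda>k \<omega>. g k (\<lambda>a\<in>S k. X a \<omega>)"
  have [measurable]: "R \<in> borel_measurable M" "?Q k \<in> borel_measurable M" for k using R gi[of k] by auto
  have "(\<integral>\<omega>. \<bar>R \<omega>\<bar> \<partial>M) \<le> 2 * (\<integral>\<omega>. \<bar>?Q k \<omega> - R \<omega>\<bar> \<partial>M)" for k
  proof -
    have di: "integrable M (\<lambda>\<omega>. ?Q k \<omega> - R \<omega>)" using gi[of k] R by simp
    have mult_sgn: "integrable M (\<lambda>\<omega>. f \<omega> * sgn (?Q k \<omega>))" if "integrable M f" for f :: "'a \<Rightarrow> real"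
    proof (rule Bochner_Integration.integrable_bound[OF that])
      have [measurable]: "f \<in> borel_measurable M" using that by auto
      show "(\<lambda>\<omega>. f \<omega> * sgn (?Q k \<omega>)) \<in> borel_measurable M" by measurable
      show "AE \<omega> in M. norm (f \<omega> * sgn (?Q k \<omega>)) \<le> norm (f \<omega>)" by (intro AE_I2) (simp add: abs_mult sgn_if)
    qed
    have "(\<integral>\<omega>. R \<omega> * sgn (?Q k \<omega>) \<partial>M) = 0"
    proof (rule integral_mult_measurable_eq_0[OF S(1) R])
      show "X i \<in> borel_measurable M" if "i \<in> S k" for i using S(2) that X_measurable by blast
      show "(\<integral>\<omega>. of_real (R \<omega>) * iexp (\<Sum>i\<in>S k. \<theta> i * X i \<omega>) \<partial>M) = 0" for \<theta>
        using zero[OF S(1) S(2), of k \<theta>] unfolding fourier_def[OF S(1) S(2)] .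
      show "(\<lambda>v. sgn (g k v)) \<in> borel_measurable (Pi\<^sub>M (S k) (\<lambda>_. borel))" using g[of k] by measurable
      show "\<bar>sgn (g k v)\<bar> \<le> 1" for v by (simp add: sgn_if)
    qed
    then have "(\<integral>\<omega>. ?Q k \<omega> * sgn (?Q k \<omega>) \<partial>M) = (\<integral>\<omega>. (?Q k \<omega> - R \<omega>) * sgn (?Q k \<omega>) \<partial>M)"
      using mult_sgn[OF gi] mult_sgn[OF R] by (simp add: left_diff_distrib)
    also have "\<dots> \<le> (\<integral>\<omega>. \<bar>?Q k \<omega> - R \<omega>\<bar> \<partial>M)"
      by (rule integral_mono[OF mult_sgn[OF di] integrable_abs[OF di]]) (auto simp: sgn_if)
    finally have Q: "(\<integral>\<omega>. \<bar>?Q k \<omega>\<bar> \<partial>M) \<le> (\<integral>\<omega>. \<bar>?Q k \<omega> - R \<omega>\<bar> \<partial>M)"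
      by (simp add: abs_sgn)
    have "(\<integral>\<omega>. \<bar>R \<omega>\<bar> \<partial>M) \<le> (\<integral>\<omega>. \<bar>?Q k \<omega> - R \<omega>\<bar> + \<bar>?Q k \<omega>\<bar> \<partial>M)"
      by (rule integral_mono) (use R di gi in auto)
    also have "\<dots> = (\<integral>\<omega>. \<bar>?Q k \<omega> - R \<omega>\<bar> \<partial>M) + (\<integral>\<omega>. \<bar>?Q k \<omega>\<bar> \<partial>M)"
      by (rule Bochner_Integration.integral_add) (use di gi in auto)
    finally show ?thesis using Q by linarith
  qed
  then have le: "\<exists>N. \<forall>k\<ge>N. (\<integral>\<omega>. \<bar>R \<omega>\<bar> \<partial>M) \<le> 2 * (\<integral>\<omega>. \<bar>?Q k \<omega> - R \<omega>\<bar> \<partial>M)" by blast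
  have "(\<lambda>k. 2 * (\<integral>\<omega>. \<bar>?Q k \<omega> - R \<omega>\<bar> \<partial>M)) \<longlonglongrightarrow> 2 * 0"
    by (intro tendsto_mult_left lim)
  then have "(\<integral>\<omega>. \<bar>R \<omega>\<bar> \<partial>M) \<le> 2 * 0" by (rule LIMSEQ_le_const) (rule le)
  moreover have "0 \<le> (\<integral>\<omega>. \<bar>R \<omega>\<bar> \<partial>M)" by simp
  ultimately have "(\<integral>\<omega>. \<bar>R \<omega>\<bar> \<partial>M) = 0" by linarith
  then have "AE \<omega> in M. \<bar>R \<omega>\<bar> = 0" using R by (subst (asm) integral_nonneg_eq_0_iff_AE) auto
  then show ?thesis by simp
qed

end

text \<open>The form in which closability is used. The two derivatives may come from different bases and from
different approximating sequences; all that links them is \<open>F\<close> and the dual vectors.\<close>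

lemma D1p_functionals_agree:
  assumes X: "gaussian_array M X m" and X': "gaussian_array M X' m"
    and XX': "\<And>a. a \<in> UNIV \<times> {1..m} \<Longrightarrow> AE \<omega> in M. X a \<omega> = X' a \<omega>"
    and p: "1 < p" and e: "\<And>j. square_integrable (lebesgue_on {0..T}) (e j)" and e': "\<And>j. square_integrable (lebesgue_on {0..T}) (e' j)"
    and h: "square_integrable (lebesgue_on {0..T}) h" and h': "square_integrable (lebesgue_on {0..T}) h'"
    and dual: "\<And>j. (\<integral>t. e j t * h t \<partial>lebesgue_on {0..T}) = (if j = j0 then 1 else 0)"
    and dual': "\<And>j. (\<integral>t. e' j t * h' t \<partial>lebesgue_on {0..T}) = (if j = j0 then 1 else 0)"
    and l0: "l0 \<in> {1..m}"
    and D: "in_D1p M T m p e (\<lambda>j l. X (j, l)) F DF" and D': "in_D1p M T m p e' (\<lambda>j l. X' (j, l)) F DF'"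
  shows "AE \<omega> in M. (\<integral>t. DF l0 t \<omega> * h t \<partial>lebesgue_on {0..T}) = (\<integral>t. DF' l0 t \<omega> * h' t \<partial>lebesgue_on {0..T})"
proof -
  interpret X: gaussian_array M X m by (rule X)
  interpret X': gaussian_array M X' m by (rule X')
  let ?b = "(j0, l0)"
  define Z where "Z \<omega> = (\<integral>t. DF l0 t \<omega> * h t \<partial>lebesgue_on {0..T})" for \<omega>
  define Z' where "Z' \<omega> = (\<integral>t. DF' l0 t \<omega> * h' t \<partial>lebesgue_on {0..T})" for \<omega>
  note P = X.D1p_functional[OF p e h dual l0 D, folded Z_def]
  note P' = X'.D1p_functional[OF p e' h' dual' l0 D', folded Z'_def]
  have Zi: "integrable M Z" "integrable M Z'" using P(1) P'(1) by (simp_all add: Z_def[abs_def] Z'_def[abs_def])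
  have bA: "?b \<in> UNIV \<times> {1..m}" using l0 by simp
  have Fm [measurable]: "F \<in> borel_measurable M" using D by (simp add: in_D1p_def in_Lp_def)
  have AEfin: "AE \<omega> in M. \<forall>a\<in>S. X a \<omega> = X' a \<omega>" if "finite S" "S \<subseteq> UNIV \<times> {1..m}" for S
    using that XX' by (subst AE_finite_all) auto
  have fcong: "X'.fourier S Y' \<theta> = X.fourier S Y \<theta>"
    if S: "finite S" "S \<subseteq> UNIV \<times> {1..m}" and Y: "Y \<in> borel_measurable M" "Y' \<in> borel_measurable M" and ae: "AE \<omega> in M. Y' \<omega> = Y \<omega>" for S Y Y' \<theta>
    unfolding X.fourier_def[OF S] X'.fourier_def[OF S]
  proof (rule integral_cong_AE)
    note [measurable] = Y X.phase_measurable[OF S] X'.phase_measurable[OF S]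
    show "AE \<omega> in M. of_real (Y' \<omega>) * iexp (\<Sum>a\<in>S. \<theta> a * X' a \<omega>) = of_real (Y \<omega>) * iexp (\<Sum>a\<in>S. \<theta> a * X a \<omega>)"
      using ae AEfin[OF S] by eventually_elim simp
    show "(\<lambda>\<omega>. of_real (Y' \<omega>) * iexp (\<Sum>a\<in>S. \<theta> a * X' a \<omega>)) \<in> borel_measurable M"
      "(\<lambda>\<omega>. of_real (Y \<omega>) * iexp (\<Sum>a\<in>S. \<theta> a * X a \<omega>)) \<in> borel_measurable M" by measurable
  qed
  have Xb [measurable]: "X ?b \<in> borel_measurable M" "X' ?b \<in> borel_measurable M"
    using X.X_measurable[OF bA] X'.X_measurable[OF bA] by auto
  define R where "R \<omega> = Z \<omega> - Z' \<omega>" for \<omega>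
  have Ri: "integrable M R" unfolding R_def[abs_def] using Zi by simp
  have zero_b: "X.fourier S R \<theta> = 0" if S: "finite S" "S \<subseteq> UNIV \<times> {1..m}" "?b \<in> S" for S \<theta>
  proof -
    have "X.fourier S Z' \<theta> = X'.fourier S Z' \<theta>"
      using Zi by (intro fcong[symmetric] S) auto
    also have "\<dots> = X'.fourier S (\<lambda>\<omega>. X' ?b \<omega> * F \<omega>) \<theta> - \<i> * of_real (\<theta> ?b) * X'.fourier S F \<theta>"
      using P'(2)[OF S, of \<theta>] by (simp add: Z'_def[abs_def])
    also have "X'.fourier S (\<lambda>\<omega>. X' ?b \<omega> * F \<omega>) \<theta> = X.fourier S (\<lambda>\<omega>. X ?b \<omega> * F \<omega>) \<theta>"
    proof (intro fcong S)
      show "AE \<omega> in M. X' ?b \<omega> * F \<omega> = X ?b \<omega> * F \<omega>" using XX'[OF bA] by eventually_elim simp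
    qed measurable
    also have "X'.fourier S F \<theta> = X.fourier S F \<theta>" by (intro fcong S) auto
    also have "X.fourier S (\<lambda>\<omega>. X ?b \<omega> * F \<omega>) \<theta> - \<i> * of_real (\<theta> ?b) * X.fourier S F \<theta> = X.fourier S Z \<theta>"
      using P(2)[OF S, of \<theta>] by (simp add: Z_def[abs_def])
    finally have eq: "X.fourier S Z' \<theta> = X.fourier S Z \<theta>" .
    have "X.fourier S Z \<theta> = X.fourier S (\<lambda>\<omega>. R \<omega> + Z' \<omega>) \<theta>" by (simp add: R_def)
    also have "\<dots> = X.fourier S R \<theta> + X.fourier S Z' \<theta>" by (rule X.fourier_add[OF S(1,2) Ri Zi(2)])
    finally show ?thesis using eq by simp
  qed
  (* The identity is available for index sets that contain b. For other sets extend theta by 0. *)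
  have zero: "X.fourier S R \<theta> = 0" if S: "finite S" "S \<subseteq> UNIV \<times> {1..m}" for S \<theta>
  proof -
    have i: "finite (insert ?b S)" "insert ?b S \<subseteq> UNIV \<times> {1..m}" using S bA by auto
    have "X.fourier S R \<theta> = X.fourier (insert ?b S) R (\<lambda>a. if a \<in> S then \<theta> a else 0)"
      by (rule X.fourier_extend[symmetric]) (use S i in auto)
    then show ?thesis using zero_b[OF i] by simp
  qed
  obtain S g where Sg: "\<And>k. finite (S k)" "\<And>k. S k \<subseteq> UNIV \<times> {1..m}" "\<And>k. g k \<in> borel_measurable (Pi\<^sub>M (S k) (\<lambda>_. borel))"
      "\<And>k. integrable M (\<lambda>\<omega>. g k (\<lambda>a\<in>S k. X a \<omega>))"
    and lim: "(\<lambda>k. \<integral>\<omega>. \<bar>g k (\<lambda>a\<in>S k. X a \<omega>) - Z \<omega>\<bar> \<partial>M) \<longlonglongrightarrow> 0"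
    using P(3) by blast
  obtain S' g' where Sg': "\<And>k. finite (S' k)" "\<And>k. S' k \<subseteq> UNIV \<times> {1..m}" "\<And>k. g' k \<in> borel_measurable (Pi\<^sub>M (S' k) (\<lambda>_. borel))"
      "\<And>k. integrable M (\<lambda>\<omega>. g' k (\<lambda>a\<in>S' k. X' a \<omega>))"
    and lim': "(\<lambda>k. \<integral>\<omega>. \<bar>g' k (\<lambda>a\<in>S' k. X' a \<omega>) - Z' \<omega>\<bar> \<partial>M) \<longlonglongrightarrow> 0"
    using P'(3) by blast
  define U where "U k = S k \<union> S' k" for k
  define q where "q k v = g k (restrict v (S k)) - g' k (restrict v (S' k))" for k and v :: "nat \<times> nat \<Rightarrow> real"
  let ?G = "\<lambda>k \<omega>. g k (\<lambda>a\<in>S k. X a \<omega>)" and ?G' = "\<lambda>k \<omega>. g' k (\<lambda>a\<in>S' k. X' a \<omega>)"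
  have U: "finite (U k)" "U k \<subseteq> UNIV \<times> {1..m}" for k using Sg Sg' by (auto simp: U_def)
  have qm: "q k \<in> borel_measurable (Pi\<^sub>M (U k) (\<lambda>_. borel))" for k
    unfolding q_def[abs_def]
    by (intro borel_measurable_diff measurable_compose[OF measurable_restrict_subset Sg(3)] measurable_compose[OF measurable_restrict_subset Sg'(3)])
       (auto simp: U_def)
  have qX: "AE \<omega> in M. q k (\<lambda>a\<in>U k. X a \<omega>) = ?G k \<omega> - ?G' k \<omega>" for k
    using AEfin[OF Sg'(1)[of k] Sg'(2)[of k]]
  proof eventually_elim
    fix \<omega> assume a: "\<forall>a\<in>S' k. X a \<omega> = X' a \<omega>"
    have "restrict (\<lambda>a\<in>U k. X a \<omega>) (S k) = (\<lambda>a\<in>S k. X a \<omega>)" "restrict (\<lambda>a\<in>U k. X a \<omega>) (S' k) = (\<lambda>a\<in>S' k. X' a \<omega>)"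
      using a by (auto simp: U_def restrict_def fun_eq_iff)
    then show "q k (\<lambda>a\<in>U k. X a \<omega>) = ?G k \<omega> - ?G' k \<omega>" by (simp add: q_def)
  qed
  have Vm: "(\<lambda>\<omega>. \<lambda>a\<in>U k. X a \<omega>) \<in> M \<rightarrow>\<^sub>M Pi\<^sub>M (U k) (\<lambda>_. borel)" for k
    by (rule measurable_restrict) (use U(2) X.X_measurable in blast)
  have qXm [measurable]: "(\<lambda>\<omega>. q k (\<lambda>a\<in>U k. X a \<omega>)) \<in> borel_measurable M" for k
    using measurable_compose[OF Vm qm] .
  have GGi: "integrable M (\<lambda>\<omega>. ?G k \<omega> - ?G' k \<omega>)" for k using Sg(4) Sg'(4) by simp
  have qi: "integrable M (\<lambda>\<omega>. q k (\<lambda>a\<in>U k. X a \<omega>))" for k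
    using integrable_cong_AE[OF qXm borel_measurable_integrable[OF GGi] qX] GGi by blast
  have "AE \<omega> in M. R \<omega> = 0"
  proof (rule X.fourier_zero_imp_null[OF Ri zero U qm qi])
    have Rm [measurable]: "R \<in> borel_measurable M" using Ri by auto
    have Gm [measurable]: "?G k \<in> borel_measurable M" "?G' k \<in> borel_measurable M" for k using Sg(4) Sg'(4) by auto
    have zm [measurable]: "Z \<in> borel_measurable M" "Z' \<in> borel_measurable M" using Zi by auto
    have "(\<integral>\<omega>. \<bar>q k (\<lambda>a\<in>U k. X a \<omega>) - R \<omega>\<bar> \<partial>M) \<le> (\<integral>\<omega>. \<bar>?G k \<omega> - Z \<omega>\<bar> \<partial>M) + (\<integral>\<omega>. \<bar>?G' k \<omega> - Z' \<omega>\<bar> \<partial>M)" for k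
    proof -
      have i: "integrable M (\<lambda>\<omega>. \<bar>?G k \<omega> - Z \<omega>\<bar>)" "integrable M (\<lambda>\<omega>. \<bar>?G' k \<omega> - Z' \<omega>\<bar>)"
        using Sg(4) Sg'(4) Zi by auto
      have "(\<integral>\<omega>. \<bar>q k (\<lambda>a\<in>U k. X a \<omega>) - R \<omega>\<bar> \<partial>M) \<le> (\<integral>\<omega>. \<bar>?G k \<omega> - Z \<omega>\<bar> + \<bar>?G' k \<omega> - Z' \<omega>\<bar> \<partial>M)"
      proof (rule integral_mono_AE)
        show "AE \<omega> in M. \<bar>q k (\<lambda>a\<in>U k. X a \<omega>) - R \<omega>\<bar> \<le> \<bar>?G k \<omega> - Z \<omega>\<bar> + \<bar>?G' k \<omega> - Z' \<omega>\<bar>"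
          using qX[of k]
        proof eventually_elim
          fix \<omega> assume a: "q k (\<lambda>a\<in>U k. X a \<omega>) = ?G k \<omega> - ?G' k \<omega>"
          show "\<bar>q k (\<lambda>a\<in>U k. X a \<omega>) - R \<omega>\<bar> \<le> \<bar>?G k \<omega> - Z \<omega>\<bar> + \<bar>?G' k \<omega> - Z' \<omega>\<bar>"
            unfolding a R_def by linarith
        qed
      qed (use i qi Ri in auto)
      then show ?thesis using i by simp
    qed
    then show "(\<lambda>k. \<integral>\<omega>. \<bar>q k (\<lambda>a\<in>U k. X a \<omega>) - R \<omega>\<bar> \<partial>M) \<longlonglongrightarrow> 0"
      by (intro Lim_null_comparison[OF _ tendsto_add_zero[OF lim lim']]) simp
  qed
  then show ?thesis by eventually_elim (simp add: R_def Z_def Z'_def)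
qed

section \<open>Transfer between the two derivatives\<close>

context frac_kernel
begin

lemma fbm_op_cong_AE:
  assumes "AE u in L. f u = g u" and [measurable]: "f \<in> borel_measurable L" "g \<in> borel_measurable L"
  shows "fbm_op f s = fbm_op g s"
  unfolding fbm_op_def
proof (rule integral_cong_AE)
  show "AE u in L. fbm_kernel \<alpha> s u * f u = fbm_kernel \<alpha> s u * g u"
    using assms(1) by eventually_elim simp
qed measurable

lemma fbm_op_diff_AE:
  assumes "in_L2 T f" "in_L2 T g"
  shows "AE s in L. fbm_op (\<lambda>u. f u - g u) s = fbm_op f s - fbm_op g s"
  using fbm_kernel_integrable_AE[OF assms(1)] fbm_kernel_integrable_AE[OF assms(2)]
  by eventually_elim (simp add: fbm_op_def right_diff_distrib)

lemma fbm_op_scale: "fbm_op (\<lambda>u. c * f u) s = c * fbm_op f s"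
proof -
  have "(\<lambda>u. fbm_kernel \<alpha> s u * (c * f u)) = (\<lambda>u. c * (fbm_kernel \<alpha> s u * f u))" by (simp only: mult_ac)
  then show ?thesis by (simp add: fbm_op_def)
qed

lemma fbm_op_sum_AE:
  assumes "finite I" "\<And>i. i \<in> I \<Longrightarrow> in_L2 T (f i)"
  shows "AE s in L. fbm_op (\<lambda>u. \<Sum>i\<in>I. f i u) s = (\<Sum>i\<in>I. fbm_op (f i) s)"
proof -
  have "AE s in L. \<forall>i\<in>I. integrable L (\<lambda>u. fbm_kernel \<alpha> s u * f i u)"
    using assms fbm_kernel_integrable_AE by (subst AE_finite_all) auto
  then show ?thesis
    by eventually_elim (simp add: fbm_op_def sum_distrib_left Bochner_Integration.integral_sum)
qed

lemma cov_kernel_integrable_AE: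
  assumes g: "integrable L g"
  shows "AE t in L. integrable L (\<lambda>s. cov_kernel t s * g s)"
proof -
  have [measurable]: "g \<in> borel_measurable L" using g by auto
  have "(\<integral>\<^sup>+t. \<integral>\<^sup>+s. ennreal (cov_kernel t s * \<bar>g s\<bar>) \<partial>L \<partial>L) = (\<integral>\<^sup>+s. \<integral>\<^sup>+t. ennreal (cov_kernel t s * \<bar>g s\<bar>) \<partial>L \<partial>L)"
    by (rule LL.Fubini') measurable
  also have "\<dots> \<le> (\<integral>\<^sup>+s. ennreal schur_const * ennreal \<bar>g s\<bar> \<partial>L)"
  proof (rule nn_integral_mono)
    fix s assume "s \<in> space L"
    then have s: "s \<in> {0..T}" by simp
    have "(\<integral>\<^sup>+t. ennreal (cov_kernel t s * \<bar>g s\<bar>) \<partial>L) = (\<integral>\<^sup>+t. ennreal (cov_kernel s t) * ennreal \<bar>g s\<bar> \<partial>L)"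
      by (intro nn_integral_cong) (simp add: cov_kernel_def abs_minus_commute[of s] ennreal_mult'')
    also have "\<dots> = (\<integral>\<^sup>+t. ennreal (cov_kernel s t) \<partial>L) * ennreal \<bar>g s\<bar>" by (rule nn_integral_multc) measurable
    also have "\<dots> \<le> ennreal schur_const * ennreal \<bar>g s\<bar>" by (intro mult_right_mono nn_integral_cov_kernel_le s) auto
    finally show "(\<integral>\<^sup>+t. ennreal (cov_kernel t s * \<bar>g s\<bar>) \<partial>L) \<le> ennreal schur_const * ennreal \<bar>g s\<bar>" .
  qed
  also have "\<dots> = ennreal schur_const * (\<integral>\<^sup>+s. ennreal \<bar>g s\<bar> \<partial>L)" by (rule nn_integral_cmult) measurable
  also have "\<dots> < \<infinity>" using g by (simp add: integrable_iff_bounded ennreal_mult_less_top)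
  finally have "AE t in L. (\<integral>\<^sup>+s. ennreal (cov_kernel t s * \<bar>g s\<bar>) \<partial>L) \<noteq> \<infinity>"
    by (intro nn_integral_PInf_AE) auto
  then show ?thesis
    by eventually_elim (auto intro!: integrableI_bounded simp: abs_mult less_top)
qed

lemma kappa_pos: "0 < kappa (\<alpha> + 1/2)"
  using \<alpha>_pos \<alpha>_less by (simp add: kappa_def)

text \<open>The constant in the definition of the Volterra kernel is chosen such that this holds.\<close>

lemma kappa_covariance: "(kappa (\<alpha> + 1/2) * \<alpha>)\<^sup>2 * Beta \<alpha> (1 - 2*\<alpha>) = (\<alpha> + 1/2) * (2 * (\<alpha> + 1/2) - 1)"
proof -
  have n: "\<alpha> \<notin> \<int>\<^sub>\<le>\<^sub>0" using \<alpha>_pos nonpos_Ints_nonpos[of \<alpha>] by linarith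
  have g: "Gamma (\<alpha> + 1) = \<alpha> * Gamma \<alpha>" by (rule Gamma_plus1[OF n])
  have pos: "Gamma \<alpha> > 0" "Gamma (1 - \<alpha>) > 0" "Gamma (1 - 2*\<alpha>) > 0"
    using \<alpha>_pos \<alpha>_less by simp_all
  have e: "3/2 - (\<alpha> + 1/2) = 1 - \<alpha>" "\<alpha> + 1/2 + 1/2 = \<alpha> + 1" "2 - 2 * (\<alpha> + 1/2) = 1 - 2*\<alpha>" "\<alpha> + (1 - 2*\<alpha>) = 1 - \<alpha>" by auto
  have k: "(kappa (\<alpha> + 1/2))\<^sup>2 = 2 * (\<alpha> + 1/2) * Gamma (1 - \<alpha>) / (\<alpha> * Gamma \<alpha> * Gamma (1 - 2*\<alpha>))"
    unfolding kappa_def e g using \<alpha>_pos pos by (intro real_sqrt_pow2) simp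
  have cancel: "2 * (\<alpha> + 1/2) * y / (\<alpha> * x * z) * \<alpha>\<^sup>2 * (x * z / y) = (\<alpha> + 1/2) * (2 * (\<alpha> + 1/2) - 1)"
    if "x > 0" "y > 0" "z > 0" for x y z :: real
    using that \<alpha>_pos by (simp add: field_simps power2_eq_square)
  show ?thesis unfolding power_mult_distrib k Beta_def e by (rule cancel[OF pos])
qed

text \<open>The factor in \<open>B_star\<close> is the reciprocal of the one that Abel inversion produces.\<close>

lemma kappa_inverse: "kappa (\<alpha> + 1/2) * \<alpha> * (2 * (\<alpha> + 1/2) * kappa1 (\<alpha> + 1/2) / kappa (\<alpha> + 1/2)) * Beta \<alpha> (1 - \<alpha>) = 1"
proof -
  have n: "\<alpha> \<notin> \<int>\<^sub>\<le>\<^sub>0" using \<alpha>_pos nonpos_Ints_nonpos[of \<alpha>] by linarith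
  have g: "Gamma (\<alpha> + 1) = \<alpha> * Gamma \<alpha>" by (rule Gamma_plus1[OF n])
  have pos: "Gamma \<alpha> > 0" "Gamma (1 - \<alpha>) > 0" using \<alpha>_pos \<alpha>_less by simp_all
  have e: "3/2 - (\<alpha> + 1/2) = 1 - \<alpha>" "\<alpha> + 1/2 + 1/2 = \<alpha> + 1" "\<alpha> + (1 - \<alpha>) = 1" by auto
  have "kappa (\<alpha> + 1/2) * \<alpha> * (2 * (\<alpha> + 1/2) * kappa1 (\<alpha> + 1/2) / kappa (\<alpha> + 1/2)) * Beta \<alpha> (1 - \<alpha>)
    = \<alpha> * (2 * (\<alpha> + 1/2) * kappa1 (\<alpha> + 1/2)) * Beta \<alpha> (1 - \<alpha>)"
    using kappa_pos by simp
  also have "\<dots> = 1"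
  proof -
    have cancel: "\<alpha> * (2 * (\<alpha> + 1/2) * (1 / (2 * (\<alpha> + 1/2) * (\<alpha> * x) * y))) * (x * y / Gamma 1) = 1"
      if "x > 0" "y > 0" for x y :: real
      using that \<alpha>_pos by (simp add: divide_simps)
    show ?thesis unfolding kappa1_def Beta_def e g by (rule cancel[OF pos])
  qed
  finally show ?thesis .
qed

lemma L2_phi_norm_sq_eq:
  assumes "in_L2 T f"
  shows "L2_phi_norm_sq (\<alpha> + 1/2) T f = (\<integral>s. (kappa (\<alpha> + 1/2) * \<alpha> * fbm_op f s)\<^sup>2 \<partial>L)"
proof -
  have phi: "phi (\<alpha> + 1/2) (s - r) = (kappa (\<alpha> + 1/2) * \<alpha>)\<^sup>2 * cov_kernel s r" for s r
  proof -
    have "2 * (\<alpha> + 1/2) - 2 = 2 * \<alpha> - 1" by simp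
    then show ?thesis unfolding phi_def cov_kernel_def mult.assoc[symmetric] kappa_covariance by simp
  qed
  have "L2_phi_norm_sq (\<alpha> + 1/2) T f = (\<integral>p. (kappa (\<alpha> + 1/2) * \<alpha>)\<^sup>2 * (f (fst p) * f (snd p) * cov_kernel (fst p) (snd p)) \<partial>(L \<Otimes>\<^sub>M L))"
    unfolding L2_phi_norm_sq_def phi by (intro Bochner_Integration.integral_cong refl) (simp add: case_prod_beta' mult_ac)
  also have "\<dots> = (kappa (\<alpha> + 1/2) * \<alpha>)\<^sup>2 * (\<integral>s. (fbm_op f s)\<^sup>2 \<partial>L)"
    unfolding fbm_op_isometry(2)[OF assms] by simp
  also have "\<dots> = (\<integral>s. (kappa (\<alpha> + 1/2) * \<alpha> * fbm_op f s)\<^sup>2 \<partial>L)"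
    by (simp add: power_mult_distrib[of "kappa (\<alpha> + 1/2) * \<alpha>"])
  finally show ?thesis .
qed

end

context brownian
begin

lemma Wiener_isometry:
  assumes Q: "finite Q" and l: "l \<in> {1..m}"
    and I: "\<And>q. q \<in> Q \<Longrightarrow> has_Wiener_integral M T (W l) (f q) (I q)"
  shows "(\<integral>\<omega>. (\<Sum>q\<in>Q. c q * I q \<omega>)\<^sup>2 \<partial>M) = (\<integral>s. (\<Sum>q\<in>Q. c q * f q s)\<^sup>2 \<partial>lebesgue_on {0..T})"
proof -
  have sI: "square_integrable M (I q)" and sf: "square_integrable (lebesgue_on {0..T}) (f q)" if "q \<in> Q" for q
    using I[OF that] by (auto simp: has_Wiener_integral_square_integrable has_Wiener_integral_def in_L2_iff)
  have f: "(c q * x * (c r * y)) = (c q * c r) * (x * y)" for q r x y by (simp only: mult_ac)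
  have "(\<integral>\<omega>. (\<Sum>q\<in>Q. c q * I q \<omega>)\<^sup>2 \<partial>M) = (\<Sum>q\<in>Q. \<Sum>r\<in>Q. \<integral>\<omega>. c q * I q \<omega> * (c r * I r \<omega>) \<partial>M)"
    unfolding power2_eq_square sum_product
    by (rule integral_double_sum) (intro square_integrable_mult_integrable square_integrable_scale sI)
  also have "\<dots> = (\<Sum>q\<in>Q. \<Sum>r\<in>Q. \<integral>s. c q * f q s * (c r * f r s) \<partial>lebesgue_on {0..T})"
    unfolding f integral_mult_right_zero
    using Wiener_integral_covariance[OF l l I I] by (intro sum.cong refl) (simp add: L2_inner_def)
  also have "\<dots> = (\<integral>s. (\<Sum>q\<in>Q. c q * f q s)\<^sup>2 \<partial>lebesgue_on {0..T})"
    unfolding power2_eq_square sum_product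
    by (rule integral_double_sum[symmetric]) (intro square_integrable_mult_integrable square_integrable_scale sf)
  finally show ?thesis .
qed

end

text \<open>All formulas are written with \<open>\<alpha> + 1/2\<close> in place of the Hurst parameter.\<close>

locale fbm_setting = BM: brownian M T m W + K: frac_kernel T \<alpha>
  for M :: "'a measure" and T :: real and m :: nat and W :: "nat \<Rightarrow> real \<Rightarrow> 'a \<Rightarrow> real" and \<alpha> :: real +
  fixes B :: "nat \<Rightarrow> real \<Rightarrow> 'a \<Rightarrow> real"
  assumes fBm: "fractional_Brownian_motion_of M (\<alpha> + 1/2) T m W B"
begin

abbreviation "\<kappa> \<equiv> kappa (\<alpha> + 1/2) * \<alpha>"

lemma B_Wiener: "l \<in> {1..m} \<Longrightarrow> t \<in> {0..T} \<Longrightarrow> has_Wiener_integral M T (W l) (\<lambda>s. indicator {0..t} s * Z_kernel (\<alpha> + 1/2) t s) (B l t)"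
  using fBm by (simp add: fractional_Brownian_motion_of_def)

lemma Z_AE:
  assumes "t \<in> {0..T}"
  shows "AE s in K.L. indicator {0..t} s * Z_kernel (\<alpha> + 1/2) t s = \<kappa> * K.fbm_op (indicator {0<..t}) s"
  using K.AE_L_neq[of 0] K.AE_L_neq[of t] K.AE_L_in
proof eventually_elim
  fix s assume s: "s \<noteq> 0" "s \<noteq> t" "s \<in> {0..T}"
  show "indicator {0..t} s * Z_kernel (\<alpha> + 1/2) t s = \<kappa> * K.fbm_op (indicator {0<..t}) s"
  proof (cases "s < t")
    case True
    then show ?thesis using K.Z_kernel_eq_fbm_op[of s t] s assms by (simp add: indicator_def)
  next
    case False
    then show ?thesis using K.fbm_op_indicator_eq_0[of t s] s by (simp add: indicator_def)
  qed
qed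

text \<open>The integral of a step function against \<open>B\<close> is a linear combination of the Wiener integrals that define
the values of \<open>B\<close>, so the left hand side is the squared norm of \<open>\<kappa> fbm_op\<close> of the difference.\<close>

lemma step_integral_B_isometry:
  assumes l: "l \<in> {1..m}" and t: "\<And>i. i \<le> n \<Longrightarrow> t i \<in> {0..T}" "\<And>i. i < n \<Longrightarrow> t i \<le> t (Suc i)"
    and J: "has_Wiener_integral M T (W l) x J"
    and y: "in_L2 T y" and xy: "AE s in K.L. x s = \<kappa> * K.fbm_op y s"
  shows "(\<integral>\<omega>. (step_integral (B l) n t a \<omega> - J \<omega>)\<^sup>2 \<partial>M) = L2_phi_norm_sq (\<alpha> + 1/2) T (\<lambda>s. step_function n t a s - y s)"
proof -
  define R where "R = {..<n} \<times> (UNIV :: bool set)"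
  (* None stands for J; the Boolean selects the right or the left end point of an interval. *)
  define Q where "Q = insert None (Some ` R)"
  define tt where "tt r = t (if snd r then Suc (fst r) else fst r)" for r :: "nat \<times> bool"
  define cc where "cc r = a (fst r) * (if snd r then 1 else -1)" for r :: "nat \<times> bool"
  define c where "c q = (case q of None \<Rightarrow> -1 | Some r \<Rightarrow> cc r)" for q
  define I where "I q = (case q of None \<Rightarrow> J | Some r \<Rightarrow> B l (tt r))" for q
  define f where "f q = (case q of None \<Rightarrow> x | Some r \<Rightarrow> (\<lambda>s. indicator {0..tt r} s * Z_kernel (\<alpha> + 1/2) (tt r) s))" for q
  have R: "finite R" by (simp add: R_def)
  have tt: "tt r \<in> {0..T}" if "r \<in> R" for r using that t(1)[of "fst r"] t(1)[of "Suc (fst r)"] by (auto simp: R_def tt_def)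
  have sumQ: "(\<Sum>q\<in>Q. h q) = h None + (\<Sum>i<n. h (Some (i, True)) + h (Some (i, False)))" for h :: "(nat \<times> bool) option \<Rightarrow> real"
  proof -
    have "(\<Sum>q\<in>Q. h q) = h None + (\<Sum>r\<in>R. h (Some r))"
      unfolding Q_def using R by (subst sum.insert) (auto simp: sum.reindex)
    also have "(\<Sum>r\<in>R. h (Some r)) = (\<Sum>i<n. \<Sum>b\<in>UNIV. h (Some (i, b)))"
      unfolding R_def by (simp add: sum.cartesian_product case_prod_beta)
    finally show ?thesis by (simp add: UNIV_bool add.commute)
  qed
  have iso: "(\<integral>\<omega>. (\<Sum>q\<in>Q. c q * I q \<omega>)\<^sup>2 \<partial>M) = (\<integral>s. (\<Sum>q\<in>Q. c q * f q s)\<^sup>2 \<partial>K.L)"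
  proof (rule BM.Wiener_isometry[OF _ l])
    show "finite Q" using R by (simp add: Q_def)
    fix q assume "q \<in> Q"
    then show "has_Wiener_integral M T (W l) (f q) (I q)"
      using J B_Wiener[OF l] tt by (auto simp: Q_def f_def I_def)
  qed
  have lhs: "(\<Sum>q\<in>Q. c q * I q \<omega>) = step_integral (B l) n t a \<omega> - J \<omega>" for \<omega>
    unfolding sumQ by (simp add: c_def cc_def I_def tt_def step_integral_def right_diff_distrib)
  have ind2: "in_L2 T (indicator {0<..t i})" for i
    using indicator_Ioc_square_integrable in_L2_iff by blast
  have dif2: "in_L2 T (\<lambda>u. a i * (indicator {0<..t (Suc i)} u - indicator {0<..t i} u))" for i
    using ind2 unfolding in_L2_iff by (intro square_integrable_scale square_integrable_diff) auto
  have st2: "in_L2 T (step_function n t a)" using step_function_square_integrable in_L2_iff by blast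
  have st: "step_function n t a = (\<lambda>u. \<Sum>i<n. a i * (indicator {0<..t (Suc i)} u - indicator {0<..t i} u))"
    by (rule ext, rule step_function_eq) (use t in auto)
  have "AE s in K.L. \<forall>i\<in>{..n}. indicator {0..t i} s * Z_kernel (\<alpha> + 1/2) (t i) s = \<kappa> * K.fbm_op (indicator {0<..t i}) s"
    using Z_AE t(1) by (subst AE_finite_all) auto
  moreover have "AE s in K.L. \<forall>i\<in>{..<n}. K.fbm_op (\<lambda>u. indicator {0<..t (Suc i)} u - indicator {0<..t i} u) s = K.fbm_op (indicator {0<..t (Suc i)}) s - K.fbm_op (indicator {0<..t i}) s"
    using K.fbm_op_diff_AE[OF ind2 ind2] by (subst AE_finite_all) auto
  moreover have "AE s in K.L. K.fbm_op (step_function n t a) s = (\<Sum>i<n. K.fbm_op (\<lambda>u. a i * (indicator {0<..t (Suc i)} u - indicator {0<..t i} u)) s)"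
    unfolding st by (rule K.fbm_op_sum_AE) (use dif2 in auto)
  ultimately have rhs: "AE s in K.L. (\<Sum>q\<in>Q. c q * f q s) = \<kappa> * K.fbm_op (\<lambda>s. step_function n t a s - y s) s"
    using K.fbm_op_diff_AE[OF st2 y] xy
  proof eventually_elim
    fix s
    assume 1: "\<forall>i\<in>{..n}. indicator {0..t i} s * Z_kernel (\<alpha> + 1/2) (t i) s = \<kappa> * K.fbm_op (indicator {0<..t i}) s"
      and 2: "\<forall>i\<in>{..<n}. K.fbm_op (\<lambda>u. indicator {0<..t (Suc i)} u - indicator {0<..t i} u) s = K.fbm_op (indicator {0<..t (Suc i)}) s - K.fbm_op (indicator {0<..t i}) s"
      and 3: "K.fbm_op (step_function n t a) s = (\<Sum>i<n. K.fbm_op (\<lambda>u. a i * (indicator {0<..t (Suc i)} u - indicator {0<..t i} u)) s)"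
      and 4: "K.fbm_op (\<lambda>u. step_function n t a u - y u) s = K.fbm_op (step_function n t a) s - K.fbm_op y s"
      and 5: "x s = \<kappa> * K.fbm_op y s"
    have "(\<Sum>q\<in>Q. c q * f q s) = - x s + (\<Sum>i<n. a i * (\<kappa> * K.fbm_op (indicator {0<..t (Suc i)}) s) - a i * (\<kappa> * K.fbm_op (indicator {0<..t i}) s))"
      unfolding sumQ using 1 by (simp add: c_def cc_def f_def tt_def)
    also have "(\<Sum>i<n. a i * (\<kappa> * K.fbm_op (indicator {0<..t (Suc i)}) s) - a i * (\<kappa> * K.fbm_op (indicator {0<..t i}) s)) = \<kappa> * K.fbm_op (step_function n t a) s"
      unfolding 3 sum_distrib_left K.fbm_op_scale
    proof (intro sum.cong refl)
      fix i assume "i \<in> {..<n}"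
      then have i: "K.fbm_op (\<lambda>u. indicator {0<..t (Suc i)} u - indicator {0<..t i} u) s = K.fbm_op (indicator {0<..t (Suc i)}) s - K.fbm_op (indicator {0<..t i}) s"
        using 2 by blast
      show "a i * (\<kappa> * K.fbm_op (indicator {0<..t (Suc i)}) s) - a i * (\<kappa> * K.fbm_op (indicator {0<..t i}) s)
        = \<kappa> * (a i * K.fbm_op (\<lambda>u. indicator {0<..t (Suc i)} u - indicator {0<..t i} u) s)"
        unfolding i by (simp only: right_diff_distrib mult_ac)
    qed
    finally show "(\<Sum>q\<in>Q. c q * f q s) = \<kappa> * K.fbm_op (\<lambda>s. step_function n t a s - y s) s"
      unfolding 4 5 by (simp add: algebra_simps)
  qed
  have sy2: "in_L2 T (\<lambda>s. step_function n t a s - y s)"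
    using st2 y unfolding in_L2_iff by (rule square_integrable_diff)
  have sf: "square_integrable K.L (\<lambda>s. \<Sum>q\<in>Q. c q * f q s)"
  proof (intro square_integrable_sum square_integrable_scale)
    fix q assume "q \<in> Q"
    then have "has_Wiener_integral M T (W l) (f q) (I q)"
      using J B_Wiener[OF l] tt by (auto simp: Q_def f_def I_def)
    then show "square_integrable K.L (f q)" by (simp add: has_Wiener_integral_def in_L2_iff)
  qed
  have "(\<integral>s. (\<Sum>q\<in>Q. c q * f q s)\<^sup>2 \<partial>K.L) = (\<integral>s. (\<kappa> * K.fbm_op (\<lambda>s. step_function n t a s - y s) s)\<^sup>2 \<partial>K.L)"
  proof (rule integral_cong_AE)
    have [measurable]: "K.fbm_op (\<lambda>s. step_function n t a s - y s) \<in> borel_measurable K.L"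
      using sy2 by (intro K.fbm_op_measurable) (simp add: in_L2_def)
    note [measurable] = square_integrable_measurable[OF sf]
    show "AE s in K.L. (\<Sum>q\<in>Q. c q * f q s)\<^sup>2 = (\<kappa> * K.fbm_op (\<lambda>s. step_function n t a s - y s) s)\<^sup>2"
      using rhs by eventually_elim simp
    show "(\<lambda>s. (\<Sum>q\<in>Q. c q * f q s)\<^sup>2) \<in> borel_measurable K.L"
      "(\<lambda>s. (\<kappa> * K.fbm_op (\<lambda>s. step_function n t a s - y s) s)\<^sup>2) \<in> borel_measurable K.L" by measurable
  qed
  then show ?thesis using iso unfolding lhs K.L2_phi_norm_sq_eq[OF sy2] by simp
qed

text \<open>The step functions that approximate \<open>y\<close> in the \<open>\<phi>\<close>-norm have integrals against \<open>B\<close> that converge both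
to \<open>I\<close>, by definition, and to \<open>J\<close>, by the isometry.\<close>

lemma fBm_integral_eq_Wiener_integral:
  assumes l: "l \<in> {1..m}" and J: "has_Wiener_integral M T (W l) x J"
    and y: "in_L2 T y" and xy: "AE s in K.L. x s = \<kappa> * K.fbm_op y s"
    and I: "has_fBm_integral M (\<alpha> + 1/2) T (B l) y I"
  shows "AE \<omega> in M. J \<omega> = I \<omega>"
proof -
  obtain n :: "nat \<Rightarrow> nat" and t a where *: "\<And>k i. i \<le> n k \<Longrightarrow> t k i \<in> {0..T}" "\<And>k i. i < n k \<Longrightarrow> t k i \<le> t k (Suc i)"
        "(\<lambda>k. L2_phi_norm_sq (\<alpha> + 1/2) T (\<lambda>s. step_function (n k) (t k) (a k) s - y s)) \<longlonglongrightarrow> 0"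
        "(\<lambda>k. \<integral>\<omega>. (step_integral (B l) (n k) (t k) (a k) \<omega> - I \<omega>)\<^sup>2 \<partial>M) \<longlonglongrightarrow> 0"
     and sI: "square_integrable M I"
    using I unfolding has_fBm_integral_def mean_square_integral_def square_integrable_def by blast
  have sJ: "square_integrable M J" by (rule BM.has_Wiener_integral_square_integrable[OF J])
  have sB: "square_integrable M (B l s)" if "s \<in> {0..T}" for s
    by (rule BM.has_Wiener_integral_square_integrable[OF B_Wiener[OF l that]])
  have sS: "square_integrable M (step_integral (B l) (n k) (t k) (a k))" for k
    unfolding step_integral_def[abs_def]
    by (intro square_integrable_sum square_integrable_scale square_integrable_diff sB *(1)) auto
  have LI: "L2_tendsto M (\<lambda>k. step_integral (B l) (n k) (t k) (a k)) I"
    using *(4) sI sS by (simp add: L2_tendsto_def)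
  have "(\<integral>\<omega>. (step_integral (B l) (n k) (t k) (a k) \<omega> - J \<omega>)\<^sup>2 \<partial>M) = L2_phi_norm_sq (\<alpha> + 1/2) T (\<lambda>s. step_function (n k) (t k) (a k) s - y s)" for k
    by (rule step_integral_B_isometry[OF l _ _ J y xy]) (use *(1,2) in auto)
  then have LJ: "L2_tendsto M (\<lambda>k. step_integral (B l) (n k) (t k) (a k)) J"
    using *(3) sJ sS by (simp add: L2_tendsto_def)
  have "L2_tendsto M (\<lambda>k \<omega>. step_integral (B l) (n k) (t k) (a k) \<omega> + -1 * step_integral (B l) (n k) (t k) (a k) \<omega>) (\<lambda>\<omega>. J \<omega> + -1 * I \<omega>)"
    by (intro L2_tendsto_add L2_tendsto_scale LI LJ)
  then have "(\<lambda>k::nat. \<integral>\<omega>. (J \<omega> - I \<omega>)\<^sup>2 \<partial>M) \<longlonglongrightarrow> 0"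
    by (simp add: L2_tendsto_def power2_commute)
  then have "(\<integral>\<omega>. (J \<omega> - I \<omega>)\<^sup>2 \<partial>M) = 0" by (simp add: LIMSEQ_const_iff)
  moreover have "integrable M (\<lambda>\<omega>. (J \<omega> - I \<omega>)\<^sup>2)" using square_integrable_diff[OF sJ sI] by (simp add: square_integrable_def)
  ultimately have "AE \<omega> in M. (J \<omega> - I \<omega>)\<^sup>2 = 0" by (subst (asm) integral_nonneg_eq_0_iff_AE) auto
  then show ?thesis by eventually_elim simp
qed

lemma Wiener_integrals_gaussian_array:
  assumes x: "orthonormal_basis_L2 T x" and I: "\<And>j l. l \<in> {1..m} \<Longrightarrow> has_Wiener_integral M T (W l) (x j) (I j l)"
  shows "gaussian_array M (\<lambda>(j, l). I j l) m"
proof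
  fix a assume "a \<in> (UNIV :: nat set) \<times> {1..m}"
  then show "(case a of (j, l) \<Rightarrow> I j l) \<in> borel_measurable M"
    using BM.has_Wiener_integral_square_integrable[OF I] by (auto simp: square_integrable_def)
next
  fix F :: "(nat \<times> nat) set" and \<theta> :: "nat \<times> nat \<Rightarrow> real"
  assume F: "finite F" "F \<subseteq> UNIV \<times> {1..m}"
  let ?X = "\<lambda>a. I (fst a) (snd a)"
  have Xi: "has_Wiener_integral M T (W (snd a)) (x (fst a)) (?X a)" "snd a \<in> {1..m}" if "a \<in> F" for a
    using that F I by auto
  have g: "BM.centred_gaussian (\<lambda>\<omega>. \<Sum>a\<in>F. \<theta> a * ?X a \<omega>)"
    by (rule BM.Wiener_integrals_gaussian[OF F(1), of snd "\<lambda>a. x (fst a)"]) (use Xi in auto)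
  have s: "square_integrable M (?X a)" if "a \<in> F" for a
    by (rule BM.has_Wiener_integral_square_integrable[OF Xi(1)[OF that]])
  have f: "(\<theta> a * u * (\<theta> b * v)) = (\<theta> a * \<theta> b) * (u * v)" for a b u v by (simp only: mult_ac)
  have "(\<integral>\<omega>. (\<Sum>a\<in>F. \<theta> a * ?X a \<omega>)\<^sup>2 \<partial>M) = (\<Sum>a\<in>F. \<Sum>b\<in>F. \<integral>\<omega>. \<theta> a * ?X a \<omega> * (\<theta> b * ?X b \<omega>) \<partial>M)"
    unfolding power2_eq_square sum_product
    by (rule integral_double_sum) (intro square_integrable_mult_integrable square_integrable_scale s)
  also have "\<dots> = (\<Sum>a\<in>F. \<Sum>b\<in>F. if b = a then (\<theta> a)\<^sup>2 else 0)"
  proof (intro sum.cong refl)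
    fix a b assume ab: "a \<in> F" "b \<in> F"
    have "(\<integral>\<omega>. ?X a \<omega> * ?X b \<omega> \<partial>M) = (if snd a = snd b then L2_inner T (x (fst a)) (x (fst b)) else 0)"
      by (rule BM.Wiener_integral_covariance) (use Xi ab in auto)
    also have "\<dots> = (if b = a then 1 else 0)"
      using x unfolding orthonormal_basis_L2_def by (auto simp: prod_eq_iff)
    finally show "(\<integral>\<omega>. \<theta> a * ?X a \<omega> * (\<theta> b * ?X b \<omega>) \<partial>M) = (if b = a then (\<theta> a)\<^sup>2 else 0)"
      unfolding f integral_mult_right_zero by (simp add: power2_eq_square)
  qed
  also have "\<dots> = (\<Sum>a\<in>F. (\<theta> a)\<^sup>2)" using F(1) by (intro sum.cong refl) (simp add: sum.delta)
  finally have var: "(\<integral>\<omega>. (\<Sum>a\<in>F. \<theta> a * ?X a \<omega>)\<^sup>2 \<partial>M) = (\<Sum>a\<in>F. (\<theta> a)\<^sup>2)" .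
  have "(\<integral>\<omega>. iexp (\<Sum>a\<in>F. \<theta> a * ?X a \<omega>) \<partial>M) = of_real (exp (- (\<Sum>a\<in>F. (\<theta> a)\<^sup>2) / 2))"
    using g unfolding BM.centred_gaussian_def var by (elim conjE)
  then show "(\<integral>\<omega>. iexp (\<Sum>a\<in>F. \<theta> a * (case a of (j, l) \<Rightarrow> I j l) \<omega>) \<partial>M) = of_real (exp (- (\<Sum>a\<in>F. (\<theta> a)\<^sup>2) / 2))"
    by (simp only: case_prod_beta)
qed

text \<open>Both sides have the same coefficients with respect to the basis \<open>x\<close>. The coefficient of \<open>\<kappa> fbm_op DHF\<close>
at \<open>x j\<close> is the pairing of \<open>DHF\<close> with \<open>h = \<kappa> fbm_adj (x j)\<close>, and \<open>h\<close> is dual to the functions \<open>y i\<close>,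
because \<open>\<kappa> fbm_op (y i) = x i\<close>.\<close>

lemma derivative_transfer:
  assumes p: "1 < p" and x: "orthonormal_basis_L2 T x" and xs: "\<And>j. smooth_on_Icc T (x j)"
    and y: "\<And>j. y j = B_star (\<alpha> + 1/2) T (x j)"
    and I: "\<And>j l. l \<in> {1..m} \<Longrightarrow> has_Wiener_integral M T (W l) (x j) (I j l)"
    and I': "\<And>j l. l \<in> {1..m} \<Longrightarrow> has_fBm_integral M (\<alpha> + 1/2) T (B l) (y j) (I' j l)"
    and D: "in_D1p M T m p x I F DF" and D': "in_D1p M T m p y I' F DHF"
    and l: "l \<in> {1..m}"
  shows "AE \<omega> in M. in_L2 T (\<lambda>t. DF l t \<omega>) \<and> in_L2 T (\<lambda>t. DHF l t \<omega>) \<and>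
    (AE s in K.L. DF l s \<omega> = \<kappa> * K.fbm_op (\<lambda>t. DHF l t \<omega>) s)"
proof -
  have x2: "in_L2 T (x j)" and on: "L2_inner T (x i) (x j) = (if i = j then 1 else 0)" for i j
    using x by (auto simp: orthonormal_basis_L2_def)
  have xm [measurable]: "x j \<in> borel_measurable K.L" for j using x2 by (simp add: in_L2_def)
  have C1: "\<exists>x1. (\<forall>s\<in>{0..T}. (x j has_real_derivative x1 s) (at s within {0..T})) \<and> continuous_on {0..T} x1" for j
  proof -
    obtain g where g: "\<And>s. s \<in> {0..T} \<Longrightarrow> g 0 s = x j s"
      "\<And>n s. s \<in> {0..T} \<Longrightarrow> (g n has_real_derivative g (Suc n) s) (at s within {0..T})"
      using xs[of j] unfolding smooth_on_Icc_def by blast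
    have "(x j has_real_derivative g 1 s) (at s within {0..T})" if s: "s \<in> {0..T}" for s
      by (rule has_field_derivative_transform_within[OF _ zero_less_one s, of "g 0"]) (use g s in auto)
    moreover have "continuous_on {0..T} (g 1)"
      using g(2)[of _ 1] by (meson DERIV_continuous continuous_on_eq_continuous_within)
    ultimately show ?thesis by blast
  qed
  have bdd: "\<exists>C. \<forall>s\<in>{0..T}. \<bar>x j s\<bar> \<le> C" for j
  proof -
    have "continuous_on {0..T} (x j)"
      using C1[of j] by (meson DERIV_continuous continuous_on_eq_continuous_within)
    then have "bounded (x j ` {0..T})" by (intro compact_imp_bounded compact_continuous_image) auto
    then show ?thesis unfolding bounded_iff by auto
  qed
  define c0 where "c0 = 2 * (\<alpha> + 1/2) * kappa1 (\<alpha> + 1/2) / kappa (\<alpha> + 1/2)"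
  (* B_star is given by deriv, which is under control almost everywhere only. So y j inherits its
     properties from the representative that B_star_inverse provides. *)
  have y_props: "in_L2 T (y j) \<and> (AE s in K.L. x j s = \<kappa> * K.fbm_op (y j) s)" for j
  proof -
    obtain x1 where x1: "\<And>s. s \<in> {0..T} \<Longrightarrow> (x j has_real_derivative x1 s) (at s within {0..T})" "continuous_on {0..T} x1"
      using C1[of j] by blast
    obtain z where z: "AE t in K.L. B_star (\<alpha> + 1/2) T (x j) t = z t" "in_L2 T z"
      "\<And>s. s \<in> {0<..<T} \<Longrightarrow> K.fbm_op z s = c0 * Beta \<alpha> (1 - \<alpha>) * x j s"
      using K.B_star_inverse[OF x1 c0_def] by blast
    have yz: "AE t in K.L. y j t = z t" using z(1) y by simp
    have "integrable K.L (y j)" by (rule integrable_lebesgue_on_cong_AE[OF K.L2_integrable[OF z(2)] yz]) simp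
    then have ym: "y j \<in> borel_measurable K.L" by auto
    have "integrable K.L (\<lambda>s. (y j s)\<^sup>2)"
    proof (rule integrable_lebesgue_on_cong_AE)
      show "integrable K.L (\<lambda>s. (z s)\<^sup>2)" using z(2) by (simp add: in_L2_def)
      show "AE s in K.L. (y j s)\<^sup>2 = (z s)\<^sup>2" using yz by eventually_elim simp
    qed simp
    then have "in_L2 T (y j)" using ym by (simp add: in_L2_def)
    moreover have "AE s in K.L. x j s = \<kappa> * K.fbm_op (y j) s"
      using K.AE_L_neq[of 0] K.AE_L_neq[of T] K.AE_L_in
    proof eventually_elim
      fix s assume s: "s \<noteq> 0" "s \<noteq> T" "s \<in> {0..T}"
      have "K.fbm_op (y j) s = K.fbm_op z s" by (rule K.fbm_op_cong_AE[OF yz ym]) (use z(2) in \<open>simp add: in_L2_def\<close>)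
      also have "\<dots> = c0 * Beta \<alpha> (1 - \<alpha>) * x j s" by (rule z(3)) (use s in auto)
      finally have "\<kappa> * K.fbm_op (y j) s = (\<kappa> * c0 * Beta \<alpha> (1 - \<alpha>)) * x j s" by simp
      then show "x j s = \<kappa> * K.fbm_op (y j) s" unfolding c0_def K.kappa_inverse by simp
    qed
    ultimately show ?thesis by blast
  qed
  have eqI: "AE \<omega> in M. I j l \<omega> = I' j l \<omega>" if "l \<in> {1..m}" for j l
    by (rule fBm_integral_eq_Wiener_integral[OF that I[OF that]]) (use y_props I'[OF that] in auto)
  let ?X = "\<lambda>(j, l). I j l" and ?X' = "\<lambda>(j, l). I' j l"
  have gX: "gaussian_array M ?X m" by (rule Wiener_integrals_gaussian_array[OF x I])
  then interpret X: gaussian_array M ?X m .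
  have XX': "AE \<omega> in M. ?X a \<omega> = ?X' a \<omega>" if "a \<in> UNIV \<times> {1..m}" for a
    using eqI that by (cases a) auto
  have X'm: "?X' a \<in> borel_measurable M" if "a \<in> UNIV \<times> {1..m}" for a
    using I' that by (cases a) (auto simp: has_fBm_integral_def mean_square_integral_def)
  have gX': "gaussian_array M ?X' m"
  proof
    fix F :: "(nat \<times> nat) set" and \<theta> :: "nat \<times> nat \<Rightarrow> real"
    assume F: "finite F" "F \<subseteq> UNIV \<times> {1..m}"
    have "(\<integral>\<omega>. iexp (\<Sum>a\<in>F. \<theta> a * ?X' a \<omega>) \<partial>M) = (\<integral>\<omega>. iexp (\<Sum>a\<in>F. \<theta> a * ?X a \<omega>) \<partial>M)"
    proof (rule integral_cong_AE)
      have m': "(\<lambda>\<omega>. \<Sum>a\<in>F. \<theta> a * ?X' a \<omega>) \<in> borel_measurable M"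
        using F X'm by (intro borel_measurable_sum borel_measurable_times) auto
      note [measurable] = m' X.phase_measurable[OF F]
      show "AE \<omega> in M. iexp (\<Sum>a\<in>F. \<theta> a * ?X' a \<omega>) = iexp (\<Sum>a\<in>F. \<theta> a * ?X a \<omega>)"
      proof -
        have "AE \<omega> in M. \<forall>a\<in>F. ?X a \<omega> = ?X' a \<omega>" using XX' F by (subst AE_finite_all) auto
        then show ?thesis by eventually_elim simp
      qed
      show "(\<lambda>\<omega>. iexp (\<Sum>a\<in>F. \<theta> a * ?X' a \<omega>)) \<in> borel_measurable M" "(\<lambda>\<omega>. iexp (\<Sum>a\<in>F. \<theta> a * ?X a \<omega>)) \<in> borel_measurable M" by measurable
    qed
    then show "(\<integral>\<omega>. iexp (\<Sum>a\<in>F. \<theta> a * ?X' a \<omega>) \<partial>M) = of_real (exp (- (\<Sum>a\<in>F. (\<theta> a)\<^sup>2) / 2))"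
      unfolding X.X_char[OF F] .
  qed (rule X'm)
  have adj2: "in_L2 T (K.fbm_adj (x j))" for j
    using bdd[of j] K.fbm_adj_in_L2[OF xm, of j] by blast
  have adjoint: "(\<integral>u. f u * (\<kappa> * K.fbm_adj (x j) u) \<partial>K.L) = (\<integral>s. \<kappa> * K.fbm_op f s * x j s \<partial>K.L)" if "in_L2 T f" for f j
  proof -
    obtain C where "\<And>s. s \<in> {0..T} \<Longrightarrow> \<bar>x j s\<bar> \<le> C" using bdd[of j] by blast
    from K.fbm_op_adjoint[OF that xm this] have "\<kappa> * (\<integral>u. f u * K.fbm_adj (x j) u \<partial>K.L) = \<kappa> * (\<integral>s. K.fbm_op f s * x j s \<partial>K.L)" by simp
    then have "(\<integral>u. \<kappa> * (f u * K.fbm_adj (x j) u) \<partial>K.L) = (\<integral>s. \<kappa> * (K.fbm_op f s * x j s) \<partial>K.L)" by (simp only: integral_mult_right_zero)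
    then show ?thesis by (simp only: mult_ac)
  qed
  have fd: "(\<lambda>t. DF l t \<omega>) \<in> borel_measurable K.L" if "\<omega> \<in> space M" for \<omega>
  proof -
    have "(\<lambda>(t, \<omega>). DF l t \<omega>) \<in> borel_measurable (K.L \<Otimes>\<^sub>M M)" using D l by (auto simp: in_D1p_def in_Lp_L2_def)
    from measurable_Pair1[OF this that] show ?thesis by simp
  qed
  have fd': "(\<lambda>t. DHF l t \<omega>) \<in> borel_measurable K.L" if "\<omega> \<in> space M" for \<omega>
  proof -
    have "(\<lambda>(t, \<omega>). DHF l t \<omega>) \<in> borel_measurable (K.L \<Otimes>\<^sub>M M)" using D' l by (auto simp: in_D1p_def in_Lp_L2_def)
    from measurable_Pair1[OF this that] show ?thesis by simp
  qed
  have sq: "AE \<omega> in M. in_L2 T (\<lambda>t. DF l t \<omega>)"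
  proof -
    have "AE \<omega> in M. integrable K.L (\<lambda>t. (DF l t \<omega>)\<^sup>2)" using D l by (auto simp: in_D1p_def in_Lp_L2_def)
    then show ?thesis using AE_space by eventually_elim (simp add: in_L2_def fd)
  qed
  have sq': "AE \<omega> in M. in_L2 T (\<lambda>t. DHF l t \<omega>)"
  proof -
    have "AE \<omega> in M. integrable K.L (\<lambda>t. (DHF l t \<omega>)\<^sup>2)" using D' l by (auto simp: in_D1p_def in_Lp_L2_def)
    then show ?thesis using AE_space by eventually_elim (simp add: in_L2_def fd')
  qed
  have agree: "AE \<omega> in M. (\<integral>t. DF l t \<omega> * x j t \<partial>K.L) = (\<integral>t. DHF l t \<omega> * (\<kappa> * K.fbm_adj (x j) t) \<partial>K.L)" for j
  proof (rule D1p_functionals_agree[OF gX gX' XX' p, where e = x and e' = y and ?j0.0 = j and F = F])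
    show "square_integrable K.L (x i)" "square_integrable K.L (y i)" for i
      using x2 y_props unfolding in_L2_iff by auto
    show "square_integrable K.L (x j)" using x2 unfolding in_L2_iff by auto
    show "square_integrable K.L (\<lambda>t. \<kappa> * K.fbm_adj (x j) t)"
      using adj2 unfolding in_L2_iff by (intro square_integrable_scale)
    show "(\<integral>t. x i t * x j t \<partial>K.L) = (if i = j then 1 else 0)" for i using on[of i j] by (simp add: L2_inner_def)
    show "(\<integral>t. y i t * (\<kappa> * K.fbm_adj (x j) t) \<partial>K.L) = (if i = j then 1 else 0)" for i
    proof -
      have y2: "in_L2 T (y i)" using y_props by blast
      have "(\<integral>t. y i t * (\<kappa> * K.fbm_adj (x j) t) \<partial>K.L) = (\<integral>s. \<kappa> * K.fbm_op (y i) s * x j s \<partial>K.L)" by (rule adjoint[OF y2])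
      also have "\<dots> = (\<integral>s. x i s * x j s \<partial>K.L)"
      proof (rule integral_cong_AE)
        have [measurable]: "K.fbm_op (y i) \<in> borel_measurable K.L" using y2 by (intro K.fbm_op_measurable) (simp add: in_L2_def)
        show "AE s in K.L. \<kappa> * K.fbm_op (y i) s * x j s = x i s * x j s"
          using y_props[of i] by (auto elim: eventually_mono)
        show "(\<lambda>s. \<kappa> * K.fbm_op (y i) s * x j s) \<in> borel_measurable K.L" "(\<lambda>s. x i s * x j s) \<in> borel_measurable K.L" by measurable
      qed
      finally show ?thesis using on[of i j] by (simp add: L2_inner_def)
    qed
    show "in_D1p M T m p x (\<lambda>j l. ?X (j, l)) F DF" using D by simp
    show "in_D1p M T m p y (\<lambda>j l. ?X' (j, l)) F DHF" using D' by simp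
  qed (use l in auto)
  then have "AE \<omega> in M. \<forall>j. (\<integral>t. DF l t \<omega> * x j t \<partial>K.L) = (\<integral>t. DHF l t \<omega> * (\<kappa> * K.fbm_adj (x j) t) \<partial>K.L)"
    by (simp add: AE_all_countable)
  then show ?thesis using sq sq'
  proof eventually_elim
    fix \<omega> assume eq: "\<forall>j. (\<integral>t. DF l t \<omega> * x j t \<partial>K.L) = (\<integral>t. DHF l t \<omega> * (\<kappa> * K.fbm_adj (x j) t) \<partial>K.L)"
      and f: "in_L2 T (\<lambda>t. DF l t \<omega>)" and g: "in_L2 T (\<lambda>t. DHF l t \<omega>)"
    define r where "r s = DF l s \<omega> - \<kappa> * K.fbm_op (\<lambda>t. DHF l t \<omega>) s" for s
    have op: "square_integrable K.L (\<lambda>s. \<kappa> * K.fbm_op (\<lambda>t. DHF l t \<omega>) s)"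
      using K.fbm_op_in_L2[OF g] unfolding in_L2_iff by (rule square_integrable_scale)
    have r2: "square_integrable K.L r" unfolding r_def[abs_def]
      using f op unfolding in_L2_iff by (rule square_integrable_diff)
    have "L2_inner T r (x j) = 0" for j
    proof -
      have sx: "square_integrable K.L (x j)" using x2 unfolding in_L2_iff by auto
      have i: "integrable K.L (\<lambda>t. DF l t \<omega> * x j t)" "integrable K.L (\<lambda>s. \<kappa> * K.fbm_op (\<lambda>t. DHF l t \<omega>) s * x j s)"
        using square_integrable_mult_integrable[OF _ sx] f op unfolding in_L2_iff by auto
      have "L2_inner T r (x j) = (\<integral>t. DF l t \<omega> * x j t \<partial>K.L) - (\<integral>s. \<kappa> * K.fbm_op (\<lambda>t. DHF l t \<omega>) s * x j s \<partial>K.L)"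
        unfolding L2_inner_def r_def left_diff_distrib by (rule Bochner_Integration.integral_diff[OF i])
      then show ?thesis using eq adjoint[OF g, of j] by simp
    qed
    moreover have "(\<lambda>n. L2_norm_sq T (\<lambda>s. r s - (\<Sum>i<n. L2_inner T r (x i) * x i s))) \<longlonglongrightarrow> 0"
      using x r2 unfolding orthonormal_basis_L2_def in_L2_iff by blast
    ultimately have "(\<lambda>n::nat. L2_norm_sq T r) \<longlonglongrightarrow> 0" by simp
    then have "(\<integral>s. (r s)\<^sup>2 \<partial>K.L) = 0" by (simp add: LIMSEQ_const_iff L2_norm_sq_def)
    moreover have "integrable K.L (\<lambda>s. (r s)\<^sup>2)" using r2 by (simp add: square_integrable_def)
    ultimately have "AE s in K.L. (r s)\<^sup>2 = 0" by (subst (asm) integral_nonneg_eq_0_iff_AE) auto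
    then have "AE s in K.L. DF l s \<omega> = \<kappa> * K.fbm_op (\<lambda>t. DHF l t \<omega>) s" by eventually_elim (simp add: r_def)
    then show "in_L2 T (\<lambda>t. DF l t \<omega>) \<and> in_L2 T (\<lambda>t. DHF l t \<omega>) \<and> (AE s in K.L. DF l s \<omega> = \<kappa> * K.fbm_op (\<lambda>t. DHF l t \<omega>) s)"
      using f g by blast
  qed
qed

end

text \<open>The analytic content of the theorem, for a fixed path.\<close>

lemma (in frac_kernel) inversion_formulas:
  assumes f: "in_L2 T f" and g: "in_L2 T g" and fg: "AE s in L. f s = kappa (\<alpha> + 1/2) * \<alpha> * fbm_op g s"
  defines "J \<equiv> \<lambda>s. \<integral>u. (u - s) powr (-\<alpha>) * u powr \<alpha> * f u \<partial>lebesgue_on {s..T}"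
  shows "AE s in L. J differentiable (at s) \<and> g s = - (2 * (\<alpha> + 1/2) * kappa1 (\<alpha> + 1/2) / kappa (\<alpha> + 1/2)) * s powr (-\<alpha>) * deriv J s"
    and "AE t in L. integrable L (\<lambda>s. s powr (-\<alpha>) * \<bar>t - s\<bar> powr (2*\<alpha> - 1) * deriv J s) \<and>
      (\<integral>r. phi (\<alpha> + 1/2) (t - r) * g r \<partial>L) = c1H (\<alpha> + 1/2) * (\<integral>s. s powr (-\<alpha>) * \<bar>t - s\<bar> powr (2*\<alpha> - 1) * deriv J s \<partial>L)"
proof -
  define c0 where "c0 = 2 * (\<alpha> + 1/2) * kappa1 (\<alpha> + 1/2) / kappa (\<alpha> + 1/2)"
  define k where "k = kappa (\<alpha> + 1/2) * \<alpha>"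
  have inv: "k * c0 * Beta \<alpha> (1 - \<alpha>) = 1" using kappa_inverse by (simp only: k_def c0_def)
  then have c0: "c0 \<noteq> 0" by auto
  have "c0 * (k * Beta \<alpha> (1 - \<alpha>)) = 1" using inv by (simp only: mult_ac)
  then have kB: "k * Beta (1 - \<alpha>) \<alpha> = 1 / c0" using c0 by (simp add: Beta_commute[of "1 - \<alpha>"] field_simps)
  have fm: "f \<in> borel_measurable L" using f by (simp add: in_L2_def)
  have der: "AE s in L. (J has_real_derivative - ((1 / c0) * (s powr \<alpha> * g s))) (at s)"
    using fbm_op_inverse_AE[OF g fg fm] unfolding J_def k_def[symmetric] kB .
  have d: "AE s in L. J differentiable (at s) \<and> deriv J s = - ((1 / c0) * (s powr \<alpha> * g s))"
    using der
  proof eventually_elim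
    fix s assume *: "(J has_real_derivative - ((1 / c0) * (s powr \<alpha> * g s))) (at s)"
    then have "deriv J s = - ((1 / c0) * (s powr \<alpha> * g s))" by (rule DERIV_imp_deriv)
    moreover have "J differentiable (at s)" using * real_differentiable_def by blast
    ultimately show "J differentiable (at s) \<and> deriv J s = - ((1 / c0) * (s powr \<alpha> * g s))" by blast
  qed
  have d': "AE s in L. s powr (-\<alpha>) * deriv J s = - (1 / c0) * g s"
    using d AE_L_neq[of 0] AE_L_in
  proof eventually_elim
    fix s assume s: "J differentiable (at s) \<and> deriv J s = - ((1 / c0) * (s powr \<alpha> * g s))" "s \<noteq> 0" "s \<in> {0..T}"
    have "s powr (-\<alpha>) * s powr \<alpha> = 1" using s(2) by (simp add: powr_minus)
    moreover have "s powr (-\<alpha>) * deriv J s = (s powr (-\<alpha>) * s powr \<alpha>) * (- (1 / c0) * g s)" using s(1) by simp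
    ultimately show "s powr (-\<alpha>) * deriv J s = - (1 / c0) * g s" by simp
  qed
  show "AE s in L. J differentiable (at s) \<and> g s = - (2 * (\<alpha> + 1/2) * kappa1 (\<alpha> + 1/2) / kappa (\<alpha> + 1/2)) * s powr (-\<alpha>) * deriv J s"
    unfolding c0_def[symmetric] using d d'
    by eventually_elim (use c0 in \<open>simp add: mult.assoc\<close>)
  define b where "b = Beta \<alpha> (1 - 2*\<alpha>)"
  have b: "b > 0" using \<alpha>_pos \<alpha>_less by (simp add: b_def Beta_pos)
  have gm [measurable]: "g \<in> borel_measurable L" using g by (simp add: in_L2_def)
  show "AE t in L. integrable L (\<lambda>s. s powr (-\<alpha>) * \<bar>t - s\<bar> powr (2*\<alpha> - 1) * deriv J s) \<and>
      (\<integral>r. phi (\<alpha> + 1/2) (t - r) * g r \<partial>L) = c1H (\<alpha> + 1/2) * (\<integral>s. s powr (-\<alpha>) * \<bar>t - s\<bar> powr (2*\<alpha> - 1) * deriv J s \<partial>L)"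
    using cov_kernel_integrable_AE[OF L2_integrable[OF g]]
  proof eventually_elim
    fix t assume "integrable L (\<lambda>s. cov_kernel t s * g s)"
    then have "integrable L (\<lambda>s. (- (1 / c0) / b) * (cov_kernel t s * g s))" by (rule integrable_mult_right)
    moreover have eq: "(- (1 / c0) / b) * (cov_kernel t s * g s) = - (1 / c0) * (\<bar>t - s\<bar> powr (2*\<alpha> - 1) * g s)" for s
      using b by (simp add: cov_kernel_def b_def[symmetric])
    ultimately have i: "integrable L (\<lambda>s. - (1 / c0) * (\<bar>t - s\<bar> powr (2*\<alpha> - 1) * g s))" by (simp only:)
    have ae: "AE s in L. s powr (-\<alpha>) * \<bar>t - s\<bar> powr (2*\<alpha> - 1) * deriv J s = - (1 / c0) * (\<bar>t - s\<bar> powr (2*\<alpha> - 1) * g s)"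
      using d'
    proof eventually_elim
      fix s assume s: "s powr (-\<alpha>) * deriv J s = - (1 / c0) * g s"
      have "s powr (-\<alpha>) * \<bar>t - s\<bar> powr (2*\<alpha> - 1) * deriv J s = \<bar>t - s\<bar> powr (2*\<alpha> - 1) * (s powr (-\<alpha>) * deriv J s)" by (simp only: mult_ac)
      then show "s powr (-\<alpha>) * \<bar>t - s\<bar> powr (2*\<alpha> - 1) * deriv J s = - (1 / c0) * (\<bar>t - s\<bar> powr (2*\<alpha> - 1) * g s)"
        unfolding s by simp
    qed
    have i': "integrable L (\<lambda>s. s powr (-\<alpha>) * \<bar>t - s\<bar> powr (2*\<alpha> - 1) * deriv J s)"
      by (rule integrable_lebesgue_on_cong_AE[OF i ae]) simp
    have "(\<integral>s. s powr (-\<alpha>) * \<bar>t - s\<bar> powr (2*\<alpha> - 1) * deriv J s \<partial>L) = (\<integral>s. - (1 / c0) * (\<bar>t - s\<bar> powr (2*\<alpha> - 1) * g s) \<partial>L)"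
      by (rule integral_cong_AE[OF borel_measurable_integrable[OF i'] borel_measurable_integrable[OF i] ae])
    then have "(\<integral>s. s powr (-\<alpha>) * \<bar>t - s\<bar> powr (2*\<alpha> - 1) * deriv J s \<partial>L) = - (1 / c0) * (\<integral>s. \<bar>t - s\<bar> powr (2*\<alpha> - 1) * g s \<partial>L)"
      by (simp only: integral_mult_right_zero)
    moreover have "c1H (\<alpha> + 1/2) = - ((\<alpha> + 1/2) * (2 * (\<alpha> + 1/2) - 1)) * c0"
      by (simp add: c1H_def c0_def power2_eq_square)
    ultimately have "c1H (\<alpha> + 1/2) * (\<integral>s. s powr (-\<alpha>) * \<bar>t - s\<bar> powr (2*\<alpha> - 1) * deriv J s \<partial>L) = (\<alpha> + 1/2) * (2 * (\<alpha> + 1/2) - 1) * (\<integral>s. \<bar>t - s\<bar> powr (2*\<alpha> - 1) * g s \<partial>L)"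
      using c0 by simp
    also have "\<dots> = (\<integral>r. phi (\<alpha> + 1/2) (t - r) * g r \<partial>L)"
    proof -
      have "phi (\<alpha> + 1/2) (t - r) * g r = (\<alpha> + 1/2) * (2 * (\<alpha> + 1/2) - 1) * (\<bar>t - r\<bar> powr (2*\<alpha> - 1) * g r)" for r
      proof -
        have "2 * (\<alpha> + 1/2) - 2 = 2 * \<alpha> - 1" by simp
        then show ?thesis unfolding phi_def by (simp only: mult.assoc)
      qed
      then show ?thesis by (simp only: integral_mult_right_zero)
    qed
    finally show "integrable L (\<lambda>s. s powr (-\<alpha>) * \<bar>t - s\<bar> powr (2*\<alpha> - 1) * deriv J s) \<and>
      (\<integral>r. phi (\<alpha> + 1/2) (t - r) * g r \<partial>L) = c1H (\<alpha> + 1/2) * (\<integral>s. s powr (-\<alpha>) * \<bar>t - s\<bar> powr (2*\<alpha> - 1) * deriv J s \<partial>L)"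
      using i' by simp
  qed
qed

theorem proposition2p6:
  fixes M :: "'a measure" and T H p :: real and m :: nat
    and W B :: "nat \<Rightarrow> real \<Rightarrow> 'a \<Rightarrow> real"
    and \<xi> \<eta> :: "nat \<Rightarrow> real \<Rightarrow> real"
    and I_\<xi> I_\<eta> :: "nat \<Rightarrow> nat \<Rightarrow> 'a \<Rightarrow> real"
    and F :: "'a \<Rightarrow> real"
    and DF DHF :: "nat \<Rightarrow> real \<Rightarrow> 'a \<Rightarrow> real"
  assumes "prob_space M"
    and "0 < T" and "1/2 < H" and "H < 1" and "1 < p"
    and "standard_Brownian_motion M T m W"
    and "fractional_Brownian_motion_of M H T m W B"
    and "orthonormal_basis_L2 T \<xi>" and "\<And>j. smooth_on_Icc T (\<xi> j)"
    and "\<And>j. \<eta> j = B_star H T (\<xi> j)"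
    and "\<And>j l. l \<in> {1..m} \<Longrightarrow> has_Wiener_integral M T (W l) (\<xi> j) (I_\<xi> j l)"
    and "\<And>j l. l \<in> {1..m} \<Longrightarrow> has_fBm_integral M H T (B l) (\<eta> j) (I_\<eta> j l)"
    and "in_D1p M T m p \<xi> I_\<xi> F DF"
    and "in_D1p M T m p \<eta> I_\<eta> F DHF"
  shows "\<forall>l\<in>{1..m}. AE \<omega> in M.
     (AE s in lebesgue_on {0..T}.
        (\<lambda>s. \<integral>u. (u - s) powr (1/2 - H) * u powr (H - 1/2) * DF l u \<omega> \<partial>lebesgue_on {s..T})
          differentiable (at s) \<and>
        DHF l s \<omega> = - (2 * H * kappa1 H / kappa H) * s powr (1/2 - H) *
          deriv (\<lambda>s. \<integral>u. (u - s) powr (1/2 - H) * u powr (H - 1/2) * DF l u \<omega>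
                   \<partial>lebesgue_on {s..T}) s) \<and>
     (AE t in lebesgue_on {0..T}.
        integrable (lebesgue_on {0..T})
          (\<lambda>s. s powr (1/2 - H) * \<bar>t - s\<bar> powr (2 * H - 2) *
             deriv (\<lambda>s. \<integral>u. (u - s) powr (1/2 - H) * u powr (H - 1/2) * DF l u \<omega>
                      \<partial>lebesgue_on {s..T}) s) \<and>
        phi_derivative H T DHF l t \<omega> = c1H H *
          (\<integral>s. s powr (1/2 - H) * \<bar>t - s\<bar> powr (2 * H - 2) *
             deriv (\<lambda>s. \<integral>u. (u - s) powr (1/2 - H) * u powr (H - 1/2) * DF l u \<omega>
                      \<partial>lebesgue_on {s..T}) s \<partial>lebesgue_on {0..T}))"
proof
  fix l assume l: "l \<in> {1..m}"
  define \<alpha> where "\<alpha> = H - 1/2"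
  have H: "\<alpha> + 1/2 = H" and e1: "- \<alpha> = 1/2 - H" and e2: "2 * \<alpha> - 1 = 2 * H - 2" by (simp_all add: \<alpha>_def)
  interpret prob_space M by (rule assms(1))
  interpret fbm_setting M T m W \<alpha> B
    by unfold_locales (use assms in \<open>simp_all add: H \<alpha>_def\<close>)
  have "AE \<omega> in M. in_L2 T (\<lambda>t. DF l t \<omega>) \<and> in_L2 T (\<lambda>t. DHF l t \<omega>) \<and>
    (AE s in K.L. DF l s \<omega> = \<kappa> * K.fbm_op (\<lambda>t. DHF l t \<omega>) s)"
    by (rule derivative_transfer[where x = \<xi> and y = \<eta> and I = I_\<xi> and I' = I_\<eta> and F = F and p = p])
       (use assms l in \<open>simp_all add: H\<close>)
  then show "AE \<omega> in M.
     (AE s in lebesgue_on {0..T}.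
        (\<lambda>s. \<integral>u. (u - s) powr (1/2 - H) * u powr (H - 1/2) * DF l u \<omega> \<partial>lebesgue_on {s..T})
          differentiable (at s) \<and>
        DHF l s \<omega> = - (2 * H * kappa1 H / kappa H) * s powr (1/2 - H) *
          deriv (\<lambda>s. \<integral>u. (u - s) powr (1/2 - H) * u powr (H - 1/2) * DF l u \<omega>
                   \<partial>lebesgue_on {s..T}) s) \<and>
     (AE t in lebesgue_on {0..T}.
        integrable (lebesgue_on {0..T})
          (\<lambda>s. s powr (1/2 - H) * \<bar>t - s\<bar> powr (2 * H - 2) *
             deriv (\<lambda>s. \<integral>u. (u - s) powr (1/2 - H) * u powr (H - 1/2) * DF l u \<omega>
                      \<partial>lebesgue_on {s..T}) s) \<and>
        phi_derivative H T DHF l t \<omega> = c1H H *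
          (\<integral>s. s powr (1/2 - H) * \<bar>t - s\<bar> powr (2 * H - 2) *
             deriv (\<lambda>s. \<integral>u. (u - s) powr (1/2 - H) * u powr (H - 1/2) * DF l u \<omega>
                      \<partial>lebesgue_on {s..T}) s \<partial>lebesgue_on {0..T}))"
  proof eventually_elim
    case (elim \<omega>)
    then have f: "in_L2 T (\<lambda>t. DF l t \<omega>)" and g: "in_L2 T (\<lambda>t. DHF l t \<omega>)"
      and fg: "AE s in K.L. DF l s \<omega> = \<kappa> * K.fbm_op (\<lambda>t. DHF l t \<omega>) s" by blast+
    show ?case
      using K.inversion_formulas[OF f g fg] unfolding H e1 e2 phi_derivative_def \<alpha>_def[symmetric] by blast
  qed
qed

end
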